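(* Let $\mathcal V,\mathcal W$ be symmetric monoidal categories, let $(\mathsf M,\mu,\eta,\nabla)$ be a symmetric monoidal monad on $\mathcal W$, let $F\colon\mathcal V\to\mathcal W$ be a symmetric (lax) monoidal functor with comparison maps $F_\epsilon\colon I_{\mathcal W}\to FI_{\mathcal V}$ and $\widetilde F$, and let $i\colon\mathcal U\hookrightarrow\mathcal W$ be a full strict monoidal subcategory. Write $$(\mathcal U/\mathsf MF)\colon\ \mathcal V\xrightarrow{\ F\ }\mathcal W\xrightarrow{\ \mathsf L_{\mathsf M}\ }\mathsf{Kl}_{\mathsf M}\xrightarrow{\ \mathcal U/(-)\ }\mathsf{cat}.$$ For any $\mathcal V$-category $\mathcal C$, change of base along this composite yields a 2-category $(\mathcal U/\mathsf MF)_*\mathcal C$. If $(\mathcal C,\boxtimes,J)$ is a monoidal (respectively symmetric monoidal) $\mathcal V$-category, then $(\mathcal U/\mathsf MF)_*\mathcal C$ is a nearly strict monoidal (respectively nearly strict symmetric monoidal) 2-category. Explicitly: (i) The 0-cells are the objects of $\mathcal C$. (ii) The 1-cells from $X$ to $Y$ are $\mathsf{Kl}_{\mathsf M}$-arrows $f\colon U_1\to F\mathcal C(X,Y)$ with $U_1$ an object of $\mathcal U$. (iii) The 2-cells from $f\colon U_1\to F\mathcal C(X,Y)$ to $g\colon V_1\to F\mathcal C(X,Y)$ are $\mathsf{Kl}_{\mathsf M}$-arrows $\varphi\colon U_1\to V_1$ with $f=\varphi;g$ in $\mathsf{Kl}_{\mathsf M}$; they compose vertically by composition in $\mathsf{Kl}_{\mathsf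 M}$. (iv) Horizontal composition sends 1-cells $f_1\colon U_1\to F\mathcal C(X,Y)$ and $f_2\colon U_2\to F\mathcal C(Y,Z)$ to the $\mathsf{Kl}_{\mathsf M}$-composite $$U_1\otimes U_2\xrightarrow{f_1\otimes f_2}F\mathcal C(X,Y)\otimes F\mathcal C(Y,Z)\xrightarrow{( * )}F\mathcal C(X,Z),$$ where $( * )$ is the $\mathsf{Kl}_{\mathsf M}$-arrow given by $\widetilde F;F(;_{\mathcal C});\eta$, and sends 2-cells $\varphi_1,\varphi_2$ to $\varphi_1\otimes\varphi_2$ (products taken in $\mathsf{Kl}_{\mathsf M}$). The identity 1-cell on $X$ is $F_\epsilon;F(\mathsf{id}_X);\eta$, viewed as a $\mathsf{Kl}_{\mathsf M}$-arrow $I_{\mathcal W}\to F\mathcal C(X,X)$. (v) When $\mathcal C$ is monoidal, the monoidal product is $(A,B)\mapsto A\boxtimes B$ on 0-cells, sends 1-cells $f_i\colon U_i\to F\mathcal C(A_i,B_i)$ ($i=1,2$) to the $\mathsf{Kl}_{\mathsf M}$-composite of $f_1\otimes f_2$ with the $\mathsf{Kl}_{\mathsf M}$-arrow $F\mathcal C(A_1,B_1)\otimes F\mathcal C(A_2,B_2)\to F\mathcal C(A_1\boxtimes A_2,B_1\boxtimes B_2)$ given by $\widetilde F;F(\boxtimes);\eta$, and sends 2-cells $\varphi_1,\varphi_2$ to $\varphi_1\otimes\varphi_2$. Its unit is the unit object $J$ of $\mathcal C$. Interchange holds only up to natural invertible 2-cells (tensorators) $\vartheta_{f_1,f_2,g_1,g_2}\colon(f_1\boxtimes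 f_2);(g_1\boxtimes g_2)\Rightarrow(f_1;g_1)\boxtimes(f_2;g_2)$, given by the symmetry map $m$ that rearranges the parameter objects, $U_1\otimes U_2\otimes P_1\otimes P_2\to U_1\otimes P_1\otimes U_2\otimes P_2$ (where $f_i$ has parameter object $U_i$ and $g_i$ has parameter object $P_i$). The coherence 1-cells are lifted from those of $\mathcal C$: each component $c\colon I_{\mathcal V}\to\mathcal C(A,B)$ of a coherence isomorphism of $\mathcal C$ is replaced by $F_\epsilon;F(c);\eta$; for example the left unitor has components $F_\epsilon;F(l^{\mathcal C}_X);\eta\colon I_{\mathcal W}\to F\mathcal C(J\boxtimes X,X)$ in $\mathsf{Kl}_{\mathsf M}$. In the symmetric case, the symmetry is natural only up to a 2-cell that swaps the parameter objects.
   Context: Composition is written in diagrammatic order: $f;g=g\circ f$. 2-categories are strict. $\mathsf{cat}$ is the category of small categories with Cartesian product, where "small" is relative to a universe for which the slices below are small; a $\mathsf{cat}$-enriched category is a 2-category. Enriched notions. For a symmetric monoidal category $(\mathcal V,\otimes,I)$, a $\mathcal V$-category has composition arrows $;_{\mathcal C}\colon\mathcal C(A,B)\otimes\mathcal C(B,C)\to\mathcal C(A,C)$ and identities $\mathsf{id}_A\colon I\to\mathcal C(A,A)$. Its underlying category $\mathcal C_0$ has the same objects, arrows $f\colon I\to\mathcal C(A,B)$, and composites $I\cong I\otimes I\xrightarrow{f\otimes g}\mathcal C(A,B)\otimes\mathcal C(B,C)\xrightarrow{;}\mathcal C(A,C)$. The product $\mathcal C\otimes\mathcal D$ of $\mathcal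 V$-categories has pairs as objects and hom-objects $\mathcal C(A_1,B_1)\otimes\mathcal D(A_2,B_2)$, with composition using the symmetry map $m\colon(X_1\otimes X_2)\otimes(Y_1\otimes Y_2)\to(X_1\otimes Y_1)\otimes(X_2\otimes Y_2)$. For a $\mathcal V$-functor $\boxtimes\colon\mathcal C\otimes\mathcal C\to\mathcal C$, $\bar\boxtimes_0\colon\mathcal C_0\times\mathcal C_0\to\mathcal C_0$ sends $(f_1,f_2)$ to $I\cong I\otimes I\xrightarrow{f_1\otimes f_2}\mathcal C(A_1,B_1)\otimes\mathcal C(A_2,B_2)\xrightarrow{\boxtimes}\mathcal C(A_1\boxtimes A_2,B_1\boxtimes B_2)$. A monoidal $\mathcal V$-category $(\mathcal C,\boxtimes,J)$ consists of a $\mathcal V$-category $\mathcal C$, a $\mathcal V$-functor $\boxtimes\colon\mathcal C\otimes\mathcal C\to\mathcal C$, an object $J$ and $\mathcal V$-natural isomorphisms with components $a_{A,B,C}\colon I\to\mathcal C((A\boxtimes B)\boxtimes C,A\boxtimes(B\boxtimes C))$, $r_A\colon I\to\mathcal C(A\boxtimes J,A)$, $l_A\colon I\to\mathcal C(J\boxtimes A,A)$ making $(\mathcal C_0,\bar\boxtimes_0,J)$ monoidal; it is symmetric if it has a $\mathcal V$-natural isomorphism $s_{A,B}\colon I\to\mathcal C(A\boxtimes B,B\boxtimes A)$ making $\mathcal C_0$ symmetric monoidal. Lax monoidal functor $N\colon\mathcal V\to\mathcal W$: comes with $N_\epsilon\colon I_{\mathcal W}\to NI_{\mathcal V}$ and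 natural $\widetilde N_{A,B}\colon NA\otimes NB\to N(A\otimes B)$ satisfying associativity and unit laws; symmetric if $\widetilde N_{A,B};N\sigma=\sigma;\widetilde N_{B,A}$. Change of base along $N$ sends a $\mathcal V$-category $\mathcal C$ to the $\mathcal W$-category $N_*\mathcal C$ with the same objects, hom-objects $N\mathcal C(A,B)$, composition $\widetilde N;N(;_{\mathcal C})$ and identities $N_\epsilon;N(\mathsf{id}_A)$. Symmetric monoidal monad: a monad $(\mathsf M,\mu,\eta)$ on $\mathcal W$ with morphisms $\nabla_{X,Y}\colon\mathsf MX\otimes\mathsf MY\to\mathsf M(X\otimes Y)$ natural in $X,Y$ making $\mathsf M$ a symmetric monoidal functor with unit $\eta_I$ and making $\mu,\eta$ monoidal transformations. Its Kleisli category $\mathsf{Kl}_{\mathsf M}$ is symmetric monoidal, with the product of objects as in $\mathcal W$ and the product of $f\colon A\to\mathsf MX$, $g\colon B\to\mathsf MY$ equal to $(f\otimes g);\nabla$. $\mathsf L_{\mathsf M}\colon\mathcal W\to\mathsf{Kl}_{\mathsf M}$ is the identity-on-objects strict symmetric monoidal functor $f\mapsto f;\eta$. Full strict monoidal subcategory: a full subcategory $\mathcal U\subseteq\mathcal W$ containing $I_{\mathcal W}$ and closed under $\otimes$, which is a strict monoidal category with the inherited structure (associators and unitors at objects of $\mathcal U$ are identities), the inclusion being strict monoidal. In $\mathcal U/(-)\colon\mathsf{Kl}_{\mathsf M}\to\mathsf{cat}$, $\mathcal U$ is regarded as the full subcategory of $\mathsf{Kl}_{\mathsf M}$ on the objects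 of $\mathcal U$. Partial slice functor: $\mathcal U/(-)\colon\mathsf{Kl}_{\mathsf M}\to\mathsf{cat}$ sends $A$ to the category with objects pairs $(U\in\mathrm{Ob}(\mathcal U),f\colon U\to A$ in $\mathsf{Kl}_{\mathsf M})$ and arrows $(U,f)\to(V,g)$ the $\mathsf{Kl}_{\mathsf M}$-arrows $\varphi\colon U\to V$ with $f=\varphi;g$; it acts on arrows by post-composition. Its lax monoidal structure has unit comparison picking $\mathsf{id}_I$ and comparison $(f_1,f_2)\mapsto f_1\otimes f_2$, $(\varphi,\psi)\mapsto\varphi\otimes\psi$. Nearly strict monoidal 2-category: a 2-category $\mathbb C$ with a pseudofunctor $\boxtimes\colon\mathbb C\times\mathbb C\to\mathbb C$, an object $J$, and invertible 1-cells $a_{A,B,C}\colon(A\boxtimes B)\boxtimes C\cong A\boxtimes(B\boxtimes C)$, $r_A\colon A\boxtimes J\cong A$, $l_A\colon J\boxtimes A\cong A$ that are (strictly) 2-natural and satisfy the pentagon and triangle identities. In particular interchange holds only up to coherent invertible 2-cells, the tensorators. It is a nearly strict symmetric monoidal 2-category if it is moreover equipped with a strong 2-natural transformation (naturality up to coherent invertible 2-cells) with 1-cell components $s_{A,B}\colon A\boxtimes B\to B\boxtimes A$ satisfying $s_{A,B};s_{B,A}=\mathsf{id}$ and the coherence axioms for symmetric monoidal categories. *)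

theory Defs
  imports Main
begin

section \<open>Categories and functors\<close>

text \<open>
  Composition is in diagrammatic order. A category is a family of hom-sets, which need not be
  disjoint: in a Kleisli category the same arrow of the base may inhabit several hom-sets. Therefore
  composition, and the action of functors on arrows, take the relevant objects as arguments:
  \<open>Cmp C A B D f g\<close> is the composite of \<open>f: A \<rightarrow> B\<close> and \<open>g: B \<rightarrow> D\<close>.
\<close>

record ('o, 'a) cat =
  Obj :: "'o set"
  Hom :: "'o \<Rightarrow> 'o \<Rightarrow> 'a set"
  Idn :: "'o \<Rightarrow> 'a"
  Cmp :: "'o \<Rightarrow> 'o \<Rightarrow> 'o \<Rightarrow> 'a \<Rightarrow> 'a \<Rightarrow> 'a"

text \<open>
  \<open>\<llangle>C \<Turnstile> A, f, B, g, D\<rrangle>\<close> is the composite of the path \<open>A \<rightarrow> B \<rightarrow> D\<close> formed by \<open>f\<close> and \<open>g\<close>,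
  and similarly for longer paths.
\<close>

abbreviation path2 ("\<llangle>_ \<Turnstile> _, _, _, _, _\<rrangle>") where
  "\<llangle>C \<Turnstile> A, f, B, g, D\<rrangle> \<equiv> Cmp C A B D f g"
abbreviation path3 ("\<llangle>_ \<Turnstile> _, _, _, _, _, _, _\<rrangle>") where
  "\<llangle>C \<Turnstile> A, f, B, g, D, h, E\<rrangle> \<equiv> Cmp C A B E f (Cmp C B D E g h)"
abbreviation path4 ("\<llangle>_ \<Turnstile> _, _, _, _, _, _, _, _, _\<rrangle>") where
  "\<llangle>C \<Turnstile> A, f, B, g, D, h, E, k, G\<rrangle> \<equiv> Cmp C A B G f (Cmp C B D G g (Cmp C D E G h k))"

locale category =
  fixes C :: "('o, 'a, 'x) cat_scheme"
  assumes id_hom: "A \<in> Obj C \<Longrightarrow> Idn C A \<in> Hom C A A"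
    and cmp_hom: "\<lbrakk>A \<in> Obj C; B \<in> Obj C; D \<in> Obj C; f \<in> Hom C A B; g \<in> Hom C B D\<rbrakk>
      \<Longrightarrow> \<llangle>C \<Turnstile> A, f, B, g, D\<rrangle> \<in> Hom C A D"
    and cmp_assoc: "\<lbrakk>A \<in> Obj C; B \<in> Obj C; D \<in> Obj C; E \<in> Obj C;
      f \<in> Hom C A B; g \<in> Hom C B D; h \<in> Hom C D E\<rbrakk>
      \<Longrightarrow> Cmp C A D E (Cmp C A B D f g) h = Cmp C A B E f (Cmp C B D E g h)"
    and id_left: "\<lbrakk>A \<in> Obj C; B \<in> Obj C; f \<in> Hom C A B\<rbrakk> \<Longrightarrow> \<llangle>C \<Turnstile> A, Idn C A, A, f, B\<rrangle> = f"
    and id_right: "\<lbrakk>A \<in> Obj C; B \<in> Obj C; f \<in> Hom C A B\<rbrakk> \<Longrightarrow> \<llangle>C \<Turnstile> A, f, B, Idn C B, B\<rrangle> = f"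

definition inverse_arrows :: "('o, 'a, 'x) cat_scheme \<Rightarrow> 'o \<Rightarrow> 'o \<Rightarrow> 'a \<Rightarrow> 'a \<Rightarrow> bool" where
  "inverse_arrows C A B f g \<longleftrightarrow> f \<in> Hom C A B \<and> g \<in> Hom C B A
    \<and> \<llangle>C \<Turnstile> A, f, B, g, A\<rrangle> = Idn C A \<and> \<llangle>C \<Turnstile> B, g, A, f, B\<rrangle> = Idn C B"

definition is_iso :: "('o, 'a, 'x) cat_scheme \<Rightarrow> 'o \<Rightarrow> 'o \<Rightarrow> 'a \<Rightarrow> bool" where
  "is_iso C A B f \<longleftrightarrow> (\<exists>g. inverse_arrows C A B f g)"

definition inv_arr :: "('o, 'a, 'x) cat_scheme \<Rightarrow> 'o \<Rightarrow> 'o \<Rightarrow> 'a \<Rightarrow> 'a" where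
  "inv_arr C A B f = (THE g. inverse_arrows C A B f g)"

record ('o1, 'a1, 'o2, 'a2) fn =
  FO :: "'o1 \<Rightarrow> 'o2"
  FA :: "'o1 \<Rightarrow> 'o1 \<Rightarrow> 'a1 \<Rightarrow> 'a2"

locale cat_functor = C: category C + D: category D
  for C :: "('o1, 'a1, 'x) cat_scheme" and D :: "('o2, 'a2, 'y) cat_scheme" +
  fixes F :: "('o1, 'a1, 'o2, 'a2, 'z) fn_scheme"
  assumes fun_obj: "A \<in> Obj C \<Longrightarrow> FO F A \<in> Obj D"
    and fun_hom: "\<lbrakk>A \<in> Obj C; B \<in> Obj C; f \<in> Hom C A B\<rbrakk> \<Longrightarrow> FA F A B f \<in> Hom D (FO F A) (FO F B)"
    and fun_id: "A \<in> Obj C \<Longrightarrow> FA F A A (Idn C A) = Idn D (FO F A)"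
    and fun_cmp: "\<lbrakk>A \<in> Obj C; B \<in> Obj C; E \<in> Obj C; f \<in> Hom C A B; g \<in> Hom C B E\<rbrakk>
      \<Longrightarrow> FA F A E \<llangle>C \<Turnstile> A, f, B, g, E\<rrangle>
        = \<llangle>D \<Turnstile> FO F A, FA F A B f, FO F B, FA F B E g, FO F E\<rrangle>"

text \<open>Equality of functors out of \<open>C\<close>: values off the objects and hom-sets of \<open>C\<close> are irrelevant.\<close>

definition fn_eq :: "('o1, 'a1, 'x) cat_scheme \<Rightarrow> ('o1, 'a1, 'o2, 'a2, 'y) fn_scheme
    \<Rightarrow> ('o1, 'a1, 'o2, 'a2, 'z) fn_scheme \<Rightarrow> bool" where
  "fn_eq C F G \<longleftrightarrow> (\<forall>A\<in>Obj C. FO F A = FO G A)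
    \<and> (\<forall>A\<in>Obj C. \<forall>B\<in>Obj C. \<forall>f\<in>Hom C A B. FA F A B f = FA G A B f)"

definition fn_id :: "('o, 'a, 'o, 'a) fn" where
  "fn_id = \<lparr>FO = (\<lambda>A. A), FA = (\<lambda>A B f. f)\<rparr>"

definition fn_comp :: "('o1, 'a1, 'o2, 'a2, 'x) fn_scheme \<Rightarrow> ('o2, 'a2, 'o3, 'a3, 'y) fn_scheme
    \<Rightarrow> ('o1, 'a1, 'o3, 'a3) fn" where
  "fn_comp F G = \<lparr>FO = (\<lambda>A. FO G (FO F A)),
    FA = (\<lambda>A B f. FA G (FO F A) (FO F B) (FA F A B f))\<rparr>"

definition fn_const :: "('o2, 'a2, 'x) cat_scheme \<Rightarrow> 'o2 \<Rightarrow> ('o1, 'a1, 'o2, 'a2) fn" where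
  "fn_const D X = \<lparr>FO = (\<lambda>_. X), FA = (\<lambda>_ _ _. Idn D X)\<rparr>"

definition fn_pair :: "('o, 'a, 'o1, 'a1, 'x) fn_scheme \<Rightarrow> ('o, 'a, 'o2, 'a2, 'y) fn_scheme
    \<Rightarrow> ('o, 'a, 'o1 \<times> 'o2, 'a1 \<times> 'a2) fn" where
  "fn_pair F G = \<lparr>FO = (\<lambda>A. (FO F A, FO G A)), FA = (\<lambda>A B f. (FA F A B f, FA G A B f))\<rparr>"

definition fn_prod :: "('o1, 'a1, 'p1, 'b1, 'x) fn_scheme \<Rightarrow> ('o2, 'a2, 'p2, 'b2, 'y) fn_scheme
    \<Rightarrow> ('o1 \<times> 'o2, 'a1 \<times> 'a2, 'p1 \<times> 'p2, 'b1 \<times> 'b2) fn" where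
  "fn_prod F G = \<lparr>FO = (\<lambda>(A, A'). (FO F A, FO G A')),
    FA = (\<lambda>(A, A') (B, B') (f, f'). (FA F A B f, FA G A' B' f'))\<rparr>"

definition fn_assoc :: "(('o1 \<times> 'o2) \<times> 'o3, ('a1 \<times> 'a2) \<times> 'a3,
    'o1 \<times> ('o2 \<times> 'o3), 'a1 \<times> ('a2 \<times> 'a3)) fn" where
  "fn_assoc = \<lparr>FO = (\<lambda>((A, B), D). (A, (B, D))), FA = (\<lambda>_ _ ((f, g), h). (f, (g, h)))\<rparr>"

definition fn_swap :: "('o1 \<times> 'o2, 'a1 \<times> 'a2, 'o2 \<times> 'o1, 'a2 \<times> 'a1) fn" where
  "fn_swap = \<lparr>FO = (\<lambda>(A, B). (B, A)), FA = (\<lambda>_ _ (f, g). (g, f))\<rparr>"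

definition prod_cat :: "('o1, 'a1, 'x) cat_scheme \<Rightarrow> ('o2, 'a2, 'y) cat_scheme
    \<Rightarrow> ('o1 \<times> 'o2, 'a1 \<times> 'a2) cat" where
  "prod_cat C D = \<lparr>Obj = Obj C \<times> Obj D,
    Hom = (\<lambda>(A, A') (B, B'). Hom C A B \<times> Hom D A' B'),
    Idn = (\<lambda>(A, A'). (Idn C A, Idn D A')),
    Cmp = (\<lambda>(A, A') (B, B') (E, E') (f, f') (g, g'). (Cmp C A B E f g, Cmp D A' B' E' f' g'))\<rparr>"

definition nat_trans :: "('o1, 'a1, 'x) cat_scheme \<Rightarrow> ('o2, 'a2, 'y) cat_scheme
    \<Rightarrow> ('o1, 'a1, 'o2, 'a2, 'z) fn_scheme \<Rightarrow> ('o1, 'a1, 'o2, 'a2, 'w) fn_scheme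
    \<Rightarrow> ('o1 \<Rightarrow> 'a2) \<Rightarrow> bool" where
  "nat_trans C D F G t \<longleftrightarrow>
    (\<forall>A\<in>Obj C. t A \<in> Hom D (FO F A) (FO G A)) \<and>
    (\<forall>A\<in>Obj C. \<forall>B\<in>Obj C. \<forall>f\<in>Hom C A B.
      \<llangle>D \<Turnstile> FO F A, FA F A B f, FO F B, t B, FO G B\<rrangle>
      = \<llangle>D \<Turnstile> FO F A, t A, FO G A, FA G A B f, FO G B\<rrangle>)"

definition nat_iso :: "('o1, 'a1, 'x) cat_scheme \<Rightarrow> ('o2, 'a2, 'y) cat_scheme
    \<Rightarrow> ('o1, 'a1, 'o2, 'a2, 'z) fn_scheme \<Rightarrow> ('o1, 'a1, 'o2, 'a2, 'w) fn_scheme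
    \<Rightarrow> ('o1 \<Rightarrow> 'a2) \<Rightarrow> bool" where
  "nat_iso C D F G t \<longleftrightarrow> nat_trans C D F G t \<and> (\<forall>A\<in>Obj C. is_iso D (FO F A) (FO G A) (t A))"

section \<open>Monoidal categories\<close>

text \<open>
  The structure maps point as follows: \<open>Asc C A B D: (A \<otimes> B) \<otimes> D \<rightarrow> A \<otimes> (B \<otimes> D)\<close>,
  \<open>Run C A: A \<otimes> I \<rightarrow> A\<close>, \<open>Lun C A: I \<otimes> A \<rightarrow> A\<close>, \<open>Sym C A B: A \<otimes> B \<rightarrow> B \<otimes> A\<close>.
\<close>

record ('o, 'a) mon_cat = "('o, 'a) cat" +
  Tensor :: "('o \<times> 'o, 'a \<times> 'a, 'o, 'a) fn"
  Unt :: 'o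
  Asc :: "'o \<Rightarrow> 'o \<Rightarrow> 'o \<Rightarrow> 'a"
  Run :: "'o \<Rightarrow> 'a"
  Lun :: "'o \<Rightarrow> 'a"

record ('o, 'a) sym_mon_cat = "('o, 'a) mon_cat" +
  Sym :: "'o \<Rightarrow> 'o \<Rightarrow> 'a"

abbreviation tensor_obj ("(_ \<otimes>[_] _)" [71, 0, 70] 70) where
  "A \<otimes>[C] B \<equiv> FO (Tensor C) (A, B)"

text \<open>\<open>\<llangle>C \<Turnstile> A, f, B \<otimes> A', f', B'\<rrangle>\<close> is the product of \<open>f: A \<rightarrow> B\<close> and \<open>f': A' \<rightarrow> B'\<close>.\<close>

abbreviation tensor_arr ("\<llangle>_ \<Turnstile> _, _, _ \<otimes> _, _, _\<rrangle>") where
  "\<llangle>C \<Turnstile> A, f, B \<otimes> A', f', B'\<rrangle> \<equiv> FA (Tensor C) (A, A') (B, B') (f, f')"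

locale monoidal_category = category C for C :: "('o, 'a, 'x) mon_cat_scheme" +
  assumes tensor_functor: "cat_functor (prod_cat C C) C (Tensor C)"
    and unt_obj: "Unt C \<in> Obj C"
    and asc_nat_iso: "nat_iso (prod_cat (prod_cat C C) C) C
      (fn_comp (fn_prod (Tensor C) fn_id) (Tensor C))
      (fn_comp fn_assoc (fn_comp (fn_prod fn_id (Tensor C)) (Tensor C)))
      (\<lambda>((A, B), D). Asc C A B D)"
    and run_nat_iso: "nat_iso C C (fn_comp (fn_pair fn_id (fn_const C (Unt C))) (Tensor C)) fn_id (Run C)"
    and lun_nat_iso: "nat_iso C C (fn_comp (fn_pair (fn_const C (Unt C)) fn_id) (Tensor C)) fn_id (Lun C)"
    and pentagon: "\<lbrakk>A \<in> Obj C; B \<in> Obj C; D \<in> Obj C; E \<in> Obj C\<rbrakk> \<Longrightarrow>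
      \<llangle>C \<Turnstile> ((A \<otimes>[C] B) \<otimes>[C] D) \<otimes>[C] E,
         \<llangle>C \<Turnstile> (A \<otimes>[C] B) \<otimes>[C] D, Asc C A B D, A \<otimes>[C] (B \<otimes>[C] D) \<otimes> E, Idn C E, E\<rrangle>,
         (A \<otimes>[C] (B \<otimes>[C] D)) \<otimes>[C] E,
         Asc C A (B \<otimes>[C] D) E,
         A \<otimes>[C] ((B \<otimes>[C] D) \<otimes>[C] E),
         \<llangle>C \<Turnstile> A, Idn C A, A \<otimes> (B \<otimes>[C] D) \<otimes>[C] E, Asc C B D E, B \<otimes>[C] (D \<otimes>[C] E)\<rrangle>,
         A \<otimes>[C] (B \<otimes>[C] (D \<otimes>[C] E))\<rrangle>
      = \<llangle>C \<Turnstile> ((A \<otimes>[C] B) \<otimes>[C] D) \<otimes>[C] E,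
         Asc C (A \<otimes>[C] B) D E,
         (A \<otimes>[C] B) \<otimes>[C] (D \<otimes>[C] E),
         Asc C A B (D \<otimes>[C] E),
         A \<otimes>[C] (B \<otimes>[C] (D \<otimes>[C] E))\<rrangle>"
    and triangle: "\<lbrakk>A \<in> Obj C; B \<in> Obj C\<rbrakk> \<Longrightarrow>
      \<llangle>C \<Turnstile> (A \<otimes>[C] Unt C) \<otimes>[C] B,
         Asc C A (Unt C) B,
         A \<otimes>[C] (Unt C \<otimes>[C] B),
         \<llangle>C \<Turnstile> A, Idn C A, A \<otimes> Unt C \<otimes>[C] B, Lun C B, B\<rrangle>,
         A \<otimes>[C] B\<rrangle>
      = \<llangle>C \<Turnstile> A \<otimes>[C] Unt C, Run C A, A \<otimes> B, Idn C B, B\<rrangle>"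

locale symmetric_monoidal_category = monoidal_category C
  for C :: "('o, 'a, 'x) sym_mon_cat_scheme" +
  assumes sym_nat_iso: "nat_iso (prod_cat C C) C (Tensor C) (fn_comp fn_swap (Tensor C))
      (\<lambda>(A, B). Sym C A B)"
    and sym_sym: "\<lbrakk>A \<in> Obj C; B \<in> Obj C\<rbrakk> \<Longrightarrow>
      \<llangle>C \<Turnstile> A \<otimes>[C] B, Sym C A B, B \<otimes>[C] A, Sym C B A, A \<otimes>[C] B\<rrangle> = Idn C (A \<otimes>[C] B)"
    and hexagon: "\<lbrakk>A \<in> Obj C; B \<in> Obj C; D \<in> Obj C\<rbrakk> \<Longrightarrow>
      \<llangle>C \<Turnstile> (A \<otimes>[C] B) \<otimes>[C] D,
         Asc C A B D,
         A \<otimes>[C] (B \<otimes>[C] D),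
         Sym C A (B \<otimes>[C] D),
         (B \<otimes>[C] D) \<otimes>[C] A,
         Asc C B D A,
         B \<otimes>[C] (D \<otimes>[C] A)\<rrangle>
      = \<llangle>C \<Turnstile> (A \<otimes>[C] B) \<otimes>[C] D,
         \<llangle>C \<Turnstile> A \<otimes>[C] B, Sym C A B, B \<otimes>[C] A \<otimes> D, Idn C D, D\<rrangle>,
         (B \<otimes>[C] A) \<otimes>[C] D,
         Asc C B A D,
         B \<otimes>[C] (A \<otimes>[C] D),
         \<llangle>C \<Turnstile> B, Idn C B, B \<otimes> A \<otimes>[C] D, Sym C A D, D \<otimes>[C] A\<rrangle>,
         B \<otimes>[C] (D \<otimes>[C] A)\<rrangle>"
    and sym_unit: "A \<in> Obj C \<Longrightarrow>
      \<llangle>C \<Turnstile> A \<otimes>[C] Unt C, Sym C A (Unt C), Unt C \<otimes>[C] A, Lun C A, A\<rrangle> = Run C A"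

text \<open>The symmetry map \<open>m: (X1 \<otimes> X2) \<otimes> (Y1 \<otimes> Y2) \<rightarrow> (X1 \<otimes> Y1) \<otimes> (X2 \<otimes> Y2)\<close>.\<close>

definition interchange :: "('o, 'a, 'x) sym_mon_cat_scheme \<Rightarrow> 'o \<Rightarrow> 'o \<Rightarrow> 'o \<Rightarrow> 'o \<Rightarrow> 'a" where
  "interchange V X1 X2 Y1 Y2 =
    \<llangle>V \<Turnstile> (X1 \<otimes>[V] X2) \<otimes>[V] (Y1 \<otimes>[V] Y2),
       Asc V X1 X2 (Y1 \<otimes>[V] Y2),
       X1 \<otimes>[V] (X2 \<otimes>[V] (Y1 \<otimes>[V] Y2)),
       \<llangle>V \<Turnstile> X1, Idn V X1, X1 \<otimes>
         X2 \<otimes>[V] (Y1 \<otimes>[V] Y2),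
         \<llangle>V \<Turnstile> X2 \<otimes>[V] (Y1 \<otimes>[V] Y2),
            inv_arr V ((X2 \<otimes>[V] Y1) \<otimes>[V] Y2) (X2 \<otimes>[V] (Y1 \<otimes>[V] Y2)) (Asc V X2 Y1 Y2),
            (X2 \<otimes>[V] Y1) \<otimes>[V] Y2,
            \<llangle>V \<Turnstile> X2 \<otimes>[V] Y1, Sym V X2 Y1, Y1 \<otimes>[V] X2 \<otimes> Y2, Idn V Y2, Y2\<rrangle>,
            (Y1 \<otimes>[V] X2) \<otimes>[V] Y2,
            Asc V Y1 X2 Y2,
            Y1 \<otimes>[V] (X2 \<otimes>[V] Y2)\<rrangle>,
         Y1 \<otimes>[V] (X2 \<otimes>[V] Y2)\<rrangle>,
       X1 \<otimes>[V] (Y1 \<otimes>[V] (X2 \<otimes>[V] Y2)),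
       inv_arr V ((X1 \<otimes>[V] Y1) \<otimes>[V] (X2 \<otimes>[V] Y2)) (X1 \<otimes>[V] (Y1 \<otimes>[V] (X2 \<otimes>[V] Y2)))
         (Asc V X1 Y1 (X2 \<otimes>[V] Y2)),
       (X1 \<otimes>[V] Y1) \<otimes>[V] (X2 \<otimes>[V] Y2)\<rrangle>"

text \<open>The isomorphism \<open>I \<cong> I \<otimes> I\<close>, for composites of arrows out of the unit.\<close>

definition unit_split :: "('o, 'a, 'x) mon_cat_scheme \<Rightarrow> 'a" where
  "unit_split V = inv_arr V (Unt V \<otimes>[V] Unt V) (Unt V) (Lun V (Unt V))"

definition full_strict_monoidal_subcategory ::
    "('o, 'a, 'x) mon_cat_scheme \<Rightarrow> 'o set \<Rightarrow> bool" where
  "full_strict_monoidal_subcategory W U \<longleftrightarrow> U \<subseteq> Obj W \<and> Unt W \<in> U \<and>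
    (\<forall>A\<in>U. \<forall>B\<in>U. A \<otimes>[W] B \<in> U) \<and>
    (\<forall>A\<in>U. \<forall>B\<in>U. \<forall>D\<in>U. (A \<otimes>[W] B) \<otimes>[W] D = A \<otimes>[W] (B \<otimes>[W] D)
      \<and> Asc W A B D = Idn W (A \<otimes>[W] (B \<otimes>[W] D))) \<and>
    (\<forall>A\<in>U. A \<otimes>[W] Unt W = A \<and> Run W A = Idn W A) \<and>
    (\<forall>A\<in>U. Unt W \<otimes>[W] A = A \<and> Lun W A = Idn W A)"

section \<open>Lax monoidal functors\<close>

record ('o1, 'a1, 'o2, 'a2) lax_fn = "('o1, 'a1, 'o2, 'a2) fn" +
  Leps :: 'a2
  Ltil :: "'o1 \<Rightarrow> 'o1 \<Rightarrow> 'a2"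

locale lax_monoidal_functor = cat_functor V W N
  for V :: "('o1, 'a1, 'x) mon_cat_scheme" and W :: "('o2, 'a2, 'y) mon_cat_scheme"
    and N :: "('o1, 'a1, 'o2, 'a2, 'z) lax_fn_scheme" +
  assumes source_monoidal: "monoidal_category V"
    and target_monoidal: "monoidal_category W"
    and eps_hom: "Leps N \<in> Hom W (Unt W) (FO N (Unt V))"
    and til_nat: "nat_trans (prod_cat V V) W
      (fn_comp (fn_prod N N) (Tensor W)) (fn_comp (Tensor V) N) (\<lambda>(A, B). Ltil N A B)"
    and lax_assoc: "\<lbrakk>A \<in> Obj V; B \<in> Obj V; D \<in> Obj V\<rbrakk> \<Longrightarrow>
      \<llangle>W \<Turnstile> (FO N A \<otimes>[W] FO N B) \<otimes>[W] FO N D,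
         \<llangle>W \<Turnstile> FO N A \<otimes>[W] FO N B, Ltil N A B, FO N (A \<otimes>[V] B) \<otimes> FO N D, Idn W (FO N D), FO N D\<rrangle>,
         FO N (A \<otimes>[V] B) \<otimes>[W] FO N D,
         Ltil N (A \<otimes>[V] B) D,
         FO N ((A \<otimes>[V] B) \<otimes>[V] D),
         FA N ((A \<otimes>[V] B) \<otimes>[V] D) (A \<otimes>[V] (B \<otimes>[V] D)) (Asc V A B D),
         FO N (A \<otimes>[V] (B \<otimes>[V] D))\<rrangle>
      = \<llangle>W \<Turnstile> (FO N A \<otimes>[W] FO N B) \<otimes>[W] FO N D,
         Asc W (FO N A) (FO N B) (FO N D),
         FO N A \<otimes>[W] (FO N B \<otimes>[W] FO N D),
         \<llangle>W \<Turnstile> FO N A, Idn W (FO N A), FO N A \<otimes> FO N B \<otimes>[W] FO N D, Ltil N B D, FO N (B \<otimes>[V] D)\<rrangle>,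
         FO N A \<otimes>[W] FO N (B \<otimes>[V] D),
         Ltil N A (B \<otimes>[V] D),
         FO N (A \<otimes>[V] (B \<otimes>[V] D))\<rrangle>"
    and lax_run: "A \<in> Obj V \<Longrightarrow>
      \<llangle>W \<Turnstile> FO N A \<otimes>[W] Unt W,
         \<llangle>W \<Turnstile> FO N A, Idn W (FO N A), FO N A \<otimes> Unt W, Leps N, FO N (Unt V)\<rrangle>,
         FO N A \<otimes>[W] FO N (Unt V),
         Ltil N A (Unt V),
         FO N (A \<otimes>[V] Unt V),
         FA N (A \<otimes>[V] Unt V) A (Run V A),
         FO N A\<rrangle> = Run W (FO N A)"
    and lax_lun: "A \<in> Obj V \<Longrightarrow>
      \<llangle>W \<Turnstile> Unt W \<otimes>[W] FO N A,
         \<llangle>W \<Turnstile> Unt W, Leps N, FO N (Unt V) \<otimes> FO N A, Idn W (FO N A), FO N A\<rrangle>,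
         FO N (Unt V) \<otimes>[W] FO N A,
         Ltil N (Unt V) A,
         FO N (Unt V \<otimes>[V] A),
         FA N (Unt V \<otimes>[V] A) A (Lun V A),
         FO N A\<rrangle> = Lun W (FO N A)"

locale symmetric_lax_monoidal_functor = lax_monoidal_functor V W N
  for V :: "('o1, 'a1, 'x) sym_mon_cat_scheme" and W :: "('o2, 'a2, 'y) sym_mon_cat_scheme"
    and N :: "('o1, 'a1, 'o2, 'a2, 'z) lax_fn_scheme" +
  assumes source_symmetric: "symmetric_monoidal_category V"
    and target_symmetric: "symmetric_monoidal_category W"
    and lax_sym: "\<lbrakk>A \<in> Obj V; B \<in> Obj V\<rbrakk> \<Longrightarrow>
      \<llangle>W \<Turnstile> FO N A \<otimes>[W] FO N B, Ltil N A B, FO N (A \<otimes>[V] B),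
         FA N (A \<otimes>[V] B) (B \<otimes>[V] A) (Sym V A B), FO N (B \<otimes>[V] A)\<rrangle>
      = \<llangle>W \<Turnstile> FO N A \<otimes>[W] FO N B, Sym W (FO N A) (FO N B), FO N B \<otimes>[W] FO N A,
         Ltil N B A, FO N (B \<otimes>[V] A)\<rrangle>"

definition lax_id :: "('o, 'a, 'x) mon_cat_scheme \<Rightarrow> ('o, 'a, 'o, 'a) lax_fn" where
  "lax_id W = \<lparr>FO = (\<lambda>A. A), FA = (\<lambda>A B f. f), Leps = Idn W (Unt W),
    Ltil = (\<lambda>A B. Idn W (A \<otimes>[W] B))\<rparr>"

definition lax_comp :: "('o1, 'a1, 'x1) mon_cat_scheme \<Rightarrow> ('o2, 'a2, 'x2) mon_cat_scheme
    \<Rightarrow> ('o3, 'a3, 'x3) mon_cat_scheme \<Rightarrow> ('o1, 'a1, 'o2, 'a2, 'y) lax_fn_scheme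
    \<Rightarrow> ('o2, 'a2, 'o3, 'a3, 'z) lax_fn_scheme \<Rightarrow> ('o1, 'a1, 'o3, 'a3) lax_fn" where
  "lax_comp V W X F G = \<lparr>
    FO = (\<lambda>A. FO G (FO F A)),
    FA = (\<lambda>A B f. FA G (FO F A) (FO F B) (FA F A B f)),
    Leps = \<llangle>X \<Turnstile> Unt X, Leps G, FO G (Unt W), FA G (Unt W) (FO F (Unt V)) (Leps F), FO G (FO F (Unt V))\<rrangle>,
    Ltil = (\<lambda>A B. \<llangle>X \<Turnstile> FO G (FO F A) \<otimes>[X] FO G (FO F B),
      Ltil G (FO F A) (FO F B), FO G (FO F A \<otimes>[W] FO F B),
      FA G (FO F A \<otimes>[W] FO F B) (FO F (A \<otimes>[V] B)) (Ltil F A B), FO G (FO F (A \<otimes>[V] B))\<rrangle>)\<rparr>"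

definition monoidal_transformation :: "('o1, 'a1, 'x) mon_cat_scheme
    \<Rightarrow> ('o2, 'a2, 'y) mon_cat_scheme \<Rightarrow> ('o1, 'a1, 'o2, 'a2, 'z) lax_fn_scheme
    \<Rightarrow> ('o1, 'a1, 'o2, 'a2, 'w) lax_fn_scheme \<Rightarrow> ('o1 \<Rightarrow> 'a2) \<Rightarrow> bool" where
  "monoidal_transformation V W F G t \<longleftrightarrow> nat_trans V W F G t \<and>
    \<llangle>W \<Turnstile> Unt W, Leps F, FO F (Unt V), t (Unt V), FO G (Unt V)\<rrangle> = Leps G \<and>
    (\<forall>A\<in>Obj V. \<forall>B\<in>Obj V.
      \<llangle>W \<Turnstile> FO F A \<otimes>[W] FO F B, Ltil F A B, FO F (A \<otimes>[V] B), t (A \<otimes>[V] B), FO G (A \<otimes>[V] B)\<rrangle>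
      = \<llangle>W \<Turnstile> FO F A \<otimes>[W] FO F B, \<llangle>W \<Turnstile> FO F A, t A, FO G A \<otimes> FO F B, t B, FO G B\<rrangle>,
          FO G A \<otimes>[W] FO G B, Ltil G A B, FO G (A \<otimes>[V] B)\<rrangle>)"

section \<open>Symmetric monoidal monads and Kleisli categories\<close>

record ('o, 'a) sm_monad =
  Mfun :: "('o, 'a, 'o, 'a) fn"
  Mmu :: "'o \<Rightarrow> 'a"
  Meta :: "'o \<Rightarrow> 'a"
  Mnab :: "'o \<Rightarrow> 'o \<Rightarrow> 'a"

definition monad_lax :: "('o, 'a, 'x) mon_cat_scheme \<Rightarrow> ('o, 'a, 'y) sm_monad_scheme
    \<Rightarrow> ('o, 'a, 'o, 'a) lax_fn" where
  "monad_lax W M = \<lparr>FO = FO (Mfun M), FA = FA (Mfun M), Leps = Meta M (Unt W), Ltil = Mnab M\<rparr>"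

locale symmetric_monoidal_monad =
  symmetric_lax_monoidal_functor W W "monad_lax W M"
  for W :: "('o, 'a, 'x) sym_mon_cat_scheme" and M :: "('o, 'a, 'y) sm_monad_scheme" +
  assumes mu_monoidal: "monoidal_transformation W W
      (lax_comp W W W (monad_lax W M) (monad_lax W M)) (monad_lax W M) (Mmu M)"
    and eta_monoidal: "monoidal_transformation W W (lax_id W) (monad_lax W M) (Meta M)"
    and mu_assoc: "X \<in> Obj W \<Longrightarrow> (let T = FO (Mfun M) in
      \<llangle>W \<Turnstile> T (T (T X)), FA (Mfun M) (T (T X)) (T X) (Mmu M X), T (T X), Mmu M X, T X\<rrangle>
      = \<llangle>W \<Turnstile> T (T (T X)), Mmu M (T X), T (T X), Mmu M X, T X\<rrangle>)"
    and eta_mu: "X \<in> Obj W \<Longrightarrow> (let T = FO (Mfun M) in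
      \<llangle>W \<Turnstile> T X, Meta M (T X), T (T X), Mmu M X, T X\<rrangle> = Idn W (T X))"
    and M_eta_mu: "X \<in> Obj W \<Longrightarrow> (let T = FO (Mfun M) in
      \<llangle>W \<Turnstile> T X, FA (Mfun M) X (T X) (Meta M X), T (T X), Mmu M X, T X\<rrangle> = Idn W (T X))"

text \<open>\<open>kl_lift W M A B f\<close> is the Kleisli arrow \<open>f;\<eta>\<close> given by the arrow \<open>f: A \<rightarrow> B\<close> of \<open>W\<close>.\<close>

definition kl_lift :: "('o, 'a, 'x) cat_scheme \<Rightarrow> ('o, 'a, 'y) sm_monad_scheme
    \<Rightarrow> 'o \<Rightarrow> 'o \<Rightarrow> 'a \<Rightarrow> 'a" where
  "kl_lift W M A B f = \<llangle>W \<Turnstile> A, f, B, Meta M B, FO (Mfun M) B\<rrangle>"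

definition kleisli :: "('o, 'a, 'x) sym_mon_cat_scheme \<Rightarrow> ('o, 'a, 'y) sm_monad_scheme
    \<Rightarrow> ('o, 'a) sym_mon_cat" where
  "kleisli W M = (let T = FO (Mfun M) in \<lparr>
    Obj = Obj W,
    Hom = (\<lambda>A X. Hom W A (T X)),
    Idn = Meta M,
    Cmp = (\<lambda>A X Y f g. \<llangle>W \<Turnstile> A, f, T X, FA (Mfun M) X (T Y) g, T (T Y), Mmu M Y, T Y\<rrangle>),
    Tensor = \<lparr>FO = FO (Tensor W),
      FA = (\<lambda>(A, B) (X, Y) (f, g). \<llangle>W \<Turnstile> A \<otimes>[W] B, \<llangle>W \<Turnstile> A, f, T X \<otimes> B, g, T Y\<rrangle>,
        T X \<otimes>[W] T Y, Mnab M X Y, T (X \<otimes>[W] Y)\<rrangle>)\<rparr>,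
    Unt = Unt W,
    Asc = (\<lambda>A B D. kl_lift W M ((A \<otimes>[W] B) \<otimes>[W] D) (A \<otimes>[W] (B \<otimes>[W] D)) (Asc W A B D)),
    Run = (\<lambda>A. kl_lift W M (A \<otimes>[W] Unt W) A (Run W A)),
    Lun = (\<lambda>A. kl_lift W M (Unt W \<otimes>[W] A) A (Lun W A)),
    Sym = (\<lambda>A B. kl_lift W M (A \<otimes>[W] B) (B \<otimes>[W] A) (Sym W A B))\<rparr>)"

text \<open>The functor \<open>L\<^sub>M: W \<rightarrow> Kl\<^sub>M\<close>; it is strict, so its comparison maps are Kleisli identities.\<close>

definition kl_embed :: "('o, 'a, 'x) mon_cat_scheme \<Rightarrow> ('o, 'a, 'y) sm_monad_scheme
    \<Rightarrow> ('o, 'a, 'o, 'a) lax_fn" where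
  "kl_embed W M = \<lparr>FO = (\<lambda>A. A), FA = kl_lift W M, Leps = Meta M (Unt W),
    Ltil = (\<lambda>A B. Meta M (A \<otimes>[W] B))\<rparr>"

section \<open>Lax monoidal functors into the category of small categories\<close>

text \<open>
  The product of categories changes the types of objects and arrows, so the cartesian category
  \<open>cat\<close> is not itself an instance of the record of monoidal categories. The definitions below
  are those of lax monoidal functors into \<open>cat\<close> and of change of base along them, unfolded:
  \<open>Kfun A\<close> is the category at \<open>A\<close>, \<open>Karr A B f\<close> is the functor at \<open>f: A \<rightarrow> B\<close>, and the functor
  from the terminal category that is the unit comparison is given by the object \<open>Keps\<close> it picks.
\<close>

record ('o, 'a, 'c, 'd) cat_lax =
  Kfun :: "'o \<Rightarrow> ('c, 'd) cat"
  Karr :: "'o \<Rightarrow> 'o \<Rightarrow> 'a \<Rightarrow> ('c, 'd, 'c, 'd) fn"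
  Keps :: 'c
  Ktil :: "'o \<Rightarrow> 'o \<Rightarrow> ('c \<times> 'c, 'd \<times> 'd, 'c, 'd) fn"

locale lax_monoidal_to_cat = monoidal_category V
  for V :: "('o, 'a, 'x) mon_cat_scheme" +
  fixes N :: "('o, 'a, 'c, 'd, 'y) cat_lax_scheme"
  assumes k_cat: "A \<in> Obj V \<Longrightarrow> category (Kfun N A)"
    and k_functor: "\<lbrakk>A \<in> Obj V; B \<in> Obj V; f \<in> Hom V A B\<rbrakk>
      \<Longrightarrow> cat_functor (Kfun N A) (Kfun N B) (Karr N A B f)"
    and k_id: "A \<in> Obj V \<Longrightarrow> fn_eq (Kfun N A) (Karr N A A (Idn V A)) fn_id"
    and k_cmp: "\<lbrakk>A \<in> Obj V; B \<in> Obj V; D \<in> Obj V; f \<in> Hom V A B; g \<in> Hom V B D\<rbrakk>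
      \<Longrightarrow> fn_eq (Kfun N A) (Karr N A D \<llangle>V \<Turnstile> A, f, B, g, D\<rrangle>) (fn_comp (Karr N A B f) (Karr N B D g))"
    and k_eps: "Keps N \<in> Obj (Kfun N (Unt V))"
    and k_til_functor: "\<lbrakk>A \<in> Obj V; B \<in> Obj V\<rbrakk>
      \<Longrightarrow> cat_functor (prod_cat (Kfun N A) (Kfun N B)) (Kfun N (A \<otimes>[V] B)) (Ktil N A B)"
    and k_til_nat: "\<lbrakk>A \<in> Obj V; A' \<in> Obj V; B \<in> Obj V; B' \<in> Obj V; f \<in> Hom V A A'; g \<in> Hom V B B'\<rbrakk>
      \<Longrightarrow> fn_eq (prod_cat (Kfun N A) (Kfun N B))
        (fn_comp (fn_prod (Karr N A A' f) (Karr N B B' g)) (Ktil N A' B'))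
        (fn_comp (Ktil N A B)
          (Karr N (A \<otimes>[V] B) (A' \<otimes>[V] B') \<llangle>V \<Turnstile> A, f, A' \<otimes> B, g, B'\<rrangle>))"
    and k_assoc: "\<lbrakk>A \<in> Obj V; B \<in> Obj V; D \<in> Obj V\<rbrakk>
      \<Longrightarrow> fn_eq (prod_cat (prod_cat (Kfun N A) (Kfun N B)) (Kfun N D))
        (fn_comp (fn_prod (Ktil N A B) fn_id) (fn_comp (Ktil N (A \<otimes>[V] B) D)
          (Karr N ((A \<otimes>[V] B) \<otimes>[V] D) (A \<otimes>[V] (B \<otimes>[V] D)) (Asc V A B D))))
        (fn_comp fn_assoc (fn_comp (fn_prod fn_id (Ktil N B D)) (Ktil N A (B \<otimes>[V] D))))"
    and k_run: "A \<in> Obj V \<Longrightarrow> fn_eq (Kfun N A)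
        (fn_comp (fn_pair fn_id (fn_const (Kfun N (Unt V)) (Keps N)))
          (fn_comp (Ktil N A (Unt V)) (Karr N (A \<otimes>[V] Unt V) A (Run V A)))) fn_id"
    and k_lun: "A \<in> Obj V \<Longrightarrow> fn_eq (Kfun N A)
        (fn_comp (fn_pair (fn_const (Kfun N (Unt V)) (Keps N)) fn_id)
          (fn_comp (Ktil N (Unt V) A) (Karr N (Unt V \<otimes>[V] A) A (Lun V A)))) fn_id"

definition cat_lax_comp :: "('o1, 'a1, 'x) mon_cat_scheme \<Rightarrow> ('o2, 'a2, 'y) mon_cat_scheme
    \<Rightarrow> ('o1, 'a1, 'o2, 'a2, 'z) lax_fn_scheme \<Rightarrow> ('o2, 'a2, 'c, 'd, 'w) cat_lax_scheme
    \<Rightarrow> ('o1, 'a1, 'c, 'd) cat_lax" where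
  "cat_lax_comp V W F N = \<lparr>
    Kfun = (\<lambda>A. Kfun N (FO F A)),
    Karr = (\<lambda>A B f. Karr N (FO F A) (FO F B) (FA F A B f)),
    Keps = FO (Karr N (Unt W) (FO F (Unt V)) (Leps F)) (Keps N),
    Ktil = (\<lambda>A B. fn_comp (Ktil N (FO F A) (FO F B))
      (Karr N (FO F A \<otimes>[W] FO F B) (FO F (A \<otimes>[V] B)) (Ltil F A B)))\<rparr>"

text \<open>
  The partial slice functor. Here \<open>D\<close> is the Kleisli category and \<open>U\<close> the set of objects of the
  full subcategory.
\<close>

definition slice_cat :: "('o, 'a, 'x) cat_scheme \<Rightarrow> 'o set \<Rightarrow> 'o \<Rightarrow> ('o \<times> 'a, 'a) cat" where
  "slice_cat D U A = \<lparr>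
    Obj = {(X, f). X \<in> U \<and> f \<in> Hom D X A},
    Hom = (\<lambda>(X, f) (Y, g). {\<phi> \<in> Hom D X Y. f = \<llangle>D \<Turnstile> X, \<phi>, Y, g, A\<rrangle>}),
    Idn = (\<lambda>(X, f). Idn D X),
    Cmp = (\<lambda>(X, f) (Y, g) (Z, h) \<phi> \<psi>. \<llangle>D \<Turnstile> X, \<phi>, Y, \<psi>, Z\<rrangle>)\<rparr>"

definition slice_functor :: "('o, 'a, 'x) mon_cat_scheme \<Rightarrow> 'o set
    \<Rightarrow> ('o, 'a, 'o \<times> 'a, 'a) cat_lax" where
  "slice_functor D U = \<lparr>
    Kfun = slice_cat D U,
    Karr = (\<lambda>A B k. \<lparr>FO = (\<lambda>(X, f). (X, \<llangle>D \<Turnstile> X, f, A, k, B\<rrangle>)), FA = (\<lambda>_ _ \<phi>. \<phi>)\<rparr>),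
    Keps = (Unt D, Idn D (Unt D)),
    Ktil = (\<lambda>A B. \<lparr>
      FO = (\<lambda>((X, f), (Y, g)). (X \<otimes>[D] Y, \<llangle>D \<Turnstile> X, f, A \<otimes> Y, g, B\<rrangle>)),
      FA = (\<lambda>((X, f), (Y, g)) ((X', f'), (Y', g')) (\<phi>, \<psi>). \<llangle>D \<Turnstile> X, \<phi>, X' \<otimes> Y, \<psi>, Y'\<rrangle>)\<rparr>)\<rparr>"

section \<open>Enriched categories\<close>

record ('c, 'vo, 'va) vcat =
  VObj :: "'c set"
  VHom :: "'c \<Rightarrow> 'c \<Rightarrow> 'vo"
  VIdn :: "'c \<Rightarrow> 'va"
  VCmp :: "'c \<Rightarrow> 'c \<Rightarrow> 'c \<Rightarrow> 'va"

locale vcategory = V: monoidal_category V for V :: "('vo, 'va, 'x) mon_cat_scheme" +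
  fixes C :: "('c, 'vo, 'va, 'y) vcat_scheme"
  assumes vhom_obj: "\<lbrakk>A \<in> VObj C; B \<in> VObj C\<rbrakk> \<Longrightarrow> VHom C A B \<in> Obj V"
    and vid_hom: "A \<in> VObj C \<Longrightarrow> VIdn C A \<in> Hom V (Unt V) (VHom C A A)"
    and vcmp_hom: "\<lbrakk>A \<in> VObj C; B \<in> VObj C; D \<in> VObj C\<rbrakk>
      \<Longrightarrow> VCmp C A B D \<in> Hom V (VHom C A B \<otimes>[V] VHom C B D) (VHom C A D)"
    and vcmp_assoc: "\<lbrakk>A \<in> VObj C; B \<in> VObj C; D \<in> VObj C; E \<in> VObj C\<rbrakk> \<Longrightarrow>
      \<llangle>V \<Turnstile> (VHom C A B \<otimes>[V] VHom C B D) \<otimes>[V] VHom C D E,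
         \<llangle>V \<Turnstile> VHom C A B \<otimes>[V] VHom C B D, VCmp C A B D, VHom C A D \<otimes>
            VHom C D E, Idn V (VHom C D E), VHom C D E\<rrangle>,
         VHom C A D \<otimes>[V] VHom C D E,
         VCmp C A D E,
         VHom C A E\<rrangle>
      = \<llangle>V \<Turnstile> (VHom C A B \<otimes>[V] VHom C B D) \<otimes>[V] VHom C D E,
         Asc V (VHom C A B) (VHom C B D) (VHom C D E),
         VHom C A B \<otimes>[V] (VHom C B D \<otimes>[V] VHom C D E),
         \<llangle>V \<Turnstile> VHom C A B, Idn V (VHom C A B), VHom C A B \<otimes>
            VHom C B D \<otimes>[V] VHom C D E, VCmp C B D E, VHom C B E\<rrangle>,
         VHom C A B \<otimes>[V] VHom C B E,
         VCmp C A B E,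
         VHom C A E\<rrangle>"
    and vid_left: "\<lbrakk>A \<in> VObj C; B \<in> VObj C\<rbrakk> \<Longrightarrow>
      \<llangle>V \<Turnstile> Unt V \<otimes>[V] VHom C A B,
         \<llangle>V \<Turnstile> Unt V, VIdn C A, VHom C A A \<otimes> VHom C A B, Idn V (VHom C A B), VHom C A B\<rrangle>,
         VHom C A A \<otimes>[V] VHom C A B,
         VCmp C A A B,
         VHom C A B\<rrangle> = Lun V (VHom C A B)"
    and vid_right: "\<lbrakk>A \<in> VObj C; B \<in> VObj C\<rbrakk> \<Longrightarrow>
      \<llangle>V \<Turnstile> VHom C A B \<otimes>[V] Unt V,
         \<llangle>V \<Turnstile> VHom C A B, Idn V (VHom C A B), VHom C A B \<otimes> Unt V, VIdn C B, VHom C B B\<rrangle>,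
         VHom C A B \<otimes>[V] VHom C B B,
         VCmp C A B B,
         VHom C A B\<rrangle> = Run V (VHom C A B)"

definition underlying :: "('vo, 'va, 'x) mon_cat_scheme \<Rightarrow> ('c, 'vo, 'va, 'y) vcat_scheme
    \<Rightarrow> ('c, 'va) cat" where
  "underlying V C = \<lparr>
    Obj = VObj C,
    Hom = (\<lambda>A B. Hom V (Unt V) (VHom C A B)),
    Idn = VIdn C,
    Cmp = (\<lambda>A B D f g.
      \<llangle>V \<Turnstile> Unt V, unit_split V, Unt V \<otimes>[V] Unt V,
         \<llangle>V \<Turnstile> Unt V, f, VHom C A B \<otimes> Unt V, g, VHom C B D\<rrangle>,
         VHom C A B \<otimes>[V] VHom C B D, VCmp C A B D, VHom C A D\<rrangle>)\<rparr>"

definition vcat_prod :: "('vo, 'va, 'x) sym_mon_cat_scheme \<Rightarrow> ('c, 'vo, 'va, 'y) vcat_scheme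
    \<Rightarrow> ('d, 'vo, 'va, 'z) vcat_scheme \<Rightarrow> ('c \<times> 'd, 'vo, 'va) vcat" where
  "vcat_prod V C D = \<lparr>
    VObj = VObj C \<times> VObj D,
    VHom = (\<lambda>(A1, A2) (B1, B2). VHom C A1 B1 \<otimes>[V] VHom D A2 B2),
    VIdn = (\<lambda>(A1, A2). \<llangle>V \<Turnstile> Unt V, unit_split V, Unt V \<otimes>[V] Unt V,
      \<llangle>V \<Turnstile> Unt V, VIdn C A1, VHom C A1 A1 \<otimes> Unt V, VIdn D A2, VHom D A2 A2\<rrangle>,
      VHom C A1 A1 \<otimes>[V] VHom D A2 A2\<rrangle>),
    VCmp = (\<lambda>(A1, A2) (B1, B2) (E1, E2).
      \<llangle>V \<Turnstile> (VHom C A1 B1 \<otimes>[V] VHom D A2 B2) \<otimes>[V] (VHom C B1 E1 \<otimes>[V] VHom D B2 E2),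
         interchange V (VHom C A1 B1) (VHom D A2 B2) (VHom C B1 E1) (VHom D B2 E2),
         (VHom C A1 B1 \<otimes>[V] VHom C B1 E1) \<otimes>[V] (VHom D A2 B2 \<otimes>[V] VHom D B2 E2),
         \<llangle>V \<Turnstile> VHom C A1 B1 \<otimes>[V] VHom C B1 E1, VCmp C A1 B1 E1, VHom C A1 E1 \<otimes>
            VHom D A2 B2 \<otimes>[V] VHom D B2 E2, VCmp D A2 B2 E2, VHom D A2 E2\<rrangle>,
         VHom C A1 E1 \<otimes>[V] VHom D A2 E2\<rrangle>)\<rparr>"

record ('c, 'd, 'va) vfn =
  VFO :: "'c \<Rightarrow> 'd"
  VFA :: "'c \<Rightarrow> 'c \<Rightarrow> 'va"

locale vfunctor = C: vcategory V C + D: vcategory V D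
  for V :: "('vo, 'va, 'x) mon_cat_scheme" and C :: "('c, 'vo, 'va, 'y) vcat_scheme"
    and D :: "('d, 'vo, 'va, 'z) vcat_scheme" +
  fixes F :: "('c, 'd, 'va, 'w) vfn_scheme"
  assumes vfun_obj: "A \<in> VObj C \<Longrightarrow> VFO F A \<in> VObj D"
    and vfun_hom: "\<lbrakk>A \<in> VObj C; B \<in> VObj C\<rbrakk>
      \<Longrightarrow> VFA F A B \<in> Hom V (VHom C A B) (VHom D (VFO F A) (VFO F B))"
    and vfun_id: "A \<in> VObj C \<Longrightarrow>
      \<llangle>V \<Turnstile> Unt V, VIdn C A, VHom C A A, VFA F A A, VHom D (VFO F A) (VFO F A)\<rrangle> = VIdn D (VFO F A)"
    and vfun_cmp: "\<lbrakk>A \<in> VObj C; B \<in> VObj C; E \<in> VObj C\<rbrakk> \<Longrightarrow>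
      \<llangle>V \<Turnstile> VHom C A B \<otimes>[V] VHom C B E, VCmp C A B E, VHom C A E,
         VFA F A E, VHom D (VFO F A) (VFO F E)\<rrangle>
      = \<llangle>V \<Turnstile> VHom C A B \<otimes>[V] VHom C B E,
         \<llangle>V \<Turnstile> VHom C A B, VFA F A B, VHom D (VFO F A) (VFO F B) \<otimes>
            VHom C B E, VFA F B E, VHom D (VFO F B) (VFO F E)\<rrangle>,
         VHom D (VFO F A) (VFO F B) \<otimes>[V] VHom D (VFO F B) (VFO F E),
         VCmp D (VFO F A) (VFO F B) (VFO F E),
         VHom D (VFO F A) (VFO F E)\<rrangle>"

definition vfn_id :: "('vo, 'va, 'x) mon_cat_scheme \<Rightarrow> ('c, 'vo, 'va, 'y) vcat_scheme
    \<Rightarrow> ('c, 'c, 'va) vfn" where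
  "vfn_id V C = \<lparr>VFO = (\<lambda>A. A), VFA = (\<lambda>A B. Idn V (VHom C A B))\<rparr>"

definition vfn_comp :: "('vo, 'va, 'x) mon_cat_scheme \<Rightarrow> ('c, 'vo, 'va, 'y1) vcat_scheme
    \<Rightarrow> ('d, 'vo, 'va, 'y2) vcat_scheme \<Rightarrow> ('e, 'vo, 'va, 'y3) vcat_scheme
    \<Rightarrow> ('c, 'd, 'va, 'z1) vfn_scheme \<Rightarrow> ('d, 'e, 'va, 'z2) vfn_scheme \<Rightarrow> ('c, 'e, 'va) vfn" where
  "vfn_comp V C D E F G = \<lparr>
    VFO = (\<lambda>A. VFO G (VFO F A)),
    VFA = (\<lambda>A B. \<llangle>V \<Turnstile> VHom C A B, VFA F A B, VHom D (VFO F A) (VFO F B),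
      VFA G (VFO F A) (VFO F B), VHom E (VFO G (VFO F A)) (VFO G (VFO F B))\<rrangle>)\<rparr>"

definition vfn_prod :: "('vo, 'va, 'x) mon_cat_scheme
    \<Rightarrow> ('c, 'vo, 'va, 'y1) vcat_scheme \<Rightarrow> ('c1, 'vo, 'va, 'y2) vcat_scheme
    \<Rightarrow> ('d, 'vo, 'va, 'y3) vcat_scheme \<Rightarrow> ('d1, 'vo, 'va, 'y4) vcat_scheme
    \<Rightarrow> ('c, 'c1, 'va, 'z1) vfn_scheme \<Rightarrow> ('d, 'd1, 'va, 'z2) vfn_scheme
    \<Rightarrow> ('c \<times> 'd, 'c1 \<times> 'd1, 'va) vfn" where
  "vfn_prod V C C' D D' F G = \<lparr>
    VFO = (\<lambda>(A1, A2). (VFO F A1, VFO G A2)),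
    VFA = (\<lambda>(A1, A2) (B1, B2).
      \<llangle>V \<Turnstile> VHom C A1 B1, VFA F A1 B1, VHom C' (VFO F A1) (VFO F B1) \<otimes>
         VHom D A2 B2, VFA G A2 B2, VHom D' (VFO G A2) (VFO G B2)\<rrangle>)\<rparr>"

definition vfn_assoc :: "('vo, 'va, 'x) mon_cat_scheme \<Rightarrow> ('c, 'vo, 'va, 'y1) vcat_scheme
    \<Rightarrow> ('d, 'vo, 'va, 'y2) vcat_scheme \<Rightarrow> ('e, 'vo, 'va, 'y3) vcat_scheme
    \<Rightarrow> (('c \<times> 'd) \<times> 'e, 'c \<times> ('d \<times> 'e), 'va) vfn" where
  "vfn_assoc V C D E = \<lparr>
    VFO = (\<lambda>((A1, A2), A3). (A1, (A2, A3))),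
    VFA = (\<lambda>((A1, A2), A3) ((B1, B2), B3). Asc V (VHom C A1 B1) (VHom D A2 B2) (VHom E A3 B3))\<rparr>"

definition vfn_swap :: "('vo, 'va, 'x) sym_mon_cat_scheme \<Rightarrow> ('c, 'vo, 'va, 'y1) vcat_scheme
    \<Rightarrow> ('d, 'vo, 'va, 'y2) vcat_scheme \<Rightarrow> ('c \<times> 'd, 'd \<times> 'c, 'va) vfn" where
  "vfn_swap V C D = \<lparr>
    VFO = (\<lambda>(A1, A2). (A2, A1)),
    VFA = (\<lambda>(A1, A2) (B1, B2). Sym V (VHom C A1 B1) (VHom D A2 B2))\<rparr>"

text \<open>The functors \<open>A \<mapsto> (A, J)\<close> and \<open>A \<mapsto> (J, A)\<close> from \<open>C\<close> to the product of \<open>C\<close> with itself.\<close>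

definition vfn_insert_right :: "('vo, 'va, 'x) mon_cat_scheme \<Rightarrow> ('c, 'vo, 'va, 'y) vcat_scheme
    \<Rightarrow> 'c \<Rightarrow> ('c, 'c \<times> 'c, 'va) vfn" where
  "vfn_insert_right V C J = \<lparr>
    VFO = (\<lambda>A. (A, J)),
    VFA = (\<lambda>A B. \<llangle>V \<Turnstile> VHom C A B,
      inv_arr V (VHom C A B \<otimes>[V] Unt V) (VHom C A B) (Run V (VHom C A B)),
      VHom C A B \<otimes>[V] Unt V,
      \<llangle>V \<Turnstile> VHom C A B, Idn V (VHom C A B), VHom C A B \<otimes> Unt V, VIdn C J, VHom C J J\<rrangle>,
      VHom C A B \<otimes>[V] VHom C J J\<rrangle>)\<rparr>"

definition vfn_insert_left :: "('vo, 'va, 'x) mon_cat_scheme \<Rightarrow> ('c, 'vo, 'va, 'y) vcat_scheme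
    \<Rightarrow> 'c \<Rightarrow> ('c, 'c \<times> 'c, 'va) vfn" where
  "vfn_insert_left V C J = \<lparr>
    VFO = (\<lambda>A. (J, A)),
    VFA = (\<lambda>A B. \<llangle>V \<Turnstile> VHom C A B,
      inv_arr V (Unt V \<otimes>[V] VHom C A B) (VHom C A B) (Lun V (VHom C A B)),
      Unt V \<otimes>[V] VHom C A B,
      \<llangle>V \<Turnstile> Unt V, VIdn C J, VHom C J J \<otimes> VHom C A B, Idn V (VHom C A B), VHom C A B\<rrangle>,
      VHom C J J \<otimes>[V] VHom C A B\<rrangle>)\<rparr>"

definition v_nat_iso :: "('vo, 'va, 'x) mon_cat_scheme \<Rightarrow> ('c, 'vo, 'va, 'y1) vcat_scheme
    \<Rightarrow> ('d, 'vo, 'va, 'y2) vcat_scheme \<Rightarrow> ('c, 'd, 'va, 'z1) vfn_scheme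
    \<Rightarrow> ('c, 'd, 'va, 'z2) vfn_scheme \<Rightarrow> ('c \<Rightarrow> 'va) \<Rightarrow> bool" where
  "v_nat_iso V C D F G t \<longleftrightarrow>
    (\<forall>A\<in>VObj C. is_iso (underlying V D) (VFO F A) (VFO G A) (t A)) \<and>
    (\<forall>A\<in>VObj C. \<forall>B\<in>VObj C.
      \<llangle>V \<Turnstile> VHom C A B,
         inv_arr V (Unt V \<otimes>[V] VHom C A B) (VHom C A B) (Lun V (VHom C A B)),
         Unt V \<otimes>[V] VHom C A B,
         \<llangle>V \<Turnstile> Unt V, t A, VHom D (VFO F A) (VFO G A) \<otimes>
            VHom C A B, VFA G A B, VHom D (VFO G A) (VFO G B)\<rrangle>,
         VHom D (VFO F A) (VFO G A) \<otimes>[V] VHom D (VFO G A) (VFO G B),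
         VCmp D (VFO F A) (VFO G A) (VFO G B),
         VHom D (VFO F A) (VFO G B)\<rrangle>
      = \<llangle>V \<Turnstile> VHom C A B,
         inv_arr V (VHom C A B \<otimes>[V] Unt V) (VHom C A B) (Run V (VHom C A B)),
         VHom C A B \<otimes>[V] Unt V,
         \<llangle>V \<Turnstile> VHom C A B, VFA F A B, VHom D (VFO F A) (VFO F B) \<otimes>
            Unt V, t B, VHom D (VFO F B) (VFO G B)\<rrangle>,
         VHom D (VFO F A) (VFO F B) \<otimes>[V] VHom D (VFO F B) (VFO G B),
         VCmp D (VFO F A) (VFO F B) (VFO G B),
         VHom D (VFO F A) (VFO G B)\<rrangle>)"

record ('c, 'va) mon_struct =
  VTensor :: "('c \<times> 'c, 'c, 'va) vfn"
  VUnt :: 'c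
  VAsc :: "'c \<Rightarrow> 'c \<Rightarrow> 'c \<Rightarrow> 'va"
  VRun :: "'c \<Rightarrow> 'va"
  VLun :: "'c \<Rightarrow> 'va"

abbreviation vtensor_obj ("(_ \<boxtimes>[_] _)" [71, 0, 70] 70) where
  "A \<boxtimes>[S] B \<equiv> VFO (VTensor S) (A, B)"

definition underlying_monoidal :: "('vo, 'va, 'x) mon_cat_scheme
    \<Rightarrow> ('c, 'vo, 'va, 'y) vcat_scheme \<Rightarrow> ('c, 'va, 'z) mon_struct_scheme \<Rightarrow> ('c, 'va) mon_cat" where
  "underlying_monoidal V C S = \<lparr>
    Obj = Obj (underlying V C), Hom = Hom (underlying V C),
    Idn = Idn (underlying V C), Cmp = Cmp (underlying V C),
    Tensor = \<lparr>FO = VFO (VTensor S),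
      FA = (\<lambda>(A1, A2) (B1, B2) (f1, f2).
        \<llangle>V \<Turnstile> Unt V, unit_split V, Unt V \<otimes>[V] Unt V,
           \<llangle>V \<Turnstile> Unt V, f1, VHom C A1 B1 \<otimes> Unt V, f2, VHom C A2 B2\<rrangle>,
           VHom C A1 B1 \<otimes>[V] VHom C A2 B2,
           VFA (VTensor S) (A1, A2) (B1, B2),
           VHom C (A1 \<boxtimes>[S] A2) (B1 \<boxtimes>[S] B2)\<rrangle>)\<rparr>,
    Unt = VUnt S, Asc = VAsc S, Run = VRun S, Lun = VLun S\<rparr>"

definition underlying_symmetric :: "('vo, 'va, 'x) mon_cat_scheme
    \<Rightarrow> ('c, 'vo, 'va, 'y) vcat_scheme \<Rightarrow> ('c, 'va, 'z) mon_struct_scheme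
    \<Rightarrow> ('c \<Rightarrow> 'c \<Rightarrow> 'va) \<Rightarrow> ('c, 'va) sym_mon_cat" where
  "underlying_symmetric V C S s = mon_cat.extend (underlying_monoidal V C S) \<lparr>Sym = s\<rparr>"

locale monoidal_vcategory = vcategory V C
  for V :: "('vo, 'va, 'x) sym_mon_cat_scheme" and C :: "('c, 'vo, 'va, 'y) vcat_scheme" +
  fixes S :: "('c, 'va, 'z) mon_struct_scheme"
  assumes base_symmetric: "symmetric_monoidal_category V"
    and vtensor_functor: "vfunctor V (vcat_prod V C C) C (VTensor S)"
    and vunt_obj: "VUnt S \<in> VObj C"
    and vasc_nat_iso: "v_nat_iso V (vcat_prod V (vcat_prod V C C) C) C
      (vfn_comp V (vcat_prod V (vcat_prod V C C) C) (vcat_prod V C C) C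
        (vfn_prod V (vcat_prod V C C) C C C (VTensor S) (vfn_id V C)) (VTensor S))
      (vfn_comp V (vcat_prod V (vcat_prod V C C) C) (vcat_prod V C (vcat_prod V C C)) C
        (vfn_assoc V C C C)
        (vfn_comp V (vcat_prod V C (vcat_prod V C C)) (vcat_prod V C C) C
          (vfn_prod V C C (vcat_prod V C C) C (vfn_id V C) (VTensor S)) (VTensor S)))
      (\<lambda>((A, B), D). VAsc S A B D)"
    and vrun_nat_iso: "v_nat_iso V C C
      (vfn_comp V C (vcat_prod V C C) C (vfn_insert_right V C (VUnt S)) (VTensor S))
      (vfn_id V C) (VRun S)"
    and vlun_nat_iso: "v_nat_iso V C C
      (vfn_comp V C (vcat_prod V C C) C (vfn_insert_left V C (VUnt S)) (VTensor S))
      (vfn_id V C) (VLun S)"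
    and underlying_is_monoidal: "monoidal_category (underlying_monoidal V C S)"

locale symmetric_monoidal_vcategory = monoidal_vcategory V C S
  for V :: "('vo, 'va, 'x) sym_mon_cat_scheme" and C :: "('c, 'vo, 'va, 'y) vcat_scheme"
    and S :: "('c, 'va, 'z) mon_struct_scheme" +
  fixes s :: "'c \<Rightarrow> 'c \<Rightarrow> 'va"
  assumes vsym_nat_iso: "v_nat_iso V (vcat_prod V C C) C (VTensor S)
      (vfn_comp V (vcat_prod V C C) (vcat_prod V C C) C (vfn_swap V C C) (VTensor S))
      (\<lambda>(A, B). s A B)"
    and underlying_is_symmetric: "symmetric_monoidal_category (underlying_symmetric V C S s)"

section \<open>2-categories\<close>

text \<open>
  A (strict) 2-category is a category enriched in \<open>cat\<close>: \<open>HomC T X Y\<close> is a category, whose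
  composition is vertical composition, and \<open>HComp T X Y Z\<close> is a functor, which is
  horizontal composition.
\<close>

record ('o, 'c, 'd) twocat =
  Cell0 :: "'o set"
  HomC :: "'o \<Rightarrow> 'o \<Rightarrow> ('c, 'd) cat"
  Id1 :: "'o \<Rightarrow> 'c"
  HComp :: "'o \<Rightarrow> 'o \<Rightarrow> 'o \<Rightarrow> ('c \<times> 'c, 'd \<times> 'd, 'c, 'd) fn"

locale two_category =
  fixes T :: "('o, 'c, 'd, 'x) twocat_scheme"
  assumes homc_cat: "\<lbrakk>X \<in> Cell0 T; Y \<in> Cell0 T\<rbrakk> \<Longrightarrow> category (HomC T X Y)"
    and id1_cell: "X \<in> Cell0 T \<Longrightarrow> Id1 T X \<in> Obj (HomC T X X)"
    and hcomp_functor: "\<lbrakk>X \<in> Cell0 T; Y \<in> Cell0 T; Z \<in> Cell0 T\<rbrakk>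
      \<Longrightarrow> cat_functor (prod_cat (HomC T X Y) (HomC T Y Z)) (HomC T X Z) (HComp T X Y Z)"
    and hcomp_assoc: "\<lbrakk>W \<in> Cell0 T; X \<in> Cell0 T; Y \<in> Cell0 T; Z \<in> Cell0 T\<rbrakk>
      \<Longrightarrow> fn_eq (prod_cat (prod_cat (HomC T W X) (HomC T X Y)) (HomC T Y Z))
        (fn_comp (fn_prod (HComp T W X Y) fn_id) (HComp T W Y Z))
        (fn_comp fn_assoc (fn_comp (fn_prod fn_id (HComp T X Y Z)) (HComp T W X Z)))"
    and hcomp_id_left: "\<lbrakk>X \<in> Cell0 T; Y \<in> Cell0 T\<rbrakk> \<Longrightarrow> fn_eq (HomC T X Y)
        (fn_comp (fn_pair (fn_const (HomC T X X) (Id1 T X)) fn_id) (HComp T X X Y)) fn_id"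
    and hcomp_id_right: "\<lbrakk>X \<in> Cell0 T; Y \<in> Cell0 T\<rbrakk> \<Longrightarrow> fn_eq (HomC T X Y)
        (fn_comp (fn_pair fn_id (fn_const (HomC T Y Y) (Id1 T Y))) (HComp T X Y Y)) fn_id"

definition change_of_base :: "('vo, 'va, 'x) mon_cat_scheme
    \<Rightarrow> ('vo, 'va, 'c, 'd, 'y) cat_lax_scheme \<Rightarrow> ('o, 'vo, 'va, 'z) vcat_scheme
    \<Rightarrow> ('o, 'c, 'd) twocat" where
  "change_of_base V N C = \<lparr>
    Cell0 = VObj C,
    HomC = (\<lambda>X Y. Kfun N (VHom C X Y)),
    Id1 = (\<lambda>X. FO (Karr N (Unt V) (VHom C X X) (VIdn C X)) (Keps N)),
    HComp = (\<lambda>X Y Z. fn_comp (Ktil N (VHom C X Y) (VHom C Y Z))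
      (Karr N (VHom C X Y \<otimes>[V] VHom C Y Z) (VHom C X Z) (VCmp C X Y Z)))\<rparr>"

text \<open>
  \<open>\<llangle>T \<Turnstile>\<^sub>1 X, f, Y, g, Z\<rrangle>\<close> is the horizontal composite of the 1-cells \<open>f: X \<rightarrow> Y\<close> and \<open>g: Y \<rightarrow> Z\<close>.
  \<open>whr T X Y Z f f' \<phi> g\<close> and \<open>whl T X Y Z f g g' \<psi>\<close> are the whiskerings
  \<open>f;g \<Rightarrow> f';g\<close> of \<open>\<phi>: f \<Rightarrow> f'\<close> by \<open>g\<close> and \<open>f;g \<Rightarrow> f;g'\<close> of \<open>\<psi>: g \<Rightarrow> g'\<close> by \<open>f\<close>.
\<close>

abbreviation hpath2 ("\<llangle>_ \<Turnstile>\<^sub>1 _, _, _, _, _\<rrangle>") where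
  "\<llangle>T \<Turnstile>\<^sub>1 X, f, Y, g, Z\<rrangle> \<equiv> FO (HComp T X Y Z) (f, g)"
abbreviation hpath3 ("\<llangle>_ \<Turnstile>\<^sub>1 _, _, _, _, _, _, _\<rrangle>") where
  "\<llangle>T \<Turnstile>\<^sub>1 W, f, X, g, Y, h, Z\<rrangle> \<equiv> FO (HComp T W X Z) (f, FO (HComp T X Y Z) (g, h))"

abbreviation whr where
  "whr T X Y Z f f' \<phi> g \<equiv> FA (HComp T X Y Z) (f, g) (f', g) (\<phi>, Idn (HomC T Y Z) g)"
abbreviation whl where
  "whl T X Y Z f g g' \<psi> \<equiv> FA (HComp T X Y Z) (f, g) (f, g') (Idn (HomC T X Y) f, \<psi>)"

definition iso_1cell :: "('o, 'c, 'd, 'x) twocat_scheme \<Rightarrow> 'o \<Rightarrow> 'o \<Rightarrow> 'c \<Rightarrow> bool" where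
  "iso_1cell T X Y f \<longleftrightarrow> f \<in> Obj (HomC T X Y) \<and> (\<exists>g \<in> Obj (HomC T Y X).
    \<llangle>T \<Turnstile>\<^sub>1 X, f, Y, g, X\<rrangle> = Id1 T X \<and> \<llangle>T \<Turnstile>\<^sub>1 Y, g, X, f, Y\<rrangle> = Id1 T Y)"

definition prod_twocat :: "('o1, 'c1, 'd1, 'x) twocat_scheme \<Rightarrow> ('o2, 'c2, 'd2, 'y) twocat_scheme
    \<Rightarrow> ('o1 \<times> 'o2, 'c1 \<times> 'c2, 'd1 \<times> 'd2) twocat" where
  "prod_twocat S T = \<lparr>
    Cell0 = Cell0 S \<times> Cell0 T,
    HomC = (\<lambda>(X, X') (Y, Y'). prod_cat (HomC S X Y) (HomC T X' Y')),
    Id1 = (\<lambda>(X, X'). (Id1 S X, Id1 T X')),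
    HComp = (\<lambda>(X, X') (Y, Y') (Z, Z'). \<lparr>
      FO = (\<lambda>((f, f'), (g, g')). (FO (HComp S X Y Z) (f, g), FO (HComp T X' Y' Z') (f', g'))),
      FA = (\<lambda>((f, f'), (g, g')) ((h, h'), (k, k')) ((\<phi>, \<phi>'), (\<psi>, \<psi>')).
        (FA (HComp S X Y Z) (f, g) (h, k) (\<phi>, \<psi>), FA (HComp T X' Y' Z') (f', g') (h', k') (\<phi>', \<psi>')))\<rparr>)\<rparr>"

section \<open>Pseudofunctors and transformations between 2-categories\<close>

text \<open>
  \<open>Pcmp P X Y Z f g: P f; P g \<Rightarrow> P (f;g)\<close> and \<open>Punit P X: id \<Rightarrow> P id\<close> are the compositor and the unitor.
\<close>

record ('o1, 'c1, 'd1, 'o2, 'c2, 'd2) psfn =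
  P0 :: "'o1 \<Rightarrow> 'o2"
  P1 :: "'o1 \<Rightarrow> 'o1 \<Rightarrow> ('c1, 'd1, 'c2, 'd2) fn"
  Pcmp :: "'o1 \<Rightarrow> 'o1 \<Rightarrow> 'o1 \<Rightarrow> 'c1 \<Rightarrow> 'c1 \<Rightarrow> 'd2"
  Punit :: "'o1 \<Rightarrow> 'd2"

locale pseudofunctor = S: two_category S + T: two_category T
  for S :: "('o1, 'c1, 'd1, 'x) twocat_scheme" and T :: "('o2, 'c2, 'd2, 'y) twocat_scheme" +
  fixes P :: "('o1, 'c1, 'd1, 'o2, 'c2, 'd2, 'z) psfn_scheme"
  assumes ps_0cell: "X \<in> Cell0 S \<Longrightarrow> P0 P X \<in> Cell0 T"
    and ps_functor: "\<lbrakk>X \<in> Cell0 S; Y \<in> Cell0 S\<rbrakk>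
      \<Longrightarrow> cat_functor (HomC S X Y) (HomC T (P0 P X) (P0 P Y)) (P1 P X Y)"
    and ps_cmp_nat_iso: "\<lbrakk>X \<in> Cell0 S; Y \<in> Cell0 S; Z \<in> Cell0 S\<rbrakk>
      \<Longrightarrow> nat_iso (prod_cat (HomC S X Y) (HomC S Y Z)) (HomC T (P0 P X) (P0 P Z))
        (fn_comp (fn_prod (P1 P X Y) (P1 P Y Z)) (HComp T (P0 P X) (P0 P Y) (P0 P Z)))
        (fn_comp (HComp S X Y Z) (P1 P X Z))
        (\<lambda>(f, g). Pcmp P X Y Z f g)"
    and ps_unit_iso: "X \<in> Cell0 S \<Longrightarrow> is_iso (HomC T (P0 P X) (P0 P X))
        (Id1 T (P0 P X)) (FO (P1 P X X) (Id1 S X)) (Punit P X)"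
    and ps_cmp_assoc: "\<lbrakk>W \<in> Cell0 S; X \<in> Cell0 S; Y \<in> Cell0 S; Z \<in> Cell0 S;
      f \<in> Obj (HomC S W X); g \<in> Obj (HomC S X Y); h \<in> Obj (HomC S Y Z)\<rbrakk> \<Longrightarrow>
      (let W' = P0 P W; X' = P0 P X; Y' = P0 P Y; Z' = P0 P Z;
           f' = FO (P1 P W X) f; g' = FO (P1 P X Y) g; h' = FO (P1 P Y Z) h;
           fg = \<llangle>S \<Turnstile>\<^sub>1 W, f, X, g, Y\<rrangle>; gh = \<llangle>S \<Turnstile>\<^sub>1 X, g, Y, h, Z\<rrangle>;
           fg' = FO (P1 P W Y) fg; gh' = FO (P1 P X Z) gh;
           fgh' = FO (P1 P W Z) \<llangle>S \<Turnstile>\<^sub>1 W, f, X, g, Y, h, Z\<rrangle>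
       in \<llangle>HomC T W' Z' \<Turnstile>
            \<llangle>T \<Turnstile>\<^sub>1 W', f', X', g', Y', h', Z'\<rrangle>,
            whr T W' Y' Z' \<llangle>T \<Turnstile>\<^sub>1 W', f', X', g', Y'\<rrangle> fg' (Pcmp P W X Y f g) h',
            \<llangle>T \<Turnstile>\<^sub>1 W', fg', Y', h', Z'\<rrangle>,
            Pcmp P W Y Z fg h,
            fgh'\<rrangle>
        = \<llangle>HomC T W' Z' \<Turnstile>
            \<llangle>T \<Turnstile>\<^sub>1 W', f', X', g', Y', h', Z'\<rrangle>,
            whl T W' X' Z' f' \<llangle>T \<Turnstile>\<^sub>1 X', g', Y', h', Z'\<rrangle> gh' (Pcmp P X Y Z g h),
            \<llangle>T \<Turnstile>\<^sub>1 W', f', X', gh', Z'\<rrangle>,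
            Pcmp P W X Z f gh,
            fgh'\<rrangle>)"
    and ps_unit_left: "\<lbrakk>X \<in> Cell0 S; Y \<in> Cell0 S; f \<in> Obj (HomC S X Y)\<rbrakk> \<Longrightarrow>
      (let X' = P0 P X; Y' = P0 P Y; f' = FO (P1 P X Y) f; i' = FO (P1 P X X) (Id1 S X)
       in \<llangle>HomC T X' Y' \<Turnstile> f', whr T X' X' Y' (Id1 T X') i' (Punit P X) f',
            \<llangle>T \<Turnstile>\<^sub>1 X', i', X', f', Y'\<rrangle>, Pcmp P X X Y (Id1 S X) f, f'\<rrangle> = Idn (HomC T X' Y') f')"
    and ps_unit_right: "\<lbrakk>X \<in> Cell0 S; Y \<in> Cell0 S; f \<in> Obj (HomC S X Y)\<rbrakk> \<Longrightarrow>
      (let X' = P0 P X; Y' = P0 P Y; f' = FO (P1 P X Y) f; i' = FO (P1 P Y Y) (Id1 S Y)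
       in \<llangle>HomC T X' Y' \<Turnstile> f', whl T X' Y' Y' f' (Id1 T Y') i' (Punit P Y),
            \<llangle>T \<Turnstile>\<^sub>1 X', f', Y', i', Y'\<rrangle>, Pcmp P X Y Y f (Id1 S Y), f'\<rrangle> = Idn (HomC T X' Y') f')"

text \<open>\<open>strict_psfn T\<close> completes the cell maps of a strict 2-functor into \<open>T\<close> with identity comparisons.\<close>

definition strict_psfn :: "('o2, 'c2, 'd2, 'x) twocat_scheme \<Rightarrow> ('o1 \<Rightarrow> 'o2)
    \<Rightarrow> ('o1 \<Rightarrow> 'o1 \<Rightarrow> ('c1, 'd1, 'c2, 'd2) fn) \<Rightarrow> ('o1, 'c1, 'd1, 'o2, 'c2, 'd2) psfn" where
  "strict_psfn T p0 p1 = \<lparr>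
    P0 = p0,
    P1 = p1,
    Pcmp = (\<lambda>X Y Z f g. Idn (HomC T (p0 X) (p0 Z))
      \<llangle>T \<Turnstile>\<^sub>1 p0 X, FO (p1 X Y) f, p0 Y, FO (p1 Y Z) g, p0 Z\<rrangle>),
    Punit = (\<lambda>X. Idn (HomC T (p0 X) (p0 X)) (Id1 T (p0 X)))\<rparr>"

definition ps_id :: "('o, 'c, 'd, 'x) twocat_scheme \<Rightarrow> ('o, 'c, 'd, 'o, 'c, 'd) psfn" where
  "ps_id T = strict_psfn T (\<lambda>X. X) (\<lambda>X Y. fn_id)"

definition ps_const :: "('o2, 'c2, 'd2, 'x) twocat_scheme \<Rightarrow> 'o2
    \<Rightarrow> ('o1, 'c1, 'd1, 'o2, 'c2, 'd2) psfn" where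
  "ps_const T J = strict_psfn T (\<lambda>_. J) (\<lambda>_ _. fn_const (HomC T J J) (Id1 T J))"

definition ps_assoc :: "('o1, 'c1, 'd1, 'x) twocat_scheme \<Rightarrow> ('o2, 'c2, 'd2, 'y) twocat_scheme
    \<Rightarrow> ('o3, 'c3, 'd3, 'z) twocat_scheme
    \<Rightarrow> (('o1 \<times> 'o2) \<times> 'o3, ('c1 \<times> 'c2) \<times> 'c3, ('d1 \<times> 'd2) \<times> 'd3,
        'o1 \<times> ('o2 \<times> 'o3), 'c1 \<times> ('c2 \<times> 'c3), 'd1 \<times> ('d2 \<times> 'd3)) psfn" where
  "ps_assoc R S T = strict_psfn (prod_twocat R (prod_twocat S T))
    (\<lambda>((X, Y), Z). (X, (Y, Z))) (\<lambda>_ _. fn_assoc)"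

definition ps_swap :: "('o1, 'c1, 'd1, 'x) twocat_scheme \<Rightarrow> ('o2, 'c2, 'd2, 'y) twocat_scheme
    \<Rightarrow> ('o1 \<times> 'o2, 'c1 \<times> 'c2, 'd1 \<times> 'd2, 'o2 \<times> 'o1, 'c2 \<times> 'c1, 'd2 \<times> 'd1) psfn" where
  "ps_swap S T = strict_psfn (prod_twocat T S) (\<lambda>(X, Y). (Y, X)) (\<lambda>_ _. fn_swap)"

definition ps_pair :: "('o, 'c, 'd, 'o1, 'c1, 'd1, 'x) psfn_scheme
    \<Rightarrow> ('o, 'c, 'd, 'o2, 'c2, 'd2, 'y) psfn_scheme
    \<Rightarrow> ('o, 'c, 'd, 'o1 \<times> 'o2, 'c1 \<times> 'c2, 'd1 \<times> 'd2) psfn" where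
  "ps_pair P Q = \<lparr>
    P0 = (\<lambda>X. (P0 P X, P0 Q X)),
    P1 = (\<lambda>X Y. fn_pair (P1 P X Y) (P1 Q X Y)),
    Pcmp = (\<lambda>X Y Z f g. (Pcmp P X Y Z f g, Pcmp Q X Y Z f g)),
    Punit = (\<lambda>X. (Punit P X, Punit Q X))\<rparr>"

definition ps_prod :: "('o1, 'c1, 'd1, 'p1, 'e1, 'h1, 'x) psfn_scheme
    \<Rightarrow> ('o2, 'c2, 'd2, 'p2, 'e2, 'h2, 'y) psfn_scheme
    \<Rightarrow> ('o1 \<times> 'o2, 'c1 \<times> 'c2, 'd1 \<times> 'd2, 'p1 \<times> 'p2, 'e1 \<times> 'e2, 'h1 \<times> 'h2) psfn" where
  "ps_prod P Q = \<lparr>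
    P0 = (\<lambda>(X, X'). (P0 P X, P0 Q X')),
    P1 = (\<lambda>(X, X') (Y, Y'). fn_prod (P1 P X Y) (P1 Q X' Y')),
    Pcmp = (\<lambda>(X, X') (Y, Y') (Z, Z') (f, f') (g, g'). (Pcmp P X Y Z f g, Pcmp Q X' Y' Z' f' g')),
    Punit = (\<lambda>(X, X'). (Punit P X, Punit Q X'))\<rparr>"

definition ps_comp :: "('o1, 'c1, 'd1, 'x) twocat_scheme \<Rightarrow> ('o2, 'c2, 'd2, 'y) twocat_scheme
    \<Rightarrow> ('o3, 'c3, 'd3, 'z) twocat_scheme \<Rightarrow> ('o1, 'c1, 'd1, 'o2, 'c2, 'd2, 'w) psfn_scheme
    \<Rightarrow> ('o2, 'c2, 'd2, 'o3, 'c3, 'd3, 'v) psfn_scheme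
    \<Rightarrow> ('o1, 'c1, 'd1, 'o3, 'c3, 'd3) psfn" where
  "ps_comp R S T P Q = \<lparr>
    P0 = (\<lambda>X. P0 Q (P0 P X)),
    P1 = (\<lambda>X Y. fn_comp (P1 P X Y) (P1 Q (P0 P X) (P0 P Y))),
    Pcmp = (\<lambda>X Y Z f g.
      let X' = P0 P X; Y' = P0 P Y; Z' = P0 P Z; f' = FO (P1 P X Y) f; g' = FO (P1 P Y Z) g;
          f'g' = \<llangle>S \<Turnstile>\<^sub>1 X', f', Y', g', Z'\<rrangle>; fg' = FO (P1 P X Z) \<llangle>R \<Turnstile>\<^sub>1 X, f, Y, g, Z\<rrangle>
      in \<llangle>HomC T (P0 Q X') (P0 Q Z') \<Turnstile>
           \<llangle>T \<Turnstile>\<^sub>1 P0 Q X', FO (P1 Q X' Y') f', P0 Q Y', FO (P1 Q Y' Z') g', P0 Q Z'\<rrangle>,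
           Pcmp Q X' Y' Z' f' g',
           FO (P1 Q X' Z') f'g',
           FA (P1 Q X' Z') f'g' fg' (Pcmp P X Y Z f g),
           FO (P1 Q X' Z') fg'\<rrangle>),
    Punit = (\<lambda>X. let X' = P0 P X; i' = FO (P1 P X X) (Id1 R X)
      in \<llangle>HomC T (P0 Q X') (P0 Q X') \<Turnstile>
           Id1 T (P0 Q X'),
           Punit Q X',
           FO (P1 Q X' X') (Id1 S X'),
           FA (P1 Q X' X') (Id1 S X') i' (Punit P X),
           FO (P1 Q X' X') i'\<rrangle>)\<rparr>"

text \<open>
  A strong transformation from \<open>P\<close> to \<open>Q\<close> has 1-cells \<open>t X: P X \<rightarrow> Q X\<close> and invertible 2-cells
  \<open>n X Y f: P f; t Y \<Rightarrow> t X; Q f\<close>, natural in \<open>f\<close> and compatible with compositors and unitors.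
\<close>

locale strong_transformation = P: pseudofunctor S T P + Q: pseudofunctor S T Q
  for S :: "('o1, 'c1, 'd1, 'x) twocat_scheme" and T :: "('o2, 'c2, 'd2, 'y) twocat_scheme"
    and P :: "('o1, 'c1, 'd1, 'o2, 'c2, 'd2, 'z) psfn_scheme"
    and Q :: "('o1, 'c1, 'd1, 'o2, 'c2, 'd2, 'w) psfn_scheme" +
  fixes t :: "'o1 \<Rightarrow> 'c2" and n :: "'o1 \<Rightarrow> 'o1 \<Rightarrow> 'c1 \<Rightarrow> 'd2"
  assumes st_1cell: "X \<in> Cell0 S \<Longrightarrow> t X \<in> Obj (HomC T (P0 P X) (P0 Q X))"
    and st_nat_iso: "\<lbrakk>X \<in> Cell0 S; Y \<in> Cell0 S\<rbrakk> \<Longrightarrow>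
      nat_iso (HomC S X Y) (HomC T (P0 P X) (P0 Q Y))
        (fn_comp (fn_pair (P1 P X Y) (fn_const (HomC T (P0 P Y) (P0 Q Y)) (t Y)))
          (HComp T (P0 P X) (P0 P Y) (P0 Q Y)))
        (fn_comp (fn_pair (fn_const (HomC T (P0 P X) (P0 Q X)) (t X)) (P1 Q X Y))
          (HComp T (P0 P X) (P0 Q X) (P0 Q Y)))
        (n X Y)"
    and st_cmp: "\<lbrakk>X \<in> Cell0 S; Y \<in> Cell0 S; Z \<in> Cell0 S;
      f \<in> Obj (HomC S X Y); g \<in> Obj (HomC S Y Z)\<rbrakk> \<Longrightarrow>
      (let PX = P0 P X; PY = P0 P Y; PZ = P0 P Z; QX = P0 Q X; QY = P0 Q Y; QZ = P0 Q Z;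
           Pf = FO (P1 P X Y) f; Pg = FO (P1 P Y Z) g; Qf = FO (P1 Q X Y) f; Qg = FO (P1 Q Y Z) g;
           fg = \<llangle>S \<Turnstile>\<^sub>1 X, f, Y, g, Z\<rrangle>; Pfg = FO (P1 P X Z) fg; Qfg = FO (P1 Q X Z) fg
       in \<llangle>HomC T PX QZ \<Turnstile>
            \<llangle>T \<Turnstile>\<^sub>1 PX, Pf, PY, Pg, PZ, t Z, QZ\<rrangle>,
            whr T PX PZ QZ \<llangle>T \<Turnstile>\<^sub>1 PX, Pf, PY, Pg, PZ\<rrangle> Pfg (Pcmp P X Y Z f g) (t Z),
            \<llangle>T \<Turnstile>\<^sub>1 PX, Pfg, PZ, t Z, QZ\<rrangle>,
            n X Z fg,
            \<llangle>T \<Turnstile>\<^sub>1 PX, t X, QX, Qfg, QZ\<rrangle>\<rrangle>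
        = \<llangle>HomC T PX QZ \<Turnstile>
            \<llangle>T \<Turnstile>\<^sub>1 PX, Pf, PY, Pg, PZ, t Z, QZ\<rrangle>,
            whl T PX PY QZ Pf \<llangle>T \<Turnstile>\<^sub>1 PY, Pg, PZ, t Z, QZ\<rrangle> \<llangle>T \<Turnstile>\<^sub>1 PY, t Y, QY, Qg, QZ\<rrangle> (n Y Z g),
            \<llangle>T \<Turnstile>\<^sub>1 PX, Pf, PY, t Y, QY, Qg, QZ\<rrangle>,
            whr T PX QY QZ \<llangle>T \<Turnstile>\<^sub>1 PX, Pf, PY, t Y, QY\<rrangle> \<llangle>T \<Turnstile>\<^sub>1 PX, t X, QX, Qf, QY\<rrangle> (n X Y f) Qg,
            \<llangle>T \<Turnstile>\<^sub>1 PX, t X, QX, Qf, QY, Qg, QZ\<rrangle>,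
            whl T PX QX QZ (t X) \<llangle>T \<Turnstile>\<^sub>1 QX, Qf, QY, Qg, QZ\<rrangle> Qfg (Pcmp Q X Y Z f g),
            \<llangle>T \<Turnstile>\<^sub>1 PX, t X, QX, Qfg, QZ\<rrangle>\<rrangle>)"
    and st_unit: "X \<in> Cell0 S \<Longrightarrow>
      (let PX = P0 P X; QX = P0 Q X; Pi = FO (P1 P X X) (Id1 S X); Qi = FO (P1 Q X X) (Id1 S X)
       in \<llangle>HomC T PX QX \<Turnstile>
            t X,
            whr T PX PX QX (Id1 T PX) Pi (Punit P X) (t X),
            \<llangle>T \<Turnstile>\<^sub>1 PX, Pi, PX, t X, QX\<rrangle>,
            n X X (Id1 S X),
            \<llangle>T \<Turnstile>\<^sub>1 PX, t X, QX, Qi, QX\<rrangle>\<rrangle>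
        = whl T PX QX QX (t X) (Id1 T QX) Qi (Punit Q X))"

text \<open>A (strictly) 2-natural transformation is a strong one whose naturality 2-cells are identities.\<close>

definition two_natural :: "('o1, 'c1, 'd1, 'x) twocat_scheme \<Rightarrow> ('o2, 'c2, 'd2, 'y) twocat_scheme
    \<Rightarrow> ('o1, 'c1, 'd1, 'o2, 'c2, 'd2, 'z) psfn_scheme
    \<Rightarrow> ('o1, 'c1, 'd1, 'o2, 'c2, 'd2, 'w) psfn_scheme \<Rightarrow> ('o1 \<Rightarrow> 'c2) \<Rightarrow> bool" where
  "two_natural S T P Q t \<longleftrightarrow>
    (\<forall>X\<in>Cell0 S. \<forall>Y\<in>Cell0 S. \<forall>f\<in>Obj (HomC S X Y).
      \<llangle>T \<Turnstile>\<^sub>1 P0 P X, FO (P1 P X Y) f, P0 P Y, t Y, P0 Q Y\<rrangle>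
      = \<llangle>T \<Turnstile>\<^sub>1 P0 P X, t X, P0 Q X, FO (P1 Q X Y) f, P0 Q Y\<rrangle>) \<and>
    strong_transformation S T P Q t (\<lambda>X Y f. Idn (HomC T (P0 P X) (P0 Q Y))
      \<llangle>T \<Turnstile>\<^sub>1 P0 P X, FO (P1 P X Y) f, P0 P Y, t Y, P0 Q Y\<rrangle>)"

section \<open>Nearly strict monoidal 2-categories\<close>

record ('o, 'c, 'd) mon_twostruct =
  TTensor :: "('o \<times> 'o, 'c \<times> 'c, 'd \<times> 'd, 'o, 'c, 'd) psfn"
  TUnt :: 'o
  TAsc :: "'o \<Rightarrow> 'o \<Rightarrow> 'o \<Rightarrow> 'c"
  TRun :: "'o \<Rightarrow> 'c"
  TLun :: "'o \<Rightarrow> 'c"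

abbreviation ttensor_obj ("(_ \<otimes>\<^sub>0[_] _)" [71, 0, 70] 70) where
  "X \<otimes>\<^sub>0[S] Y \<equiv> P0 (TTensor S) (X, Y)"

text \<open>\<open>\<llangle>S \<Turnstile>\<^sub>1 X, f, Y \<otimes> X', f', Y'\<rrangle>\<close> is the product of the 1-cells \<open>f: X \<rightarrow> Y\<close> and \<open>f': X' \<rightarrow> Y'\<close>.\<close>

abbreviation ttensor_1cell ("\<llangle>_ \<Turnstile>\<^sub>1 _, _, _ \<otimes> _, _, _\<rrangle>") where
  "\<llangle>S \<Turnstile>\<^sub>1 X, f, Y \<otimes> X', f', Y'\<rrangle> \<equiv> FO (P1 (TTensor S) (X, X') (Y, Y')) (f, f')"

locale nearly_strict_monoidal = two_category T for T :: "('o, 'c, 'd, 'x) twocat_scheme" +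
  fixes S :: "('o, 'c, 'd, 'y) mon_twostruct_scheme"
  assumes ttensor_pseudofunctor: "pseudofunctor (prod_twocat T T) T (TTensor S)"
    and tunt_0cell: "TUnt S \<in> Cell0 T"
    and tasc_iso: "\<lbrakk>A \<in> Cell0 T; B \<in> Cell0 T; D \<in> Cell0 T\<rbrakk> \<Longrightarrow>
      iso_1cell T ((A \<otimes>\<^sub>0[S] B) \<otimes>\<^sub>0[S] D) (A \<otimes>\<^sub>0[S] (B \<otimes>\<^sub>0[S] D)) (TAsc S A B D)"
    and trun_iso: "A \<in> Cell0 T \<Longrightarrow> iso_1cell T (A \<otimes>\<^sub>0[S] TUnt S) A (TRun S A)"
    and tlun_iso: "A \<in> Cell0 T \<Longrightarrow> iso_1cell T (TUnt S \<otimes>\<^sub>0[S] A) A (TLun S A)"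
    and tasc_natural: "two_natural (prod_twocat (prod_twocat T T) T) T
      (ps_comp (prod_twocat (prod_twocat T T) T) (prod_twocat T T) T
        (ps_prod (TTensor S) (ps_id T)) (TTensor S))
      (ps_comp (prod_twocat (prod_twocat T T) T) (prod_twocat T (prod_twocat T T)) T
        (ps_assoc T T T)
        (ps_comp (prod_twocat T (prod_twocat T T)) (prod_twocat T T) T
          (ps_prod (ps_id T) (TTensor S)) (TTensor S)))
      (\<lambda>((A, B), D). TAsc S A B D)"
    and trun_natural: "two_natural T T
      (ps_comp T (prod_twocat T T) T (ps_pair (ps_id T) (ps_const T (TUnt S))) (TTensor S))
      (ps_id T) (TRun S)"
    and tlun_natural: "two_natural T T
      (ps_comp T (prod_twocat T T) T (ps_pair (ps_const T (TUnt S)) (ps_id T)) (TTensor S))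
      (ps_id T) (TLun S)"
    and tpentagon: "\<lbrakk>A \<in> Cell0 T; B \<in> Cell0 T; D \<in> Cell0 T; E \<in> Cell0 T\<rbrakk> \<Longrightarrow>
      \<llangle>T \<Turnstile>\<^sub>1 ((A \<otimes>\<^sub>0[S] B) \<otimes>\<^sub>0[S] D) \<otimes>\<^sub>0[S] E,
         \<llangle>S \<Turnstile>\<^sub>1 (A \<otimes>\<^sub>0[S] B) \<otimes>\<^sub>0[S] D, TAsc S A B D, A \<otimes>\<^sub>0[S] (B \<otimes>\<^sub>0[S] D) \<otimes> E, Id1 T E, E\<rrangle>,
         (A \<otimes>\<^sub>0[S] (B \<otimes>\<^sub>0[S] D)) \<otimes>\<^sub>0[S] E,
         TAsc S A (B \<otimes>\<^sub>0[S] D) E,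
         A \<otimes>\<^sub>0[S] ((B \<otimes>\<^sub>0[S] D) \<otimes>\<^sub>0[S] E),
         \<llangle>S \<Turnstile>\<^sub>1 A, Id1 T A, A \<otimes> (B \<otimes>\<^sub>0[S] D) \<otimes>\<^sub>0[S] E, TAsc S B D E, B \<otimes>\<^sub>0[S] (D \<otimes>\<^sub>0[S] E)\<rrangle>,
         A \<otimes>\<^sub>0[S] (B \<otimes>\<^sub>0[S] (D \<otimes>\<^sub>0[S] E))\<rrangle>
      = \<llangle>T \<Turnstile>\<^sub>1 ((A \<otimes>\<^sub>0[S] B) \<otimes>\<^sub>0[S] D) \<otimes>\<^sub>0[S] E,
         TAsc S (A \<otimes>\<^sub>0[S] B) D E,
         (A \<otimes>\<^sub>0[S] B) \<otimes>\<^sub>0[S] (D \<otimes>\<^sub>0[S] E),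
         TAsc S A B (D \<otimes>\<^sub>0[S] E),
         A \<otimes>\<^sub>0[S] (B \<otimes>\<^sub>0[S] (D \<otimes>\<^sub>0[S] E))\<rrangle>"
    and ttriangle: "\<lbrakk>A \<in> Cell0 T; B \<in> Cell0 T\<rbrakk> \<Longrightarrow>
      \<llangle>T \<Turnstile>\<^sub>1 (A \<otimes>\<^sub>0[S] TUnt S) \<otimes>\<^sub>0[S] B,
         TAsc S A (TUnt S) B,
         A \<otimes>\<^sub>0[S] (TUnt S \<otimes>\<^sub>0[S] B),
         \<llangle>S \<Turnstile>\<^sub>1 A, Id1 T A, A \<otimes> TUnt S \<otimes>\<^sub>0[S] B, TLun S B, B\<rrangle>,
         A \<otimes>\<^sub>0[S] B\<rrangle>
      = \<llangle>S \<Turnstile>\<^sub>1 A \<otimes>\<^sub>0[S] TUnt S, TRun S A, A \<otimes> B, Id1 T B, B\<rrangle>"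

text \<open>
  The symmetry consists of 1-cells \<open>s A B: A \<otimes> B \<rightarrow> B \<otimes> A\<close> and 2-cells
  \<open>n (A1, A2) (B1, B2) (f1, f2): (f1 \<otimes> f2); s B1 B2 \<Rightarrow> s A1 A2; (f2 \<otimes> f1)\<close>.
\<close>

locale nearly_strict_symmetric_monoidal = nearly_strict_monoidal T S
  for T :: "('o, 'c, 'd, 'x) twocat_scheme" and S :: "('o, 'c, 'd, 'y) mon_twostruct_scheme" +
  fixes s :: "'o \<Rightarrow> 'o \<Rightarrow> 'c" and n :: "'o \<times> 'o \<Rightarrow> 'o \<times> 'o \<Rightarrow> 'c \<times> 'c \<Rightarrow> 'd"
  assumes tsym_strong: "strong_transformation (prod_twocat T T) T (TTensor S)
      (ps_comp (prod_twocat T T) (prod_twocat T T) T (ps_swap T T) (TTensor S))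
      (\<lambda>(A, B). s A B) n"
    and tsym_sym: "\<lbrakk>A \<in> Cell0 T; B \<in> Cell0 T\<rbrakk> \<Longrightarrow>
      \<llangle>T \<Turnstile>\<^sub>1 A \<otimes>\<^sub>0[S] B, s A B, B \<otimes>\<^sub>0[S] A, s B A, A \<otimes>\<^sub>0[S] B\<rrangle> = Id1 T (A \<otimes>\<^sub>0[S] B)"
    and thexagon: "\<lbrakk>A \<in> Cell0 T; B \<in> Cell0 T; D \<in> Cell0 T\<rbrakk> \<Longrightarrow>
      \<llangle>T \<Turnstile>\<^sub>1 (A \<otimes>\<^sub>0[S] B) \<otimes>\<^sub>0[S] D,
         TAsc S A B D,
         A \<otimes>\<^sub>0[S] (B \<otimes>\<^sub>0[S] D),
         s A (B \<otimes>\<^sub>0[S] D),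
         (B \<otimes>\<^sub>0[S] D) \<otimes>\<^sub>0[S] A,
         TAsc S B D A,
         B \<otimes>\<^sub>0[S] (D \<otimes>\<^sub>0[S] A)\<rrangle>
      = \<llangle>T \<Turnstile>\<^sub>1 (A \<otimes>\<^sub>0[S] B) \<otimes>\<^sub>0[S] D,
         \<llangle>S \<Turnstile>\<^sub>1 A \<otimes>\<^sub>0[S] B, s A B, B \<otimes>\<^sub>0[S] A \<otimes> D, Id1 T D, D\<rrangle>,
         (B \<otimes>\<^sub>0[S] A) \<otimes>\<^sub>0[S] D,
         TAsc S B A D,
         B \<otimes>\<^sub>0[S] (A \<otimes>\<^sub>0[S] D),
         \<llangle>S \<Turnstile>\<^sub>1 B, Id1 T B, B \<otimes> A \<otimes>\<^sub>0[S] D, s A D, D \<otimes>\<^sub>0[S] A\<rrangle>,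
         B \<otimes>\<^sub>0[S] (D \<otimes>\<^sub>0[S] A)\<rrangle>"
    and tsym_unit: "A \<in> Cell0 T \<Longrightarrow>
      \<llangle>T \<Turnstile>\<^sub>1 A \<otimes>\<^sub>0[S] TUnt S, s A (TUnt S), TUnt S \<otimes>\<^sub>0[S] A, TLun S A, A\<rrangle> = TRun S A"

section \<open>The construction\<close>

text \<open>The composite \<open>(U/MF): V \<rightarrow> W \<rightarrow> Kl\<^sub>M \<rightarrow> cat\<close>.\<close>

definition slice_MF :: "('vo, 'va, 'x) mon_cat_scheme \<Rightarrow> ('wo, 'wa, 'y) sym_mon_cat_scheme
    \<Rightarrow> ('wo, 'wa, 'z) sm_monad_scheme \<Rightarrow> ('vo, 'va, 'wo, 'wa, 'w) lax_fn_scheme \<Rightarrow> 'wo set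
    \<Rightarrow> ('vo, 'va, 'wo \<times> 'wa, 'wa) cat_lax" where
  "slice_MF V W M F U =
    cat_lax_comp V (kleisli W M) (lax_comp V W (kleisli W M) F (kl_embed W M))
      (slice_functor (kleisli W M) U)"

text \<open>
  \<open>push V W M F X Y Z h: F X \<otimes> F Y \<rightarrow> F Z\<close> is the Kleisli arrow that is the composite of the
  comparison map of \<open>F\<close>, of \<open>F h\<close> and of \<open>\<eta>\<close>, for \<open>h: X \<otimes> Y \<rightarrow> Z\<close> in \<open>V\<close>.
  \<open>lift_1cell V W M F C A B c\<close> is the 1-cell \<open>F\<^sub>\<epsilon>; F c; \<eta>\<close>, with parameter object \<open>I\<close>, for \<open>c: I \<rightarrow> C(A,B)\<close>.
\<close>

definition push :: "('vo, 'va, 'x) mon_cat_scheme \<Rightarrow> ('wo, 'wa, 'y) mon_cat_scheme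
    \<Rightarrow> ('wo, 'wa, 'z) sm_monad_scheme \<Rightarrow> ('vo, 'va, 'wo, 'wa, 'w) lax_fn_scheme
    \<Rightarrow> 'vo \<Rightarrow> 'vo \<Rightarrow> 'vo \<Rightarrow> 'va \<Rightarrow> 'wa" where
  "push V W M F X Y Z h = \<llangle>W \<Turnstile> FO F X \<otimes>[W] FO F Y, Ltil F X Y, FO F (X \<otimes>[V] Y),
    FA F (X \<otimes>[V] Y) Z h, FO F Z, Meta M (FO F Z), FO (Mfun M) (FO F Z)\<rrangle>"

definition lift_1cell :: "('vo, 'va, 'x) mon_cat_scheme \<Rightarrow> ('wo, 'wa, 'y) mon_cat_scheme
    \<Rightarrow> ('wo, 'wa, 'z) sm_monad_scheme \<Rightarrow> ('vo, 'va, 'wo, 'wa, 'w) lax_fn_scheme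
    \<Rightarrow> ('c, 'vo, 'va, 'u) vcat_scheme \<Rightarrow> 'c \<Rightarrow> 'c \<Rightarrow> 'va \<Rightarrow> 'wo \<times> 'wa" where
  "lift_1cell V W M F C A B c = (Unt W, \<llangle>W \<Turnstile> Unt W, Leps F, FO F (Unt V),
    FA F (Unt V) (VHom C A B) c, FO F (VHom C A B),
    Meta M (FO F (VHom C A B)), FO (Mfun M) (FO F (VHom C A B))\<rrangle>)"

end

theory Submission
  imports Defs
begin

text \<open>
  Write \<open>K\<close> for the Kleisli category and \<open>G\<close> for \<open>F\<close> followed by the inclusion of \<open>W\<close> into
  \<open>K\<close>. The category \<open>K\<close> is symmetric monoidal and the inclusion is strict, so \<open>G\<close> is symmetric
  lax monoidal (\<open>lax_functor_into_kleisli\<close>). The slices \<open>A \<mapsto> U/GA\<close> are lax monoidal into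
  categories: their laws are those of \<open>G\<close> up to the associators and unitors of \<open>K\<close>, which
  naturality moves to objects of \<open>U\<close>, where they are identities (\<open>slice_lax_monoidal\<close>). Change of
  base along a lax monoidal functor into categories yields a 2-category
  (\<open>two_category_change_of_base\<close>).

  The rest separates into a layer of 1-cells, governed by \<open>V\<close> and \<open>C\<close>, and a layer of 2-cells,
  governed by \<open>U\<close> and the symmetry of \<open>K\<close>.

  A 1-cell is an element of \<open>U/GA\<close>, where \<open>A\<close> is a hom-object of \<open>C\<close>. Arrows of \<open>V\<close> act on such
  elements, and elements at \<open>A\<close> and \<open>B\<close> multiply to an element at \<open>A \<otimes> B\<close>. Horizontal composition
  and the monoidal product are multiplication followed by the action of the structure arrows of \<open>C\<close>.
  Thus equal arrows of \<open>V\<close> give equal 1-cells. In particular, arrows \<open>I \<rightarrow> C(X, Y)\<close>, acting on the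
  unit element, give 1-cells compatibly with composition and products (\<open>lift_hcomp\<close>,
  \<open>lift_tensor\<close>); so the pentagon, the triangle, the hexagon and the invertibility of the coherence
  1-cells are inherited from the underlying category of \<open>C\<close>. Likewise \<open>V\<close>-naturality of the
  coherence isomorphisms yields naturality squares of 1-cells (\<open>lift_square\<close>).

  A 2-cell is an arrow of \<open>K\<close> between parameter objects, subject to a condition on its boundary,
  and the coherence 1-cells have parameter object \<open>I\<close>. Hence every equation between 2-cells is an
  equation between arrows of the strict symmetric monoidal category \<open>U\<close>
  (\<open>strong_transformation_into_slices\<close>, \<open>two_natural_into_slices\<close>). Multiplying four elements in
  two different orders gives the same result only after the interchange map of \<open>V\<close> has acted, and
  then up to the 2-cell given by the interchange map of \<open>K\<close> on the parameter objects
  (\<open>mul_interchange_hom\<close>). As \<open>\<boxtimes>\<close> is a \<open>V\<close>-functor, this yields the tensorators. What remains is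
  that the interchange map is coherent: \<open>interchange_assoc\<close> makes \<open>\<boxtimes>\<close> a pseudofunctor,
  \<open>interchange_interchange\<close> makes the associator strictly 2-natural, and \<open>interchange_sym\<close> makes
  the symmetry natural up to the 2-cell that swaps the parameter objects.
\<close>

section \<open>Calculus in categories and monoidal categories\<close>

lemma is_iso_hom: "is_iso C A B f \<Longrightarrow> f \<in> Hom C A B"
  by (auto simp: is_iso_def inverse_arrows_def)

context category
begin

lemmas cat_simps = id_hom cmp_hom cmp_assoc id_left id_right

text \<open>
  Paths are bracketed to the right, so an equation between composites of two arrows does not match
  inside a longer path; this rule extends it to the path.
\<close>

lemma postcompose_eq:
  assumes "\<llangle>C \<Turnstile> A, f, B, g, D\<rrangle> = \<llangle>C \<Turnstile> A, f', B', g', D\<rrangle>"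
    and "A \<in> Obj C" "B \<in> Obj C" "B' \<in> Obj C" "D \<in> Obj C" "E \<in> Obj C"
    and "f \<in> Hom C A B" "g \<in> Hom C B D" "f' \<in> Hom C A B'" "g' \<in> Hom C B' D" "k \<in> Hom C D E"
  shows "\<llangle>C \<Turnstile> A, f, B, g, D, k, E\<rrangle> = \<llangle>C \<Turnstile> A, f', B', g', D, k, E\<rrangle>"
  using assms by (metis cmp_assoc)

lemma inverse_arrows_unique:
  assumes "A \<in> Obj C" "B \<in> Obj C" "inverse_arrows C A B f g" "inverse_arrows C A B f g'"
  shows "g = g'"
  using assms unfolding inverse_arrows_def by (metis cmp_assoc id_left id_right)

lemma inv_arr_eqI:
  assumes "A \<in> Obj C" "B \<in> Obj C" "inverse_arrows C A B f g"
  shows "inv_arr C A B f = g"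
  unfolding inv_arr_def using assms inverse_arrows_unique by blast

lemma inv_arr_inverse:
  assumes "A \<in> Obj C" "B \<in> Obj C" "is_iso C A B f"
  shows "inverse_arrows C A B f (inv_arr C A B f)"
  using assms inv_arr_eqI unfolding is_iso_def by metis

lemma inv_arr_hom:
  assumes "A \<in> Obj C" "B \<in> Obj C" "is_iso C A B f"
  shows "inv_arr C A B f \<in> Hom C B A"
  using inv_arr_inverse[OF assms] by (simp add: inverse_arrows_def)

lemma inv_arr_right:
  assumes "A \<in> Obj C" "B \<in> Obj C" "is_iso C A B f"
  shows "\<llangle>C \<Turnstile> A, f, B, inv_arr C A B f, A\<rrangle> = Idn C A"
  using inv_arr_inverse[OF assms] by (simp add: inverse_arrows_def)

lemma inverse_arrows_id: "A \<in> Obj C \<Longrightarrow> inverse_arrows C A A (Idn C A) (Idn C A)"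
  by (simp add: inverse_arrows_def cat_simps)

lemma is_iso_id: "A \<in> Obj C \<Longrightarrow> is_iso C A A (Idn C A)"
  using inverse_arrows_id unfolding is_iso_def by blast

lemma inv_arr_id: "A \<in> Obj C \<Longrightarrow> inv_arr C A A (Idn C A) = Idn C A"
  using inv_arr_eqI inverse_arrows_id by blast

lemma is_iso_cmp:
  assumes "A \<in> Obj C" "B \<in> Obj C" "D \<in> Obj C" "is_iso C A B f" "is_iso C B D g"
  shows "is_iso C A D \<llangle>C \<Turnstile> A, f, B, g, D\<rrangle>"
proof -
  obtain f' g' where f': "inverse_arrows C A B f f'" and g': "inverse_arrows C B D g g'"
    using assms by (auto simp: is_iso_def)
  note i = f'[unfolded inverse_arrows_def] g'[unfolded inverse_arrows_def]
  have "\<llangle>C \<Turnstile> B, g, D, g', B, f', A\<rrangle> = f'"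
    using i assms by (metis cmp_assoc id_left)
  moreover have "\<llangle>C \<Turnstile> B, f', A, f, B, g, D\<rrangle> = g"
    using i assms by (metis cmp_assoc id_left)
  ultimately have "inverse_arrows C A D \<llangle>C \<Turnstile> A, f, B, g, D\<rrangle> \<llangle>C \<Turnstile> D, g', B, f', A\<rrangle>"
    using i assms by (simp add: inverse_arrows_def cat_simps)
  then show ?thesis by (auto simp: is_iso_def)
qed

end

lemma category_prod_cat:
  assumes "category C" "category D"
  shows "category (prod_cat C D)"
proof -
  interpret C: category C by fact
  interpret D: category D by fact
  show ?thesis
    by unfold_locales (auto simp: prod_cat_def C.cat_simps D.cat_simps)
qed

lemma inverse_arrows_prod_cat:
  "inverse_arrows (prod_cat C D) (A, A') (B, B') (f, f') (g, g')
    \<longleftrightarrow> inverse_arrows C A B f g \<and> inverse_arrows D A' B' f' g'"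
  by (auto simp: inverse_arrows_def prod_cat_def)

lemma is_iso_prod_cat:
  "is_iso (prod_cat C D) (A, A') (B, B') (f, f') \<longleftrightarrow> is_iso C A B f \<and> is_iso D A' B' f'"
  by (simp add: is_iso_def inverse_arrows_prod_cat)

lemma (in cat_functor) fun_is_iso:
  assumes "A \<in> Obj C" "B \<in> Obj C" "is_iso C A B f"
  shows "is_iso D (FO F A) (FO F B) (FA F A B f)"
proof -
  obtain g where g: "inverse_arrows C A B f g"
    using assms by (auto simp: is_iso_def)
  have "inverse_arrows D (FO F A) (FO F B) (FA F A B f) (FA F B A g)"
    using g assms fun_hom unfolding inverse_arrows_def by (simp add: fun_cmp[symmetric] fun_id)
  then show ?thesis by (auto simp: is_iso_def)
qed

context monoidal_category
begin

lemma tensor_obj: "A \<in> Obj C \<Longrightarrow> B \<in> Obj C \<Longrightarrow> A \<otimes>[C] B \<in> Obj C"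
  using cat_functor.fun_obj[OF tensor_functor, of "(A, B)"] by (simp add: prod_cat_def)

lemma tensor_hom:
  assumes "A \<in> Obj C" "B \<in> Obj C" "A' \<in> Obj C" "B' \<in> Obj C" "f \<in> Hom C A B" "f' \<in> Hom C A' B'"
  shows "\<llangle>C \<Turnstile> A, f, B \<otimes> A', f', B'\<rrangle> \<in> Hom C (A \<otimes>[C] A') (B \<otimes>[C] B')"
  using cat_functor.fun_hom[OF tensor_functor, of "(A, A')" "(B, B')" "(f, f')"] assms
  by (simp add: prod_cat_def)

lemma tensor_id:
  "A \<in> Obj C \<Longrightarrow> B \<in> Obj C \<Longrightarrow> \<llangle>C \<Turnstile> A, Idn C A, A \<otimes> B, Idn C B, B\<rrangle> = Idn C (A \<otimes>[C] B)"
  using cat_functor.fun_id[OF tensor_functor, of "(A, B)"] by (simp add: prod_cat_def)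

lemma tensor_cmp:
  assumes "A \<in> Obj C" "B \<in> Obj C" "D \<in> Obj C" "A' \<in> Obj C" "B' \<in> Obj C" "D' \<in> Obj C"
    "f \<in> Hom C A B" "f' \<in> Hom C A' B'" "g \<in> Hom C B D" "g' \<in> Hom C B' D'"
  shows "\<llangle>C \<Turnstile> A \<otimes>[C] A', \<llangle>C \<Turnstile> A, f, B \<otimes> A', f', B'\<rrangle>, B \<otimes>[C] B',
      \<llangle>C \<Turnstile> B, g, D \<otimes> B', g', D'\<rrangle>, D \<otimes>[C] D'\<rrangle>
    = \<llangle>C \<Turnstile> A, \<llangle>C \<Turnstile> A, f, B, g, D\<rrangle>, D \<otimes> A', \<llangle>C \<Turnstile> A', f', B', g', D'\<rrangle>, D'\<rrangle>"
  using cat_functor.fun_cmp[OF tensor_functor, of "(A, A')" "(B, B')" "(D, D')" "(f, f')" "(g, g')"]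
    assms by (simp add: prod_cat_def)

lemma tensor_cmp_then:
  assumes "A \<in> Obj C" "B \<in> Obj C" "D \<in> Obj C" "A' \<in> Obj C" "B' \<in> Obj C" "D' \<in> Obj C" "E \<in> Obj C"
    "f \<in> Hom C A B" "f' \<in> Hom C A' B'" "g \<in> Hom C B D" "g' \<in> Hom C B' D'"
    "k \<in> Hom C (D \<otimes>[C] D') E"
  shows "\<llangle>C \<Turnstile> A \<otimes>[C] A', \<llangle>C \<Turnstile> A, f, B \<otimes> A', f', B'\<rrangle>, B \<otimes>[C] B',
      \<llangle>C \<Turnstile> B, g, D \<otimes> B', g', D'\<rrangle>, D \<otimes>[C] D', k, E\<rrangle>
    = \<llangle>C \<Turnstile> A \<otimes>[C] A', \<llangle>C \<Turnstile> A, \<llangle>C \<Turnstile> A, f, B, g, D\<rrangle>, D \<otimes> A', \<llangle>C \<Turnstile> A', f', B', g', D'\<rrangle>, D'\<rrangle>,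
        D \<otimes>[C] D', k, E\<rrangle>"
  using assms by (subst tensor_cmp[symmetric]) (simp_all add: cat_simps tensor_obj tensor_hom)

lemma asc_is_iso:
  "A \<in> Obj C \<Longrightarrow> B \<in> Obj C \<Longrightarrow> D \<in> Obj C \<Longrightarrow>
    is_iso C ((A \<otimes>[C] B) \<otimes>[C] D) (A \<otimes>[C] (B \<otimes>[C] D)) (Asc C A B D)"
  using asc_nat_iso
  by (force simp: nat_iso_def prod_cat_def fn_comp_def fn_prod_def fn_id_def fn_assoc_def)

lemma asc_nat:
  assumes "A \<in> Obj C" "B \<in> Obj C" "D \<in> Obj C" "A' \<in> Obj C" "B' \<in> Obj C" "D' \<in> Obj C"
    "f \<in> Hom C A A'" "g \<in> Hom C B B'" "h \<in> Hom C D D'"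
  shows "\<llangle>C \<Turnstile> (A \<otimes>[C] B) \<otimes>[C] D,
      \<llangle>C \<Turnstile> A \<otimes>[C] B, \<llangle>C \<Turnstile> A, f, A' \<otimes> B, g, B'\<rrangle>, A' \<otimes>[C] B' \<otimes> D, h, D'\<rrangle>,
      (A' \<otimes>[C] B') \<otimes>[C] D', Asc C A' B' D', A' \<otimes>[C] (B' \<otimes>[C] D')\<rrangle>
    = \<llangle>C \<Turnstile> (A \<otimes>[C] B) \<otimes>[C] D, Asc C A B D, A \<otimes>[C] (B \<otimes>[C] D),
      \<llangle>C \<Turnstile> A, f, A' \<otimes> B \<otimes>[C] D, \<llangle>C \<Turnstile> B, g, B' \<otimes> D, h, D'\<rrangle>, B' \<otimes>[C] D'\<rrangle>,
      A' \<otimes>[C] (B' \<otimes>[C] D')\<rrangle>"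
  using asc_nat_iso assms
  by (simp add: nat_iso_def nat_trans_def prod_cat_def fn_comp_def fn_prod_def fn_id_def fn_assoc_def
      split_paired_Ball_Sigma)

lemma run_is_iso: "A \<in> Obj C \<Longrightarrow> is_iso C (A \<otimes>[C] Unt C) A (Run C A)"
  using run_nat_iso
  by (simp add: nat_iso_def fn_comp_def fn_pair_def fn_id_def fn_const_def)

lemma run_nat:
  assumes "A \<in> Obj C" "A' \<in> Obj C" "f \<in> Hom C A A'"
  shows "\<llangle>C \<Turnstile> A \<otimes>[C] Unt C, \<llangle>C \<Turnstile> A, f, A' \<otimes> Unt C, Idn C (Unt C), Unt C\<rrangle>, A' \<otimes>[C] Unt C,
      Run C A', A'\<rrangle> = \<llangle>C \<Turnstile> A \<otimes>[C] Unt C, Run C A, A, f, A'\<rrangle>"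
  using run_nat_iso assms
  by (simp add: nat_iso_def nat_trans_def fn_comp_def fn_pair_def fn_id_def fn_const_def)

lemma lun_is_iso: "A \<in> Obj C \<Longrightarrow> is_iso C (Unt C \<otimes>[C] A) A (Lun C A)"
  using lun_nat_iso
  by (simp add: nat_iso_def fn_comp_def fn_pair_def fn_id_def fn_const_def)

lemma lun_nat:
  assumes "A \<in> Obj C" "A' \<in> Obj C" "f \<in> Hom C A A'"
  shows "\<llangle>C \<Turnstile> Unt C \<otimes>[C] A, \<llangle>C \<Turnstile> Unt C, Idn C (Unt C), Unt C \<otimes> A, f, A'\<rrangle>, Unt C \<otimes>[C] A',
      Lun C A', A'\<rrangle> = \<llangle>C \<Turnstile> Unt C \<otimes>[C] A, Lun C A, A, f, A'\<rrangle>"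
  using lun_nat_iso assms
  by (simp add: nat_iso_def nat_trans_def fn_comp_def fn_pair_def fn_id_def fn_const_def)

lemmas asc_hom = is_iso_hom[OF asc_is_iso]
lemmas run_hom = is_iso_hom[OF run_is_iso]
lemmas lun_hom = is_iso_hom[OF lun_is_iso]

lemmas mon_simps = cat_simps unt_obj tensor_obj tensor_hom tensor_id asc_hom run_hom lun_hom

text \<open>
  The interchange law is used from left to right: once all composites of products have become
  products of composites, the factors are compared separately.
\<close>

lemmas tensor_merge = tensor_cmp tensor_cmp_then

end

context symmetric_monoidal_category
begin

lemma sym_is_iso:
  "A \<in> Obj C \<Longrightarrow> B \<in> Obj C \<Longrightarrow> is_iso C (A \<otimes>[C] B) (B \<otimes>[C] A) (Sym C A B)"
  using sym_nat_iso by (force simp: nat_iso_def prod_cat_def fn_comp_def fn_swap_def)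

lemmas sym_hom = is_iso_hom[OF sym_is_iso]

lemma sym_nat:
  assumes "A \<in> Obj C" "B \<in> Obj C" "A' \<in> Obj C" "B' \<in> Obj C" "f \<in> Hom C A A'" "g \<in> Hom C B B'"
  shows "\<llangle>C \<Turnstile> A \<otimes>[C] B, \<llangle>C \<Turnstile> A, f, A' \<otimes> B, g, B'\<rrangle>, A' \<otimes>[C] B', Sym C A' B', B' \<otimes>[C] A'\<rrangle>
    = \<llangle>C \<Turnstile> A \<otimes>[C] B, Sym C A B, B \<otimes>[C] A, \<llangle>C \<Turnstile> B, g, B' \<otimes> A, f, A'\<rrangle>, B' \<otimes>[C] A'\<rrangle>"
  using sym_nat_iso assms
  by (simp add: nat_iso_def nat_trans_def prod_cat_def fn_comp_def fn_swap_def
      split_paired_Ball_Sigma)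

lemmas smc_simps = mon_simps sym_hom

end

context lax_monoidal_functor
begin

sublocale S: monoidal_category V by (rule source_monoidal)
sublocale T: monoidal_category W by (rule target_monoidal)

lemma til_hom:
  "A \<in> Obj V \<Longrightarrow> B \<in> Obj V \<Longrightarrow> Ltil N A B \<in> Hom W (FO N A \<otimes>[W] FO N B) (FO N (A \<otimes>[V] B))"
  using til_nat by (force simp: nat_trans_def prod_cat_def fn_comp_def fn_prod_def)

lemma til_natural:
  assumes "A \<in> Obj V" "B \<in> Obj V" "A' \<in> Obj V" "B' \<in> Obj V" "f \<in> Hom V A A'" "g \<in> Hom V B B'"
  shows "\<llangle>W \<Turnstile> FO N A \<otimes>[W] FO N B,
      \<llangle>W \<Turnstile> FO N A, FA N A A' f, FO N A' \<otimes> FO N B, FA N B B' g, FO N B'\<rrangle>, FO N A' \<otimes>[W] FO N B',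
      Ltil N A' B', FO N (A' \<otimes>[V] B')\<rrangle>
    = \<llangle>W \<Turnstile> FO N A \<otimes>[W] FO N B, Ltil N A B, FO N (A \<otimes>[V] B),
      FA N (A \<otimes>[V] B) (A' \<otimes>[V] B') \<llangle>V \<Turnstile> A, f, A' \<otimes> B, g, B'\<rrangle>, FO N (A' \<otimes>[V] B')\<rrangle>"
  using til_nat assms
  by (simp add: nat_trans_def prod_cat_def fn_comp_def fn_prod_def split_paired_Ball_Sigma)

lemmas lax_simps = fun_obj fun_hom fun_id eps_hom til_hom

end

section \<open>Kleisli categories of symmetric monoidal monads\<close>

lemma kleisli_simps:
  "Obj (kleisli W M) = Obj W"
  "Hom (kleisli W M) A X = Hom W A (FO (Mfun M) X)"
  "Idn (kleisli W M) = Meta M"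
  "Cmp (kleisli W M) A X Y f g = \<llangle>W \<Turnstile> A, f, FO (Mfun M) X, FA (Mfun M) X (FO (Mfun M) Y) g,
    FO (Mfun M) (FO (Mfun M) Y), Mmu M Y, FO (Mfun M) Y\<rrangle>"
  "FO (Tensor (kleisli W M)) = FO (Tensor W)"
  "FA (Tensor (kleisli W M)) (A, B) (X, Y) (f, g) = \<llangle>W \<Turnstile> A \<otimes>[W] B,
    \<llangle>W \<Turnstile> A, f, FO (Mfun M) X \<otimes> B, g, FO (Mfun M) Y\<rrangle>,
    FO (Mfun M) X \<otimes>[W] FO (Mfun M) Y, Mnab M X Y, FO (Mfun M) (X \<otimes>[W] Y)\<rrangle>"
  "Unt (kleisli W M) = Unt W"
  "Asc (kleisli W M) A B D
    = kl_lift W M ((A \<otimes>[W] B) \<otimes>[W] D) (A \<otimes>[W] (B \<otimes>[W] D)) (Asc W A B D)"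
  "Run (kleisli W M) A = kl_lift W M (A \<otimes>[W] Unt W) A (Run W A)"
  "Lun (kleisli W M) A = kl_lift W M (Unt W \<otimes>[W] A) A (Lun W A)"
  "Sym (kleisli W M) A B = kl_lift W M (A \<otimes>[W] B) (B \<otimes>[W] A) (Sym W A B)"
  by (simp_all add: kleisli_def Let_def)

context symmetric_monoidal_monad
begin

sublocale W: symmetric_monoidal_category W by (rule target_symmetric)

abbreviation MO where "MO \<equiv> FO (Mfun M)"
abbreviation MA where "MA \<equiv> FA (Mfun M)"

lemma MO_obj: "A \<in> Obj W \<Longrightarrow> MO A \<in> Obj W"
  using fun_obj by (simp add: monad_lax_def)

lemma MA_hom: "\<lbrakk>A \<in> Obj W; B \<in> Obj W; f \<in> Hom W A B\<rbrakk> \<Longrightarrow> MA A B f \<in> Hom W (MO A) (MO B)"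
  using fun_hom by (simp add: monad_lax_def)

lemma MA_id: "A \<in> Obj W \<Longrightarrow> MA A A (Idn W A) = Idn W (MO A)"
  using fun_id by (simp add: monad_lax_def)

lemma MA_cmp: "\<lbrakk>A \<in> Obj W; B \<in> Obj W; E \<in> Obj W; f \<in> Hom W A B; g \<in> Hom W B E\<rbrakk>
    \<Longrightarrow> MA A E \<llangle>W \<Turnstile> A, f, B, g, E\<rrangle> = \<llangle>W \<Turnstile> MO A, MA A B f, MO B, MA B E g, MO E\<rrangle>"
  using fun_cmp by (simp add: monad_lax_def)

lemma mu_hom: "A \<in> Obj W \<Longrightarrow> Mmu M A \<in> Hom W (MO (MO A)) (MO A)"
  using mu_monoidal
  by (simp add: monoidal_transformation_def nat_trans_def lax_comp_def monad_lax_def)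

lemma eta_hom: "A \<in> Obj W \<Longrightarrow> Meta M A \<in> Hom W A (MO A)"
  using eta_monoidal
  by (simp add: monoidal_transformation_def nat_trans_def lax_id_def monad_lax_def)

lemma nab_hom: "A \<in> Obj W \<Longrightarrow> B \<in> Obj W \<Longrightarrow> Mnab M A B \<in> Hom W (MO A \<otimes>[W] MO B) (MO (A \<otimes>[W] B))"
  using til_hom by (simp add: monad_lax_def)

lemmas m_simps = W.smc_simps MO_obj MA_hom MA_id MA_cmp mu_hom eta_hom nab_hom

lemma mu_nat: "\<lbrakk>A \<in> Obj W; B \<in> Obj W; f \<in> Hom W A B\<rbrakk>
    \<Longrightarrow> \<llangle>W \<Turnstile> MO (MO A), Mmu M A, MO A, MA A B f, MO B\<rrangle>
      = \<llangle>W \<Turnstile> MO (MO A), MA (MO A) (MO B) (MA A B f), MO (MO B), Mmu M B, MO B\<rrangle>"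
  using mu_monoidal
  by (simp add: monoidal_transformation_def nat_trans_def lax_comp_def monad_lax_def)

text \<open>
  The variants ending in \<open>then\<close> rewrite with a naturality square at the head of a longer path.
\<close>

lemma mu_nat_then: "\<lbrakk>A \<in> Obj W; B \<in> Obj W; D \<in> Obj W; f \<in> Hom W A B; k \<in> Hom W (MO B) D\<rbrakk>
    \<Longrightarrow> \<llangle>W \<Turnstile> MO (MO A), Mmu M A, MO A, MA A B f, MO B, k, D\<rrangle>
      = \<llangle>W \<Turnstile> MO (MO A), MA (MO A) (MO B) (MA A B f), MO (MO B), Mmu M B, MO B, k, D\<rrangle>"
  by (rule C.postcompose_eq[OF mu_nat]) (simp_all add: m_simps)

lemma eta_nat: "\<lbrakk>A \<in> Obj W; B \<in> Obj W; f \<in> Hom W A B\<rbrakk>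
    \<Longrightarrow> \<llangle>W \<Turnstile> A, Meta M A, MO A, MA A B f, MO B\<rrangle> = \<llangle>W \<Turnstile> A, f, B, Meta M B, MO B\<rrangle>"
  using eta_monoidal
  by (simp add: monoidal_transformation_def nat_trans_def lax_id_def monad_lax_def)

lemma eta_nat_then: "\<lbrakk>A \<in> Obj W; B \<in> Obj W; D \<in> Obj W; f \<in> Hom W A B; k \<in> Hom W (MO B) D\<rbrakk>
    \<Longrightarrow> \<llangle>W \<Turnstile> A, Meta M A, MO A, MA A B f, MO B, k, D\<rrangle>
      = \<llangle>W \<Turnstile> A, f, B, Meta M B, MO B, k, D\<rrangle>"
  by (rule C.postcompose_eq[OF eta_nat]) (simp_all add: m_simps)

lemma nab_nat:
  assumes "A \<in> Obj W" "B \<in> Obj W" "A' \<in> Obj W" "B' \<in> Obj W" "f \<in> Hom W A A'" "g \<in> Hom W B B'"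
  shows "\<llangle>W \<Turnstile> MO A \<otimes>[W] MO B, Mnab M A B, MO (A \<otimes>[W] B),
      MA (A \<otimes>[W] B) (A' \<otimes>[W] B') \<llangle>W \<Turnstile> A, f, A' \<otimes> B, g, B'\<rrangle>, MO (A' \<otimes>[W] B')\<rrangle>
    = \<llangle>W \<Turnstile> MO A \<otimes>[W] MO B, \<llangle>W \<Turnstile> MO A, MA A A' f, MO A' \<otimes> MO B, MA B B' g, MO B'\<rrangle>,
      MO A' \<otimes>[W] MO B', Mnab M A' B', MO (A' \<otimes>[W] B')\<rrangle>"
  using til_natural[OF assms] by (simp add: monad_lax_def)

lemma nab_nat_then:
  assumes "A \<in> Obj W" "B \<in> Obj W" "A' \<in> Obj W" "B' \<in> Obj W" "f \<in> Hom W A A'" "g \<in> Hom W B B'"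
    "D \<in> Obj W" "k \<in> Hom W (MO (A' \<otimes>[W] B')) D"
  shows "\<llangle>W \<Turnstile> MO A \<otimes>[W] MO B, Mnab M A B, MO (A \<otimes>[W] B),
      MA (A \<otimes>[W] B) (A' \<otimes>[W] B') \<llangle>W \<Turnstile> A, f, A' \<otimes> B, g, B'\<rrangle>, MO (A' \<otimes>[W] B'), k, D\<rrangle>
    = \<llangle>W \<Turnstile> MO A \<otimes>[W] MO B, \<llangle>W \<Turnstile> MO A, MA A A' f, MO A' \<otimes> MO B, MA B B' g, MO B'\<rrangle>,
      MO A' \<otimes>[W] MO B', Mnab M A' B', MO (A' \<otimes>[W] B'), k, D\<rrangle>"
  by (rule C.postcompose_eq[OF nab_nat]) (simp_all add: m_simps assms)

lemma mu_nab:
  assumes "A \<in> Obj W" "B \<in> Obj W"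
  shows "\<llangle>W \<Turnstile> MO (MO A) \<otimes>[W] MO (MO B), Mnab M (MO A) (MO B), MO (MO A \<otimes>[W] MO B),
      MA (MO A \<otimes>[W] MO B) (MO (A \<otimes>[W] B)) (Mnab M A B), MO (MO (A \<otimes>[W] B)),
      Mmu M (A \<otimes>[W] B), MO (A \<otimes>[W] B)\<rrangle>
    = \<llangle>W \<Turnstile> MO (MO A) \<otimes>[W] MO (MO B),
      \<llangle>W \<Turnstile> MO (MO A), Mmu M A, MO A \<otimes> MO (MO B), Mmu M B, MO B\<rrangle>,
      MO A \<otimes>[W] MO B, Mnab M A B, MO (A \<otimes>[W] B)\<rrangle>"
  using mu_monoidal assms
  by (simp add: monoidal_transformation_def lax_comp_def monad_lax_def m_simps)

lemma eta_nab:
  assumes "A \<in> Obj W" "B \<in> Obj W"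
  shows "\<llangle>W \<Turnstile> A \<otimes>[W] B, \<llangle>W \<Turnstile> A, Meta M A, MO A \<otimes> B, Meta M B, MO B\<rrangle>,
      MO A \<otimes>[W] MO B, Mnab M A B, MO (A \<otimes>[W] B)\<rrangle> = Meta M (A \<otimes>[W] B)"
  using eta_monoidal assms
  by (simp add: monoidal_transformation_def lax_id_def monad_lax_def m_simps)

lemmas m_unit_simps =
  eta_mu[unfolded Let_def] M_eta_mu[unfolded Let_def] mu_assoc[unfolded Let_def]

lemmas m_rewrites = m_simps mu_nat mu_nat_then eta_nat eta_nat_then nab_nat nab_nat_then
  mu_nab m_unit_simps S.tensor_merge

abbreviation K where "K \<equiv> kleisli W M"
abbreviation L where "L \<equiv> kl_lift W M"

lemma category_kleisli: "category K"
  by unfold_locales (simp_all add: kleisli_simps m_rewrites)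

sublocale K: category K by (rule category_kleisli)

lemma lift_hom: "\<lbrakk>A \<in> Obj W; B \<in> Obj W; f \<in> Hom W A B\<rbrakk> \<Longrightarrow> L A B f \<in> Hom K A B"
  by (simp add: kl_lift_def kleisli_simps m_simps)

lemma lift_id: "A \<in> Obj W \<Longrightarrow> L A A (Idn W A) = Idn K A"
  by (simp add: kl_lift_def kleisli_simps m_simps)

text \<open>
  Next to a lifted arrow, a Kleisli composite involves no multiplication of the monad: the unit of the
  monad cancels it. This is how the structure maps of the Kleisli category, which are all lifted, are
  brought back to \<open>W\<close>.
\<close>

lemma lift_cmp_left:
  "\<lbrakk>A \<in> Obj W; B \<in> Obj W; D \<in> Obj W; f \<in> Hom W A B; g \<in> Hom K B D\<rbrakk>
    \<Longrightarrow> \<llangle>K \<Turnstile> A, L A B f, B, g, D\<rrangle> = \<llangle>W \<Turnstile> A, f, B, g, MO D\<rrangle>"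
  by (simp add: kl_lift_def kleisli_simps m_rewrites)

lemma lift_cmp_right:
  "\<lbrakk>A \<in> Obj W; B \<in> Obj W; D \<in> Obj W; f \<in> Hom K A B; g \<in> Hom W B D\<rbrakk>
    \<Longrightarrow> \<llangle>K \<Turnstile> A, f, B, L B D g, D\<rrangle> = \<llangle>W \<Turnstile> A, f, MO B, MA B D g, MO D\<rrangle>"
  by (simp add: kl_lift_def kleisli_simps m_rewrites)

lemma lift_cmp:
  "\<lbrakk>A \<in> Obj W; B \<in> Obj W; D \<in> Obj W; f \<in> Hom W A B; g \<in> Hom W B D\<rbrakk>
    \<Longrightarrow> \<llangle>K \<Turnstile> A, L A B f, B, L B D g, D\<rrangle> = L A D \<llangle>W \<Turnstile> A, f, B, g, D\<rrangle>"
  by (simp add: kl_lift_def kleisli_simps m_rewrites)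

text \<open>
  Lifting is strict monoidal because the unit of the monad is a monoidal transformation.
\<close>

lemma lift_tensor:
  assumes "A \<in> Obj W" "B \<in> Obj W" "A' \<in> Obj W" "B' \<in> Obj W" "f \<in> Hom W A B" "f' \<in> Hom W A' B'"
  shows "\<llangle>K \<Turnstile> A, L A B f, B \<otimes> A', L A' B' f', B'\<rrangle>
    = L (A \<otimes>[W] A') (B \<otimes>[W] B') \<llangle>W \<Turnstile> A, f, B \<otimes> A', f', B'\<rrangle>"
  using assms
  by (simp add: kl_lift_def kleisli_simps m_simps S.tensor_cmp[symmetric] eta_nab)

lemma lift_is_iso:
  assumes "A \<in> Obj W" "B \<in> Obj W" "is_iso W A B f"
  shows "is_iso K A B (L A B f)"
proof -
  obtain g where "inverse_arrows W A B f g"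
    using assms by (auto simp: is_iso_def)
  then have "inverse_arrows K A B (L A B f) (L B A g)"
    using assms by (simp add: inverse_arrows_def lift_hom lift_cmp lift_id)
  then show ?thesis by (auto simp: is_iso_def)
qed

lemma tensor_functor_kleisli: "cat_functor (prod_cat K K) K (Tensor K)"
proof -
  interpret KK: category "prod_cat K K"
    by (rule category_prod_cat) (rule category_kleisli)+
  show ?thesis
    by unfold_locales
       (auto simp: prod_cat_def kleisli_simps m_rewrites eta_nab)
qed

lemmas kl_obj_simps = kleisli_simps(1,5,7)

lemma nab_asc:
  assumes "A \<in> Obj W" "B \<in> Obj W" "D \<in> Obj W"
  shows "\<llangle>W \<Turnstile> (MO A \<otimes>[W] MO B) \<otimes>[W] MO D,
      \<llangle>W \<Turnstile> MO A \<otimes>[W] MO B, Mnab M A B, MO (A \<otimes>[W] B) \<otimes> MO D, Idn W (MO D), MO D\<rrangle>,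
      MO (A \<otimes>[W] B) \<otimes>[W] MO D, Mnab M (A \<otimes>[W] B) D, MO ((A \<otimes>[W] B) \<otimes>[W] D),
      MA ((A \<otimes>[W] B) \<otimes>[W] D) (A \<otimes>[W] (B \<otimes>[W] D)) (Asc W A B D), MO (A \<otimes>[W] (B \<otimes>[W] D))\<rrangle>
    = \<llangle>W \<Turnstile> (MO A \<otimes>[W] MO B) \<otimes>[W] MO D, Asc W (MO A) (MO B) (MO D),
      MO A \<otimes>[W] (MO B \<otimes>[W] MO D),
      \<llangle>W \<Turnstile> MO A, Idn W (MO A), MO A \<otimes> MO B \<otimes>[W] MO D, Mnab M B D, MO (B \<otimes>[W] D)\<rrangle>,
      MO A \<otimes>[W] MO (B \<otimes>[W] D), Mnab M A (B \<otimes>[W] D), MO (A \<otimes>[W] (B \<otimes>[W] D))\<rrangle>"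
  using lax_assoc[OF assms] by (simp add: monad_lax_def)

lemma nab_run: "A \<in> Obj W \<Longrightarrow>
    \<llangle>W \<Turnstile> MO A \<otimes>[W] Unt W, \<llangle>W \<Turnstile> MO A, Idn W (MO A), MO A \<otimes> Unt W, Meta M (Unt W), MO (Unt W)\<rrangle>,
      MO A \<otimes>[W] MO (Unt W), Mnab M A (Unt W), MO (A \<otimes>[W] Unt W), MA (A \<otimes>[W] Unt W) A (Run W A),
      MO A\<rrangle> = Run W (MO A)"
  using lax_run by (simp add: monad_lax_def)

lemma nab_lun: "A \<in> Obj W \<Longrightarrow>
    \<llangle>W \<Turnstile> Unt W \<otimes>[W] MO A, \<llangle>W \<Turnstile> Unt W, Meta M (Unt W), MO (Unt W) \<otimes> MO A, Idn W (MO A), MO A\<rrangle>,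
      MO (Unt W) \<otimes>[W] MO A, Mnab M (Unt W) A, MO (Unt W \<otimes>[W] A), MA (Unt W \<otimes>[W] A) A (Lun W A),
      MO A\<rrangle> = Lun W (MO A)"
  using lax_lun by (simp add: monad_lax_def)

lemma nab_sym: "A \<in> Obj W \<Longrightarrow> B \<in> Obj W \<Longrightarrow>
    \<llangle>W \<Turnstile> MO A \<otimes>[W] MO B, Mnab M A B, MO (A \<otimes>[W] B),
      MA (A \<otimes>[W] B) (B \<otimes>[W] A) (Sym W A B), MO (B \<otimes>[W] A)\<rrangle>
    = \<llangle>W \<Turnstile> MO A \<otimes>[W] MO B, Sym W (MO A) (MO B), MO B \<otimes>[W] MO A, Mnab M B A, MO (B \<otimes>[W] A)\<rrangle>"
  using lax_sym by (simp add: monad_lax_def)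

text \<open>
  A product of Kleisli arrows is a product in \<open>W\<close> followed by \<open>\<nabla>\<close>. The associativity of \<open>\<nabla>\<close> brings
  the associator in front of \<open>\<nabla>\<close>, where its naturality in \<open>W\<close> applies. The unitors and the symmetry
  below are natural for analogous reasons.
\<close>

lemma kleisli_asc_nat:
  assumes o: "A \<in> Obj W" "B \<in> Obj W" "D \<in> Obj W" "A' \<in> Obj W" "B' \<in> Obj W" "D' \<in> Obj W"
    and h: "f \<in> Hom K A A'" "g \<in> Hom K B B'" "h \<in> Hom K D D'"
  shows "\<llangle>K \<Turnstile> (A \<otimes>[W] B) \<otimes>[W] D,
      \<llangle>K \<Turnstile> A \<otimes>[W] B, \<llangle>K \<Turnstile> A, f, A' \<otimes> B, g, B'\<rrangle>, A' \<otimes>[W] B' \<otimes> D, h, D'\<rrangle>,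
      (A' \<otimes>[W] B') \<otimes>[W] D', Asc K A' B' D', A' \<otimes>[W] (B' \<otimes>[W] D')\<rrangle>
    = \<llangle>K \<Turnstile> (A \<otimes>[W] B) \<otimes>[W] D, Asc K A B D, A \<otimes>[W] (B \<otimes>[W] D),
      \<llangle>K \<Turnstile> A, f, A' \<otimes> B \<otimes>[W] D, \<llangle>K \<Turnstile> B, g, B' \<otimes> D, h, D'\<rrangle>, B' \<otimes>[W] D'\<rrangle>,
      A' \<otimes>[W] (B' \<otimes>[W] D')\<rrangle>" (is "?l = ?r")
proof -
  note h' = h[unfolded kleisli_simps]
  let ?fgh = "\<llangle>W \<Turnstile> A \<otimes>[W] B, \<llangle>W \<Turnstile> A, f, MO A' \<otimes> B, g, MO B'\<rrangle>, MO A' \<otimes>[W] MO B' \<otimes> D, h, MO D'\<rrangle>"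
  let ?k = "\<llangle>W \<Turnstile> MO A' \<otimes>[W] (MO B' \<otimes>[W] MO D'),
      \<llangle>W \<Turnstile> MO A', Idn W (MO A'), MO A' \<otimes> MO B' \<otimes>[W] MO D', Mnab M B' D', MO (B' \<otimes>[W] D')\<rrangle>,
      MO A' \<otimes>[W] MO (B' \<otimes>[W] D'), Mnab M A' (B' \<otimes>[W] D'), MO (A' \<otimes>[W] (B' \<otimes>[W] D'))\<rrangle>"
  have "?l = \<llangle>W \<Turnstile> (A \<otimes>[W] B) \<otimes>[W] D, ?fgh, (MO A' \<otimes>[W] MO B') \<otimes>[W] MO D',
      \<llangle>W \<Turnstile> (MO A' \<otimes>[W] MO B') \<otimes>[W] MO D',
      \<llangle>W \<Turnstile> MO A' \<otimes>[W] MO B', Mnab M A' B', MO (A' \<otimes>[W] B') \<otimes> MO D', Idn W (MO D'), MO D'\<rrangle>,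
      MO (A' \<otimes>[W] B') \<otimes>[W] MO D', Mnab M (A' \<otimes>[W] B') D', MO ((A' \<otimes>[W] B') \<otimes>[W] D'),
      MA ((A' \<otimes>[W] B') \<otimes>[W] D') (A' \<otimes>[W] (B' \<otimes>[W] D')) (Asc W A' B' D'),
      MO (A' \<otimes>[W] (B' \<otimes>[W] D'))\<rrangle>, MO (A' \<otimes>[W] (B' \<otimes>[W] D'))\<rrangle>"
    using o h' by (simp add: kleisli_simps(8) lift_cmp_right kl_obj_simps kleisli_simps(2,6)
        m_simps S.tensor_merge)
  also have "\<dots> = \<llangle>W \<Turnstile> (A \<otimes>[W] B) \<otimes>[W] D, ?fgh, (MO A' \<otimes>[W] MO B') \<otimes>[W] MO D',
      Asc W (MO A') (MO B') (MO D'), MO A' \<otimes>[W] (MO B' \<otimes>[W] MO D'), ?k,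
      MO (A' \<otimes>[W] (B' \<otimes>[W] D'))\<rrangle>"
    using o by (subst nab_asc) simp_all
  also have "\<dots> = \<llangle>W \<Turnstile> (A \<otimes>[W] B) \<otimes>[W] D, Asc W A B D, A \<otimes>[W] (B \<otimes>[W] D),
      \<llangle>W \<Turnstile> A, f, MO A' \<otimes> B \<otimes>[W] D, \<llangle>W \<Turnstile> B, g, MO B' \<otimes> D, h, MO D'\<rrangle>, MO B' \<otimes>[W] MO D'\<rrangle>,
      MO A' \<otimes>[W] (MO B' \<otimes>[W] MO D'), ?k, MO (A' \<otimes>[W] (B' \<otimes>[W] D'))\<rrangle>"
    by (rule C.postcompose_eq[OF S.asc_nat]) (simp_all add: o h' m_simps)
  also have "\<dots> = ?r"
    using o h' by (simp add: kleisli_simps(8) lift_cmp_left kl_obj_simps kleisli_simps(2,6)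
        m_simps S.tensor_merge)
  finally show ?thesis .
qed

lemma kleisli_run_nat:
  assumes o: "A \<in> Obj W" "A' \<in> Obj W" and f: "f \<in> Hom K A A'"
  shows "\<llangle>K \<Turnstile> A \<otimes>[W] Unt W, \<llangle>K \<Turnstile> A, f, A' \<otimes> Unt W, Idn K (Unt W), Unt W\<rrangle>, A' \<otimes>[W] Unt W,
      Run K A', A'\<rrangle> = \<llangle>K \<Turnstile> A \<otimes>[W] Unt W, Run K A, A, f, A'\<rrangle>" (is "?l = ?r")
proof -
  note f' = f[unfolded kleisli_simps]
  let ?f1 = "\<llangle>W \<Turnstile> A, f, MO A' \<otimes> Unt W, Idn W (Unt W), Unt W\<rrangle>"
  have "?l = \<llangle>W \<Turnstile> A \<otimes>[W] Unt W, ?f1, MO A' \<otimes>[W] Unt W, \<llangle>W \<Turnstile> MO A' \<otimes>[W] Unt W,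
      \<llangle>W \<Turnstile> MO A', Idn W (MO A'), MO A' \<otimes> Unt W, Meta M (Unt W), MO (Unt W)\<rrangle>,
      MO A' \<otimes>[W] MO (Unt W), Mnab M A' (Unt W), MO (A' \<otimes>[W] Unt W),
      MA (A' \<otimes>[W] Unt W) A' (Run W A'), MO A'\<rrangle>, MO A'\<rrangle>"
    using o f' by (simp add: kleisli_simps(9) lift_cmp_right kl_obj_simps kleisli_simps(2,3,6)
        m_simps S.tensor_merge)
  also have "\<dots> = \<llangle>W \<Turnstile> A \<otimes>[W] Unt W, ?f1, MO A' \<otimes>[W] Unt W, Run W (MO A'), MO A'\<rrangle>"
    using o by (subst nab_run) simp_all
  also have "\<dots> = ?r"
    using o f' by (simp add: S.run_nat kleisli_simps(9) lift_cmp_left kl_obj_simps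
        kleisli_simps(2) m_simps)
  finally show ?thesis .
qed

lemma kleisli_lun_nat:
  assumes o: "A \<in> Obj W" "A' \<in> Obj W" and f: "f \<in> Hom K A A'"
  shows "\<llangle>K \<Turnstile> Unt W \<otimes>[W] A, \<llangle>K \<Turnstile> Unt W, Idn K (Unt W), Unt W \<otimes> A, f, A'\<rrangle>, Unt W \<otimes>[W] A',
      Lun K A', A'\<rrangle> = \<llangle>K \<Turnstile> Unt W \<otimes>[W] A, Lun K A, A, f, A'\<rrangle>" (is "?l = ?r")
proof -
  note f' = f[unfolded kleisli_simps]
  let ?f1 = "\<llangle>W \<Turnstile> Unt W, Idn W (Unt W), Unt W \<otimes> A, f, MO A'\<rrangle>"
  have "?l = \<llangle>W \<Turnstile> Unt W \<otimes>[W] A, ?f1, Unt W \<otimes>[W] MO A', \<llangle>W \<Turnstile> Unt W \<otimes>[W] MO A',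
      \<llangle>W \<Turnstile> Unt W, Meta M (Unt W), MO (Unt W) \<otimes> MO A', Idn W (MO A'), MO A'\<rrangle>,
      MO (Unt W) \<otimes>[W] MO A', Mnab M (Unt W) A', MO (Unt W \<otimes>[W] A'),
      MA (Unt W \<otimes>[W] A') A' (Lun W A'), MO A'\<rrangle>, MO A'\<rrangle>"
    using o f' by (simp add: kleisli_simps(10) lift_cmp_right kl_obj_simps kleisli_simps(2,3,6)
        m_simps S.tensor_merge)
  also have "\<dots> = \<llangle>W \<Turnstile> Unt W \<otimes>[W] A, ?f1, Unt W \<otimes>[W] MO A', Lun W (MO A'), MO A'\<rrangle>"
    using o by (subst nab_lun) simp_all
  also have "\<dots> = ?r"
    using o f' by (simp add: S.lun_nat kleisli_simps(10) lift_cmp_left kl_obj_simps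
        kleisli_simps(2) m_simps)
  finally show ?thesis .
qed

lemma kleisli_sym_nat:
  assumes o: "A \<in> Obj W" "B \<in> Obj W" "A' \<in> Obj W" "B' \<in> Obj W"
    and h: "f \<in> Hom K A A'" "g \<in> Hom K B B'"
  shows "\<llangle>K \<Turnstile> A \<otimes>[W] B, \<llangle>K \<Turnstile> A, f, A' \<otimes> B, g, B'\<rrangle>, A' \<otimes>[W] B', Sym K A' B', B' \<otimes>[W] A'\<rrangle>
    = \<llangle>K \<Turnstile> A \<otimes>[W] B, Sym K A B, B \<otimes>[W] A, \<llangle>K \<Turnstile> B, g, B' \<otimes> A, f, A'\<rrangle>, B' \<otimes>[W] A'\<rrangle>"
    (is "?l = ?r")
proof -
  note h' = h[unfolded kleisli_simps]
  let ?fg = "\<llangle>W \<Turnstile> A, f, MO A' \<otimes> B, g, MO B'\<rrangle>"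
  have "?l = \<llangle>W \<Turnstile> A \<otimes>[W] B, ?fg, MO A' \<otimes>[W] MO B', \<llangle>W \<Turnstile> MO A' \<otimes>[W] MO B', Mnab M A' B',
      MO (A' \<otimes>[W] B'), MA (A' \<otimes>[W] B') (B' \<otimes>[W] A') (Sym W A' B'), MO (B' \<otimes>[W] A')\<rrangle>,
      MO (B' \<otimes>[W] A')\<rrangle>"
    using o h' by (simp add: kleisli_simps(11) lift_cmp_right kl_obj_simps kleisli_simps(2,6) m_simps)
  also have "\<dots> = \<llangle>W \<Turnstile> A \<otimes>[W] B, ?fg, MO A' \<otimes>[W] MO B', Sym W (MO A') (MO B'),
      MO B' \<otimes>[W] MO A', Mnab M B' A', MO (B' \<otimes>[W] A')\<rrangle>"
    using o by (subst nab_sym) simp_all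
  also have "\<dots> = \<llangle>W \<Turnstile> A \<otimes>[W] B, Sym W A B, B \<otimes>[W] A, \<llangle>W \<Turnstile> B, g, MO B' \<otimes> A, f, MO A'\<rrangle>,
      MO B' \<otimes>[W] MO A', Mnab M B' A', MO (B' \<otimes>[W] A')\<rrangle>"
    by (rule C.postcompose_eq[OF W.sym_nat]) (simp_all add: o h' m_simps)
  also have "\<dots> = ?r"
    using o h' by (simp add: kleisli_simps(11) lift_cmp_left kl_obj_simps kleisli_simps(2,6) m_simps)
  finally show ?thesis .
qed

lemmas lift_simps = kl_obj_simps lift_hom lift_cmp lift_tensor lift_id[symmetric] W.smc_simps MO_obj

lemma monoidal_category_kleisli: "monoidal_category K"
proof (intro monoidal_category.intro monoidal_category_axioms.intro category_kleisli
    tensor_functor_kleisli)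
  show "nat_iso (prod_cat (prod_cat K K) K) K (fn_comp (fn_prod (Tensor K) fn_id) (Tensor K))
      (fn_comp fn_assoc (fn_comp (fn_prod fn_id (Tensor K)) (Tensor K))) (\<lambda>((A, B), D). Asc K A B D)"
    using kleisli_asc_nat
    by (auto simp: nat_iso_def nat_trans_def prod_cat_def fn_comp_def fn_prod_def fn_id_def
        fn_assoc_def kl_obj_simps kleisli_simps(8) lift_is_iso S.asc_is_iso lift_hom m_simps)
  show "nat_iso K K (fn_comp (fn_pair fn_id (fn_const K (Unt K))) (Tensor K)) fn_id (Run K)"
    using kleisli_run_nat
    by (auto simp: nat_iso_def nat_trans_def fn_comp_def fn_pair_def fn_id_def
        fn_const_def kl_obj_simps kleisli_simps(9) lift_is_iso S.run_is_iso lift_hom m_simps)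
  show "nat_iso K K (fn_comp (fn_pair (fn_const K (Unt K)) fn_id) (Tensor K)) fn_id (Lun K)"
    using kleisli_lun_nat
    by (auto simp: nat_iso_def nat_trans_def fn_comp_def fn_pair_def fn_id_def
        fn_const_def kl_obj_simps kleisli_simps(10) lift_is_iso S.lun_is_iso lift_hom m_simps)
qed (simp_all add: lift_simps kleisli_simps(8-10) S.pentagon S.triangle)

lemma symmetric_monoidal_category_kleisli: "symmetric_monoidal_category K"
proof (intro symmetric_monoidal_category.intro symmetric_monoidal_category_axioms.intro
    monoidal_category_kleisli)
  show "nat_iso (prod_cat K K) K (Tensor K) (fn_comp fn_swap (Tensor K)) (\<lambda>(A, B). Sym K A B)"
    using kleisli_sym_nat
    by (auto simp: nat_iso_def nat_trans_def prod_cat_def fn_comp_def fn_swap_def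
        kl_obj_simps kleisli_simps(11) lift_is_iso W.sym_is_iso lift_hom m_simps)
qed (simp_all add: lift_simps kleisli_simps(8-11) W.hexagon W.sym_sym W.sym_unit)

lemma embed_FO: "FO (lax_comp V W K F (kl_embed W M)) = FO F"
  and embed_FA: "FA (lax_comp V W K F (kl_embed W M)) A B f = L (FO F A) (FO F B) (FA F A B f)"
  by (simp_all add: lax_comp_def kl_embed_def)

lemma embed_eps:
  assumes "lax_monoidal_functor V W F"
  shows "Leps (lax_comp V W K F (kl_embed W M)) = L (Unt W) (FO F (Unt V)) (Leps F)"
proof -
  interpret F: lax_monoidal_functor V W F by fact
  show ?thesis
    using K.id_left[of "Unt W" "FO F (Unt V)"]
    by (simp add: lax_comp_def kl_embed_def lift_hom kl_obj_simps kleisli_simps(3)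
        F.lax_simps m_simps F.S.mon_simps)
qed

lemma embed_til:
  assumes "lax_monoidal_functor V W F" "A \<in> Obj V" "B \<in> Obj V"
  shows "Ltil (lax_comp V W K F (kl_embed W M)) A B
    = L (FO F A \<otimes>[W] FO F B) (FO F (A \<otimes>[V] B)) (Ltil F A B)"
proof -
  interpret F: lax_monoidal_functor V W F by fact
  show ?thesis
    using assms K.id_left[of "FO F A \<otimes>[W] FO F B" "FO F (A \<otimes>[V] B)"]
    by (simp add: lax_comp_def kl_embed_def lift_hom kl_obj_simps kleisli_simps(3)
        F.lax_simps m_simps F.S.mon_simps)
qed

text \<open>
  Every law of \<open>F\<close> is an equation in \<open>W\<close>, and lifting, being a strict monoidal functor, preserves it.
\<close>

lemma lax_functor_into_kleisli:
  fixes V :: "('vo, 'va, 'v) sym_mon_cat_scheme" and F :: "('vo, 'va, 'o, 'a, 'f) lax_fn_scheme"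
  assumes "symmetric_lax_monoidal_functor V W F"
  shows "symmetric_lax_monoidal_functor V K (lax_comp V W K F (kl_embed W M))"
proof -
  interpret F: symmetric_lax_monoidal_functor V W F by fact
  interpret V: symmetric_monoidal_category V by (rule F.source_symmetric)
  interpret KM: symmetric_monoidal_category K by (rule symmetric_monoidal_category_kleisli)
  let ?G = "lax_comp V W K F (kl_embed W M)"
  note simps = embed_FO embed_FA embed_eps[OF F.lax_monoidal_functor_axioms]
    embed_til[OF F.lax_monoidal_functor_axioms] lift_simps F.lax_simps V.smc_simps F.fun_cmp
  show ?thesis
  proof unfold_locales
    show "nat_trans (prod_cat V V) K (fn_comp (fn_prod ?G ?G) (Tensor K)) (fn_comp (Tensor V) ?G)
        (\<lambda>(A, B). Ltil ?G A B)"
      by (auto simp: nat_trans_def prod_cat_def fn_comp_def fn_prod_def simps F.til_natural)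
  qed (simp_all add: simps kleisli_simps(8-11) F.lax_assoc F.lax_run F.lax_lun F.lax_sym
        F.source_monoidal monoidal_category_kleisli
        F.source_symmetric symmetric_monoidal_category_kleisli)
qed

lemma full_strict_monoidal_subcategory_kleisli:
  assumes "full_strict_monoidal_subcategory W U"
  shows "full_strict_monoidal_subcategory K U"
  using assms
  by (auto simp: full_strict_monoidal_subcategory_def kl_obj_simps kleisli_simps(8-10)
      lift_id S.tensor_obj subset_iff)

end

section \<open>Strict monoidal subcategories\<close>

locale strict_subcategory = monoidal_category K
  for K :: "('o, 'a, 'x) mon_cat_scheme" +
  fixes U :: "'o set"
  assumes strict: "full_strict_monoidal_subcategory K U"
begin

abbreviation strict_tensor (infixr "\<cdot>" 70) where
  "P \<cdot> Q \<equiv> P \<otimes>[K] Q"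

lemma strict_obj: "P \<in> U \<Longrightarrow> P \<in> Obj K"
  and strict_unit: "Unt K \<in> U"
  and strict_tensor: "P \<in> U \<Longrightarrow> Q \<in> U \<Longrightarrow> P \<cdot> Q \<in> U"
  and strict_tensor_assoc:
    "P \<in> U \<Longrightarrow> Q \<in> U \<Longrightarrow> R \<in> U \<Longrightarrow> (P \<cdot> Q) \<cdot> R = P \<cdot> Q \<cdot> R"
  and strict_unit_right: "P \<in> U \<Longrightarrow> P \<cdot> Unt K = P"
  and strict_unit_left: "P \<in> U \<Longrightarrow> Unt K \<cdot> P = P"
  and strict_asc: "P \<in> U \<Longrightarrow> Q \<in> U \<Longrightarrow> R \<in> U \<Longrightarrow> Asc K P Q R = Idn K (P \<cdot> Q \<cdot> R)"
  and strict_run: "P \<in> U \<Longrightarrow> Run K P = Idn K P"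
  and strict_lun: "P \<in> U \<Longrightarrow> Lun K P = Idn K P"
  using strict by (auto simp: full_strict_monoidal_subcategory_def)

lemmas strict_objs = strict_obj strict_unit strict_tensor strict_tensor_assoc strict_unit_right
  strict_unit_left

text \<open>
  Strictness is only required of the objects of \<open>U\<close>. For arrows it follows from the naturality of
  associators and unitors that are identities.
\<close>

lemma strict_arr_assoc:
  assumes "P \<in> U" "Q \<in> U" "R \<in> U" "P' \<in> U" "Q' \<in> U" "R' \<in> U"
    "f \<in> Hom K P P'" "g \<in> Hom K Q Q'" "h \<in> Hom K R R'"
  shows "\<llangle>K \<Turnstile> P \<cdot> Q, \<llangle>K \<Turnstile> P, f, P' \<otimes> Q, g, Q'\<rrangle>, P' \<cdot> Q' \<otimes> R, h, R'\<rrangle>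
    = \<llangle>K \<Turnstile> P, f, P' \<otimes> Q \<cdot> R, \<llangle>K \<Turnstile> Q, g, Q' \<otimes> R, h, R'\<rrangle>, Q' \<cdot> R'\<rrangle>" (is "?l = ?r")
proof -
  \<comment> \<open>The typing is recorded first, since rewriting the objects hides the pattern of the tensor rules.\<close>
  have "?l \<in> Hom K ((P \<cdot> Q) \<cdot> R) ((P' \<cdot> Q') \<cdot> R')"
    and "?r \<in> Hom K (P \<cdot> Q \<cdot> R) (P' \<cdot> Q' \<cdot> R')"
    using assms by (simp_all only: mon_simps strict_obj)
  then show ?thesis
    using asc_nat[of P Q R P' Q' R' f g h] assms
    by (simp add: strict_asc strict_objs mon_simps)
qed

lemma strict_arr_unit_right:
  assumes "P \<in> U" "P' \<in> U" "f \<in> Hom K P P'"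
  shows "\<llangle>K \<Turnstile> P, f, P' \<otimes> Unt K, Idn K (Unt K), Unt K\<rrangle> = f" (is "?l = _")
proof -
  have "?l \<in> Hom K (P \<cdot> Unt K) (P' \<cdot> Unt K)"
    using assms by (simp only: mon_simps strict_obj)
  then show ?thesis
    using run_nat[of P P' f] assms by (simp add: strict_run strict_objs mon_simps)
qed

lemma strict_arr_unit_left:
  assumes "P \<in> U" "P' \<in> U" "f \<in> Hom K P P'"
  shows "\<llangle>K \<Turnstile> Unt K, Idn K (Unt K), Unt K \<otimes> P, f, P'\<rrangle> = f" (is "?l = _")
proof -
  have "?l \<in> Hom K (Unt K \<cdot> P) (Unt K \<cdot> P')"
    using assms by (simp only: mon_simps strict_obj)
  then show ?thesis
    using lun_nat[of P P' f] assms by (simp add: strict_lun strict_objs mon_simps)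
qed

end

section \<open>Partial slices along a lax monoidal functor\<close>

text \<open>
  The objects of the category assigned to \<open>A\<close> are called the elements at \<open>A\<close>. Arrows of \<open>V\<close> act on
  elements, and elements at \<open>A\<close> and \<open>B\<close> multiply to an element at \<open>A \<otimes> B\<close>; this is the notation in which
  1-cells are computed later.
\<close>

locale slice_along = strict_subcategory K U + G: lax_monoidal_functor V K G
  for V :: "('vo, 'va, 'v) mon_cat_scheme" and K :: "('o, 'a, 'x) mon_cat_scheme"
    and U :: "'o set" and G :: "('vo, 'va, 'o, 'a, 'g) lax_fn_scheme"
begin

abbreviation N where "N \<equiv> cat_lax_comp V K G (slice_functor K U)"
abbreviation El where "El A \<equiv> Obj (Kfun N A)"
abbreviation act where "act A B f \<equiv> FO (Karr N A B f)"
abbreviation mul where "mul A B \<equiv> FO (Ktil N A B)"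

lemma slice_simps:
  "El A = {(P, f). P \<in> U \<and> f \<in> Hom K P (FO G A)}"
  "Hom (Kfun N A) (P, f) (Q, g) = {\<phi> \<in> Hom K P Q. f = \<llangle>K \<Turnstile> P, \<phi>, Q, g, FO G A\<rrangle>}"
  "Idn (Kfun N A) (P, f) = Idn K P"
  "Cmp (Kfun N A) (P, f) (Q, g) (R, h) \<phi> \<psi> = \<llangle>K \<Turnstile> P, \<phi>, Q, \<psi>, R\<rrangle>"
  "act A B k (P, f) = (P, \<llangle>K \<Turnstile> P, f, FO G A, FA G A B k, FO G B\<rrangle>)"
  "FA (Karr N A B k) x y \<phi> = \<phi>"
  "Keps N = (Unt K, \<llangle>K \<Turnstile> Unt K, Idn K (Unt K), Unt K, Leps G, FO G (Unt V)\<rrangle>)"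
  "mul A B ((P, f), (Q, g)) = (P \<cdot> Q, \<llangle>K \<Turnstile> P \<cdot> Q,
    \<llangle>K \<Turnstile> P, f, FO G A \<otimes> Q, g, FO G B\<rrangle>, FO G A \<cdot> FO G B, Ltil G A B, FO G (A \<otimes>[V] B)\<rrangle>)"
  "FA (Ktil N A B) ((P, f), (Q, g)) ((P', f'), (Q', g')) (\<phi>, \<psi>) = \<llangle>K \<Turnstile> P, \<phi>, P' \<otimes> Q, \<psi>, Q'\<rrangle>"
  by (simp_all add: cat_lax_comp_def slice_functor_def slice_cat_def fn_comp_def)

lemmas g_simps = strict_obj mon_simps G.lax_simps G.S.mon_simps G.fun_cmp

lemma category_slice: "A \<in> Obj V \<Longrightarrow> category (Kfun N A)"
  by unfold_locales (auto simp: slice_simps g_simps)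

text \<open>
  Associativity of \<open>G\<close> produces the associator of \<open>K\<close> at the objects \<open>GA\<close>, \<open>GB\<close>, \<open>GD\<close>. Naturality moves
  it to the parameter objects, where it is an identity. The two unit laws below follow in the same
  way.
\<close>

lemma slice_assoc:
  assumes o: "A \<in> Obj V" "B \<in> Obj V" "D \<in> Obj V" and u: "P \<in> U" "Q \<in> U" "R \<in> U"
    and h: "f \<in> Hom K P (FO G A)" "g \<in> Hom K Q (FO G B)" "h \<in> Hom K R (FO G D)"
  shows "act ((A \<otimes>[V] B) \<otimes>[V] D) (A \<otimes>[V] (B \<otimes>[V] D)) (Asc V A B D)
      (mul (A \<otimes>[V] B) D (mul A B ((P, f), (Q, g)), (R, h)))
    = mul A (B \<otimes>[V] D) ((P, f), mul B D ((Q, g), (R, h)))"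
    (is "?l = ?r")
proof -
  let ?GA = "FO G A" and ?GB = "FO G B" and ?GD = "FO G D"
  let ?fgh = "\<llangle>K \<Turnstile> P \<cdot> Q, \<llangle>K \<Turnstile> P, f, ?GA \<otimes> Q, g, ?GB\<rrangle>, ?GA \<cdot> ?GB \<otimes> R, h, ?GD\<rrangle>"
  let ?E = "FO G (A \<otimes>[V] (B \<otimes>[V] D))"
  let ?k = "\<llangle>K \<Turnstile> ?GA \<cdot> ?GB \<cdot> ?GD,
         \<llangle>K \<Turnstile> ?GA, Idn K ?GA, ?GA \<otimes> ?GB \<cdot> ?GD, Ltil G B D, FO G (B \<otimes>[V] D)\<rrangle>,
         ?GA \<cdot> FO G (B \<otimes>[V] D), Ltil G A (B \<otimes>[V] D), ?E\<rrangle>"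
  note simps = o u h g_simps tensor_merge
  have "snd ?l = \<llangle>K \<Turnstile> (P \<cdot> Q) \<cdot> R, ?fgh, (?GA \<cdot> ?GB) \<cdot> ?GD,
      \<llangle>K \<Turnstile> (?GA \<cdot> ?GB) \<cdot> ?GD,
         \<llangle>K \<Turnstile> ?GA \<cdot> ?GB, Ltil G A B, FO G (A \<otimes>[V] B) \<otimes> ?GD, Idn K ?GD, ?GD\<rrangle>,
         FO G (A \<otimes>[V] B) \<cdot> ?GD, Ltil G (A \<otimes>[V] B) D, FO G ((A \<otimes>[V] B) \<otimes>[V] D),
         FA G ((A \<otimes>[V] B) \<otimes>[V] D) (A \<otimes>[V] (B \<otimes>[V] D)) (Asc V A B D), ?E\<rrangle>, ?E\<rrangle>"
    by (simp add: simps slice_simps)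
  also have "\<dots> = \<llangle>K \<Turnstile> (P \<cdot> Q) \<cdot> R, ?fgh, (?GA \<cdot> ?GB) \<cdot> ?GD,
      Asc K ?GA ?GB ?GD, ?GA \<cdot> ?GB \<cdot> ?GD, ?k, ?E\<rrangle>"
    using o by (subst G.lax_assoc) simp_all
  also have "\<dots> = \<llangle>K \<Turnstile> (P \<cdot> Q) \<cdot> R, Asc K P Q R, P \<cdot> Q \<cdot> R,
      \<llangle>K \<Turnstile> P, f, ?GA \<otimes> Q \<cdot> R, \<llangle>K \<Turnstile> Q, g, ?GB \<otimes> R, h, ?GD\<rrangle>, ?GB \<cdot> ?GD\<rrangle>,
      ?GA \<cdot> ?GB \<cdot> ?GD, ?k, ?E\<rrangle>"
    by (rule postcompose_eq[OF asc_nat]) (simp_all add: simps)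
  also have "\<dots> = snd ?r"
    by (simp add: simps slice_simps strict_asc strict_objs)
  finally show ?thesis
    using u by (simp add: slice_simps strict_objs)
qed

lemma slice_run:
  assumes o: "A \<in> Obj V" and u: "P \<in> U" and f: "f \<in> Hom K P (FO G A)"
  shows "act (A \<otimes>[V] Unt V) A (Run V A) (mul A (Unt V) ((P, f), Keps N)) = (P, f)"
    (is "?l = _")
proof -
  let ?GA = "FO G A"
  note simps = o u f g_simps tensor_merge
  have "snd ?l = \<llangle>K \<Turnstile> P \<cdot> Unt K, \<llangle>K \<Turnstile> P, f, ?GA \<otimes> Unt K, Idn K (Unt K), Unt K\<rrangle>, ?GA \<cdot> Unt K,
      \<llangle>K \<Turnstile> ?GA \<cdot> Unt K,
         \<llangle>K \<Turnstile> ?GA, Idn K ?GA, ?GA \<otimes> Unt K, Leps G, FO G (Unt V)\<rrangle>,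
         ?GA \<cdot> FO G (Unt V), Ltil G A (Unt V), FO G (A \<otimes>[V] Unt V),
         FA G (A \<otimes>[V] Unt V) A (Run V A), ?GA\<rrangle>, ?GA\<rrangle>"
    by (simp add: simps slice_simps)
  also have "\<dots> = \<llangle>K \<Turnstile> P \<cdot> Unt K, \<llangle>K \<Turnstile> P, f, ?GA \<otimes> Unt K, Idn K (Unt K), Unt K\<rrangle>,
      ?GA \<cdot> Unt K, Run K ?GA, ?GA\<rrangle>"
    using o by (subst G.lax_run) simp_all
  also have "\<dots> = \<llangle>K \<Turnstile> P \<cdot> Unt K, Run K P, P, f, ?GA\<rrangle>"
    by (simp add: simps run_nat)
  also have "\<dots> = f"
    by (simp add: simps strict_run strict_objs)
  finally show ?thesis
    using u by (simp add: slice_simps strict_objs)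
qed

lemma slice_lun:
  assumes o: "A \<in> Obj V" and u: "P \<in> U" and f: "f \<in> Hom K P (FO G A)"
  shows "act (Unt V \<otimes>[V] A) A (Lun V A) (mul (Unt V) A (Keps N, (P, f))) = (P, f)"
    (is "?l = _")
proof -
  let ?GA = "FO G A"
  note simps = o u f g_simps tensor_merge
  have "snd ?l = \<llangle>K \<Turnstile> Unt K \<cdot> P, \<llangle>K \<Turnstile> Unt K, Idn K (Unt K), Unt K \<otimes> P, f, ?GA\<rrangle>, Unt K \<cdot> ?GA,
      \<llangle>K \<Turnstile> Unt K \<cdot> ?GA,
         \<llangle>K \<Turnstile> Unt K, Leps G, FO G (Unt V) \<otimes> ?GA, Idn K ?GA, ?GA\<rrangle>,
         FO G (Unt V) \<cdot> ?GA, Ltil G (Unt V) A, FO G (Unt V \<otimes>[V] A),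
         FA G (Unt V \<otimes>[V] A) A (Lun V A), ?GA\<rrangle>, ?GA\<rrangle>"
    by (simp add: simps slice_simps)
  also have "\<dots> = \<llangle>K \<Turnstile> Unt K \<cdot> P, \<llangle>K \<Turnstile> Unt K, Idn K (Unt K), Unt K \<otimes> P, f, ?GA\<rrangle>,
      Unt K \<cdot> ?GA, Lun K ?GA, ?GA\<rrangle>"
    using o by (subst G.lax_lun) simp_all
  also have "\<dots> = \<llangle>K \<Turnstile> Unt K \<cdot> P, Lun K P, P, f, ?GA\<rrangle>"
    by (simp add: simps lun_nat)
  also have "\<dots> = f"
    by (simp add: simps strict_lun strict_objs)
  finally show ?thesis
    using u by (simp add: slice_simps strict_objs)
qed

lemma slice_lax_monoidal: "lax_monoidal_to_cat V N"
proof (intro lax_monoidal_to_cat.intro lax_monoidal_to_cat_axioms.intro category_slice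
    G.source_monoidal)
  fix A B f
  assume o: "A \<in> Obj V" "B \<in> Obj V" "f \<in> Hom V A B"
  interpret A: category "Kfun N A" using o category_slice by blast
  interpret B: category "Kfun N B" using o category_slice by blast
  show "cat_functor (Kfun N A) (Kfun N B) (Karr N A B f)"
    by unfold_locales (auto simp: o slice_simps g_simps)
next
  fix A B
  assume o: "A \<in> Obj V" "B \<in> Obj V"
  interpret AB: category "prod_cat (Kfun N A) (Kfun N B)"
    using o category_slice category_prod_cat by blast
  interpret C: category "Kfun N (A \<otimes>[V] B)" using o category_slice G.S.tensor_obj by blast
  show "cat_functor (prod_cat (Kfun N A) (Kfun N B)) (Kfun N (A \<otimes>[V] B)) (Ktil N A B)"
    by unfold_locales (auto simp: o prod_cat_def slice_simps g_simps strict_objs tensor_merge)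
next
  fix A A' B B' f g
  assume "A \<in> Obj V" "A' \<in> Obj V" "B \<in> Obj V" "B' \<in> Obj V" "f \<in> Hom V A A'" "g \<in> Hom V B B'"
  then show "fn_eq (prod_cat (Kfun N A) (Kfun N B))
        (fn_comp (fn_prod (Karr N A A' f) (Karr N B B' g)) (Ktil N A' B'))
        (fn_comp (Ktil N A B)
          (Karr N (A \<otimes>[V] B) (A' \<otimes>[V] B') \<llangle>V \<Turnstile> A, f, A' \<otimes> B, g, B'\<rrangle>))"
    by (auto simp: fn_eq_def fn_comp_def fn_prod_def prod_cat_def slice_simps g_simps
        G.til_natural[symmetric] tensor_merge)
next
  fix A B D
  assume o: "A \<in> Obj V" "B \<in> Obj V" "D \<in> Obj V"
  show "fn_eq (prod_cat (prod_cat (Kfun N A) (Kfun N B)) (Kfun N D))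
        (fn_comp (fn_prod (Ktil N A B) fn_id) (fn_comp (Ktil N (A \<otimes>[V] B) D)
          (Karr N ((A \<otimes>[V] B) \<otimes>[V] D) (A \<otimes>[V] (B \<otimes>[V] D)) (Asc V A B D))))
        (fn_comp fn_assoc (fn_comp (fn_prod fn_id (Ktil N B D)) (Ktil N A (B \<otimes>[V] D))))"
    using slice_assoc[OF o]
    by (auto simp: fn_eq_def fn_comp_def fn_prod_def fn_id_def fn_assoc_def prod_cat_def
        slice_simps(1,2)) (simp_all add: slice_simps(6,8,9) strict_arr_assoc)
next
  fix A assume o: "A \<in> Obj V"
  show "fn_eq (Kfun N A)
        (fn_comp (fn_pair fn_id (fn_const (Kfun N (Unt V)) (Keps N)))
          (fn_comp (Ktil N A (Unt V)) (Karr N (A \<otimes>[V] Unt V) A (Run V A)))) fn_id"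
    using slice_run[OF o]
    by (auto simp: fn_eq_def fn_comp_def fn_pair_def fn_id_def fn_const_def slice_simps(1,2))
       (simp add: slice_simps strict_arr_unit_right)
  show "fn_eq (Kfun N A)
        (fn_comp (fn_pair (fn_const (Kfun N (Unt V)) (Keps N)) fn_id)
          (fn_comp (Ktil N (Unt V) A) (Karr N (Unt V \<otimes>[V] A) A (Lun V A)))) fn_id"
    using slice_lun[OF o]
    by (auto simp: fn_eq_def fn_comp_def fn_pair_def fn_id_def fn_const_def slice_simps(1,2))
       (simp add: slice_simps strict_arr_unit_left)
qed (auto simp: fn_eq_def fn_comp_def fn_id_def slice_simps g_simps strict_unit)

end

section \<open>2-categories by change of base\<close>

lemma prod_cat_simps:
  "Obj (prod_cat C D) = Obj C \<times> Obj D"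
  "Hom (prod_cat C D) (A, A') (B, B') = Hom C A B \<times> Hom D A' B'"
  "Idn (prod_cat C D) (A, A') = (Idn C A, Idn D A')"
  "Cmp (prod_cat C D) (A, A') (B, B') (E, E') (f, f') (g, g')
    = (Cmp C A B E f g, Cmp D A' B' E' f' g')"
  by (simp_all add: prod_cat_def)

lemma fn_id_simps: "FO fn_id x = x" "FA fn_id x y h = h"
  by (simp_all add: fn_id_def)

lemma fn_comp_simps:
  "FO (fn_comp F G) x = FO G (FO F x)"
  "FA (fn_comp F G) x y h = FA G (FO F x) (FO F y) (FA F x y h)"
  by (simp_all add: fn_comp_def)

lemma fn_const_simps: "FO (fn_const D z) x = z" "FA (fn_const D z) x y h = Idn D z"
  by (simp_all add: fn_const_def)

lemma fn_pair_simps: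
  "FO (fn_pair F G) x = (FO F x, FO G x)"
  "FA (fn_pair F G) x y h = (FA F x y h, FA G x y h)"
  by (simp_all add: fn_pair_def)

lemma fn_prod_simps:
  "FO (fn_prod F G) (x, x') = (FO F x, FO G x')"
  "FA (fn_prod F G) (x, x') (y, y') (h, h') = (FA F x y h, FA G x' y' h')"
  by (simp_all add: fn_prod_def)

lemma fn_assoc_simps:
  "FO fn_assoc ((x, y), z) = (x, (y, z))" "FA fn_assoc a b ((h, k), l) = (h, (k, l))"
  by (simp_all add: fn_assoc_def)

lemma fn_swap_simps: "FO fn_swap (x, y) = (y, x)" "FA fn_swap a b (h, k) = (k, h)"
  by (simp_all add: fn_swap_def)

lemmas fn_simps = fn_id_simps fn_comp_simps fn_const_simps fn_pair_simps fn_prod_simps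
  fn_assoc_simps fn_swap_simps

context lax_monoidal_to_cat
begin

abbreviation El where "El A \<equiv> Obj (Kfun N A)"
abbreviation act where "act A B f \<equiv> FO (Karr N A B f)"
abbreviation mul where "mul A B \<equiv> FO (Ktil N A B)"

text \<open>
  The laws of a lax monoidal functor into categories, stated for elements and the arrows between them:
  the multiplication of elements is equivariant, associative and unital, up to the action of the
  structure maps of \<open>V\<close>.
\<close>

lemma act_obj: "\<lbrakk>A \<in> Obj V; B \<in> Obj V; f \<in> Hom V A B; x \<in> El A\<rbrakk>
    \<Longrightarrow> act A B f x \<in> El B"
  using k_functor cat_functor.fun_obj by metis

lemma act_hom: "\<lbrakk>A \<in> Obj V; B \<in> Obj V; f \<in> Hom V A B; x \<in> El A; x' \<in> El A;
      \<phi> \<in> Hom (Kfun N A) x x'\<rbrakk>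
    \<Longrightarrow> FA (Karr N A B f) x x' \<phi> \<in> Hom (Kfun N B) (act A B f x) (act A B f x')"
  using k_functor cat_functor.fun_hom by metis

lemma act_id: "\<lbrakk>A \<in> Obj V; x \<in> El A\<rbrakk> \<Longrightarrow> act A A (Idn V A) x = x"
  and act_id_arr: "\<lbrakk>A \<in> Obj V; x \<in> El A; x' \<in> El A; \<phi> \<in> Hom (Kfun N A) x x'\<rbrakk>
    \<Longrightarrow> FA (Karr N A A (Idn V A)) x x' \<phi> = \<phi>"
  using k_id by (simp_all add: fn_eq_def fn_simps)

lemma act_cmp: "\<lbrakk>A \<in> Obj V; B \<in> Obj V; D \<in> Obj V; f \<in> Hom V A B; g \<in> Hom V B D; x \<in> El A\<rbrakk>
    \<Longrightarrow> act B D g (act A B f x) = act A D \<llangle>V \<Turnstile> A, f, B, g, D\<rrangle> x"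
  using k_cmp by (simp add: fn_eq_def fn_simps)

lemma act_cmp_arr: "\<lbrakk>A \<in> Obj V; B \<in> Obj V; D \<in> Obj V; f \<in> Hom V A B; g \<in> Hom V B D;
      x \<in> El A; x' \<in> El A; \<phi> \<in> Hom (Kfun N A) x x'\<rbrakk>
    \<Longrightarrow> FA (Karr N B D g) (act A B f x) (act A B f x') (FA (Karr N A B f) x x' \<phi>)
      = FA (Karr N A D \<llangle>V \<Turnstile> A, f, B, g, D\<rrangle>) x x' \<phi>"
  using k_cmp by (simp add: fn_eq_def fn_simps)

lemma mul_obj: "\<lbrakk>A \<in> Obj V; B \<in> Obj V; x \<in> El A; y \<in> El B\<rbrakk>
    \<Longrightarrow> mul A B (x, y) \<in> El (A \<otimes>[V] B)"
  using cat_functor.fun_obj[OF k_til_functor, of A B "(x, y)"] by (simp add: prod_cat_simps)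

lemma mul_hom: "\<lbrakk>A \<in> Obj V; B \<in> Obj V; x \<in> El A; y \<in> El B;
      x' \<in> El A; y' \<in> El B; \<phi> \<in> Hom (Kfun N A) x x'; \<psi> \<in> Hom (Kfun N B) y y'\<rbrakk>
    \<Longrightarrow> FA (Ktil N A B) (x, y) (x', y') (\<phi>, \<psi>)
      \<in> Hom (Kfun N (A \<otimes>[V] B)) (mul A B (x, y)) (mul A B (x', y'))"
  using cat_functor.fun_hom[OF k_til_functor, of A B "(x, y)" "(x', y')" "(\<phi>, \<psi>)"]
  by (simp add: prod_cat_simps)

lemma mul_act:
  assumes "A \<in> Obj V" "A' \<in> Obj V" "B \<in> Obj V" "B' \<in> Obj V" "f \<in> Hom V A A'" "g \<in> Hom V B B'"
    and "x \<in> El A" "y \<in> El B"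
  shows "mul A' B' (act A A' f x, act B B' g y)
    = act (A \<otimes>[V] B) (A' \<otimes>[V] B') \<llangle>V \<Turnstile> A, f, A' \<otimes> B, g, B'\<rrangle> (mul A B (x, y))"
  using k_til_nat[of A A' B B' f g] assms by (simp add: fn_eq_def fn_simps prod_cat_simps)

lemma mul_act_arr:
  assumes "A \<in> Obj V" "A' \<in> Obj V" "B \<in> Obj V" "B' \<in> Obj V" "f \<in> Hom V A A'" "g \<in> Hom V B B'"
    and "x \<in> El A" "y \<in> El B" "x' \<in> El A" "y' \<in> El B"
    and "\<phi> \<in> Hom (Kfun N A) x x'" "\<psi> \<in> Hom (Kfun N B) y y'"
  shows "FA (Ktil N A' B') (act A A' f x, act B B' g y)
      (act A A' f x', act B B' g y')
      (FA (Karr N A A' f) x x' \<phi>, FA (Karr N B B' g) y y' \<psi>)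
    = FA (Karr N (A \<otimes>[V] B) (A' \<otimes>[V] B') \<llangle>V \<Turnstile> A, f, A' \<otimes> B, g, B'\<rrangle>)
      (mul A B (x, y)) (mul A B (x', y')) (FA (Ktil N A B) (x, y) (x', y') (\<phi>, \<psi>))"
  using k_til_nat[of A A' B B' f g] assms by (simp add: fn_eq_def fn_simps prod_cat_simps)

lemma mul_act_left:
  assumes "A \<in> Obj V" "A' \<in> Obj V" "B \<in> Obj V" "f \<in> Hom V A A'" "x \<in> El A" "y \<in> El B"
  shows "mul A' B (act A A' f x, y)
    = act (A \<otimes>[V] B) (A' \<otimes>[V] B) \<llangle>V \<Turnstile> A, f, A' \<otimes> B, Idn V B, B\<rrangle> (mul A B (x, y))"
  using mul_act[of A A' B B f "Idn V B" x y] assms by (simp add: act_id id_hom)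

lemma mul_act_right:
  assumes "A \<in> Obj V" "B \<in> Obj V" "B' \<in> Obj V" "g \<in> Hom V B B'" "x \<in> El A" "y \<in> El B"
  shows "mul A B' (x, act B B' g y)
    = act (A \<otimes>[V] B) (A \<otimes>[V] B') \<llangle>V \<Turnstile> A, Idn V A, A \<otimes> B, g, B'\<rrangle> (mul A B (x, y))"
  using mul_act[of A A B B' "Idn V A" g x y] assms by (simp add: act_id id_hom)

lemma mul_act_left_arr:
  assumes "A \<in> Obj V" "A' \<in> Obj V" "B \<in> Obj V" "f \<in> Hom V A A'"
    and "x \<in> El A" "y \<in> El B" "x' \<in> El A" "y' \<in> El B"
    and "\<phi> \<in> Hom (Kfun N A) x x'" "\<psi> \<in> Hom (Kfun N B) y y'"
  shows "FA (Ktil N A' B) (act A A' f x, y) (act A A' f x', y')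
      (FA (Karr N A A' f) x x' \<phi>, \<psi>)
    = FA (Karr N (A \<otimes>[V] B) (A' \<otimes>[V] B) \<llangle>V \<Turnstile> A, f, A' \<otimes> B, Idn V B, B\<rrangle>)
      (mul A B (x, y)) (mul A B (x', y')) (FA (Ktil N A B) (x, y) (x', y') (\<phi>, \<psi>))"
  using mul_act_arr[of A A' B B f "Idn V B" x y x' y' \<phi> \<psi>] assms
  by (simp add: act_id act_id_arr id_hom)

lemma mul_act_right_arr:
  assumes "A \<in> Obj V" "B \<in> Obj V" "B' \<in> Obj V" "g \<in> Hom V B B'"
    and "x \<in> El A" "y \<in> El B" "x' \<in> El A" "y' \<in> El B"
    and "\<phi> \<in> Hom (Kfun N A) x x'" "\<psi> \<in> Hom (Kfun N B) y y'"
  shows "FA (Ktil N A B') (x, act B B' g y) (x', act B B' g y')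
      (\<phi>, FA (Karr N B B' g) y y' \<psi>)
    = FA (Karr N (A \<otimes>[V] B) (A \<otimes>[V] B') \<llangle>V \<Turnstile> A, Idn V A, A \<otimes> B, g, B'\<rrangle>)
      (mul A B (x, y)) (mul A B (x', y')) (FA (Ktil N A B) (x, y) (x', y') (\<phi>, \<psi>))"
  using mul_act_arr[of A A B B' "Idn V A" g x y x' y' \<phi> \<psi>] assms
  by (simp add: act_id act_id_arr id_hom)

lemma mul_assoc:
  assumes "A \<in> Obj V" "B \<in> Obj V" "D \<in> Obj V" "x \<in> El A" "y \<in> El B" "z \<in> El D"
  shows "act ((A \<otimes>[V] B) \<otimes>[V] D) (A \<otimes>[V] (B \<otimes>[V] D)) (Asc V A B D)
      (mul (A \<otimes>[V] B) D (mul A B (x, y), z))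
    = mul A (B \<otimes>[V] D) (x, mul B D (y, z))"
  using k_assoc[of A B D] assms by (simp add: fn_eq_def fn_simps prod_cat_simps)

lemma mul_assoc_arr:
  assumes "A \<in> Obj V" "B \<in> Obj V" "D \<in> Obj V" "x \<in> El A" "y \<in> El B" "z \<in> El D"
    and "x' \<in> El A" "y' \<in> El B" "z' \<in> El D"
    and "\<phi> \<in> Hom (Kfun N A) x x'" "\<psi> \<in> Hom (Kfun N B) y y'" "\<chi> \<in> Hom (Kfun N D) z z'"
  shows "FA (Karr N ((A \<otimes>[V] B) \<otimes>[V] D) (A \<otimes>[V] (B \<otimes>[V] D)) (Asc V A B D))
      (mul (A \<otimes>[V] B) D (mul A B (x, y), z))
      (mul (A \<otimes>[V] B) D (mul A B (x', y'), z'))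
      (FA (Ktil N (A \<otimes>[V] B) D) (mul A B (x, y), z) (mul A B (x', y'), z')
        (FA (Ktil N A B) (x, y) (x', y') (\<phi>, \<psi>), \<chi>))
    = FA (Ktil N A (B \<otimes>[V] D)) (x, mul B D (y, z)) (x', mul B D (y', z'))
        (\<phi>, FA (Ktil N B D) (y, z) (y', z') (\<psi>, \<chi>))"
  using k_assoc[of A B D] assms by (simp add: fn_eq_def fn_simps prod_cat_simps)

lemma mul_run: "\<lbrakk>A \<in> Obj V; x \<in> El A\<rbrakk> \<Longrightarrow>
    act (A \<otimes>[V] Unt V) A (Run V A) (mul A (Unt V) (x, Keps N)) = x"
  and mul_lun: "\<lbrakk>A \<in> Obj V; x \<in> El A\<rbrakk> \<Longrightarrow>
    act (Unt V \<otimes>[V] A) A (Lun V A) (mul (Unt V) A (Keps N, x)) = x"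
  and mul_run_arr: "\<lbrakk>A \<in> Obj V; x \<in> El A; x' \<in> El A; \<phi> \<in> Hom (Kfun N A) x x'\<rbrakk> \<Longrightarrow>
    FA (Karr N (A \<otimes>[V] Unt V) A (Run V A))
      (mul A (Unt V) (x, Keps N)) (mul A (Unt V) (x', Keps N))
      (FA (Ktil N A (Unt V)) (x, Keps N) (x', Keps N) (\<phi>, Idn (Kfun N (Unt V)) (Keps N))) = \<phi>"
  and mul_lun_arr: "\<lbrakk>A \<in> Obj V; x \<in> El A; x' \<in> El A; \<phi> \<in> Hom (Kfun N A) x x'\<rbrakk> \<Longrightarrow>
    FA (Karr N (Unt V \<otimes>[V] A) A (Lun V A))
      (mul (Unt V) A (Keps N, x)) (mul (Unt V) A (Keps N, x'))
      (FA (Ktil N (Unt V) A) (Keps N, x) (Keps N, x') (Idn (Kfun N (Unt V)) (Keps N), \<phi>)) = \<phi>"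
  using k_run[of A] k_lun[of A] by (simp_all add: fn_eq_def fn_simps prod_cat_simps)

lemma act_unit_id: "\<lbrakk>A \<in> Obj V; f \<in> Hom V (Unt V) A\<rbrakk> \<Longrightarrow>
    Idn (Kfun N A) (act (Unt V) A f (Keps N))
    = FA (Karr N (Unt V) A f) (Keps N) (Keps N) (Idn (Kfun N (Unt V)) (Keps N))"
  using cat_functor.fun_id[OF k_functor, of "Unt V" A f "Keps N"] by (simp add: unt_obj k_eps)

lemmas k_simps = mon_simps act_obj act_hom act_id act_id_arr act_cmp act_cmp_arr mul_obj mul_hom k_eps
  category.cat_simps[OF k_cat]

end

lemma change_of_base_simps:
  "Cell0 (change_of_base V N C) = VObj C"
  "HomC (change_of_base V N C) X Y = Kfun N (VHom C X Y)"
  "Id1 (change_of_base V N C) X = FO (Karr N (Unt V) (VHom C X X) (VIdn C X)) (Keps N)"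
  "HComp (change_of_base V N C) X Y Z = fn_comp (Ktil N (VHom C X Y) (VHom C Y Z))
      (Karr N (VHom C X Y \<otimes>[V] VHom C Y Z) (VHom C X Z) (VCmp C X Y Z))"
  by (simp_all add: change_of_base_def)

text \<open>
  A horizontal composite is a product acted on by the composition of \<open>C\<close>. By equivariance, a repeated
  composite is a repeated product acted on by a composite arrow of \<open>V\<close>, so the associativity and unit
  laws follow from those of \<open>C\<close> and of the multiplication.
\<close>

theorem two_category_change_of_base:
  assumes "lax_monoidal_to_cat V N" "vcategory V C"
  shows "two_category (change_of_base V N C)"
proof -
  interpret lax_monoidal_to_cat V N by fact
  interpret C: vcategory V C by fact
  note simps = k_simps C.vhom_obj C.vid_hom C.vcmp_hom fn_simps prod_cat_simps
  let ?T = "change_of_base V N C"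
  show ?thesis
  proof (intro two_category.intro, unfold change_of_base_simps)
    fix X Y Z assume o: "X \<in> VObj C" "Y \<in> VObj C" "Z \<in> VObj C"
    interpret a: cat_functor "prod_cat (Kfun N (VHom C X Y)) (Kfun N (VHom C Y Z))"
        "Kfun N (VHom C X Y \<otimes>[V] VHom C Y Z)" "Ktil N (VHom C X Y) (VHom C Y Z)"
      using o by (simp add: k_til_functor C.vhom_obj)
    interpret b: cat_functor "Kfun N (VHom C X Y \<otimes>[V] VHom C Y Z)" "Kfun N (VHom C X Z)"
        "Karr N (VHom C X Y \<otimes>[V] VHom C Y Z) (VHom C X Z) (VCmp C X Y Z)"
      using o by (simp add: k_functor simps)
    show "cat_functor (prod_cat (Kfun N (VHom C X Y)) (Kfun N (VHom C Y Z))) (Kfun N (VHom C X Z))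
        (fn_comp (Ktil N (VHom C X Y) (VHom C Y Z))
          (Karr N (VHom C X Y \<otimes>[V] VHom C Y Z) (VHom C X Z) (VCmp C X Y Z)))"
      by unfold_locales (simp_all only: fn_simps a.fun_obj b.fun_obj a.fun_hom b.fun_hom
          a.fun_id b.fun_id a.fun_cmp b.fun_cmp)
  next
    fix W X Y Z assume o: "W \<in> VObj C" "X \<in> VObj C" "Y \<in> VObj C" "Z \<in> VObj C"
    show "fn_eq (prod_cat (prod_cat (Kfun N (VHom C W X)) (Kfun N (VHom C X Y))) (Kfun N (VHom C Y Z)))
       (fn_comp (fn_prod
           (fn_comp (Ktil N (VHom C W X) (VHom C X Y))
             (Karr N (VHom C W X \<otimes>[V] VHom C X Y) (VHom C W Y) (VCmp C W X Y))) fn_id)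
         (fn_comp (Ktil N (VHom C W Y) (VHom C Y Z))
           (Karr N (VHom C W Y \<otimes>[V] VHom C Y Z) (VHom C W Z) (VCmp C W Y Z))))
       (fn_comp fn_assoc (fn_comp (fn_prod fn_id
           (fn_comp (Ktil N (VHom C X Y) (VHom C Y Z))
             (Karr N (VHom C X Y \<otimes>[V] VHom C Y Z) (VHom C X Z) (VCmp C X Y Z))))
         (fn_comp (Ktil N (VHom C W X) (VHom C X Z))
           (Karr N (VHom C W X \<otimes>[V] VHom C X Z) (VHom C W Z) (VCmp C W X Z)))))"
      using C.vcmp_assoc[OF o]
      by (auto simp: fn_eq_def simps o mul_act_left mul_act_left_arr mul_act_right mul_act_right_arr
          mul_assoc[symmetric] mul_assoc_arr[symmetric])
  next
    fix X Y assume o: "X \<in> VObj C" "Y \<in> VObj C"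
    show "fn_eq (Kfun N (VHom C X Y))
        (fn_comp (fn_pair (fn_const (Kfun N (VHom C X X))
            (act (Unt V) (VHom C X X) (VIdn C X) (Keps N))) fn_id)
          (fn_comp (Ktil N (VHom C X X) (VHom C X Y))
            (Karr N (VHom C X X \<otimes>[V] VHom C X Y) (VHom C X Y) (VCmp C X X Y)))) fn_id"
      using C.vid_left[OF o]
      by (auto simp: fn_eq_def simps o mul_act_left mul_act_left_arr act_unit_id mul_lun mul_lun_arr)
    show "fn_eq (Kfun N (VHom C X Y))
        (fn_comp (fn_pair fn_id (fn_const (Kfun N (VHom C Y Y))
            (act (Unt V) (VHom C Y Y) (VIdn C Y) (Keps N))))
          (fn_comp (Ktil N (VHom C X Y) (VHom C Y Y))
            (Karr N (VHom C X Y \<otimes>[V] VHom C Y Y) (VHom C X Y) (VCmp C X Y Y)))) fn_id"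
      using C.vid_right[OF o]
      by (auto simp: fn_eq_def simps o mul_act_right mul_act_right_arr act_unit_id mul_run mul_run_arr)
  qed (simp_all add: simps k_cat)
qed

section \<open>Pseudofunctors\<close>

text \<open>Components that are invertible are in particular arrows of the right type.\<close>

lemma nat_isoI:
  assumes "\<And>A. A \<in> Obj C \<Longrightarrow> is_iso D (FO F A) (FO G A) (t A)"
    and "\<And>A B f. \<lbrakk>A \<in> Obj C; B \<in> Obj C; f \<in> Hom C A B\<rbrakk> \<Longrightarrow>
      \<llangle>D \<Turnstile> FO F A, FA F A B f, FO F B, t B, FO G B\<rrangle>
      = \<llangle>D \<Turnstile> FO F A, t A, FO G A, FA G A B f, FO G B\<rrangle>"
  shows "nat_iso C D F G t"
  unfolding nat_iso_def nat_trans_def using assms by (blast intro: is_iso_hom[OF assms(1)])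

lemma cat_functor_comp:
  assumes "cat_functor C D F" "cat_functor D E G"
  shows "cat_functor C E (fn_comp F G)"
proof -
  interpret F: cat_functor C D F by fact
  interpret G: cat_functor D E G by fact
  show ?thesis
    by unfold_locales (simp_all only: fn_simps F.fun_obj G.fun_obj F.fun_hom G.fun_hom
        F.fun_id G.fun_id F.fun_cmp G.fun_cmp)
qed

lemma cat_functor_id: "category C \<Longrightarrow> cat_functor C C fn_id"
  by (simp add: cat_functor_def cat_functor_axioms_def fn_simps)

lemma cat_functor_const:
  assumes "category C" "category D" "z \<in> Obj D"
  shows "cat_functor C D (fn_const D z)"
proof -
  interpret D: category D by fact
  show ?thesis
    using assms by (simp add: cat_functor_def cat_functor_axioms_def fn_simps D.cat_simps)
qed

lemma cat_functor_pair:
  assumes "cat_functor C D F" "cat_functor C E G"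
  shows "cat_functor C (prod_cat D E) (fn_pair F G)"
proof -
  interpret F: cat_functor C D F by fact
  interpret G: cat_functor C E G by fact
  interpret DE: category "prod_cat D E"
    by (intro category_prod_cat F.D.category_axioms G.D.category_axioms)
  show ?thesis
    by unfold_locales (simp_all add: fn_simps prod_cat_simps F.fun_obj G.fun_obj F.fun_hom G.fun_hom
        F.fun_id G.fun_id F.fun_cmp G.fun_cmp)
qed

lemma cat_functor_prod:
  assumes "cat_functor C D F" "cat_functor C' D' F'"
  shows "cat_functor (prod_cat C C') (prod_cat D D') (fn_prod F F')"
proof -
  interpret F: cat_functor C D F by fact
  interpret G: cat_functor C' D' F' by fact
  interpret CC: category "prod_cat C C'"
    by (intro category_prod_cat F.C.category_axioms G.C.category_axioms)
  interpret DD: category "prod_cat D D'"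
    by (intro category_prod_cat F.D.category_axioms G.D.category_axioms)
  show ?thesis
    by unfold_locales (auto simp: fn_simps prod_cat_simps F.fun_obj G.fun_obj F.fun_hom G.fun_hom
        F.fun_id G.fun_id F.fun_cmp G.fun_cmp)
qed

context two_category
begin

lemmas v_simps = category.cat_simps[OF homc_cat]

lemma hcomp_obj: "\<lbrakk>X \<in> Cell0 T; Y \<in> Cell0 T; Z \<in> Cell0 T; f \<in> Obj (HomC T X Y); g \<in> Obj (HomC T Y Z)\<rbrakk>
    \<Longrightarrow> \<llangle>T \<Turnstile>\<^sub>1 X, f, Y, g, Z\<rrangle> \<in> Obj (HomC T X Z)"
  using cat_functor.fun_obj[OF hcomp_functor, of X Y Z "(f, g)"] by (simp add: prod_cat_simps)

text \<open>
  Simplification reassociates composites of 1-cells, also in the boundaries of 2-cells. Typing rules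
  therefore leave the boundaries open up to equality.
\<close>

lemma hcomp_hom:
  assumes "X \<in> Cell0 T" "Y \<in> Cell0 T" "Z \<in> Cell0 T" "f \<in> Obj (HomC T X Y)" "g \<in> Obj (HomC T Y Z)"
    "f' \<in> Obj (HomC T X Y)" "g' \<in> Obj (HomC T Y Z)"
    "\<phi> \<in> Hom (HomC T X Y) f f'" "\<psi> \<in> Hom (HomC T Y Z) g g'"
    "a = \<llangle>T \<Turnstile>\<^sub>1 X, f, Y, g, Z\<rrangle>" "b = \<llangle>T \<Turnstile>\<^sub>1 X, f', Y, g', Z\<rrangle>"
  shows "FA (HComp T X Y Z) (f, g) (f', g') (\<phi>, \<psi>) \<in> Hom (HomC T X Z) a b"
  using cat_functor.fun_hom[OF hcomp_functor, of X Y Z "(f, g)" "(f', g')" "(\<phi>, \<psi>)"] assms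
  by (simp add: prod_cat_simps)

lemma hcomp_id:
  assumes "X \<in> Cell0 T" "Y \<in> Cell0 T" "Z \<in> Cell0 T" "f \<in> Obj (HomC T X Y)" "g \<in> Obj (HomC T Y Z)"
  shows "FA (HComp T X Y Z) (f, g) (f, g) (Idn (HomC T X Y) f, Idn (HomC T Y Z) g)
    = Idn (HomC T X Z) \<llangle>T \<Turnstile>\<^sub>1 X, f, Y, g, Z\<rrangle>"
  using cat_functor.fun_id[OF hcomp_functor, of X Y Z "(f, g)"] assms
  by (simp add: prod_cat_simps)

lemma hcomp_cmp:
  assumes "X \<in> Cell0 T" "Y \<in> Cell0 T" "Z \<in> Cell0 T" "f \<in> Obj (HomC T X Y)" "g \<in> Obj (HomC T Y Z)"
    "f' \<in> Obj (HomC T X Y)" "g' \<in> Obj (HomC T Y Z)" "f'' \<in> Obj (HomC T X Y)" "g'' \<in> Obj (HomC T Y Z)"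
    "\<phi> \<in> Hom (HomC T X Y) f f'" "\<psi> \<in> Hom (HomC T Y Z) g g'"
    "\<phi>' \<in> Hom (HomC T X Y) f' f''" "\<psi>' \<in> Hom (HomC T Y Z) g' g''"
  shows "\<llangle>HomC T X Z \<Turnstile> \<llangle>T \<Turnstile>\<^sub>1 X, f, Y, g, Z\<rrangle>, FA (HComp T X Y Z) (f, g) (f', g') (\<phi>, \<psi>),
      \<llangle>T \<Turnstile>\<^sub>1 X, f', Y, g', Z\<rrangle>, FA (HComp T X Y Z) (f', g') (f'', g'') (\<phi>', \<psi>'),
      \<llangle>T \<Turnstile>\<^sub>1 X, f'', Y, g'', Z\<rrangle>\<rrangle>
    = FA (HComp T X Y Z) (f, g) (f'', g'')
        (\<llangle>HomC T X Y \<Turnstile> f, \<phi>, f', \<phi>', f''\<rrangle>, \<llangle>HomC T Y Z \<Turnstile> g, \<psi>, g', \<psi>', g''\<rrangle>)"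
  using cat_functor.fun_cmp[OF hcomp_functor, of X Y Z "(f, g)" "(f', g')" "(f'', g'')" "(\<phi>, \<psi>)"
      "(\<phi>', \<psi>')"] assms
  by (simp add: prod_cat_simps)

lemma hcomp_assoc_obj:
  assumes "W \<in> Cell0 T" "X \<in> Cell0 T" "Y \<in> Cell0 T" "Z \<in> Cell0 T"
    "f \<in> Obj (HomC T W X)" "g \<in> Obj (HomC T X Y)" "h \<in> Obj (HomC T Y Z)"
  shows "\<llangle>T \<Turnstile>\<^sub>1 W, \<llangle>T \<Turnstile>\<^sub>1 W, f, X, g, Y\<rrangle>, Y, h, Z\<rrangle> = \<llangle>T \<Turnstile>\<^sub>1 W, f, X, g, Y, h, Z\<rrangle>"
  using hcomp_assoc[of W X Y Z] assms by (simp add: fn_eq_def fn_simps prod_cat_simps)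

lemma hcomp_assoc_arr:
  assumes "W \<in> Cell0 T" "X \<in> Cell0 T" "Y \<in> Cell0 T" "Z \<in> Cell0 T"
    "f \<in> Obj (HomC T W X)" "g \<in> Obj (HomC T X Y)" "h \<in> Obj (HomC T Y Z)"
    "f' \<in> Obj (HomC T W X)" "g' \<in> Obj (HomC T X Y)" "h' \<in> Obj (HomC T Y Z)"
    "\<phi> \<in> Hom (HomC T W X) f f'" "\<psi> \<in> Hom (HomC T X Y) g g'" "\<chi> \<in> Hom (HomC T Y Z) h h'"
  shows "FA (HComp T W Y Z) (\<llangle>T \<Turnstile>\<^sub>1 W, f, X, g, Y\<rrangle>, h) (\<llangle>T \<Turnstile>\<^sub>1 W, f', X, g', Y\<rrangle>, h')
      (FA (HComp T W X Y) (f, g) (f', g') (\<phi>, \<psi>), \<chi>)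
    = FA (HComp T W X Z) (f, \<llangle>T \<Turnstile>\<^sub>1 X, g, Y, h, Z\<rrangle>) (f', \<llangle>T \<Turnstile>\<^sub>1 X, g', Y, h', Z\<rrangle>)
      (\<phi>, FA (HComp T X Y Z) (g, h) (g', h') (\<psi>, \<chi>))"
  using hcomp_assoc[of W X Y Z] assms by (simp add: fn_eq_def fn_simps prod_cat_simps)

lemma hcomp_unit_obj:
  assumes "X \<in> Cell0 T" "Y \<in> Cell0 T" "f \<in> Obj (HomC T X Y)"
  shows "\<llangle>T \<Turnstile>\<^sub>1 X, Id1 T X, X, f, Y\<rrangle> = f" "\<llangle>T \<Turnstile>\<^sub>1 X, f, Y, Id1 T Y, Y\<rrangle> = f"
  using hcomp_id_left[of X Y] hcomp_id_right[of X Y] assms by (simp_all add: fn_eq_def fn_simps)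

lemma hcomp_unit_arr:
  assumes "X \<in> Cell0 T" "Y \<in> Cell0 T" "f \<in> Obj (HomC T X Y)" "f' \<in> Obj (HomC T X Y)"
    "\<phi> \<in> Hom (HomC T X Y) f f'"
  shows "FA (HComp T X X Y) (Id1 T X, f) (Id1 T X, f') (Idn (HomC T X X) (Id1 T X), \<phi>) = \<phi>"
    "FA (HComp T X Y Y) (f, Id1 T Y) (f', Id1 T Y) (\<phi>, Idn (HomC T Y Y) (Id1 T Y)) = \<phi>"
  using hcomp_id_left[of X Y] hcomp_id_right[of X Y] assms by (simp_all add: fn_eq_def fn_simps)

lemma whr_cmp:
  assumes "X \<in> Cell0 T" "Y \<in> Cell0 T" "Z \<in> Cell0 T" "f \<in> Obj (HomC T X Y)" "g \<in> Obj (HomC T Y Z)"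
    "f' \<in> Obj (HomC T X Y)" "f'' \<in> Obj (HomC T X Y)"
    "\<phi> \<in> Hom (HomC T X Y) f f'" "\<psi> \<in> Hom (HomC T X Y) f' f''"
  shows "whr T X Y Z f f'' \<llangle>HomC T X Y \<Turnstile> f, \<phi>, f', \<psi>, f''\<rrangle> g
    = \<llangle>HomC T X Z \<Turnstile> \<llangle>T \<Turnstile>\<^sub>1 X, f, Y, g, Z\<rrangle>, whr T X Y Z f f' \<phi> g, \<llangle>T \<Turnstile>\<^sub>1 X, f', Y, g, Z\<rrangle>,
        whr T X Y Z f' f'' \<psi> g, \<llangle>T \<Turnstile>\<^sub>1 X, f'', Y, g, Z\<rrangle>\<rrangle>"
  using assms by (subst hcomp_cmp) (simp_all add: v_simps)

lemma whl_cmp: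
  assumes "X \<in> Cell0 T" "Y \<in> Cell0 T" "Z \<in> Cell0 T" "f \<in> Obj (HomC T X Y)" "g \<in> Obj (HomC T Y Z)"
    "g' \<in> Obj (HomC T Y Z)" "g'' \<in> Obj (HomC T Y Z)"
    "\<phi> \<in> Hom (HomC T Y Z) g g'" "\<psi> \<in> Hom (HomC T Y Z) g' g''"
  shows "whl T X Y Z f g g'' \<llangle>HomC T Y Z \<Turnstile> g, \<phi>, g', \<psi>, g''\<rrangle>
    = \<llangle>HomC T X Z \<Turnstile> \<llangle>T \<Turnstile>\<^sub>1 X, f, Y, g, Z\<rrangle>, whl T X Y Z f g g' \<phi>, \<llangle>T \<Turnstile>\<^sub>1 X, f, Y, g', Z\<rrangle>,
        whl T X Y Z f g' g'' \<psi>, \<llangle>T \<Turnstile>\<^sub>1 X, f, Y, g'', Z\<rrangle>\<rrangle>"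
  using assms by (subst hcomp_cmp) (simp_all add: v_simps)

lemmas t_simps = v_simps id1_cell hcomp_obj hcomp_hom hcomp_id hcomp_assoc_obj hcomp_assoc_arr
  hcomp_unit_obj hcomp_unit_arr

end

lemma prod_twocat_simps:
  "Cell0 (prod_twocat S T) = Cell0 S \<times> Cell0 T"
  "HomC (prod_twocat S T) (X, X') (Y, Y') = prod_cat (HomC S X Y) (HomC T X' Y')"
  "Id1 (prod_twocat S T) (X, X') = (Id1 S X, Id1 T X')"
  "FO (HComp (prod_twocat S T) (X, X') (Y, Y') (Z, Z')) ((f, f'), (g, g'))
    = (FO (HComp S X Y Z) (f, g), FO (HComp T X' Y' Z') (f', g'))"
  "FA (HComp (prod_twocat S T) (X, X') (Y, Y') (Z, Z')) ((f, f'), (g, g')) ((h, h'), (k, k')) ((\<phi>, \<phi>'), (\<psi>, \<psi>'))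
    = (FA (HComp S X Y Z) (f, g) (h, k) (\<phi>, \<psi>), FA (HComp T X' Y' Z') (f', g') (h', k') (\<phi>', \<psi>'))"
  by (simp_all add: prod_twocat_def)

lemma two_category_prod:
  assumes "two_category S" "two_category T"
  shows "two_category (prod_twocat S T)"
proof -
  interpret S: two_category S by fact
  interpret T: two_category T by fact
  let ?P = "prod_twocat S T"
  have cat: "category (HomC ?P X Y)" if "X \<in> Cell0 ?P" "Y \<in> Cell0 ?P" for X Y
    using that by (auto simp: prod_twocat_simps intro!: category_prod_cat S.homc_cat T.homc_cat)
  show ?thesis
  proof (intro two_category.intro cat)
    fix X Y Z assume o: "X \<in> Cell0 ?P" "Y \<in> Cell0 ?P" "Z \<in> Cell0 ?P"
    interpret XY: category "HomC ?P X Y" using o by (simp add: cat)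
    interpret XZ: category "HomC ?P X Z" using o by (simp add: cat)
    interpret XYZ: category "prod_cat (HomC ?P X Y) (HomC ?P Y Z)"
      using o by (simp add: cat category_prod_cat)
    show "cat_functor (prod_cat (HomC ?P X Y) (HomC ?P Y Z)) (HomC ?P X Z) (HComp ?P X Y Z)"
      by unfold_locales
        (use o in \<open>auto simp: prod_twocat_simps prod_cat_simps S.t_simps T.t_simps
          S.hcomp_cmp T.hcomp_cmp\<close>)
  qed (auto simp: prod_twocat_simps prod_cat_simps fn_eq_def fn_simps S.t_simps T.t_simps)
qed

context pseudofunctor
begin

lemma p1_obj: "\<lbrakk>X \<in> Cell0 S; Y \<in> Cell0 S; f \<in> Obj (HomC S X Y)\<rbrakk>
    \<Longrightarrow> FO (P1 P X Y) f \<in> Obj (HomC T (P0 P X) (P0 P Y))"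
  using ps_functor cat_functor.fun_obj by metis

lemma p1_hom: "\<lbrakk>X \<in> Cell0 S; Y \<in> Cell0 S; f \<in> Obj (HomC S X Y); f' \<in> Obj (HomC S X Y);
      \<phi> \<in> Hom (HomC S X Y) f f'\<rbrakk>
    \<Longrightarrow> FA (P1 P X Y) f f' \<phi> \<in> Hom (HomC T (P0 P X) (P0 P Y)) (FO (P1 P X Y) f) (FO (P1 P X Y) f')"
  using ps_functor cat_functor.fun_hom by metis

lemma p1_id: "\<lbrakk>X \<in> Cell0 S; Y \<in> Cell0 S; f \<in> Obj (HomC S X Y)\<rbrakk>
    \<Longrightarrow> FA (P1 P X Y) f f (Idn (HomC S X Y) f) = Idn (HomC T (P0 P X) (P0 P Y)) (FO (P1 P X Y) f)"
  using ps_functor cat_functor.fun_id by metis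

lemma p1_cmp: "\<lbrakk>X \<in> Cell0 S; Y \<in> Cell0 S; f \<in> Obj (HomC S X Y); f' \<in> Obj (HomC S X Y);
      f'' \<in> Obj (HomC S X Y); \<phi> \<in> Hom (HomC S X Y) f f'; \<psi> \<in> Hom (HomC S X Y) f' f''\<rbrakk>
    \<Longrightarrow> FA (P1 P X Y) f f'' \<llangle>HomC S X Y \<Turnstile> f, \<phi>, f', \<psi>, f''\<rrangle>
      = \<llangle>HomC T (P0 P X) (P0 P Y) \<Turnstile> FO (P1 P X Y) f, FA (P1 P X Y) f f' \<phi>, FO (P1 P X Y) f',
          FA (P1 P X Y) f' f'' \<psi>, FO (P1 P X Y) f''\<rrangle>"
  using ps_functor cat_functor.fun_cmp by metis

lemma p1_is_iso: "\<lbrakk>X \<in> Cell0 S; Y \<in> Cell0 S; f \<in> Obj (HomC S X Y); f' \<in> Obj (HomC S X Y);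
      is_iso (HomC S X Y) f f' \<phi>\<rbrakk>
    \<Longrightarrow> is_iso (HomC T (P0 P X) (P0 P Y)) (FO (P1 P X Y) f) (FO (P1 P X Y) f') (FA (P1 P X Y) f f' \<phi>)"
  using ps_functor cat_functor.fun_is_iso by metis

lemma pcmp_is_iso:
  assumes "X \<in> Cell0 S" "Y \<in> Cell0 S" "Z \<in> Cell0 S" "f \<in> Obj (HomC S X Y)" "g \<in> Obj (HomC S Y Z)"
  shows "is_iso (HomC T (P0 P X) (P0 P Z))
    \<llangle>T \<Turnstile>\<^sub>1 P0 P X, FO (P1 P X Y) f, P0 P Y, FO (P1 P Y Z) g, P0 P Z\<rrangle>
    (FO (P1 P X Z) \<llangle>S \<Turnstile>\<^sub>1 X, f, Y, g, Z\<rrangle>) (Pcmp P X Y Z f g)"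
  using ps_cmp_nat_iso[of X Y Z] assms by (simp add: nat_iso_def fn_simps prod_cat_simps)

lemmas pcmp_hom = is_iso_hom[OF pcmp_is_iso]

lemma pcmp_hom_eq:
  assumes "X \<in> Cell0 S" "Y \<in> Cell0 S" "Z \<in> Cell0 S" "f \<in> Obj (HomC S X Y)" "g \<in> Obj (HomC S Y Z)"
    "a = \<llangle>T \<Turnstile>\<^sub>1 P0 P X, FO (P1 P X Y) f, P0 P Y, FO (P1 P Y Z) g, P0 P Z\<rrangle>"
    "b = FO (P1 P X Z) \<llangle>S \<Turnstile>\<^sub>1 X, f, Y, g, Z\<rrangle>"
  shows "Pcmp P X Y Z f g \<in> Hom (HomC T (P0 P X) (P0 P Z)) a b"
  using assms pcmp_hom by simp

lemma pcmp_nat: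
  assumes "X \<in> Cell0 S" "Y \<in> Cell0 S" "Z \<in> Cell0 S" "f \<in> Obj (HomC S X Y)" "g \<in> Obj (HomC S Y Z)"
    "f' \<in> Obj (HomC S X Y)" "g' \<in> Obj (HomC S Y Z)"
    "\<phi> \<in> Hom (HomC S X Y) f f'" "\<psi> \<in> Hom (HomC S Y Z) g g'"
  shows "\<llangle>HomC T (P0 P X) (P0 P Z) \<Turnstile>
      \<llangle>T \<Turnstile>\<^sub>1 P0 P X, FO (P1 P X Y) f, P0 P Y, FO (P1 P Y Z) g, P0 P Z\<rrangle>,
      FA (HComp T (P0 P X) (P0 P Y) (P0 P Z)) (FO (P1 P X Y) f, FO (P1 P Y Z) g)
        (FO (P1 P X Y) f', FO (P1 P Y Z) g') (FA (P1 P X Y) f f' \<phi>, FA (P1 P Y Z) g g' \<psi>),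
      \<llangle>T \<Turnstile>\<^sub>1 P0 P X, FO (P1 P X Y) f', P0 P Y, FO (P1 P Y Z) g', P0 P Z\<rrangle>,
      Pcmp P X Y Z f' g', FO (P1 P X Z) \<llangle>S \<Turnstile>\<^sub>1 X, f', Y, g', Z\<rrangle>\<rrangle>
    = \<llangle>HomC T (P0 P X) (P0 P Z) \<Turnstile>
      \<llangle>T \<Turnstile>\<^sub>1 P0 P X, FO (P1 P X Y) f, P0 P Y, FO (P1 P Y Z) g, P0 P Z\<rrangle>,
      Pcmp P X Y Z f g, FO (P1 P X Z) \<llangle>S \<Turnstile>\<^sub>1 X, f, Y, g, Z\<rrangle>,
      FA (P1 P X Z) \<llangle>S \<Turnstile>\<^sub>1 X, f, Y, g, Z\<rrangle> \<llangle>S \<Turnstile>\<^sub>1 X, f', Y, g', Z\<rrangle>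
        (FA (HComp S X Y Z) (f, g) (f', g') (\<phi>, \<psi>)), FO (P1 P X Z) \<llangle>S \<Turnstile>\<^sub>1 X, f', Y, g', Z\<rrangle>\<rrangle>"
  using ps_cmp_nat_iso[of X Y Z] assms
  by (simp add: nat_iso_def nat_trans_def fn_simps prod_cat_simps)

lemmas punit_hom = is_iso_hom[OF ps_unit_iso]

text \<open>
  In the middle of a path, a whiskered image of a 2-cell followed by a compositor can be replaced by the
  compositor followed by the image of the whiskered 2-cell. Used as rewrite rules, this lemma and the
  next collect the compositors at the front of the path.
\<close>

lemma pcmp_whr_then:
  assumes "X \<in> Cell0 S" "Y \<in> Cell0 S" "Z \<in> Cell0 S" "f \<in> Obj (HomC S X Y)" "g \<in> Obj (HomC S Y Z)"
    "f' \<in> Obj (HomC S X Y)" "\<phi> \<in> Hom (HomC S X Y) f f'"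
    "h \<in> Obj (HomC T (P0 P X) (P0 P Z))" "k \<in> Hom (HomC T (P0 P X) (P0 P Z)) (FO (P1 P X Z) \<llangle>S \<Turnstile>\<^sub>1 X, f', Y, g, Z\<rrangle>) h"
  shows "\<llangle>HomC T (P0 P X) (P0 P Z) \<Turnstile> \<llangle>T \<Turnstile>\<^sub>1 P0 P X, FO (P1 P X Y) f, P0 P Y, FO (P1 P Y Z) g, P0 P Z\<rrangle>,
      whr T (P0 P X) (P0 P Y) (P0 P Z) (FO (P1 P X Y) f) (FO (P1 P X Y) f')
        (FA (P1 P X Y) f f' \<phi>) (FO (P1 P Y Z) g),
      \<llangle>T \<Turnstile>\<^sub>1 P0 P X, FO (P1 P X Y) f', P0 P Y, FO (P1 P Y Z) g, P0 P Z\<rrangle>,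
      Pcmp P X Y Z f' g, FO (P1 P X Z) \<llangle>S \<Turnstile>\<^sub>1 X, f', Y, g, Z\<rrangle>, k, h\<rrangle>
    = \<llangle>HomC T (P0 P X) (P0 P Z) \<Turnstile> \<llangle>T \<Turnstile>\<^sub>1 P0 P X, FO (P1 P X Y) f, P0 P Y, FO (P1 P Y Z) g, P0 P Z\<rrangle>,
      Pcmp P X Y Z f g, FO (P1 P X Z) \<llangle>S \<Turnstile>\<^sub>1 X, f, Y, g, Z\<rrangle>,
      FA (P1 P X Z) \<llangle>S \<Turnstile>\<^sub>1 X, f, Y, g, Z\<rrangle> \<llangle>S \<Turnstile>\<^sub>1 X, f', Y, g, Z\<rrangle> (whr S X Y Z f f' \<phi> g), FO (P1 P X Z) \<llangle>S \<Turnstile>\<^sub>1 X, f', Y, g, Z\<rrangle>, k, h\<rrangle>"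
  using assms category.postcompose_eq[where E = h and k = k, OF T.homc_cat
      pcmp_nat[of X Y Z f g f' g \<phi> "Idn (HomC S Y Z) g"]]
  by (simp add: ps_0cell p1_obj p1_hom p1_id pcmp_hom S.t_simps T.t_simps)

lemma pcmp_whl_then:
  assumes "X \<in> Cell0 S" "Y \<in> Cell0 S" "Z \<in> Cell0 S" "f \<in> Obj (HomC S X Y)" "g \<in> Obj (HomC S Y Z)"
    "g' \<in> Obj (HomC S Y Z)" "\<phi> \<in> Hom (HomC S Y Z) g g'"
    "h \<in> Obj (HomC T (P0 P X) (P0 P Z))" "k \<in> Hom (HomC T (P0 P X) (P0 P Z)) (FO (P1 P X Z) \<llangle>S \<Turnstile>\<^sub>1 X, f, Y, g', Z\<rrangle>) h"
  shows "\<llangle>HomC T (P0 P X) (P0 P Z) \<Turnstile> \<llangle>T \<Turnstile>\<^sub>1 P0 P X, FO (P1 P X Y) f, P0 P Y, FO (P1 P Y Z) g, P0 P Z\<rrangle>,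
      whl T (P0 P X) (P0 P Y) (P0 P Z) (FO (P1 P X Y) f) (FO (P1 P Y Z) g)
        (FO (P1 P Y Z) g') (FA (P1 P Y Z) g g' \<phi>),
      \<llangle>T \<Turnstile>\<^sub>1 P0 P X, FO (P1 P X Y) f, P0 P Y, FO (P1 P Y Z) g', P0 P Z\<rrangle>,
      Pcmp P X Y Z f g', FO (P1 P X Z) \<llangle>S \<Turnstile>\<^sub>1 X, f, Y, g', Z\<rrangle>, k, h\<rrangle>
    = \<llangle>HomC T (P0 P X) (P0 P Z) \<Turnstile> \<llangle>T \<Turnstile>\<^sub>1 P0 P X, FO (P1 P X Y) f, P0 P Y, FO (P1 P Y Z) g, P0 P Z\<rrangle>,
      Pcmp P X Y Z f g, FO (P1 P X Z) \<llangle>S \<Turnstile>\<^sub>1 X, f, Y, g, Z\<rrangle>,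
      FA (P1 P X Z) \<llangle>S \<Turnstile>\<^sub>1 X, f, Y, g, Z\<rrangle> \<llangle>S \<Turnstile>\<^sub>1 X, f, Y, g', Z\<rrangle> (whl S X Y Z f g g' \<phi>), FO (P1 P X Z) \<llangle>S \<Turnstile>\<^sub>1 X, f, Y, g', Z\<rrangle>, k, h\<rrangle>"
  using assms category.postcompose_eq[where E = h and k = k, OF T.homc_cat
      pcmp_nat[of X Y Z f g f g' "Idn (HomC S X Y) f" \<phi>]]
  by (simp add: ps_0cell p1_obj p1_hom p1_id pcmp_hom S.t_simps T.t_simps)

lemmas p_assoc = ps_cmp_assoc[unfolded Let_def]
lemmas p_unit = ps_unit_left[unfolded Let_def] ps_unit_right[unfolded Let_def]

lemmas p_simps = ps_0cell p1_obj p1_hom p1_id pcmp_hom_eq punit_hom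

end

lemma ps_pair_simps:
  "P0 (ps_pair P Q) X = (P0 P X, P0 Q X)"
  "P1 (ps_pair P Q) X Y = fn_pair (P1 P X Y) (P1 Q X Y)"
  "Pcmp (ps_pair P Q) X Y Z f g = (Pcmp P X Y Z f g, Pcmp Q X Y Z f g)"
  "Punit (ps_pair P Q) X = (Punit P X, Punit Q X)"
  by (simp_all add: ps_pair_def)

lemma ps_prod_simps:
  "P0 (ps_prod P Q) (X, X') = (P0 P X, P0 Q X')"
  "P1 (ps_prod P Q) (X, X') (Y, Y') = fn_prod (P1 P X Y) (P1 Q X' Y')"
  "Pcmp (ps_prod P Q) (X, X') (Y, Y') (Z, Z') (f, f') (g, g') = (Pcmp P X Y Z f g, Pcmp Q X' Y' Z' f' g')"
  "Punit (ps_prod P Q) (X, X') = (Punit P X, Punit Q X')"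
  by (simp_all add: ps_prod_def)

lemma pseudofunctor_pair:
  assumes "pseudofunctor S T P" "pseudofunctor S T' Q"
  shows "pseudofunctor S (prod_twocat T T') (ps_pair P Q)"
proof -
  interpret P: pseudofunctor S T P by fact
  interpret Q: pseudofunctor S T' Q by fact
  note simps = ps_pair_simps prod_twocat_simps prod_cat_simps fn_simps P.p_simps Q.p_simps
    P.S.t_simps
  show ?thesis
  proof (intro pseudofunctor.intro pseudofunctor_axioms.intro two_category_prod
      P.S.two_category_axioms P.T.two_category_axioms Q.T.two_category_axioms, goal_cases)
    case (3 X Y Z)
    then show ?case
      by (intro nat_isoI) (auto simp: simps is_iso_prod_cat P.pcmp_is_iso Q.pcmp_is_iso P.pcmp_nat Q.pcmp_nat)
  qed (auto simp: simps cat_functor_pair P.ps_functor Q.ps_functor is_iso_prod_cat P.ps_unit_iso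
      Q.ps_unit_iso P.p_assoc Q.p_assoc P.p_unit Q.p_unit)
qed

lemma pseudofunctor_prod:
  assumes "pseudofunctor S T P" "pseudofunctor S' T' Q"
  shows "pseudofunctor (prod_twocat S S') (prod_twocat T T') (ps_prod P Q)"
proof -
  interpret P: pseudofunctor S T P by fact
  interpret Q: pseudofunctor S' T' Q by fact
  note simps = ps_prod_simps prod_twocat_simps prod_cat_simps fn_simps P.p_simps Q.p_simps
    P.S.t_simps Q.S.t_simps
  show ?thesis
  proof (intro pseudofunctor.intro pseudofunctor_axioms.intro two_category_prod
      P.S.two_category_axioms P.T.two_category_axioms Q.S.two_category_axioms Q.T.two_category_axioms,
      goal_cases)
    case (3 X Y Z)
    then show ?case
      by (intro nat_isoI) (auto simp: simps is_iso_prod_cat P.pcmp_is_iso Q.pcmp_is_iso P.pcmp_nat Q.pcmp_nat)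
  qed (auto simp: simps cat_functor_prod P.ps_functor Q.ps_functor is_iso_prod_cat P.ps_unit_iso
      Q.ps_unit_iso P.p_assoc Q.p_assoc P.p_unit Q.p_unit)
qed

lemma strict_psfn_simps:
  "P0 (strict_psfn T p0 p1) = p0"
  "P1 (strict_psfn T p0 p1) = p1"
  "Pcmp (strict_psfn T p0 p1) X Y Z f g
    = Idn (HomC T (p0 X) (p0 Z)) \<llangle>T \<Turnstile>\<^sub>1 p0 X, FO (p1 X Y) f, p0 Y, FO (p1 Y Z) g, p0 Z\<rrangle>"
  "Punit (strict_psfn T p0 p1) X = Idn (HomC T (p0 X) (p0 X)) (Id1 T (p0 X))"
  by (simp_all add: strict_psfn_def)

text \<open>
  This covers the identity, constant, associativity and swap pseudofunctors, whose coherence 2-cells are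
  all identities.
\<close>

lemma pseudofunctor_strict:
  assumes S: "two_category S" and T: "two_category T"
    and p0: "\<And>X. X \<in> Cell0 S \<Longrightarrow> p0 X \<in> Cell0 T"
    and p1: "\<And>X Y. X \<in> Cell0 S \<Longrightarrow> Y \<in> Cell0 S \<Longrightarrow>
      cat_functor (HomC S X Y) (HomC T (p0 X) (p0 Y)) (p1 X Y)"
    and cmp: "\<And>X Y Z. X \<in> Cell0 S \<Longrightarrow> Y \<in> Cell0 S \<Longrightarrow> Z \<in> Cell0 S \<Longrightarrow>
      fn_eq (prod_cat (HomC S X Y) (HomC S Y Z))
        (fn_comp (HComp S X Y Z) (p1 X Z))
        (fn_comp (fn_prod (p1 X Y) (p1 Y Z)) (HComp T (p0 X) (p0 Y) (p0 Z)))"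
    and unit: "\<And>X. X \<in> Cell0 S \<Longrightarrow> FO (p1 X X) (Id1 S X) = Id1 T (p0 X)"
  shows "pseudofunctor S T (strict_psfn T p0 p1)"
proof -
  interpret S: two_category S by fact
  interpret T: two_category T by fact
  have cmp_obj: "FO (p1 X Z) \<llangle>S \<Turnstile>\<^sub>1 X, f, Y, g, Z\<rrangle>
      = \<llangle>T \<Turnstile>\<^sub>1 p0 X, FO (p1 X Y) f, p0 Y, FO (p1 Y Z) g, p0 Z\<rrangle>"
    if "X \<in> Cell0 S" "Y \<in> Cell0 S" "Z \<in> Cell0 S" "f \<in> Obj (HomC S X Y)" "g \<in> Obj (HomC S Y Z)"
    for X Y Z f g
    using cmp[of X Y Z] that by (simp add: fn_eq_def fn_simps prod_cat_simps)
  have cmp_arr: "FA (p1 X Z) \<llangle>S \<Turnstile>\<^sub>1 X, f, Y, g, Z\<rrangle> \<llangle>S \<Turnstile>\<^sub>1 X, f', Y, g', Z\<rrangle>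
        (FA (HComp S X Y Z) (f, g) (f', g') (\<phi>, \<psi>))
      = FA (HComp T (p0 X) (p0 Y) (p0 Z)) (FO (p1 X Y) f, FO (p1 Y Z) g)
        (FO (p1 X Y) f', FO (p1 Y Z) g') (FA (p1 X Y) f f' \<phi>, FA (p1 Y Z) g g' \<psi>)"
    if "X \<in> Cell0 S" "Y \<in> Cell0 S" "Z \<in> Cell0 S" "f \<in> Obj (HomC S X Y)" "g \<in> Obj (HomC S Y Z)"
      "f' \<in> Obj (HomC S X Y)" "g' \<in> Obj (HomC S Y Z)"
      "\<phi> \<in> Hom (HomC S X Y) f f'" "\<psi> \<in> Hom (HomC S Y Z) g g'"
    for X Y Z f g f' g' \<phi> \<psi>
    using cmp[of X Y Z] that by (simp add: fn_eq_def fn_simps prod_cat_simps)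
  note simps = strict_psfn_simps fn_simps prod_cat_simps p0 unit S.t_simps T.t_simps cmp_obj
    cat_functor.fun_obj[OF p1] cat_functor.fun_hom[OF p1] cat_functor.fun_id[OF p1]
  show ?thesis
  proof (intro pseudofunctor.intro pseudofunctor_axioms.intro S T, goal_cases)
    case (3 X Y Z)
    then show ?case
      by (intro nat_isoI) (auto simp: simps cmp_arr intro!: category.is_iso_id[OF T.homc_cat])
  qed (auto simp: simps p1 intro!: category.is_iso_id[OF T.homc_cat])
qed

lemma pseudofunctor_id: "two_category T \<Longrightarrow> pseudofunctor T T (ps_id T)"
  unfolding ps_id_def
  by (rule pseudofunctor_strict)
     (auto simp: cat_functor_id two_category.homc_cat fn_eq_def fn_simps prod_cat_simps)

lemma pseudofunctor_const:
  assumes "two_category S" "two_category T" "J \<in> Cell0 T"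
  shows "pseudofunctor S T (ps_const T J)"
proof -
  interpret S: two_category S by fact
  interpret T: two_category T by fact
  show ?thesis
    unfolding ps_const_def
    by (rule pseudofunctor_strict)
      (auto simp: assms cat_functor_const S.homc_cat T.homc_cat fn_eq_def fn_simps prod_cat_simps
        T.t_simps)
qed

lemma pseudofunctor_assoc:
  assumes "two_category R" "two_category S" "two_category T"
  shows "pseudofunctor (prod_twocat (prod_twocat R S) T) (prod_twocat R (prod_twocat S T))
    (ps_assoc R S T)"
proof -
  interpret R: two_category R by fact
  interpret S: two_category S by fact
  interpret T: two_category T by fact
  show ?thesis
    unfolding ps_assoc_def
  proof (rule pseudofunctor_strict)
    fix X Y assume "X \<in> Cell0 (prod_twocat (prod_twocat R S) T)" "Y \<in> Cell0 (prod_twocat (prod_twocat R S) T)"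
    then show "cat_functor (HomC (prod_twocat (prod_twocat R S) T) X Y)
        (HomC (prod_twocat R (prod_twocat S T)) (case X of (xa, xb) \<Rightarrow> (case xa of (X, Y) \<Rightarrow> \<lambda>Z. (X, Y, Z)) xb)
         (case Y of (xa, xb) \<Rightarrow> (case xa of (X, Y) \<Rightarrow> \<lambda>Z. (X, Y, Z)) xb)) fn_assoc"
      by (auto simp: cat_functor_def cat_functor_axioms_def category_prod_cat R.homc_cat S.homc_cat
          T.homc_cat fn_simps prod_cat_simps prod_twocat_simps)
  qed (auto simp: assms two_category_prod fn_eq_def fn_simps prod_cat_simps prod_twocat_simps)
qed

lemma pseudofunctor_swap:
  assumes "two_category S" "two_category T"
  shows "pseudofunctor (prod_twocat S T) (prod_twocat T S) (ps_swap S T)"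
proof -
  interpret S: two_category S by fact
  interpret T: two_category T by fact
  show ?thesis
    unfolding ps_swap_def
  proof (rule pseudofunctor_strict)
    fix X Y assume "X \<in> Cell0 (prod_twocat S T)" "Y \<in> Cell0 (prod_twocat S T)"
    then show "cat_functor (HomC (prod_twocat S T) X Y)
        (HomC (prod_twocat T S) (case X of (X, Y) \<Rightarrow> (Y, X)) (case Y of (X, Y) \<Rightarrow> (Y, X))) fn_swap"
      by (auto simp: cat_functor_def cat_functor_axioms_def category_prod_cat S.homc_cat
          T.homc_cat fn_simps prod_cat_simps prod_twocat_simps)
  qed (auto simp: assms two_category_prod fn_eq_def fn_simps prod_cat_simps prod_twocat_simps)
qed

lemma ps_comp_simps:
  "P0 (ps_comp R S T P Q) X = P0 Q (P0 P X)"
  "P1 (ps_comp R S T P Q) X Y = fn_comp (P1 P X Y) (P1 Q (P0 P X) (P0 P Y))"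
  "Pcmp (ps_comp R S T P Q) X Y Z f g =
    (let X' = P0 P X; Y' = P0 P Y; Z' = P0 P Z; f' = FO (P1 P X Y) f; g' = FO (P1 P Y Z) g;
         f'g' = \<llangle>S \<Turnstile>\<^sub>1 X', f', Y', g', Z'\<rrangle>; fg' = FO (P1 P X Z) \<llangle>R \<Turnstile>\<^sub>1 X, f, Y, g, Z\<rrangle>
     in \<llangle>HomC T (P0 Q X') (P0 Q Z') \<Turnstile>
          \<llangle>T \<Turnstile>\<^sub>1 P0 Q X', FO (P1 Q X' Y') f', P0 Q Y', FO (P1 Q Y' Z') g', P0 Q Z'\<rrangle>,
          Pcmp Q X' Y' Z' f' g', FO (P1 Q X' Z') f'g',
          FA (P1 Q X' Z') f'g' fg' (Pcmp P X Y Z f g), FO (P1 Q X' Z') fg'\<rrangle>)"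
  "Punit (ps_comp R S T P Q) X = (let X' = P0 P X; i' = FO (P1 P X X) (Id1 R X)
     in \<llangle>HomC T (P0 Q X') (P0 Q X') \<Turnstile> Id1 T (P0 Q X'), Punit Q X', FO (P1 Q X' X') (Id1 S X'),
          FA (P1 Q X' X') (Id1 S X') i' (Punit P X), FO (P1 Q X' X') i'\<rrangle>)"
  by (simp_all add: ps_comp_def)

locale composable_pseudofunctors = P: pseudofunctor R S P + Q: pseudofunctor S T Q
  for R :: "('o1, 'c1, 'd1, 'x) twocat_scheme" and S :: "('o2, 'c2, 'd2, 'y) twocat_scheme"
    and T :: "('o3, 'c3, 'd3, 'z) twocat_scheme"
    and P :: "('o1, 'c1, 'd1, 'o2, 'c2, 'd2, 'v) psfn_scheme"
    and Q :: "('o2, 'c2, 'd2, 'o3, 'c3, 'd3, 'w) psfn_scheme"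
begin

abbreviation PQ where "PQ \<equiv> ps_comp R S T P Q"

lemmas pq_simps = P.p_simps Q.p_simps P.S.t_simps P.T.t_simps Q.T.t_simps fn_simps prod_cat_simps
    ps_comp_simps

lemma category_pq: "X \<in> Cell0 R \<Longrightarrow> Y \<in> Cell0 R \<Longrightarrow>
    category (HomC T (P0 Q (P0 P X)) (P0 Q (P0 P Y)))"
  by (simp add: Q.T.homc_cat P.ps_0cell Q.ps_0cell)

text \<open>
  The compositor of a composite is the compositor of \<open>Q\<close> followed by the image under \<open>Q\<close> of that of \<open>P\<close>.
  Naturality of the compositor of \<open>Q\<close> collects the images of the compositors of \<open>P\<close> at the end of the
  path. There the law for \<open>P\<close> applies, and the law for \<open>Q\<close> applies to what precedes them. The unit laws
  below are proved in the same way.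
\<close>

lemma pq_assoc:
  assumes o: "W \<in> Cell0 R" "X \<in> Cell0 R" "Y \<in> Cell0 R" "Z \<in> Cell0 R"
    "f \<in> Obj (HomC R W X)" "g \<in> Obj (HomC R X Y)" "h \<in> Obj (HomC R Y Z)"
  shows "let W' = P0 PQ W; X' = P0 PQ X;
        Y' = P0 PQ Y; Z' = P0 PQ Z;
        f' = FO (P1 PQ W X) f; g' = FO (P1 PQ X Y) g; h' = FO (P1 PQ Y Z) h;
           fg = \<llangle>R \<Turnstile>\<^sub>1 W, f, X, g, Y\<rrangle>; gh = \<llangle>R \<Turnstile>\<^sub>1 X, g, Y, h, Z\<rrangle>;
           fg' = FO (P1 PQ W Y) fg; gh' = FO (P1 PQ X Z) gh;
           fgh' = FO (P1 PQ W Z) \<llangle>R \<Turnstile>\<^sub>1 W, f, X, g, Y, h, Z\<rrangle>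
       in \<llangle>HomC T W' Z' \<Turnstile>
            \<llangle>T \<Turnstile>\<^sub>1 W', f', X', g', Y', h', Z'\<rrangle>,
            whr T W' Y' Z' \<llangle>T \<Turnstile>\<^sub>1 W', f', X', g', Y'\<rrangle> fg' (Pcmp PQ W X Y f g) h',
            \<llangle>T \<Turnstile>\<^sub>1 W', fg', Y', h', Z'\<rrangle>,
            Pcmp PQ W Y Z fg h,
            fgh'\<rrangle>
        = \<llangle>HomC T W' Z' \<Turnstile>
            \<llangle>T \<Turnstile>\<^sub>1 W', f', X', g', Y', h', Z'\<rrangle>,
            whl T W' X' Z' f' \<llangle>T \<Turnstile>\<^sub>1 X', g', Y', h', Z'\<rrangle> gh' (Pcmp PQ X Y Z g h),
            \<llangle>T \<Turnstile>\<^sub>1 W', f', X', gh', Z'\<rrangle>,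
            Pcmp PQ W X Z f gh,
            fgh'\<rrangle>"
proof -
  let ?W = "P0 P W" and ?X = "P0 P X" and ?Y = "P0 P Y" and ?Z = "P0 P Z"
  let ?H = "HomC T (P0 Q ?W) (P0 Q ?Z)"
  let ?f = "FO (P1 P W X) f" and ?g = "FO (P1 P X Y) g" and ?h = "FO (P1 P Y Z) h"
  let ?fg = "\<llangle>S \<Turnstile>\<^sub>1 ?W, ?f, ?X, ?g, ?Y\<rrangle>" and ?gh = "\<llangle>S \<Turnstile>\<^sub>1 ?X, ?g, ?Y, ?h, ?Z\<rrangle>"
  let ?pfg = "FO (P1 P W Y) \<llangle>R \<Turnstile>\<^sub>1 W, f, X, g, Y\<rrangle>" and ?pgh = "FO (P1 P X Z) \<llangle>R \<Turnstile>\<^sub>1 X, g, Y, h, Z\<rrangle>"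
  let ?qf = "FO (P1 Q ?W ?X) ?f" and ?qg = "FO (P1 Q ?X ?Y) ?g" and ?qh = "FO (P1 Q ?Y ?Z) ?h"
  let ?pfgh = "FO (P1 P W Z) \<llangle>R \<Turnstile>\<^sub>1 W, f, X, g, Y, h, Z\<rrangle>"
  let ?src = "\<llangle>T \<Turnstile>\<^sub>1 P0 Q ?W, ?qf, P0 Q ?X, ?qg, P0 Q ?Y, ?qh, P0 Q ?Z\<rrangle>"
    and ?tgt = "FO (P1 Q ?W ?Z) ?pfgh"
  let ?s = "\<llangle>S \<Turnstile>\<^sub>1 ?W, ?f, ?X, ?g, ?Y, ?h, ?Z\<rrangle>"
  let ?p' = "\<llangle>HomC S ?W ?Z \<Turnstile> ?s, whl S ?W ?X ?Z ?f ?gh ?pgh (Pcmp P X Y Z g h),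
      \<llangle>S \<Turnstile>\<^sub>1 ?W, ?f, ?X, ?pgh, ?Z\<rrangle>, Pcmp P W X Z f \<llangle>R \<Turnstile>\<^sub>1 X, g, Y, h, Z\<rrangle>, ?pfgh\<rrangle>"
  let ?A = "whr T (P0 Q ?W) (P0 Q ?Y) (P0 Q ?Z) \<llangle>T \<Turnstile>\<^sub>1 P0 Q ?W, ?qf, P0 Q ?X, ?qg, P0 Q ?Y\<rrangle>
    (FO (P1 Q ?W ?Y) ?fg) (Pcmp Q ?W ?X ?Y ?f ?g) ?qh"
  let ?A' = "whl T (P0 Q ?W) (P0 Q ?X) (P0 Q ?Z) ?qf \<llangle>T \<Turnstile>\<^sub>1 P0 Q ?X, ?qg, P0 Q ?Y, ?qh, P0 Q ?Z\<rrangle>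
    (FO (P1 Q ?X ?Z) ?gh) (Pcmp Q ?X ?Y ?Z ?g ?h)"
  note simps = o pq_simps Q.T.whr_cmp Q.T.whl_cmp Q.pcmp_whr_then Q.pcmp_whl_then Q.p1_cmp Let_def
  have "FA (P1 Q ?W ?Z) ?s ?pfgh \<llangle>HomC S ?W ?Z \<Turnstile> ?s, whr S ?W ?Y ?Z ?fg ?pfg (Pcmp P W X Y f g) ?h,
        \<llangle>S \<Turnstile>\<^sub>1 ?W, ?pfg, ?Y, ?h, ?Z\<rrangle>, Pcmp P W Y Z \<llangle>R \<Turnstile>\<^sub>1 W, f, X, g, Y\<rrangle> h, ?pfgh\<rrangle>
      = FA (P1 Q ?W ?Z) ?s ?pfgh ?p'"
    using P.p_assoc[OF o] by simp
  moreover have "\<llangle>?H \<Turnstile> ?src, ?A, \<llangle>T \<Turnstile>\<^sub>1 P0 Q ?W, FO (P1 Q ?W ?Y) ?fg, P0 Q ?Y, ?qh, P0 Q ?Z\<rrangle>,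
      Pcmp Q ?W ?Y ?Z ?fg ?h, FO (P1 Q ?W ?Z) ?s, FA (P1 Q ?W ?Z) ?s ?pfgh ?p', ?tgt\<rrangle>
    = \<llangle>?H \<Turnstile> ?src, ?A', \<llangle>T \<Turnstile>\<^sub>1 P0 Q ?W, ?qf, P0 Q ?X, FO (P1 Q ?X ?Z) ?gh, P0 Q ?Z\<rrangle>,
      Pcmp Q ?W ?X ?Z ?f ?gh, FO (P1 Q ?W ?Z) ?s, FA (P1 Q ?W ?Z) ?s ?pfgh ?p', ?tgt\<rrangle>"
    by (rule category.postcompose_eq[OF category_pq Q.p_assoc]) (simp_all add: o pq_simps)
  ultimately show ?thesis by (simp add: simps)
qed

lemma pq_unit_left:
  assumes o: "X \<in> Cell0 R" "Y \<in> Cell0 R" "f \<in> Obj (HomC R X Y)"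
  shows "let X' = P0 PQ X; Y' = P0 PQ Y;
        f' = FO (P1 PQ X Y) f; i' = FO (P1 PQ X X) (Id1 R X)
       in \<llangle>HomC T X' Y' \<Turnstile> f', whr T X' X' Y' (Id1 T X') i' (Punit PQ X) f',
            \<llangle>T \<Turnstile>\<^sub>1 X', i', X', f', Y'\<rrangle>, Pcmp PQ X X Y (Id1 R X) f, f'\<rrangle> = Idn (HomC T X' Y') f'"
proof -
  have "FA (P1 Q (P0 P X) (P0 P Y)) (FO (P1 P X Y) f) (FO (P1 P X Y) f) (\<llangle>HomC S (P0 P X) (P0 P Y) \<Turnstile> FO (P1 P X Y) f,
        whr S (P0 P X) (P0 P X) (P0 P Y) (Id1 S (P0 P X)) (FO (P1 P X X) (Id1 R X)) (Punit P X) (FO (P1 P X Y) f),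
        \<llangle>S \<Turnstile>\<^sub>1 P0 P X, FO (P1 P X X) (Id1 R X), P0 P X, FO (P1 P X Y) f, P0 P Y\<rrangle>,
        Pcmp P X X Y (Id1 R X) f, FO (P1 P X Y) f\<rrangle>)
      = FA (P1 Q (P0 P X) (P0 P Y)) (FO (P1 P X Y) f) (FO (P1 P X Y) f)
        (Idn (HomC S (P0 P X) (P0 P Y)) (FO (P1 P X Y) f))"
    using P.p_unit(1)[OF o] by simp
  then show ?thesis
    using Q.p_unit(1)[of "P0 P X" "P0 P Y" "FO (P1 P X Y) f"]
    by (simp add: o pq_simps Q.T.whr_cmp Q.T.whl_cmp Q.pcmp_whr_then Q.pcmp_whl_then Q.p1_cmp Let_def)
qed

lemma pq_unit_right:
  assumes o: "X \<in> Cell0 R" "Y \<in> Cell0 R" "f \<in> Obj (HomC R X Y)"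
  shows "let X' = P0 PQ X; Y' = P0 PQ Y;
        f' = FO (P1 PQ X Y) f; i' = FO (P1 PQ Y Y) (Id1 R Y)
       in \<llangle>HomC T X' Y' \<Turnstile> f', whl T X' Y' Y' f' (Id1 T Y') i' (Punit PQ Y),
            \<llangle>T \<Turnstile>\<^sub>1 X', f', Y', i', Y'\<rrangle>, Pcmp PQ X Y Y f (Id1 R Y), f'\<rrangle> = Idn (HomC T X' Y') f'"
proof -
  have "FA (P1 Q (P0 P X) (P0 P Y)) (FO (P1 P X Y) f) (FO (P1 P X Y) f) (\<llangle>HomC S (P0 P X) (P0 P Y) \<Turnstile> FO (P1 P X Y) f,
        whl S (P0 P X) (P0 P Y) (P0 P Y) (FO (P1 P X Y) f) (Id1 S (P0 P Y)) (FO (P1 P Y Y) (Id1 R Y)) (Punit P Y),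
        \<llangle>S \<Turnstile>\<^sub>1 P0 P X, FO (P1 P X Y) f, P0 P Y, FO (P1 P Y Y) (Id1 R Y), P0 P Y\<rrangle>,
        Pcmp P X Y Y f (Id1 R Y), FO (P1 P X Y) f\<rrangle>)
      = FA (P1 Q (P0 P X) (P0 P Y)) (FO (P1 P X Y) f) (FO (P1 P X Y) f)
        (Idn (HomC S (P0 P X) (P0 P Y)) (FO (P1 P X Y) f))"
    using P.p_unit(2)[OF o] by simp
  then show ?thesis
    using Q.p_unit(2)[of "P0 P X" "P0 P Y" "FO (P1 P X Y) f"]
    by (simp add: o pq_simps Q.T.whr_cmp Q.T.whl_cmp Q.pcmp_whr_then Q.pcmp_whl_then Q.p1_cmp Let_def)
qed

lemma pseudofunctor_pq: "pseudofunctor R T PQ"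
proof (intro pseudofunctor.intro pseudofunctor_axioms.intro P.S.two_category_axioms
    Q.T.two_category_axioms, goal_cases)
  case (1 X)
  then show ?case by (simp add: ps_comp_simps P.ps_0cell Q.ps_0cell)
next
  case (2 X Y)
  then show ?case
    using cat_functor_comp[OF P.ps_functor Q.ps_functor] by (simp add: ps_comp_simps P.ps_0cell)
next
  \<comment> \<open>compositors: invertibility and naturality\<close>
  case o: (3 X Y Z)
  let ?X = "P0 P X" and ?Y = "P0 P Y" and ?Z = "P0 P Z"
  show ?case
  proof (rule nat_isoI, goal_cases)
    case (1 x)
    obtain f g where h: "x = (f, g)" by (metis surj_pair)
    show ?case
      using 1 o unfolding h case_prod_conv fn_simps ps_comp_simps Let_def
      by (intro category.is_iso_cmp[OF category_pq] Q.pcmp_is_iso Q.p1_is_iso P.pcmp_is_iso)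
         (simp_all add: pq_simps)
  next
    case (2 x x' \<xi>)
    obtain f g f' g' \<phi> \<psi> where h: "x = (f, g)" "x' = (f', g')" "\<xi> = (\<phi>, \<psi>)"
      by (metis surj_pair)
    note x = 2[unfolded h prod_cat_simps mem_Times_iff fst_conv snd_conv]
    show ?case
      using x category.postcompose_eq[where E = "FO (P1 Q ?X ?Z) (FO (P1 P X Z) \<llangle>R \<Turnstile>\<^sub>1 X, f', Y, g', Z\<rrangle>)"
          and k = "FA (P1 Q ?X ?Z) \<llangle>S \<Turnstile>\<^sub>1 ?X, FO (P1 P X Y) f', ?Y, FO (P1 P Y Z) g', ?Z\<rrangle>
            (FO (P1 P X Z) \<llangle>R \<Turnstile>\<^sub>1 X, f', Y, g', Z\<rrangle>) (Pcmp P X Y Z f' g')",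
          OF category_pq Q.pcmp_nat[of ?X ?Y ?Z "FO (P1 P X Y) f" "FO (P1 P Y Z) g" "FO (P1 P X Y) f'"
            "FO (P1 P Y Z) g'" "FA (P1 P X Y) f f' \<phi>" "FA (P1 P Y Z) g g' \<psi>"]]
      by (simp add: h o pq_simps Q.p1_cmp[symmetric] P.pcmp_nat Let_def)
  qed
next
  \<comment> \<open>unitors\<close>
  case o: (4 X)
  then show ?case
    unfolding ps_comp_simps Let_def fn_simps
    by (intro category.is_iso_cmp[OF category_pq] Q.ps_unit_iso Q.p1_is_iso P.ps_unit_iso)
       (simp_all add: pq_simps)
qed (rule pq_assoc pq_unit_left pq_unit_right; assumption)+

end

lemma pseudofunctor_comp:
  "pseudofunctor R S P \<Longrightarrow> pseudofunctor S T Q \<Longrightarrow> pseudofunctor R T (ps_comp R S T P Q)"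
  by (simp add: composable_pseudofunctors.pseudofunctor_pq composable_pseudofunctors.intro)

section \<open>Coherence of the interchange map over strict objects\<close>

locale strict_symmetric_subcategory = strict_subcategory K U + K: symmetric_monoidal_category K
  for K :: "('o, 'a, 'x) sym_mon_cat_scheme" and U :: "'o set"
begin

text \<open>
  Left and right whiskering. A map that permutes the factors of a product of objects of \<open>U\<close> is a composite
  of whiskered symmetries, and over \<open>U\<close> whiskerings compose without associators. Two such maps are
  compared by splitting their symmetries into swaps of single factors; what is left is the exchange of
  swaps that act on disjoint factors.
\<close>

definition lw :: "'o \<Rightarrow> 'o \<Rightarrow> 'o \<Rightarrow> 'a \<Rightarrow> 'a" where
  "lw P A B f = \<llangle>K \<Turnstile> P, Idn K P, P \<otimes> A, f, B\<rrangle>"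

definition rw :: "'o \<Rightarrow> 'o \<Rightarrow> 'a \<Rightarrow> 'o \<Rightarrow> 'a" where
  "rw A B f Q = \<llangle>K \<Turnstile> A, f, B \<otimes> Q, Idn K Q, Q\<rrangle>"

lemma lw_hom: "\<lbrakk>P \<in> U; A \<in> U; B \<in> U; f \<in> Hom K A B; X = P \<cdot> A; Y = P \<cdot> B\<rbrakk> \<Longrightarrow> lw P A B f \<in> Hom K X Y"
  by (simp add: lw_def mon_simps strict_obj)

lemma rw_hom: "\<lbrakk>Q \<in> U; A \<in> U; B \<in> U; f \<in> Hom K A B; X = A \<cdot> Q; Y = B \<cdot> Q\<rbrakk> \<Longrightarrow> rw A B f Q \<in> Hom K X Y"
  by (simp add: rw_def mon_simps strict_obj)

lemma lw_cmp: "\<lbrakk>P \<in> U; A \<in> U; B \<in> U; D \<in> U; f \<in> Hom K A B; g \<in> Hom K B D\<rbrakk>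
    \<Longrightarrow> lw P A D \<llangle>K \<Turnstile> A, f, B, g, D\<rrangle>
      = \<llangle>K \<Turnstile> P \<cdot> A, lw P A B f, P \<cdot> B, lw P B D g, P \<cdot> D\<rrangle>"
  by (simp add: lw_def mon_simps strict_obj tensor_cmp)

lemma rw_cmp: "\<lbrakk>Q \<in> U; A \<in> U; B \<in> U; D \<in> U; f \<in> Hom K A B; g \<in> Hom K B D\<rbrakk>
    \<Longrightarrow> rw A D \<llangle>K \<Turnstile> A, f, B, g, D\<rrangle> Q
      = \<llangle>K \<Turnstile> A \<cdot> Q, rw A B f Q, B \<cdot> Q, rw B D g Q, D \<cdot> Q\<rrangle>"
  by (simp add: rw_def mon_simps strict_obj tensor_cmp)

lemma lw_lw:
  assumes "P \<in> U" "Q \<in> U" "A \<in> U" "B \<in> U" "f \<in> Hom K A B" "A' = Q \<cdot> A" "B' = Q \<cdot> B"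
  shows "lw P A' B' (lw Q A B f) = lw (P \<cdot> Q) A B f"
  using strict_arr_assoc[of P Q A P Q B "Idn K P" "Idn K Q" f] assms
  by (simp add: lw_def mon_simps strict_obj)

lemma rw_rw:
  assumes "P \<in> U" "Q \<in> U" "A \<in> U" "B \<in> U" "f \<in> Hom K A B" "A' = A \<cdot> P" "B' = B \<cdot> P"
  shows "rw A' B' (rw A B f P) Q = rw A B f (P \<cdot> Q)"
  using strict_arr_assoc[of A P Q B P Q f "Idn K P" "Idn K Q"] assms
  by (simp add: rw_def mon_simps strict_obj)

lemma rw_lw:
  assumes "P \<in> U" "Q \<in> U" "A \<in> U" "B \<in> U" "f \<in> Hom K A B" "A' = P \<cdot> A" "B' = P \<cdot> B"
  shows "rw A' B' (lw P A B f) Q = lw P (A \<cdot> Q) (B \<cdot> Q) (rw A B f Q)"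
  using strict_arr_assoc[of P A Q P B Q "Idn K P" f "Idn K Q"] assms
  by (simp add: rw_def lw_def mon_simps strict_obj)

lemma lw_id: "P \<in> U \<Longrightarrow> A \<in> U \<Longrightarrow> lw P A A (Idn K A) = Idn K (P \<cdot> A)"
  and rw_id: "P \<in> U \<Longrightarrow> A \<in> U \<Longrightarrow> rw A A (Idn K A) P = Idn K (A \<cdot> P)"
  by (simp_all add: lw_def rw_def mon_simps strict_obj)

lemma whisker_unit:
  "A \<in> U \<Longrightarrow> B \<in> U \<Longrightarrow> f \<in> Hom K A B \<Longrightarrow> lw (Unt K) A B f = f"
  "A \<in> U \<Longrightarrow> B \<in> U \<Longrightarrow> f \<in> Hom K A B \<Longrightarrow> rw A B f (Unt K) = f"
  by (simp_all add: lw_def rw_def strict_arr_unit_left strict_arr_unit_right)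

lemma whisker_exchange:
  assumes "A \<in> U" "B \<in> U" "A' \<in> U" "B' \<in> U" "f \<in> Hom K A B" "g \<in> Hom K A' B'"
  shows "\<llangle>K \<Turnstile> A \<cdot> A', rw A B f A', B \<cdot> A', lw B A' B' g, B \<cdot> B'\<rrangle>
    = \<llangle>K \<Turnstile> A \<cdot> A', lw A A' B' g, A \<cdot> B', rw A B f B', B \<cdot> B'\<rrangle>"
  using assms by (simp add: lw_def rw_def mon_simps strict_obj tensor_cmp)

lemma whisker_exchange_under:
  assumes u: "X \<in> U" "A \<in> U" "B \<in> U" "A' \<in> U" "B' \<in> U" and h: "f \<in> Hom K A B" "g \<in> Hom K A' B'"
  shows "\<llangle>K \<Turnstile> X \<cdot> A \<cdot> A', lw X (A \<cdot> A') (B \<cdot> A') (rw A B f A'), X \<cdot> B \<cdot> A',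
      lw (X \<cdot> B) A' B' g, X \<cdot> B \<cdot> B'\<rrangle>
    = \<llangle>K \<Turnstile> X \<cdot> A \<cdot> A', lw (X \<cdot> A) A' B' g, X \<cdot> A \<cdot> B',
      lw X (A \<cdot> B') (B \<cdot> B') (rw A B f B'), X \<cdot> B \<cdot> B'\<rrangle>"
proof -
  have "lw X (A \<cdot> A') (B \<cdot> B')
        \<llangle>K \<Turnstile> A \<cdot> A', rw A B f A', B \<cdot> A', lw B A' B' g, B \<cdot> B'\<rrangle>
      = lw X (A \<cdot> A') (B \<cdot> B')
        \<llangle>K \<Turnstile> A \<cdot> A', lw A A' B' g, A \<cdot> B', rw A B f B', B \<cdot> B'\<rrangle>"
    by (simp only: whisker_exchange[OF u(2-5) h])
  then show ?thesis
    using u h by (simp add: lw_cmp lw_lw lw_hom rw_hom strict_tensor)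
qed

lemma whisker_exchange_under_then:
  assumes u: "X \<in> U" "A \<in> U" "B \<in> U" "A' \<in> U" "B' \<in> U" "D \<in> U"
    and h: "f \<in> Hom K A B" "g \<in> Hom K A' B'" "k \<in> Hom K (X \<cdot> B \<cdot> B') D"
  shows "\<llangle>K \<Turnstile> X \<cdot> A \<cdot> A', lw X (A \<cdot> A') (B \<cdot> A') (rw A B f A'), X \<cdot> B \<cdot> A',
      lw (X \<cdot> B) A' B' g, X \<cdot> B \<cdot> B', k, D\<rrangle>
    = \<llangle>K \<Turnstile> X \<cdot> A \<cdot> A', lw (X \<cdot> A) A' B' g, X \<cdot> A \<cdot> B',
      lw X (A \<cdot> B') (B \<cdot> B') (rw A B f B'), X \<cdot> B \<cdot> B', k, D\<rrangle>"
  by (rule postcompose_eq[OF whisker_exchange_under])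
     (simp_all add: u h strict_objs lw_hom rw_hom)

lemma lw_inverse:
  assumes "P \<in> U" "A \<in> U" "B \<in> U" "f \<in> Hom K A B" "g \<in> Hom K B A"
    "\<llangle>K \<Turnstile> A, f, B, g, A\<rrangle> = Idn K A"
  shows "\<llangle>K \<Turnstile> P \<cdot> A, lw P A B f, P \<cdot> B, lw P B A g, P \<cdot> A\<rrangle> = Idn K (P \<cdot> A)"
  using assms by (simp add: lw_cmp[symmetric] lw_id)

lemma rw_inverse:
  assumes "Q \<in> U" "A \<in> U" "B \<in> U" "f \<in> Hom K A B" "g \<in> Hom K B A"
    "\<llangle>K \<Turnstile> A, f, B, g, A\<rrangle> = Idn K A"
  shows "\<llangle>K \<Turnstile> A \<cdot> Q, rw A B f Q, B \<cdot> Q, rw B A g Q, A \<cdot> Q\<rrangle> = Idn K (A \<cdot> Q)"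
  using assms by (simp add: rw_cmp[symmetric] rw_id)

lemma cancel_then:
  assumes "\<llangle>K \<Turnstile> A, f, B, g, A\<rrangle> = Idn K A" "A \<in> U" "B \<in> U" "D \<in> U"
    "f \<in> Hom K A B" "g \<in> Hom K B A" "k \<in> Hom K A D"
  shows "\<llangle>K \<Turnstile> A, f, B, g, A, k, D\<rrangle> = k"
  using assms cmp_assoc[of A B A D f g k] by (simp add: strict_obj id_left)

lemma sym_hom_eq: "\<lbrakk>P \<in> U; Q \<in> U; X = P \<cdot> Q; Y = Q \<cdot> P\<rbrakk> \<Longrightarrow> Sym K P Q \<in> Hom K X Y"
  by (simp add: K.sym_hom strict_obj)

abbreviation sw :: "'o \<Rightarrow> 'o \<Rightarrow> 'o \<Rightarrow> 'a" where
  "sw P Q R \<equiv> rw (P \<cdot> Q) (Q \<cdot> P) (Sym K P Q) R"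

lemma strict_sym_tensor_right:
  assumes "P \<in> U" "Q \<in> U" "R \<in> U"
  shows "Sym K P (Q \<cdot> R)
    = \<llangle>K \<Turnstile> P \<cdot> Q \<cdot> R, sw P Q R, Q \<cdot> P \<cdot> R,
        lw Q (P \<cdot> R) (R \<cdot> P) (Sym K P R), Q \<cdot> R \<cdot> P\<rrangle>"
  using K.hexagon[of P Q R] assms
  by (simp add: strict_asc strict_objs mon_simps sym_hom_eq lw_hom rw_hom
      lw_def[symmetric] rw_def[symmetric])

lemma strict_sym_inverse:
  assumes "P \<in> U" "Q \<in> U"
  shows "\<llangle>K \<Turnstile> P \<cdot> Q, Sym K P Q, Q \<cdot> P, Sym K Q P, P \<cdot> Q\<rrangle> = Idn K (P \<cdot> Q)"
  using assms by (simp add: K.sym_sym strict_obj)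

lemma strict_sym_unit:
  assumes "P \<in> U"
  shows "Sym K P (Unt K) = Idn K P" "Sym K (Unt K) P = Idn K P"
proof -
  show 1: "Sym K P (Unt K) = Idn K P"
    using K.sym_unit[of P] assms by (simp add: strict_run strict_lun strict_objs mon_simps sym_hom_eq)
  show "Sym K (Unt K) P = Idn K P"
    using strict_sym_inverse[of P "Unt K"] 1 assms
    by (simp add: strict_objs mon_simps sym_hom_eq)
qed

lemmas strict_simps = strict_objs cat_simps sym_hom_eq lw_hom rw_hom lw_cmp rw_cmp lw_lw rw_rw rw_lw
  lw_id rw_id

text \<open>The second hexagon arises from the first by inverting all symmetries.\<close>

lemma strict_sym_tensor_left:
  assumes "P \<in> U" "Q \<in> U" "R \<in> U"
  shows "Sym K (P \<cdot> Q) R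
    = \<llangle>K \<Turnstile> P \<cdot> Q \<cdot> R, lw P (Q \<cdot> R) (R \<cdot> Q) (Sym K Q R), P \<cdot> R \<cdot> Q,
        sw P R Q, R \<cdot> P \<cdot> Q\<rrangle>" (is "_ = ?s")
proof -
  let ?D = "P \<cdot> Q \<cdot> R" and ?E = "R \<cdot> P \<cdot> Q"
  have l: "\<llangle>K \<Turnstile> P \<cdot> R \<cdot> Q, lw P (R \<cdot> Q) (Q \<cdot> R) (Sym K R Q), ?D,
      lw P (Q \<cdot> R) (R \<cdot> Q) (Sym K Q R), P \<cdot> R \<cdot> Q,
      sw P R Q, ?E\<rrangle>
    = sw P R Q"
    using assms by (intro cancel_then lw_inverse) (simp_all add: strict_simps strict_sym_inverse)
  have r: "\<llangle>K \<Turnstile> ?E, sw R P Q, P \<cdot> R \<cdot> Q,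
      sw P R Q, ?E\<rrangle> = Idn K ?E"
    using rw_inverse[of Q "R \<cdot> P" "P \<cdot> R" "Sym K R P" "Sym K P R"] assms
    by (simp add: strict_simps strict_sym_inverse)
  have "\<llangle>K \<Turnstile> ?E, Sym K R (P \<cdot> Q), ?D, ?s, ?E\<rrangle> = Idn K ?E"
    using l r assms strict_sym_tensor_right[of R P Q] by (simp add: strict_simps)
  moreover have "\<llangle>K \<Turnstile> ?D, Sym K (P \<cdot> Q) R, ?E, Sym K R (P \<cdot> Q), ?D, ?s, ?E\<rrangle> = ?s"
    using strict_sym_inverse[of "P \<cdot> Q" R] assms
    by (intro cancel_then) (simp_all add: strict_simps)
  ultimately show ?thesis
    using assms by (simp add: strict_simps)
qed

lemma strict_interchange:
  assumes "X1 \<in> U" "X2 \<in> U" "Y1 \<in> U" "Y2 \<in> U"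
  shows "interchange K X1 X2 Y1 Y2
    = lw X1 (X2 \<cdot> Y1 \<cdot> Y2) (Y1 \<cdot> X2 \<cdot> Y2)
        (sw X2 Y1 Y2)"
  using assms
  by (simp add: interchange_def strict_asc inv_arr_id strict_simps tensor_obj
      lw_def[symmetric] rw_def[symmetric])

lemma interchange_hom:
  assumes "X1 \<in> U" "X2 \<in> U" "Y1 \<in> U" "Y2 \<in> U"
    "D = (X1 \<cdot> X2) \<cdot> Y1 \<cdot> Y2" "E = (X1 \<cdot> Y1) \<cdot> X2 \<cdot> Y2"
  shows "interchange K X1 X2 Y1 Y2 \<in> Hom K D E"
  using assms by (simp add: strict_interchange strict_simps)

lemma interchange_inverse:
  assumes "X1 \<in> U" "X2 \<in> U" "Y1 \<in> U" "Y2 \<in> U"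
  shows "inverse_arrows K ((X1 \<cdot> X2) \<cdot> Y1 \<cdot> Y2) ((X1 \<cdot> Y1) \<cdot> X2 \<cdot> Y2)
    (interchange K X1 X2 Y1 Y2) (interchange K X1 Y1 X2 Y2)"
proof -
  have "\<llangle>K \<Turnstile> X1 \<cdot> A \<cdot> B \<cdot> Y2,
      lw X1 (A \<cdot> B \<cdot> Y2) (B \<cdot> A \<cdot> Y2) (sw A B Y2),
      X1 \<cdot> B \<cdot> A \<cdot> Y2,
      lw X1 (B \<cdot> A \<cdot> Y2) (A \<cdot> B \<cdot> Y2) (sw B A Y2),
      X1 \<cdot> A \<cdot> B \<cdot> Y2\<rrangle> = Idn K (X1 \<cdot> A \<cdot> B \<cdot> Y2)"
    if "A \<in> U" "B \<in> U" for A B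
    using that assms
      rw_cmp[of Y2 "A \<cdot> B" "B \<cdot> A" "A \<cdot> B" "Sym K A B" "Sym K B A", symmetric]
    by (simp add: strict_objs sym_hom_eq lw_hom rw_hom strict_sym_inverse lw_id rw_id
        lw_cmp[symmetric])
  then show ?thesis
    using assms by (simp add: inverse_arrows_def strict_interchange strict_simps)
qed

text \<open>
  Rebracketing a product of four arrows makes the two middle factors adjacent, and the claim is then the
  naturality of the symmetry between these two.
\<close>

lemma interchange_natural:
  assumes "X1 \<in> U" "X2 \<in> U" "Y1 \<in> U" "Y2 \<in> U" "X1' \<in> U" "X2' \<in> U" "Y1' \<in> U" "Y2' \<in> U"
    "f1 \<in> Hom K X1 X1'" "f2 \<in> Hom K X2 X2'" "g1 \<in> Hom K Y1 Y1'" "g2 \<in> Hom K Y2 Y2'"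
  shows "\<llangle>K \<Turnstile> (X1 \<cdot> X2) \<cdot> Y1 \<cdot> Y2,
      \<llangle>K \<Turnstile> X1 \<cdot> X2, \<llangle>K \<Turnstile> X1, f1, X1' \<otimes> X2, f2, X2'\<rrangle>, X1' \<cdot> X2' \<otimes>
         Y1 \<cdot> Y2, \<llangle>K \<Turnstile> Y1, g1, Y1' \<otimes> Y2, g2, Y2'\<rrangle>, Y1' \<cdot> Y2'\<rrangle>,
      (X1' \<cdot> X2') \<cdot> Y1' \<cdot> Y2', interchange K X1' X2' Y1' Y2',
      (X1' \<cdot> Y1') \<cdot> X2' \<cdot> Y2'\<rrangle>
    = \<llangle>K \<Turnstile> (X1 \<cdot> X2) \<cdot> Y1 \<cdot> Y2, interchange K X1 X2 Y1 Y2,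
      (X1 \<cdot> Y1) \<cdot> X2 \<cdot> Y2,
      \<llangle>K \<Turnstile> X1 \<cdot> Y1, \<llangle>K \<Turnstile> X1, f1, X1' \<otimes> Y1, g1, Y1'\<rrangle>, X1' \<cdot> Y1' \<otimes>
         X2 \<cdot> Y2, \<llangle>K \<Turnstile> X2, f2, X2' \<otimes> Y2, g2, Y2'\<rrangle>, X2' \<cdot> Y2'\<rrangle>,
      (X1' \<cdot> Y1') \<cdot> X2' \<cdot> Y2'\<rrangle>"
proof -
  have assoc: "\<llangle>K \<Turnstile> A \<cdot> B, \<llangle>K \<Turnstile> A, a, A' \<otimes> B, b, B'\<rrangle>, A' \<cdot> B' \<otimes>
        D \<cdot> E, \<llangle>K \<Turnstile> D, d, D' \<otimes> E, e, E'\<rrangle>, D' \<cdot> E'\<rrangle>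
      = \<llangle>K \<Turnstile> A, a, A' \<otimes> B \<cdot> D \<cdot> E,
        \<llangle>K \<Turnstile> B \<cdot> D, \<llangle>K \<Turnstile> B, b, B' \<otimes> D, d, D'\<rrangle>, B' \<cdot> D' \<otimes> E, e, E'\<rrangle>,
        B' \<cdot> D' \<cdot> E'\<rrangle>"
    if "A \<in> U" "B \<in> U" "D \<in> U" "E \<in> U" "A' \<in> U" "B' \<in> U" "D' \<in> U" "E' \<in> U"
      "a \<in> Hom K A A'" "b \<in> Hom K B B'" "d \<in> Hom K D D'" "e \<in> Hom K E E'"
    for A B D E A' B' D' E' a b d e
    using that by (simp add: strict_arr_assoc strict_objs tensor_hom)
  have nat: "\<llangle>K \<Turnstile> X2 \<cdot> Y1 \<cdot> Y2,
      \<llangle>K \<Turnstile> X2 \<cdot> Y1, \<llangle>K \<Turnstile> X2, f2, X2' \<otimes> Y1, g1, Y1'\<rrangle>, X2' \<cdot> Y1' \<otimes> Y2, g2, Y2'\<rrangle>,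
      X2' \<cdot> Y1' \<cdot> Y2', sw X2' Y1' Y2',
      Y1' \<cdot> X2' \<cdot> Y2'\<rrangle>
    = \<llangle>K \<Turnstile> X2 \<cdot> Y1 \<cdot> Y2,
      sw X2 Y1 Y2, Y1 \<cdot> X2 \<cdot> Y2,
      \<llangle>K \<Turnstile> Y1 \<cdot> X2, \<llangle>K \<Turnstile> Y1, g1, Y1' \<otimes> X2, f2, X2'\<rrangle>, Y1' \<cdot> X2' \<otimes> Y2, g2, Y2'\<rrangle>,
      Y1' \<cdot> X2' \<cdot> Y2'\<rrangle>"
    using tensor_cmp[of "X2 \<cdot> Y1" "X2' \<cdot> Y1'" "Y1' \<cdot> X2'" Y2 Y2' Y2'
        "\<llangle>K \<Turnstile> X2, f2, X2' \<otimes> Y1, g1, Y1'\<rrangle>" g2 "Sym K X2' Y1'" "Idn K Y2'"]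
      tensor_cmp[of "X2 \<cdot> Y1" "Y1 \<cdot> X2" "Y1' \<cdot> X2'" Y2 Y2 Y2' "Sym K X2 Y1" "Idn K Y2"
        "\<llangle>K \<Turnstile> Y1, g1, Y1' \<otimes> X2, f2, X2'\<rrangle>" g2]
      assms by (simp add: rw_def K.sym_nat K.sym_hom mon_simps strict_objs)
  have homs: "\<llangle>K \<Turnstile> X2 \<cdot> Y1, \<llangle>K \<Turnstile> X2, f2, X2' \<otimes> Y1, g1, Y1'\<rrangle>, X2' \<cdot> Y1' \<otimes> Y2, g2, Y2'\<rrangle>
      \<in> Hom K (X2 \<cdot> Y1 \<cdot> Y2) (X2' \<cdot> Y1' \<cdot> Y2')"
    "\<llangle>K \<Turnstile> Y1 \<cdot> X2, \<llangle>K \<Turnstile> Y1, g1, Y1' \<otimes> X2, f2, X2'\<rrangle>, Y1' \<cdot> X2' \<otimes> Y2, g2, Y2'\<rrangle>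
      \<in> Hom K (Y1 \<cdot> X2 \<cdot> Y2) (Y1' \<cdot> X2' \<cdot> Y2')"
    using tensor_hom[of "X2 \<cdot> Y1" "X2' \<cdot> Y1'" Y2 Y2'] tensor_hom[of "Y1 \<cdot> X2" "Y1' \<cdot> X2'" Y2 Y2']
      assms by (simp_all add: tensor_hom strict_objs)
  show ?thesis
    using assms homs nat
    by (simp add: assoc strict_interchange lw_def tensor_cmp strict_objs cat_simps rw_hom sym_hom_eq)
qed

lemma interchange_unit:
  assumes "P \<in> U" "Q \<in> U"
  shows "interchange K P Q (Unt K) (Unt K) = Idn K (P \<cdot> Q)"
    "interchange K (Unt K) (Unt K) P Q = Idn K (P \<cdot> Q)"
    "interchange K P (Unt K) Q (Unt K) = Idn K (P \<cdot> Q)"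
    "interchange K (Unt K) P (Unt K) Q = Idn K (P \<cdot> Q)"
  using assms by (simp_all add: strict_interchange strict_sym_unit strict_simps)

text \<open>
  Split into swaps of single factors, both sides move \<open>Y1\<close> past \<open>X2\<close>, \<open>Z1\<close> past \<open>Y2\<close> and then \<open>Z1\<close> past \<open>X2\<close>.
  They differ in the order of the first two swaps, which act on disjoint factors.
\<close>

lemma interchange_assoc:
  assumes u: "X1 \<in> U" "X2 \<in> U" "Y1 \<in> U" "Y2 \<in> U" "Z1 \<in> U" "Z2 \<in> U"
  shows "\<llangle>K \<Turnstile> X1 \<cdot> X2 \<cdot> Y1 \<cdot> Y2 \<cdot> Z1 \<cdot> Z2,
      rw (X1 \<cdot> X2 \<cdot> Y1 \<cdot> Y2) (X1 \<cdot> Y1 \<cdot> X2 \<cdot> Y2)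
        (interchange K X1 X2 Y1 Y2) (Z1 \<cdot> Z2),
      X1 \<cdot> Y1 \<cdot> X2 \<cdot> Y2 \<cdot> Z1 \<cdot> Z2,
      interchange K (X1 \<cdot> Y1) (X2 \<cdot> Y2) Z1 Z2,
      X1 \<cdot> Y1 \<cdot> Z1 \<cdot> X2 \<cdot> Y2 \<cdot> Z2\<rrangle>
    = \<llangle>K \<Turnstile> X1 \<cdot> X2 \<cdot> Y1 \<cdot> Y2 \<cdot> Z1 \<cdot> Z2,
      lw (X1 \<cdot> X2) (Y1 \<cdot> Y2 \<cdot> Z1 \<cdot> Z2) (Y1 \<cdot> Z1 \<cdot> Y2 \<cdot> Z2)
        (interchange K Y1 Y2 Z1 Z2),
      X1 \<cdot> X2 \<cdot> Y1 \<cdot> Z1 \<cdot> Y2 \<cdot> Z2,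
      interchange K X1 X2 (Y1 \<cdot> Z1) (Y2 \<cdot> Z2),
      X1 \<cdot> Y1 \<cdot> Z1 \<cdot> X2 \<cdot> Y2 \<cdot> Z2\<rrangle>"
  using assms whisker_exchange_under_then[of X1 "X2 \<cdot> Y1" "Y1 \<cdot> X2" "Y2 \<cdot> Z1 \<cdot> Z2"
      "Z1 \<cdot> Y2 \<cdot> Z2" "X1 \<cdot> Y1 \<cdot> Z1 \<cdot> X2 \<cdot> Y2 \<cdot> Z2"
      "Sym K X2 Y1" "sw Y2 Z1 Z2"
      "lw (X1 \<cdot> Y1) (X2 \<cdot> Z1 \<cdot> Y2 \<cdot> Z2) (Z1 \<cdot> X2 \<cdot> Y2 \<cdot> Z2)
        (sw X2 Z1 (Y2 \<cdot> Z2))"]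
  by (simp add: strict_interchange strict_sym_tensor_left strict_sym_tensor_right strict_simps)

text \<open>
  Both sides start by swapping \<open>X3\<close> and \<open>Y1\<close> and continue by swapping \<open>X2\<close> with \<open>Y1\<close> and \<open>X3\<close> with \<open>Y2\<close>, in
  different orders.
\<close>

lemma interchange_interchange:
  assumes u: "X1 \<in> U" "X2 \<in> U" "X3 \<in> U" "Y1 \<in> U" "Y2 \<in> U" "Y3 \<in> U"
  shows "\<llangle>K \<Turnstile> X1 \<cdot> X2 \<cdot> X3 \<cdot> Y1 \<cdot> Y2 \<cdot> Y3,
      interchange K (X1 \<cdot> X2) X3 (Y1 \<cdot> Y2) Y3,
      X1 \<cdot> X2 \<cdot> Y1 \<cdot> Y2 \<cdot> X3 \<cdot> Y3,
      rw (X1 \<cdot> X2 \<cdot> Y1 \<cdot> Y2) (X1 \<cdot> Y1 \<cdot> X2 \<cdot> Y2)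
        (interchange K X1 X2 Y1 Y2) (X3 \<cdot> Y3),
      X1 \<cdot> Y1 \<cdot> X2 \<cdot> Y2 \<cdot> X3 \<cdot> Y3\<rrangle>
    = \<llangle>K \<Turnstile> X1 \<cdot> X2 \<cdot> X3 \<cdot> Y1 \<cdot> Y2 \<cdot> Y3,
      interchange K X1 (X2 \<cdot> X3) Y1 (Y2 \<cdot> Y3),
      X1 \<cdot> Y1 \<cdot> X2 \<cdot> X3 \<cdot> Y2 \<cdot> Y3,
      lw (X1 \<cdot> Y1) (X2 \<cdot> X3 \<cdot> Y2 \<cdot> Y3) (X2 \<cdot> Y2 \<cdot> X3 \<cdot> Y3)
        (interchange K X2 X3 Y2 Y3),
      X1 \<cdot> Y1 \<cdot> X2 \<cdot> Y2 \<cdot> X3 \<cdot> Y3\<rrangle>"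
  using assms whisker_exchange_under[of X1 "X2 \<cdot> Y1" "Y1 \<cdot> X2" "X3 \<cdot> Y2 \<cdot> Y3"
      "Y2 \<cdot> X3 \<cdot> Y3" "Sym K X2 Y1" "sw X3 Y2 Y3"]
  by (simp add: strict_interchange strict_sym_tensor_left strict_sym_tensor_right strict_simps)

lemma interchange_sym:
  assumes u: "X1 \<in> U" "X2 \<in> U" "Y1 \<in> U" "Y2 \<in> U"
  shows "\<llangle>K \<Turnstile> X1 \<cdot> X2 \<cdot> Y1 \<cdot> Y2, interchange K X1 X2 Y1 Y2,
      X1 \<cdot> Y1 \<cdot> X2 \<cdot> Y2, Sym K (X1 \<cdot> Y1) (X2 \<cdot> Y2),
      X2 \<cdot> Y2 \<cdot> X1 \<cdot> Y1\<rrangle>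
    = \<llangle>K \<Turnstile> X1 \<cdot> X2 \<cdot> Y1 \<cdot> Y2,
      lw (X1 \<cdot> X2) (Y1 \<cdot> Y2) (Y2 \<cdot> Y1) (Sym K Y1 Y2),
      X1 \<cdot> X2 \<cdot> Y2 \<cdot> Y1,
      sw X1 X2 (Y2 \<cdot> Y1),
      X2 \<cdot> X1 \<cdot> Y2 \<cdot> Y1, interchange K X2 X1 Y2 Y1,
      X2 \<cdot> Y2 \<cdot> X1 \<cdot> Y1\<rrangle>"
    (is "?l = ?r")
proof -
  let ?D = "X1 \<cdot> X2 \<cdot> Y1 \<cdot> Y2"
  \<comment> \<open>Split into swaps, the left-hand side first moves \<open>Y1\<close> past \<open>X2\<close> and then back.\<close>
  have "\<llangle>K \<Turnstile> ?D,
      lw X1 (X2 \<cdot> Y1 \<cdot> Y2) (Y1 \<cdot> X2 \<cdot> Y2) (sw X2 Y1 Y2),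
      X1 \<cdot> Y1 \<cdot> X2 \<cdot> Y2,
      lw X1 (Y1 \<cdot> X2 \<cdot> Y2) (X2 \<cdot> Y1 \<cdot> Y2) (sw Y1 X2 Y2),
      ?D, ?r, X2 \<cdot> Y2 \<cdot> X1 \<cdot> Y1\<rrangle> = ?r"
    using rw_inverse[of Y2 "X2 \<cdot> Y1" "Y1 \<cdot> X2" "Sym K X2 Y1" "Sym K Y1 X2"] assms
    by (intro cancel_then lw_inverse) (simp_all add: strict_simps strict_sym_inverse strict_interchange)
  then show ?thesis
    using assms
    by (simp add: strict_interchange strict_sym_tensor_left[of X1 Y1 "X2 \<cdot> Y2"]
        strict_sym_tensor_right[of X1] strict_sym_tensor_right[of Y1] strict_simps)
qed

end

section \<open>Parameter objects of slice elements\<close>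

context slice_along
begin

sublocale slice: lax_monoidal_to_cat V N by (rule slice_lax_monoidal)

text \<open>
  The parameter object of an element is its first component. The action leaves it alone, multiplication
  multiplies it, and arrows between elements are arrows of \<open>K\<close> between parameter objects that satisfy a
  condition. Only this condition depends on the second components, so that equations between arrows are
  equations in \<open>K\<close>.
\<close>

lemma par_in_U: "x \<in> El A \<Longrightarrow> fst x \<in> U"
  by (auto simp: slice_simps)

lemma par_act: "fst (act A B h x) = fst x"
  by (cases x) (simp add: slice_simps)

lemma par_mul: "fst (mul A B (x, y)) = fst x \<cdot> fst y"
  by (cases x, cases y) (simp add: slice_simps)

lemma par_unit: "fst (Keps N) = Unt K"
  by (simp add: slice_simps)

lemma mul_arr: "FA (Ktil N A B) (x, y) (x', y') (\<phi>, \<psi>) = \<llangle>K \<Turnstile> fst x, \<phi>, fst x' \<otimes> fst y, \<psi>, fst y'\<rrangle>"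
  by (cases x, cases y, cases x', cases y') (simp add: slice_simps)

lemma slice_id: "Idn (Kfun N A) x = Idn K (fst x)"
  by (cases x) (simp add: slice_simps)

lemma slice_cmp: "Cmp (Kfun N A) x y z \<phi> \<psi> = \<llangle>K \<Turnstile> fst x, \<phi>, fst y, \<psi>, fst z\<rrangle>"
  by (cases x, cases y, cases z) (simp add: slice_simps)

lemma hom_par: "\<phi> \<in> Hom (Kfun N A) x y \<Longrightarrow> \<phi> \<in> Hom K (fst x) (fst y)"
  by (cases x, cases y) (simp add: slice_simps)

lemma slice_hom_iff: "\<phi> \<in> Hom (Kfun N A) x y
    \<longleftrightarrow> \<phi> \<in> Hom K (fst x) (fst y) \<and> snd x = \<llangle>K \<Turnstile> fst x, \<phi>, fst y, snd y, FO G A\<rrangle>"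
  by (cases x, cases y) (simp add: slice_simps)

lemma slice_is_iso:
  assumes A: "A \<in> Obj V" and x: "x \<in> El A" "y \<in> El A"
    and \<phi>: "\<phi> \<in> Hom (Kfun N A) x y" and iso: "is_iso K (fst x) (fst y) \<phi>"
  shows "is_iso (Kfun N A) x y \<phi>"
proof -
  obtain \<psi> where \<psi>: "inverse_arrows K (fst x) (fst y) \<phi> \<psi>"
    using iso by (auto simp: is_iso_def)
  have o: "fst x \<in> Obj K" "fst y \<in> Obj K" "FO G A \<in> Obj K" "snd y \<in> Hom K (fst y) (FO G A)"
    using A x by (auto simp: slice_simps strict_obj G.fun_obj)
  have "snd y = \<llangle>K \<Turnstile> fst y, \<psi>, fst x, snd x, FO G A\<rrangle>"
    using cmp_assoc[of "fst y" "fst x" "fst y" "FO G A" \<psi> \<phi> "snd y"] \<phi> \<psi> o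
    by (simp add: slice_hom_iff inverse_arrows_def id_left)
  then have "inverse_arrows (Kfun N A) x y \<phi> \<psi>"
    using \<phi> \<psi> by (simp add: inverse_arrows_def slice_hom_iff slice_id slice_cmp)
  then show ?thesis by (auto simp: is_iso_def)
qed

lemma act_hom_par: "\<lbrakk>A \<in> Obj V; B \<in> Obj V; h \<in> Hom V A B; x \<in> El A; y \<in> El A;
    \<phi> \<in> Hom (Kfun N A) x y\<rbrakk> \<Longrightarrow> \<phi> \<in> Hom (Kfun N B) (act A B h x) (act A B h y)"
  using slice.act_hom[of A B h x y \<phi>] by (simp add: slice_simps(6))

lemmas par_simps = par_act par_mul par_unit mul_arr slice_id slice_cmp slice_simps(6)

end

locale symmetric_slice_along = slice_along V K U G + strict_symmetric_subcategory K U
    + G: symmetric_lax_monoidal_functor V K G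
  for V :: "('vo, 'va, 'v) sym_mon_cat_scheme" and K :: "('o, 'a, 'x) sym_mon_cat_scheme"
    and U :: "'o set" and G :: "('vo, 'va, 'o, 'a, 'g) lax_fn_scheme"
begin

sublocale V: symmetric_monoidal_category V by (rule G.source_symmetric)

text \<open>
  Here the symmetry of \<open>G\<close> enters: the symmetry of \<open>V\<close> under \<open>G\<close> becomes that of \<open>K\<close> at \<open>GA\<close> and \<open>GB\<close>, which
  naturality moves to the parameter objects.
\<close>

lemma mul_sym_hom:
  assumes o: "A \<in> Obj V" "B \<in> Obj V" and x: "x \<in> El A" "y \<in> El B"
  shows "Sym K (fst x) (fst y) \<in> Hom (Kfun N (B \<otimes>[V] A))
    (act (A \<otimes>[V] B) (B \<otimes>[V] A) (Sym V A B) (mul A B (x, y))) (mul B A (y, x))"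
proof -
  obtain P f Q g where xy: "x = (P, f)" "y = (Q, g)" by (metis surj_pair)
  then have u: "P \<in> U" "Q \<in> U" "f \<in> Hom K P (FO G A)" "g \<in> Hom K Q (FO G B)"
    using x by (auto simp: slice_simps)
  note simps = o u g_simps V.smc_simps K.smc_simps
  let ?E = "FO G (B \<otimes>[V] A)" and ?fg = "\<llangle>K \<Turnstile> P, f, FO G A \<otimes> Q, g, FO G B\<rrangle>"
  have "\<llangle>K \<Turnstile> P \<cdot> Q, ?fg, FO G A \<cdot> FO G B, Ltil G A B, FO G (A \<otimes>[V] B),
      FA G (A \<otimes>[V] B) (B \<otimes>[V] A) (Sym V A B), ?E\<rrangle>
    = \<llangle>K \<Turnstile> P \<cdot> Q, ?fg, FO G A \<cdot> FO G B, Sym K (FO G A) (FO G B), FO G B \<cdot> FO G A,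
      Ltil G B A, ?E\<rrangle>"
    using o by (simp add: G.lax_sym)
  also have "\<dots> = \<llangle>K \<Turnstile> P \<cdot> Q, Sym K P Q, Q \<cdot> P, \<llangle>K \<Turnstile> Q, g, FO G B \<otimes> P, f, FO G A\<rrangle>,
      FO G B \<cdot> FO G A, Ltil G B A, ?E\<rrangle>"
    by (rule postcompose_eq[OF K.sym_nat]) (simp_all add: simps)
  finally show ?thesis
    by (simp add: xy slice_simps simps)
qed

lemma mul_assoc_inv:
  assumes o: "A \<in> Obj V" "B \<in> Obj V" "D \<in> Obj V"
    and x: "x \<in> El A" "y \<in> El B" "z \<in> El D"
  shows "act (A \<otimes>[V] (B \<otimes>[V] D)) ((A \<otimes>[V] B) \<otimes>[V] D)
      (inv_arr V ((A \<otimes>[V] B) \<otimes>[V] D) (A \<otimes>[V] (B \<otimes>[V] D)) (Asc V A B D))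
      (mul A (B \<otimes>[V] D) (x, mul B D (y, z)))
    = mul (A \<otimes>[V] B) D (mul A B (x, y), z)"
  using o x G.C.inv_arr_hom[OF _ _ G.S.asc_is_iso] G.C.inv_arr_right[OF _ _ G.S.asc_is_iso]
  by (simp add: slice.mul_assoc[symmetric] slice.k_simps)

text \<open>
  The interchange map of \<open>V\<close> consists of a symmetry and associators. The associators rebracket products of
  elements strictly, so the source and the target arise by the same operation from the two sides of
  \<open>mul_sym_hom\<close>, and the required arrow is the image under this operation of the symmetry.
\<close>

lemma mul_interchange_hom:
  assumes o: "A1 \<in> Obj V" "A2 \<in> Obj V" "B1 \<in> Obj V" "B2 \<in> Obj V"
    and x: "x1 \<in> El A1" "x2 \<in> El A2" "y1 \<in> El B1" "y2 \<in> El B2"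
  shows "interchange K (fst x1) (fst x2) (fst y1) (fst y2)
    \<in> Hom (Kfun N ((A1 \<otimes>[V] B1) \<otimes>[V] (A2 \<otimes>[V] B2)))
      (act ((A1 \<otimes>[V] A2) \<otimes>[V] (B1 \<otimes>[V] B2)) ((A1 \<otimes>[V] B1) \<otimes>[V] (A2 \<otimes>[V] B2))
          (interchange V A1 A2 B1 B2)
        (mul (A1 \<otimes>[V] A2) (B1 \<otimes>[V] B2) (mul A1 A2 (x1, x2), mul B1 B2 (y1, y2))))
      (mul (A1 \<otimes>[V] B1) (A2 \<otimes>[V] B2) (mul A1 B1 (x1, y1), mul A2 B2 (x2, y2)))"
    (is "_ \<in> Hom _ ?src ?tgt")
proof -
  let ?mul = "\<lambda>A B x y. mul A B (x, y)"
  let ?ai = "\<lambda>A B D. inv_arr V ((A \<otimes>[V] B) \<otimes>[V] D) (A \<otimes>[V] (B \<otimes>[V] D)) (Asc V A B D)"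
  let ?Y = "B1 \<otimes>[V] (A2 \<otimes>[V] B2)"
  \<comment> \<open>The operation multiplies by \<open>x1\<close> on the left and by \<open>y2\<close> on the right, and rebrackets.\<close>
  let ?a = "\<lambda>z. act (A1 \<otimes>[V] ?Y) ((A1 \<otimes>[V] B1) \<otimes>[V] (A2 \<otimes>[V] B2)) (?ai A1 B1 (A2 \<otimes>[V] B2))
      (?mul A1 ?Y x1 (act ((B1 \<otimes>[V] A2) \<otimes>[V] B2) ?Y (Asc V B1 A2 B2) (?mul (B1 \<otimes>[V] A2) B2 z y2)))"
  let ?s = "act (A2 \<otimes>[V] B1) (B1 \<otimes>[V] A2) (Sym V A2 B1) (?mul A2 B1 x2 y1)"
  have inv: "?ai A B D \<in> Hom V (A \<otimes>[V] (B \<otimes>[V] D)) ((A \<otimes>[V] B) \<otimes>[V] D)"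
    if "A \<in> Obj V" "B \<in> Obj V" "D \<in> Obj V" for A B D
    using that G.C.inv_arr_hom[OF _ _ G.S.asc_is_iso] by (simp add: G.S.tensor_obj)
  note simps = o x inv slice.k_simps V.smc_simps
  have src: "?src = ?a ?s"
  proof -
    have "?src = act (A1 \<otimes>[V] ?Y) ((A1 \<otimes>[V] B1) \<otimes>[V] (A2 \<otimes>[V] B2)) (?ai A1 B1 (A2 \<otimes>[V] B2))
      (?mul A1 ?Y x1 (act (A2 \<otimes>[V] (B1 \<otimes>[V] B2)) ?Y
        \<llangle>V \<Turnstile> A2 \<otimes>[V] (B1 \<otimes>[V] B2), ?ai A2 B1 B2, (A2 \<otimes>[V] B1) \<otimes>[V] B2,
          \<llangle>V \<Turnstile> A2 \<otimes>[V] B1, Sym V A2 B1, B1 \<otimes>[V] A2 \<otimes> B2, Idn V B2, B2\<rrangle>, (B1 \<otimes>[V] A2) \<otimes>[V] B2,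
          Asc V B1 A2 B2, ?Y\<rrangle> (?mul A2 (B1 \<otimes>[V] B2) x2 (?mul B1 B2 y1 y2))))"
      by (simp add: interchange_def simps slice.mul_act_right
          slice.mul_assoc[of A1 A2 "B1 \<otimes>[V] B2" x1 x2 "?mul B1 B2 y1 y2", symmetric])
    also have "\<dots> = ?a ?s"
      by (simp add: simps slice.mul_act_left mul_assoc_inv[of A2 B1 B2 x2 y1 y2, symmetric])
    finally show ?thesis .
  qed
  have tgt: "?tgt = ?a (?mul B1 A2 y1 x2)"
    by (simp add: simps slice.mul_assoc mul_assoc_inv)
  have s: "Sym K (fst x2) (fst y1) \<in> Hom (Kfun N (B1 \<otimes>[V] A2)) ?s (?mul B1 A2 y1 x2)"
    by (rule mul_sym_hom) (simp_all add: o x)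
  have "FA (Ktil N (B1 \<otimes>[V] A2) B2) (?s, y2) (?mul B1 A2 y1 x2, y2) (Sym K (fst x2) (fst y1), Idn (Kfun N B2) y2)
    \<in> Hom (Kfun N ((B1 \<otimes>[V] A2) \<otimes>[V] B2)) (?mul (B1 \<otimes>[V] A2) B2 ?s y2) (?mul (B1 \<otimes>[V] A2) B2 (?mul B1 A2 y1 x2) y2)"
    using s by (intro slice.mul_hom) (simp_all add: simps del: slice.act_cmp)
  then have "FA (Ktil N A1 ?Y)
      (x1, act ((B1 \<otimes>[V] A2) \<otimes>[V] B2) ?Y (Asc V B1 A2 B2) (?mul (B1 \<otimes>[V] A2) B2 ?s y2))
      (x1, act ((B1 \<otimes>[V] A2) \<otimes>[V] B2) ?Y (Asc V B1 A2 B2) (?mul (B1 \<otimes>[V] A2) B2 (?mul B1 A2 y1 x2) y2))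
      (Idn (Kfun N A1) x1, FA (Ktil N (B1 \<otimes>[V] A2) B2) (?s, y2) (?mul B1 A2 y1 x2, y2)
        (Sym K (fst x2) (fst y1), Idn (Kfun N B2) y2))
    \<in> Hom (Kfun N ((A1 \<otimes>[V] B1) \<otimes>[V] (A2 \<otimes>[V] B2))) (?a ?s) (?a (?mul B1 A2 y1 x2))"
    by (intro act_hom_par slice.mul_hom) (simp_all add: s simps del: slice.act_cmp)
  then show ?thesis
    unfolding src tgt using x
    by (simp add: strict_interchange par_in_U par_simps strict_objs lw_def rw_def)
qed

end

section \<open>Transformations between pseudofunctors into a sliced 2-category\<close>

locale sliced_vcategory = symmetric_slice_along V K U G + C: vcategory V C
  for V :: "('vo, 'va, 'v) sym_mon_cat_scheme" and K :: "('o, 'a, 'x) sym_mon_cat_scheme"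
    and U :: "'o set" and G :: "('vo, 'va, 'o, 'a, 'g) lax_fn_scheme"
    and C :: "('c, 'vo, 'va, 'y) vcat_scheme"
begin

abbreviation T where "T \<equiv> change_of_base V N C"
abbreviation TT where "TT \<equiv> prod_twocat T T"

sublocale T: two_category T
  by (rule two_category_change_of_base) (rule slice_lax_monoidal C.vcategory_axioms)+

lemma T_par_in_U: "x \<in> Obj (HomC T X Y) \<Longrightarrow> fst x \<in> U"
  by (simp add: change_of_base_simps par_in_U)

lemma T_par_hcomp: "fst \<llangle>T \<Turnstile>\<^sub>1 X, f, Y, g, Z\<rrangle> = fst f \<cdot> fst g"
  by (simp add: change_of_base_simps fn_simps par_simps)

lemma T_par_id: "fst (Id1 T X) = Unt K"
  by (simp add: change_of_base_simps par_simps)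

lemma T_hcomp_arr: "FA (HComp T X Y Z) (f, g) (f', g') (\<phi>, \<psi>)
    = \<llangle>K \<Turnstile> fst f, \<phi>, fst f' \<otimes> fst g, \<psi>, fst g'\<rrangle>"
  by (simp add: change_of_base_simps fn_simps par_simps)

lemma T_id: "Idn (HomC T X Y) x = Idn K (fst x)"
  by (simp add: change_of_base_simps slice_id)

lemma T_cmp: "Cmp (HomC T X Y) x y z \<phi> \<psi> = \<llangle>K \<Turnstile> fst x, \<phi>, fst y, \<psi>, fst z\<rrangle>"
  by (simp add: change_of_base_simps slice_cmp)

lemma T_hom_par: "\<phi> \<in> Hom (HomC T X Y) x y \<Longrightarrow> \<phi> \<in> Hom K (fst x) (fst y)"
  by (simp add: change_of_base_simps hom_par)

lemma T_is_iso: "\<lbrakk>X \<in> VObj C; Y \<in> VObj C; x \<in> Obj (HomC T X Y); y \<in> Obj (HomC T X Y);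
    \<phi> \<in> Hom (HomC T X Y) x y; is_iso K (fst x) (fst y) \<phi>\<rbrakk> \<Longrightarrow> is_iso (HomC T X Y) x y \<phi>"
  unfolding change_of_base_simps by (rule slice_is_iso) (simp_all add: C.vhom_obj)

lemmas T_simps = T_par_hcomp T_par_id T_hcomp_arr T_id T_cmp

text \<open>
  Whiskering with a 1-cell whose parameter object is the unit is invisible in \<open>K\<close>. For components \<open>t\<close> of this
  kind, the axioms of a strong transformation therefore become equations in \<open>K\<close> in which \<open>t\<close> does not
  occur.
\<close>

lemma strong_transformation_into_slices:
  assumes P: "pseudofunctor R T P" and Q: "pseudofunctor R T Q"
    and t: "\<And>X. X \<in> Cell0 R \<Longrightarrow> t X \<in> Obj (HomC T (P0 P X) (P0 Q X))"
    and t_par: "\<And>X. X \<in> Cell0 R \<Longrightarrow> fst (t X) = Unt K"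
    and n: "\<And>X Y f. \<lbrakk>X \<in> Cell0 R; Y \<in> Cell0 R; f \<in> Obj (HomC R X Y)\<rbrakk> \<Longrightarrow>
      n X Y f \<in> Hom (HomC T (P0 P X) (P0 Q Y))
        \<llangle>T \<Turnstile>\<^sub>1 P0 P X, FO (P1 P X Y) f, P0 P Y, t Y, P0 Q Y\<rrangle>
        \<llangle>T \<Turnstile>\<^sub>1 P0 P X, t X, P0 Q X, FO (P1 Q X Y) f, P0 Q Y\<rrangle>"
    and iso: "\<And>X Y f. \<lbrakk>X \<in> Cell0 R; Y \<in> Cell0 R; f \<in> Obj (HomC R X Y)\<rbrakk> \<Longrightarrow>
      is_iso K (fst (FO (P1 P X Y) f)) (fst (FO (P1 Q X Y) f)) (n X Y f)"
    and nat: "\<And>X Y f f' \<phi>. \<lbrakk>X \<in> Cell0 R; Y \<in> Cell0 R; f \<in> Obj (HomC R X Y); f' \<in> Obj (HomC R X Y);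
      \<phi> \<in> Hom (HomC R X Y) f f'\<rbrakk> \<Longrightarrow>
      \<llangle>K \<Turnstile> fst (FO (P1 P X Y) f), FA (P1 P X Y) f f' \<phi>, fst (FO (P1 P X Y) f'), n X Y f', fst (FO (P1 Q X Y) f')\<rrangle>
      = \<llangle>K \<Turnstile> fst (FO (P1 P X Y) f), n X Y f, fst (FO (P1 Q X Y) f), FA (P1 Q X Y) f f' \<phi>, fst (FO (P1 Q X Y) f')\<rrangle>"
    and cmp: "\<And>X Y Z f g. \<lbrakk>X \<in> Cell0 R; Y \<in> Cell0 R; Z \<in> Cell0 R; f \<in> Obj (HomC R X Y); g \<in> Obj (HomC R Y Z)\<rbrakk> \<Longrightarrow>
      \<llangle>K \<Turnstile> fst (FO (P1 P X Y) f) \<cdot> fst (FO (P1 P Y Z) g), Pcmp P X Y Z f g,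
        fst (FO (P1 P X Z) \<llangle>R \<Turnstile>\<^sub>1 X, f, Y, g, Z\<rrangle>), n X Z \<llangle>R \<Turnstile>\<^sub>1 X, f, Y, g, Z\<rrangle>,
        fst (FO (P1 Q X Z) \<llangle>R \<Turnstile>\<^sub>1 X, f, Y, g, Z\<rrangle>)\<rrangle>
      = \<llangle>K \<Turnstile> fst (FO (P1 P X Y) f) \<cdot> fst (FO (P1 P Y Z) g),
        lw (fst (FO (P1 P X Y) f)) (fst (FO (P1 P Y Z) g)) (fst (FO (P1 Q Y Z) g)) (n Y Z g),
        fst (FO (P1 P X Y) f) \<cdot> fst (FO (P1 Q Y Z) g),
        rw (fst (FO (P1 P X Y) f)) (fst (FO (P1 Q X Y) f)) (n X Y f) (fst (FO (P1 Q Y Z) g)),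
        fst (FO (P1 Q X Y) f) \<cdot> fst (FO (P1 Q Y Z) g), Pcmp Q X Y Z f g,
        fst (FO (P1 Q X Z) \<llangle>R \<Turnstile>\<^sub>1 X, f, Y, g, Z\<rrangle>)\<rrangle>"
    and unit: "\<And>X. X \<in> Cell0 R \<Longrightarrow>
      \<llangle>K \<Turnstile> Unt K, Punit P X, fst (FO (P1 P X X) (Id1 R X)), n X X (Id1 R X),
        fst (FO (P1 Q X X) (Id1 R X))\<rrangle> = Punit Q X"
  shows "strong_transformation R T P Q t n"
proof -
  interpret P: pseudofunctor R T P by (rule P)
  interpret Q: pseudofunctor R T Q by (rule Q)
  have cells: "P0 P X \<in> VObj C" "P0 Q X \<in> VObj C" if "X \<in> Cell0 R" for X
    using that P.ps_0cell Q.ps_0cell by (simp_all add: change_of_base_simps)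
  have pU: "fst (FO (P1 P X Y) f) \<in> U" "fst (FO (P1 Q X Y) f) \<in> U"
    if "X \<in> Cell0 R" "Y \<in> Cell0 R" "f \<in> Obj (HomC R X Y)" for X Y f
    using that P.p1_obj Q.p1_obj T_par_in_U by blast+
  have arr: "FA (P1 P X Y) f f' \<phi> \<in> Hom K (fst (FO (P1 P X Y) f)) (fst (FO (P1 P X Y) f'))"
      "FA (P1 Q X Y) f f' \<phi> \<in> Hom K (fst (FO (P1 Q X Y) f)) (fst (FO (P1 Q X Y) f'))"
    if "X \<in> Cell0 R" "Y \<in> Cell0 R" "f \<in> Obj (HomC R X Y)" "f' \<in> Obj (HomC R X Y)"
      "\<phi> \<in> Hom (HomC R X Y) f f'" for X Y f f' \<phi>
    using that P.p1_hom Q.p1_hom T_hom_par by blast+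
  have pcmp: "Pcmp P X Y Z f g \<in> Hom K (fst (FO (P1 P X Y) f) \<cdot> fst (FO (P1 P Y Z) g))
        (fst (FO (P1 P X Z) \<llangle>R \<Turnstile>\<^sub>1 X, f, Y, g, Z\<rrangle>))"
      "Pcmp Q X Y Z f g \<in> Hom K (fst (FO (P1 Q X Y) f) \<cdot> fst (FO (P1 Q Y Z) g))
        (fst (FO (P1 Q X Z) \<llangle>R \<Turnstile>\<^sub>1 X, f, Y, g, Z\<rrangle>))"
    if "X \<in> Cell0 R" "Y \<in> Cell0 R" "Z \<in> Cell0 R" "f \<in> Obj (HomC R X Y)" "g \<in> Obj (HomC R Y Z)" for X Y Z f g
    using P.pcmp_hom[OF that, THEN T_hom_par] Q.pcmp_hom[OF that, THEN T_hom_par]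
    by (simp_all add: T_simps)
  have punit: "Punit P X \<in> Hom K (Unt K) (fst (FO (P1 P X X) (Id1 R X)))"
      "Punit Q X \<in> Hom K (Unt K) (fst (FO (P1 Q X X) (Id1 R X)))" if "X \<in> Cell0 R" for X
    using P.punit_hom[OF that, THEN T_hom_par] Q.punit_hom[OF that, THEN T_hom_par]
    by (simp_all add: T_simps)
  have nK: "n X Y f \<in> Hom K (fst (FO (P1 P X Y) f)) (fst (FO (P1 Q X Y) f))"
    if "X \<in> Cell0 R" "Y \<in> Cell0 R" "f \<in> Obj (HomC R X Y)" for X Y f
    by (rule is_iso_hom[OF iso[OF that]])
  have rcmp: "\<llangle>R \<Turnstile>\<^sub>1 X, f, Y, g, Z\<rrangle> \<in> Obj (HomC R X Z)"
    if "X \<in> Cell0 R" "Y \<in> Cell0 R" "Z \<in> Cell0 R" "f \<in> Obj (HomC R X Y)" "g \<in> Obj (HomC R Y Z)" for X Y Z f g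
    using that P.S.hcomp_obj by blast
  note simps = T_simps t_par pU arr nK pcmp punit rcmp P.S.id1_cell strict_objs
    lw_def[symmetric] rw_def[symmetric] whisker_unit
  show ?thesis
  proof (intro strong_transformation.intro strong_transformation_axioms.intro P Q, goal_cases)
    case (1 X)
    then show ?case by (rule t)
  next
    case o: (2 X Y)
    have "is_iso (HomC T (P0 P X) (P0 Q Y))
        \<llangle>T \<Turnstile>\<^sub>1 P0 P X, FO (P1 P X Y) f, P0 P Y, t Y, P0 Q Y\<rrangle>
        \<llangle>T \<Turnstile>\<^sub>1 P0 P X, t X, P0 Q X, FO (P1 Q X Y) f, P0 Q Y\<rrangle> (n X Y f)"
      if "f \<in> Obj (HomC R X Y)" for f
      by (rule T_is_iso)
        (use o that in \<open>simp_all add: cells n simps iso T.hcomp_obj P.p1_obj Q.p1_obj t P.ps_0cell Q.ps_0cell\<close>)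
    then show ?case
      using o nat[OF o] by (intro nat_isoI) (simp_all add: fn_simps simps)
  next
    case (3 X Y Z f g)
    then show ?case using cmp[of X Y Z f g] by (simp add: Let_def simps)
  next
    case (4 X)
    then show ?case using unit[of X] by (simp add: Let_def simps)
  qed
qed

text \<open>
  If the naturality squares commute, then their 2-cells are identities, and the equations in \<open>K\<close> say that both
  pseudofunctors have the same underlying action on 2-cells, compositors and unitors.
\<close>

lemma two_natural_into_slices:
  assumes P: "pseudofunctor R T P" and Q: "pseudofunctor R T Q"
    and t: "\<And>X. X \<in> Cell0 R \<Longrightarrow> t X \<in> Obj (HomC T (P0 P X) (P0 Q X))"
    and t_par: "\<And>X. X \<in> Cell0 R \<Longrightarrow> fst (t X) = Unt K"
    and square: "\<And>X Y f. \<lbrakk>X \<in> Cell0 R; Y \<in> Cell0 R; f \<in> Obj (HomC R X Y)\<rbrakk> \<Longrightarrow>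
      \<llangle>T \<Turnstile>\<^sub>1 P0 P X, FO (P1 P X Y) f, P0 P Y, t Y, P0 Q Y\<rrangle>
      = \<llangle>T \<Turnstile>\<^sub>1 P0 P X, t X, P0 Q X, FO (P1 Q X Y) f, P0 Q Y\<rrangle>"
    and arr: "\<And>X Y f f' \<phi>. \<lbrakk>X \<in> Cell0 R; Y \<in> Cell0 R; f \<in> Obj (HomC R X Y); f' \<in> Obj (HomC R X Y);
      \<phi> \<in> Hom (HomC R X Y) f f'\<rbrakk> \<Longrightarrow> FA (P1 P X Y) f f' \<phi> = FA (P1 Q X Y) f f' \<phi>"
    and cmp: "\<And>X Y Z f g. \<lbrakk>X \<in> Cell0 R; Y \<in> Cell0 R; Z \<in> Cell0 R; f \<in> Obj (HomC R X Y); g \<in> Obj (HomC R Y Z)\<rbrakk> \<Longrightarrow>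
      Pcmp P X Y Z f g = Pcmp Q X Y Z f g"
    and unit: "\<And>X. X \<in> Cell0 R \<Longrightarrow> Punit P X = Punit Q X"
  shows "two_natural R T P Q t"
proof -
  interpret P: pseudofunctor R T P by (rule P)
  interpret Q: pseudofunctor R T Q by (rule Q)
  have pU: "fst (FO (P1 P X Y) f) \<in> U" "fst (FO (P1 Q X Y) f) \<in> U"
    if "X \<in> Cell0 R" "Y \<in> Cell0 R" "f \<in> Obj (HomC R X Y)" for X Y f
    using that P.p1_obj Q.p1_obj T_par_in_U by blast+
  have par: "fst (FO (P1 P X Y) f) = fst (FO (P1 Q X Y) f)"
    if "X \<in> Cell0 R" "Y \<in> Cell0 R" "f \<in> Obj (HomC R X Y)" for X Y f
    using arg_cong[OF square[OF that], of fst] that pU[OF that]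
    by (simp add: T_simps t_par strict_objs)
  have PK: "FA (P1 Q X Y) f f' \<phi> \<in> Hom K (fst (FO (P1 Q X Y) f)) (fst (FO (P1 Q X Y) f'))"
    if "X \<in> Cell0 R" "Y \<in> Cell0 R" "f \<in> Obj (HomC R X Y)" "f' \<in> Obj (HomC R X Y)"
      "\<phi> \<in> Hom (HomC R X Y) f f'" for X Y f f' \<phi>
    using that Q.p1_hom T_hom_par by blast
  have pcmp: "Pcmp Q X Y Z f g \<in> Hom K (fst (FO (P1 Q X Y) f) \<cdot> fst (FO (P1 Q Y Z) g))
        (fst (FO (P1 Q X Z) \<llangle>R \<Turnstile>\<^sub>1 X, f, Y, g, Z\<rrangle>))"
    if "X \<in> Cell0 R" "Y \<in> Cell0 R" "Z \<in> Cell0 R" "f \<in> Obj (HomC R X Y)" "g \<in> Obj (HomC R Y Z)" for X Y Z f g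
    using Q.pcmp_hom[OF that, THEN T_hom_par] by (simp add: T_simps)
  have punit: "Punit Q X \<in> Hom K (Unt K) (fst (FO (P1 Q X X) (Id1 R X)))" if "X \<in> Cell0 R" for X
    using Q.punit_hom[OF that, THEN T_hom_par] by (simp add: T_simps)
  have rcmp: "\<llangle>R \<Turnstile>\<^sub>1 X, f, Y, g, Z\<rrangle> \<in> Obj (HomC R X Z)"
    if "X \<in> Cell0 R" "Y \<in> Cell0 R" "Z \<in> Cell0 R" "f \<in> Obj (HomC R X Y)" "g \<in> Obj (HomC R Y Z)" for X Y Z f g
    using that P.S.hcomp_obj by blast
  have src: "Idn (HomC T (P0 P X) (P0 Q Y)) \<llangle>T \<Turnstile>\<^sub>1 P0 P X, FO (P1 P X Y) f, P0 P Y, t Y, P0 Q Y\<rrangle>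
      = Idn K (fst (FO (P1 Q X Y) f))"
    if "X \<in> Cell0 R" "Y \<in> Cell0 R" "f \<in> Obj (HomC R X Y)" for X Y f
    using that pU[OF that] by (simp add: T_simps t_par par strict_objs)
  note simps = T_simps t_par pU par arr cmp unit PK pcmp punit rcmp src P.S.id1_cell strict_simps
  have "strong_transformation R T P Q t (\<lambda>X Y f. Idn (HomC T (P0 P X) (P0 Q Y))
      \<llangle>T \<Turnstile>\<^sub>1 P0 P X, FO (P1 P X Y) f, P0 P Y, t Y, P0 Q Y\<rrangle>)"
  proof (rule strong_transformation_into_slices[OF P Q t t_par], goal_cases)
    case o: (3 X Y f)
    then show ?case
      using category.id_hom[OF T.homc_cat, of "P0 P X" "P0 Q Y"] T.hcomp_obj
      by (simp add: square[OF o, symmetric] P.ps_0cell Q.ps_0cell P.p1_obj t)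
  qed (simp_all add: simps is_iso_id)
  then show ?thesis using square by (simp add: two_natural_def)
qed

end

section \<open>The monoidal structure\<close>

lemma vcat_prod_simps:
  "VObj (vcat_prod V C D) = VObj C \<times> VObj D"
  "VHom (vcat_prod V C D) (A1, A2) (B1, B2) = VHom C A1 B1 \<otimes>[V] VHom D A2 B2"
  "VIdn (vcat_prod V C D) (A1, A2) = \<llangle>V \<Turnstile> Unt V, unit_split V, Unt V \<otimes>[V] Unt V,
      \<llangle>V \<Turnstile> Unt V, VIdn C A1, VHom C A1 A1 \<otimes> Unt V, VIdn D A2, VHom D A2 A2\<rrangle>,
      VHom C A1 A1 \<otimes>[V] VHom D A2 A2\<rrangle>"
  "VCmp (vcat_prod V C D) (A1, A2) (B1, B2) (E1, E2) =
      \<llangle>V \<Turnstile> (VHom C A1 B1 \<otimes>[V] VHom D A2 B2) \<otimes>[V] (VHom C B1 E1 \<otimes>[V] VHom D B2 E2),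
         interchange V (VHom C A1 B1) (VHom D A2 B2) (VHom C B1 E1) (VHom D B2 E2),
         (VHom C A1 B1 \<otimes>[V] VHom C B1 E1) \<otimes>[V] (VHom D A2 B2 \<otimes>[V] VHom D B2 E2),
         \<llangle>V \<Turnstile> VHom C A1 B1 \<otimes>[V] VHom C B1 E1, VCmp C A1 B1 E1, VHom C A1 E1 \<otimes>
            VHom D A2 B2 \<otimes>[V] VHom D B2 E2, VCmp D A2 B2 E2, VHom D A2 E2\<rrangle>,
         VHom C A1 E1 \<otimes>[V] VHom D A2 E2\<rrangle>"
  by (simp_all add: vcat_prod_def)

lemma underlying_monoidal_simps:
  "Obj (underlying_monoidal V C B) = VObj C"
  "Hom (underlying_monoidal V C B) X Y = Hom V (Unt V) (VHom C X Y)"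
  "Idn (underlying_monoidal V C B) = VIdn C"
  "FO (Tensor (underlying_monoidal V C B)) = VFO (VTensor B)"
  "Unt (underlying_monoidal V C B) = VUnt B"
  "Asc (underlying_monoidal V C B) = VAsc B"
  "Run (underlying_monoidal V C B) = VRun B"
  "Lun (underlying_monoidal V C B) = VLun B"
  by (simp_all add: underlying_monoidal_def underlying_def)

context sliced_vcategory
begin

text \<open>
  The image of an arrow of the underlying category of \<open>C\<close>: the arrow acts on the unit element.
\<close>

definition lift :: "'c \<Rightarrow> 'c \<Rightarrow> 'va \<Rightarrow> 'o \<times> 'a" where
  "lift X Y c = act (Unt V) (VHom C X Y) c (Keps N)"

text \<open>
  The unit laws solved for the product. In this form they match the composites with inverse unitors in
  which units are inserted in \<open>V\<close>.
\<close>

lemma unit_mul: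
  assumes "A \<in> Obj V" "x \<in> El A"
  shows "mul A (Unt V) (x, Keps N)
      = act A (A \<otimes>[V] Unt V) (inv_arr V (A \<otimes>[V] Unt V) A (Run V A)) x"
    and "mul (Unt V) A (Keps N, x)
      = act A (Unt V \<otimes>[V] A) (inv_arr V (Unt V \<otimes>[V] A) A (Lun V A)) x"
proof -
  have r: "inv_arr V (A \<otimes>[V] Unt V) A (Run V A) \<in> Hom V A (A \<otimes>[V] Unt V)"
    and l: "inv_arr V (Unt V \<otimes>[V] A) A (Lun V A) \<in> Hom V A (Unt V \<otimes>[V] A)"
    using assms G.C.inv_arr_hom[OF _ _ G.S.run_is_iso] G.C.inv_arr_hom[OF _ _ G.S.lun_is_iso]
    by (simp_all add: V.smc_simps)
  have "act A (A \<otimes>[V] Unt V) (inv_arr V (A \<otimes>[V] Unt V) A (Run V A))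
      (act (A \<otimes>[V] Unt V) A (Run V A) (mul A (Unt V) (x, Keps N)))
    = mul A (Unt V) (x, Keps N)"
    using assms r G.C.inv_arr_right[OF _ _ G.S.run_is_iso] by (simp add: slice.k_simps)
  then show "mul A (Unt V) (x, Keps N)
      = act A (A \<otimes>[V] Unt V) (inv_arr V (A \<otimes>[V] Unt V) A (Run V A)) x"
    using assms by (simp only: slice.mul_run)
  have "act A (Unt V \<otimes>[V] A) (inv_arr V (Unt V \<otimes>[V] A) A (Lun V A))
      (act (Unt V \<otimes>[V] A) A (Lun V A) (mul (Unt V) A (Keps N, x)))
    = mul (Unt V) A (Keps N, x)"
    using assms l G.C.inv_arr_right[OF _ _ G.S.lun_is_iso] by (simp add: slice.k_simps)
  then show "mul (Unt V) A (Keps N, x)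
      = act A (Unt V \<otimes>[V] A) (inv_arr V (Unt V \<otimes>[V] A) A (Lun V A)) x"
    using assms by (simp only: slice.mul_lun)
qed

lemma unit_split_hom: "unit_split V \<in> Hom V (Unt V) (Unt V \<otimes>[V] Unt V)"
  unfolding unit_split_def
  by (rule G.C.inv_arr_hom) (simp_all add: V.smc_simps G.S.lun_is_iso)

lemma unit_mul_unit: "mul (Unt V) (Unt V) (Keps N, Keps N)
    = act (Unt V) (Unt V \<otimes>[V] Unt V) (unit_split V) (Keps N)"
  unfolding unit_split_def by (rule unit_mul(2)) (simp_all add: G.S.unt_obj slice.k_eps)

lemma mul_lift:
  assumes "A \<in> Obj V" "B \<in> Obj V" "D \<in> Obj V" "c \<in> Hom V (Unt V) A" "d \<in> Hom V (Unt V) B"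
    "h \<in> Hom V (A \<otimes>[V] B) D"
  shows "act (A \<otimes>[V] B) D h
      (mul A B (act (Unt V) A c (Keps N), act (Unt V) B d (Keps N)))
    = act (Unt V) D \<llangle>V \<Turnstile> Unt V, unit_split V, Unt V \<otimes>[V] Unt V,
        \<llangle>V \<Turnstile> Unt V, c, A \<otimes> Unt V, d, B\<rrangle>, A \<otimes>[V] B, h, D\<rrangle> (Keps N)"
  using assms by (simp add: slice.mul_act unit_mul_unit slice.k_simps unit_split_hom)

lemma lift_obj: "\<lbrakk>X \<in> VObj C; Y \<in> VObj C; c \<in> Hom V (Unt V) (VHom C X Y)\<rbrakk>
    \<Longrightarrow> lift X Y c \<in> Obj (HomC T X Y)"
  by (simp add: lift_def change_of_base_simps slice.k_simps C.vhom_obj)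

lemma lift_par: "fst (lift X Y c) = Unt K"
  by (simp add: lift_def par_simps)

lemma lift_id: "Id1 T X = lift X X (VIdn C X)"
  by (simp add: lift_def change_of_base_simps)

lemma lift_hcomp:
  assumes "X \<in> VObj C" "Y \<in> VObj C" "Z \<in> VObj C"
    "c \<in> Hom V (Unt V) (VHom C X Y)" "d \<in> Hom V (Unt V) (VHom C Y Z)"
  shows "\<llangle>T \<Turnstile>\<^sub>1 X, lift X Y c, Y, lift Y Z d, Z\<rrangle> = lift X Z (Cmp (underlying V C) X Y Z c d)"
  using assms
  by (simp add: lift_def change_of_base_simps fn_simps underlying_def mul_lift C.vhom_obj C.vcmp_hom)

text \<open>
  Both composites are products of \<open>z\<close> with the unit element on which an arrow of \<open>V\<close> acts, and
  \<open>V\<close>-naturality of \<open>t\<close> is the equality of these two arrows, up to the inverse unitors that turn \<open>z\<close> into such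
  products.
\<close>

lemma lift_square:
  assumes nat: "v_nat_iso V D C F H t"
    and D: "A \<in> VObj D" "B \<in> VObj D" "VHom D A B \<in> Obj V"
    and F: "VFO F A \<in> VObj C" "VFO F B \<in> VObj C" "VFA F A B \<in> Hom V (VHom D A B) (VHom C (VFO F A) (VFO F B))"
    and H: "VFO H A \<in> VObj C" "VFO H B \<in> VObj C" "VFA H A B \<in> Hom V (VHom D A B) (VHom C (VFO H A) (VFO H B))"
    and t: "t A \<in> Hom V (Unt V) (VHom C (VFO F A) (VFO H A))" "t B \<in> Hom V (Unt V) (VHom C (VFO F B) (VFO H B))"
    and z: "z \<in> El (VHom D A B)"
  shows "\<llangle>T \<Turnstile>\<^sub>1 VFO F A, act (VHom D A B) (VHom C (VFO F A) (VFO F B)) (VFA F A B) z, VFO F B,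
      lift (VFO F B) (VFO H B) (t B), VFO H B\<rrangle>
    = \<llangle>T \<Turnstile>\<^sub>1 VFO F A, lift (VFO F A) (VFO H A) (t A), VFO H A,
      act (VHom D A B) (VHom C (VFO H A) (VFO H B)) (VFA H A B) z, VFO H B\<rrangle>"
proof -
  have inv: "inv_arr V (VHom D A B \<otimes>[V] Unt V) (VHom D A B) (Run V (VHom D A B)) \<in> Hom V (VHom D A B) (VHom D A B \<otimes>[V] Unt V)"
    "inv_arr V (Unt V \<otimes>[V] VHom D A B) (VHom D A B) (Lun V (VHom D A B)) \<in> Hom V (VHom D A B) (Unt V \<otimes>[V] VHom D A B)"
    using D G.C.inv_arr_hom[OF _ _ G.S.run_is_iso] G.C.inv_arr_hom[OF _ _ G.S.lun_is_iso]
    by (simp_all add: V.smc_simps)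
  note simps = D F H t z inv slice.k_simps C.vhom_obj C.vcmp_hom
  show ?thesis
    using nat D(1,2) unfolding v_nat_iso_def lift_def change_of_base_simps fn_simps
    by (simp add: simps slice.mul_act unit_mul)
qed

end

locale sliced_monoidal_vcategory = sliced_vcategory V K U G C + C: monoidal_vcategory V C B
  for V :: "('vo, 'va, 'v) sym_mon_cat_scheme" and K :: "('o, 'a, 'x) sym_mon_cat_scheme"
    and U :: "'o set" and G :: "('vo, 'va, 'o, 'a, 'g) lax_fn_scheme"
    and C :: "('c, 'vo, 'va, 'y) vcat_scheme" and B :: "('c, 'va, 'b) mon_struct_scheme"
begin

abbreviation ten where "ten A1 A2 B1 B2 \<equiv> VFA (VTensor B) (A1, A2) (B1, B2)"

interpretation ten: vfunctor V "vcat_prod V C C" C "VTensor B" by (rule C.vtensor_functor)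

lemma ten_obj: "A1 \<in> VObj C \<Longrightarrow> A2 \<in> VObj C \<Longrightarrow> A1 \<boxtimes>[B] A2 \<in> VObj C"
  using ten.vfun_obj[of "(A1, A2)"] by (simp add: vcat_prod_simps)

lemma ten_hom: "\<lbrakk>A1 \<in> VObj C; A2 \<in> VObj C; B1 \<in> VObj C; B2 \<in> VObj C\<rbrakk> \<Longrightarrow>
    ten A1 A2 B1 B2 \<in> Hom V (VHom C A1 B1 \<otimes>[V] VHom C A2 B2) (VHom C (A1 \<boxtimes>[B] A2) (B1 \<boxtimes>[B] B2))"
  using ten.vfun_hom[of "(A1, A2)" "(B1, B2)"] by (simp add: vcat_prod_simps)

lemmas ten_cmp = ten.vfun_cmp[of "(A1, A2)" "(B1, B2)" "(E1, E2)" for A1 A2 B1 B2 E1 E2,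
    unfolded vcat_prod_simps]

lemmas c_simps = C.vhom_obj C.vcmp_hom C.vid_hom ten_obj ten_hom C.vunt_obj

definition slice_tensor :: "('c \<times> 'c, ('o \<times> 'a) \<times> ('o \<times> 'a), 'a \<times> 'a, 'c, 'o \<times> 'a, 'a) psfn" where
  "slice_tensor = \<lparr>
    P0 = VFO (VTensor B),
    P1 = (\<lambda>(A1, A2) (B1, B2). fn_comp (Ktil N (VHom C A1 B1) (VHom C A2 B2))
      (Karr N (VHom C A1 B1 \<otimes>[V] VHom C A2 B2) (VHom C (A1 \<boxtimes>[B] A2) (B1 \<boxtimes>[B] B2)) (ten A1 A2 B1 B2))),
    Pcmp = (\<lambda>_ _ _ (f1, f2) (g1, g2). interchange K (fst f1) (fst f2) (fst g1) (fst g2)),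
    Punit = (\<lambda>_. Idn K (Unt K))\<rparr>"

lemma slice_tensor_simps:
  "P0 slice_tensor = VFO (VTensor B)"
  "P1 slice_tensor (A1, A2) (B1, B2) = fn_comp (Ktil N (VHom C A1 B1) (VHom C A2 B2))
      (Karr N (VHom C A1 B1 \<otimes>[V] VHom C A2 B2) (VHom C (A1 \<boxtimes>[B] A2) (B1 \<boxtimes>[B] B2)) (ten A1 A2 B1 B2))"
  "Pcmp slice_tensor X Y Z (f1, f2) (g1, g2) = interchange K (fst f1) (fst f2) (fst g1) (fst g2)"
  "Punit slice_tensor X = Idn K (Unt K)"
  by (simp_all add: slice_tensor_def)

lemma tensor_functor_slices:
  assumes "A1 \<in> VObj C" "A2 \<in> VObj C" "B1 \<in> VObj C" "B2 \<in> VObj C"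
  shows "cat_functor (prod_cat (HomC T A1 B1) (HomC T A2 B2)) (HomC T (A1 \<boxtimes>[B] A2) (B1 \<boxtimes>[B] B2))
    (P1 slice_tensor (A1, A2) (B1, B2))"
  unfolding slice_tensor_simps change_of_base_simps
  by (rule cat_functor_comp[OF slice.k_til_functor slice.k_functor])
     (simp_all add: assms c_simps G.S.tensor_obj)

lemma ten_cell: "\<lbrakk>A1 \<in> VObj C; A2 \<in> VObj C; B1 \<in> VObj C; B2 \<in> VObj C; x1 \<in> Obj (HomC T A1 B1);
    x2 \<in> Obj (HomC T A2 B2)\<rbrakk> \<Longrightarrow>
    FO (P1 slice_tensor (A1, A2) (B1, B2)) (x1, x2) \<in> Obj (HomC T (A1 \<boxtimes>[B] A2) (B1 \<boxtimes>[B] B2))"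
  using cat_functor.fun_obj[OF tensor_functor_slices, of A1 A2 B1 B2 "(x1, x2)"]
  by (simp add: prod_cat_simps)

lemma par_ten: "fst (FO (P1 slice_tensor (A1, A2) (B1, B2)) (x1, x2)) = fst x1 \<cdot> fst x2"
  by (simp add: slice_tensor_simps fn_simps par_simps)

lemma ten_arr: "FA (P1 slice_tensor (A1, A2) (B1, B2)) (x1, x2) (y1, y2) (\<phi>, \<psi>)
    = \<llangle>K \<Turnstile> fst x1, \<phi>, fst y1 \<otimes> fst x2, \<psi>, fst y2\<rrangle>"
  by (simp add: slice_tensor_simps fn_simps par_simps)

text \<open>
  Source and target are products of the same four elements in different orders. By \<open>V\<close>-functoriality of the
  product of \<open>C\<close>, the arrow acting on the former is the interchange map of \<open>V\<close> followed by the arrow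
  acting on the latter. So the 2-cell is the image of the one in \<open>mul_interchange_hom\<close> under the
  action of that arrow, which does not change the underlying arrow of \<open>K\<close>.
\<close>

lemma tensorator_hom:
  assumes o: "A1 \<in> VObj C" "A2 \<in> VObj C" "B1 \<in> VObj C" "B2 \<in> VObj C" "D1 \<in> VObj C" "D2 \<in> VObj C"
    and x: "f1 \<in> Obj (HomC T A1 B1)" "f2 \<in> Obj (HomC T A2 B2)" "g1 \<in> Obj (HomC T B1 D1)" "g2 \<in> Obj (HomC T B2 D2)"
  shows "interchange K (fst f1) (fst f2) (fst g1) (fst g2) \<in> Hom (HomC T (A1 \<boxtimes>[B] A2) (D1 \<boxtimes>[B] D2))
    \<llangle>T \<Turnstile>\<^sub>1 A1 \<boxtimes>[B] A2, FO (P1 slice_tensor (A1, A2) (B1, B2)) (f1, f2), B1 \<boxtimes>[B] B2,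
      FO (P1 slice_tensor (B1, B2) (D1, D2)) (g1, g2), D1 \<boxtimes>[B] D2\<rrangle>
    (FO (P1 slice_tensor (A1, A2) (D1, D2)) (\<llangle>T \<Turnstile>\<^sub>1 A1, f1, B1, g1, D1\<rrangle>, \<llangle>T \<Turnstile>\<^sub>1 A2, f2, B2, g2, D2\<rrangle>))"
    (is "_ \<in> Hom _ ?src ?tgt")
proof -
  let ?m = "interchange V (VHom C A1 B1) (VHom C A2 B2) (VHom C B1 D1) (VHom C B2 D2)"
  let ?E = "(VHom C A1 B1 \<otimes>[V] VHom C A2 B2) \<otimes>[V] (VHom C B1 D1 \<otimes>[V] VHom C B2 D2)"
  let ?E' = "(VHom C A1 B1 \<otimes>[V] VHom C B1 D1) \<otimes>[V] (VHom C A2 B2 \<otimes>[V] VHom C B2 D2)"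
  let ?h = "\<llangle>V \<Turnstile> ?E',
      \<llangle>V \<Turnstile> VHom C A1 B1 \<otimes>[V] VHom C B1 D1, VCmp C A1 B1 D1, VHom C A1 D1 \<otimes>
         VHom C A2 B2 \<otimes>[V] VHom C B2 D2, VCmp C A2 B2 D2, VHom C A2 D2\<rrangle>,
      VHom C A1 D1 \<otimes>[V] VHom C A2 D2, ten A1 A2 D1 D2, VHom C (A1 \<boxtimes>[B] A2) (D1 \<boxtimes>[B] D2)\<rrangle>"
  note x' = x[unfolded change_of_base_simps]
  have m: "?m \<in> Hom V ?E ?E'"
  proof -
    have inv: "inv_arr V ((A \<otimes>[V] A') \<otimes>[V] D) (A \<otimes>[V] (A' \<otimes>[V] D)) (Asc V A A' D)
        \<in> Hom V (A \<otimes>[V] (A' \<otimes>[V] D)) ((A \<otimes>[V] A') \<otimes>[V] D)"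
      if "A \<in> Obj V" "A' \<in> Obj V" "D \<in> Obj V" for A A' D
      using that G.C.inv_arr_hom[OF _ _ G.S.asc_is_iso] by (simp add: G.S.tensor_obj)
    show ?thesis by (simp add: interchange_def o c_simps V.smc_simps inv)
  qed
  note simps = o x' m c_simps slice.k_simps V.smc_simps fn_simps slice_tensor_simps change_of_base_simps
  have src: "?src = act ?E' (VHom C (A1 \<boxtimes>[B] A2) (D1 \<boxtimes>[B] D2)) ?h
      (act ?E ?E' ?m (mul (VHom C A1 B1 \<otimes>[V] VHom C A2 B2) (VHom C B1 D1 \<otimes>[V] VHom C B2 D2)
        (mul (VHom C A1 B1) (VHom C A2 B2) (f1, f2), mul (VHom C B1 D1) (VHom C B2 D2) (g1, g2))))"
    using ten_cmp[of A1 A2 B1 B2 D1 D2] by (simp add: simps slice.mul_act)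
  have tgt: "?tgt = act ?E' (VHom C (A1 \<boxtimes>[B] A2) (D1 \<boxtimes>[B] D2)) ?h
      (mul (VHom C A1 B1 \<otimes>[V] VHom C B1 D1) (VHom C A2 B2 \<otimes>[V] VHom C B2 D2)
        (mul (VHom C A1 B1) (VHom C B1 D1) (f1, g1), mul (VHom C A2 B2) (VHom C B2 D2) (f2, g2)))"
    by (simp add: simps slice.mul_act)
  show ?thesis
    unfolding src tgt unfolding change_of_base_simps
    by (intro act_hom_par mul_interchange_hom) (simp_all add: simps del: slice.act_cmp)
qed

lemma lift_tensor:
  assumes "A1 \<in> VObj C" "A2 \<in> VObj C" "B1 \<in> VObj C" "B2 \<in> VObj C"
    "c \<in> Hom V (Unt V) (VHom C A1 B1)" "d \<in> Hom V (Unt V) (VHom C A2 B2)"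
  shows "FO (P1 slice_tensor (A1, A2) (B1, B2)) (lift A1 B1 c, lift A2 B2 d)
    = lift (A1 \<boxtimes>[B] A2) (B1 \<boxtimes>[B] B2) (FA (Tensor (underlying_monoidal V C B)) (A1, A2) (B1, B2) (c, d))"
  using assms
  by (simp add: slice_tensor_simps fn_simps lift_def mul_lift underlying_monoidal_def c_simps)

interpretation UM: monoidal_category "underlying_monoidal V C B"
  by (rule C.underlying_is_monoidal)

lemma pseudofunctor_slice_tensor: "pseudofunctor TT T slice_tensor"
proof (intro pseudofunctor.intro pseudofunctor_axioms.intro two_category_prod T.two_category_axioms, goal_cases)
  case (1 X)
  then show ?case
    by (auto simp: prod_twocat_simps change_of_base_simps slice_tensor_simps ten_obj)
next
  case (2 X Y)
  then show ?case
    using tensor_functor_slices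
    by (cases X, cases Y) (simp add: prod_twocat_simps change_of_base_simps(1) slice_tensor_simps(1))
next
  \<comment> \<open>tensorators: invertibility and naturality\<close>
  case o: (3 X Y Z)
  obtain A1 A2 B1 B2 D1 D2 where X: "X = (A1, A2)" "Y = (B1, B2)" "Z = (D1, D2)"
    and c: "A1 \<in> VObj C" "A2 \<in> VObj C" "B1 \<in> VObj C" "B2 \<in> VObj C" "D1 \<in> VObj C" "D2 \<in> VObj C"
    using o by (auto simp: prod_twocat_simps change_of_base_simps)
  show ?case
  proof (rule nat_isoI, goal_cases)
    case (1 p)
    obtain f1 f2 g1 g2 where p: "p = ((f1, f2), (g1, g2))" by (metis surj_pair)
    have x: "f1 \<in> Obj (HomC T A1 B1)" "f2 \<in> Obj (HomC T A2 B2)" "g1 \<in> Obj (HomC T B1 D1)"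
        "g2 \<in> Obj (HomC T B2 D2)"
      using 1 by (simp_all add: X p prod_cat_simps prod_twocat_simps)
    have "is_iso K ((fst f1 \<cdot> fst f2) \<cdot> fst g1 \<cdot> fst g2) ((fst f1 \<cdot> fst g1) \<cdot> fst f2 \<cdot> fst g2)
        (interchange K (fst f1) (fst f2) (fst g1) (fst g2))"
      using interchange_inverse[OF x[THEN T_par_in_U]] by (auto simp: is_iso_def)
    then show ?case
      using x c tensorator_hom[OF c x]
      by (simp add: X p fn_simps prod_twocat_simps slice_tensor_simps(1,3) T_par_hcomp par_ten
          ten_cell ten_obj T.hcomp_obj change_of_base_simps(1) T_is_iso)
  next
    case (2 p p' \<xi>)
    obtain f1 f2 g1 g2 f1' f2' g1' g2' \<phi>1 \<phi>2 \<psi>1 \<psi>2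
      where p: "p = ((f1, f2), (g1, g2))" "p' = ((f1', f2'), (g1', g2'))" "\<xi> = ((\<phi>1, \<phi>2), (\<psi>1, \<psi>2))"
      by (metis surj_pair)
    have u: "fst f1 \<in> U" "fst f2 \<in> U" "fst g1 \<in> U" "fst g2 \<in> U"
        "fst f1' \<in> U" "fst f2' \<in> U" "fst g1' \<in> U" "fst g2' \<in> U"
        "\<phi>1 \<in> Hom K (fst f1) (fst f1')" "\<phi>2 \<in> Hom K (fst f2) (fst f2')"
        "\<psi>1 \<in> Hom K (fst g1) (fst g1')" "\<psi>2 \<in> Hom K (fst g2) (fst g2')"
      using 2 by (auto simp: X p prod_cat_simps prod_twocat_simps intro: T_par_in_U T_hom_par)
    show ?case
      using interchange_natural[OF u]
      by (simp add: X p fn_simps prod_twocat_simps slice_tensor_simps(1,3) T_simps ten_arr par_ten)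
  qed
next
  \<comment> \<open>unitors\<close>
  case (4 X)
  then obtain A1 A2 where X: "X = (A1, A2)" and o: "A1 \<in> VObj C" "A2 \<in> VObj C"
    by (auto simp: prod_twocat_simps change_of_base_simps)
  have "FO (P1 slice_tensor X X) (Id1 TT X) = Id1 T (P0 slice_tensor X)"
    using UM.tensor_id[of A1 A2] o
    by (simp add: X prod_twocat_simps lift_id lift_tensor c_simps slice_tensor_simps(1) underlying_monoidal_simps)
  then show ?case
    using category.is_iso_id[OF T.homc_cat, of "P0 slice_tensor X" "P0 slice_tensor X" "Id1 T (P0 slice_tensor X)"]
      T.id1_cell[of "P0 slice_tensor X"] o
    by (simp add: X T_simps slice_tensor_simps(1,4) change_of_base_simps(1) ten_obj)
next
  \<comment> \<open>associativity of the tensorators\<close>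
  case o: (5 W X Y Z f g h)
  obtain W1 W2 X1 X2 Y1 Y2 Z1 Z2 f1 f2 g1 g2 h1 h2 where X: "W = (W1, W2)" "X = (X1, X2)" "Y = (Y1, Y2)"
    "Z = (Z1, Z2)" "f = (f1, f2)" "g = (g1, g2)" "h = (h1, h2)"
    by (metis surj_pair)
  have u: "fst f1 \<in> U" "fst f2 \<in> U" "fst g1 \<in> U" "fst g2 \<in> U" "fst h1 \<in> U" "fst h2 \<in> U"
    using o unfolding X by (auto simp: prod_twocat_simps prod_cat_simps T_par_in_U)
  show ?case
    using interchange_assoc[OF u]
    by (simp add: Let_def X u T_simps slice_tensor_simps(1,3) prod_twocat_simps par_ten strict_objs
        lw_def rw_def)
next
  \<comment> \<open>unit laws of the tensorators\<close>
  case (6 X Y f)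
  obtain A1 A2 B1 B2 f1 f2 where X: "X = (A1, A2)" "Y = (B1, B2)" "f = (f1, f2)"
    by (metis surj_pair)
  have "fst f1 \<in> U" "fst f2 \<in> U"
    using 6 unfolding X by (auto simp: prod_twocat_simps prod_cat_simps T_par_in_U)
  then show ?case
    by (simp add: Let_def X T_simps slice_tensor_simps(1,3,4) prod_twocat_simps ten_arr par_ten
        interchange_unit strict_simps tensor_id)
next
  case (7 X Y f)
  obtain A1 A2 B1 B2 f1 f2 where X: "X = (A1, A2)" "Y = (B1, B2)" "f = (f1, f2)"
    by (metis surj_pair)
  have "fst f1 \<in> U" "fst f2 \<in> U"
    using 7 unfolding X by (auto simp: prod_twocat_simps prod_cat_simps T_par_in_U)
  then show ?case
    by (simp add: Let_def X T_simps slice_tensor_simps(1,3,4) prod_twocat_simps ten_arr par_ten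
        interchange_unit strict_simps tensor_id)
qed

lemmas um_simps = underlying_monoidal_simps

lemma lift_hcomp_um:
  assumes "X \<in> VObj C" "Y \<in> VObj C" "Z \<in> VObj C"
    "c \<in> Hom V (Unt V) (VHom C X Y)" "d \<in> Hom V (Unt V) (VHom C Y Z)"
  shows "\<llangle>T \<Turnstile>\<^sub>1 X, lift X Y c, Y, lift Y Z d, Z\<rrangle> = lift X Z (Cmp (underlying_monoidal V C B) X Y Z c d)"
  using lift_hcomp[OF assms] by (simp add: underlying_monoidal_def)

lemma um_hom:
  "A1 \<in> VObj C \<Longrightarrow> A2 \<in> VObj C \<Longrightarrow> A3 \<in> VObj C \<Longrightarrow>
    VAsc B A1 A2 A3 \<in> Hom V (Unt V) (VHom C ((A1 \<boxtimes>[B] A2) \<boxtimes>[B] A3) (A1 \<boxtimes>[B] (A2 \<boxtimes>[B] A3)))"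
  "A1 \<in> VObj C \<Longrightarrow> VRun B A1 \<in> Hom V (Unt V) (VHom C (A1 \<boxtimes>[B] VUnt B) A1)"
  "A1 \<in> VObj C \<Longrightarrow> VLun B A1 \<in> Hom V (Unt V) (VHom C (VUnt B \<boxtimes>[B] A1) A1)"
  using UM.asc_hom UM.run_hom UM.lun_hom by (simp_all add: um_simps)

lemma um_tensor_hom:
  "\<lbrakk>A1 \<in> VObj C; A2 \<in> VObj C; B1 \<in> VObj C; B2 \<in> VObj C; c \<in> Hom V (Unt V) (VHom C A1 B1);
    d \<in> Hom V (Unt V) (VHom C A2 B2)\<rbrakk> \<Longrightarrow>
    FA (Tensor (underlying_monoidal V C B)) (A1, A2) (B1, B2) (c, d)
      \<in> Hom V (Unt V) (VHom C (A1 \<boxtimes>[B] A2) (B1 \<boxtimes>[B] B2))"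
  using UM.tensor_hom[of A1 B1 A2 B2 c d] by (simp add: um_simps)

lemma um_cmp_hom:
  "\<lbrakk>X \<in> VObj C; Y \<in> VObj C; Z \<in> VObj C; c \<in> Hom V (Unt V) (VHom C X Y); d \<in> Hom V (Unt V) (VHom C Y Z)\<rbrakk>
    \<Longrightarrow> Cmp (underlying_monoidal V C B) X Y Z c d \<in> Hom V (Unt V) (VHom C X Z)"
  using UM.cmp_hom[of X Y Z c d] by (simp add: um_simps)

lemma lift_iso:
  assumes "X \<in> VObj C" "Y \<in> VObj C" "is_iso (underlying_monoidal V C B) X Y c"
  shows "iso_1cell T X Y (lift X Y c)"
proof -
  obtain d where "inverse_arrows (underlying_monoidal V C B) X Y c d"
    using assms by (auto simp: is_iso_def)
  then show ?thesis
    using assms unfolding iso_1cell_def inverse_arrows_def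
    by (intro conjI bexI[of _ "lift Y X d"]) (simp_all add: lift_obj lift_hcomp_um um_simps lift_id)
qed

definition slice_monoidal :: "('c, 'o \<times> 'a, 'a) mon_twostruct" where
  "slice_monoidal = \<lparr>
    TTensor = slice_tensor,
    TUnt = VUnt B,
    TAsc = (\<lambda>A1 A2 A3. lift ((A1 \<boxtimes>[B] A2) \<boxtimes>[B] A3) (A1 \<boxtimes>[B] (A2 \<boxtimes>[B] A3)) (VAsc B A1 A2 A3)),
    TRun = (\<lambda>A. lift (A \<boxtimes>[B] VUnt B) A (VRun B A)),
    TLun = (\<lambda>A. lift (VUnt B \<boxtimes>[B] A) A (VLun B A))\<rparr>"

lemma slice_monoidal_simps:
  "TTensor slice_monoidal = slice_tensor"
  "TUnt slice_monoidal = VUnt B"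
  "TAsc slice_monoidal A1 A2 A3 = lift ((A1 \<boxtimes>[B] A2) \<boxtimes>[B] A3) (A1 \<boxtimes>[B] (A2 \<boxtimes>[B] A3)) (VAsc B A1 A2 A3)"
  "TRun slice_monoidal A = lift (A \<boxtimes>[B] VUnt B) A (VRun B A)"
  "TLun slice_monoidal A = lift (VUnt B \<boxtimes>[B] A) A (VLun B A)"
  by (simp_all add: slice_monoidal_def)

lemmas strict_ps_simps = ps_id_def ps_const_def ps_assoc_def ps_swap_def strict_psfn_simps

lemmas ps_simps = ps_comp_simps ps_prod_simps ps_pair_simps strict_ps_simps prod_twocat_simps
  prod_cat_simps fn_simps

abbreviation TTT where "TTT \<equiv> prod_twocat TT T"

abbreviation asc_source where
  "asc_source \<equiv> ps_comp TTT TT T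
    (ps_prod slice_tensor (ps_id T)) slice_tensor"

abbreviation asc_target where
  "asc_target \<equiv> ps_comp TTT (prod_twocat T TT) T
    (ps_assoc T T T) (ps_comp (prod_twocat T TT) TT T
      (ps_prod (ps_id T) slice_tensor) slice_tensor)"

lemma slice_asc_square:
  assumes o: "A1 \<in> VObj C" "A2 \<in> VObj C" "A3 \<in> VObj C" "B1 \<in> VObj C" "B2 \<in> VObj C" "B3 \<in> VObj C"
    and x: "f1 \<in> Obj (HomC T A1 B1)" "f2 \<in> Obj (HomC T A2 B2)" "f3 \<in> Obj (HomC T A3 B3)"
  shows "\<llangle>T \<Turnstile>\<^sub>1 (A1 \<boxtimes>[B] A2) \<boxtimes>[B] A3,
      FO (P1 slice_tensor (A1 \<boxtimes>[B] A2, A3) (B1 \<boxtimes>[B] B2, B3)) (FO (P1 slice_tensor (A1, A2) (B1, B2)) (f1, f2), f3),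
      (B1 \<boxtimes>[B] B2) \<boxtimes>[B] B3, TAsc slice_monoidal B1 B2 B3, B1 \<boxtimes>[B] (B2 \<boxtimes>[B] B3)\<rrangle>
    = \<llangle>T \<Turnstile>\<^sub>1 (A1 \<boxtimes>[B] A2) \<boxtimes>[B] A3, TAsc slice_monoidal A1 A2 A3, A1 \<boxtimes>[B] (A2 \<boxtimes>[B] A3),
      FO (P1 slice_tensor (A1, A2 \<boxtimes>[B] A3) (B1, B2 \<boxtimes>[B] B3)) (f1, FO (P1 slice_tensor (A2, A3) (B2, B3)) (f2, f3)),
      B1 \<boxtimes>[B] (B2 \<boxtimes>[B] B3)\<rrangle>"
proof -
  note x' = x[unfolded change_of_base_simps]
  note simps = o x' c_simps slice.k_simps V.smc_simps fn_simps slice_tensor_simps vcat_prod_simps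
    vfn_comp_def vfn_prod_def vfn_assoc_def vfn_id_def um_hom
  let ?z = "mul (VHom C A1 B1 \<otimes>[V] VHom C A2 B2) (VHom C A3 B3)
    (mul (VHom C A1 B1) (VHom C A2 B2) (f1, f2), f3)"
  show ?thesis
    using lift_square[OF C.vasc_nat_iso, of "((A1, A2), A3)" "((B1, B2), B3)" ?z]
    by (simp add: simps slice_monoidal_simps slice.mul_act_left slice.mul_act_right
        slice.mul_assoc[symmetric])
qed

text \<open>
  The naturality squares commute by \<open>V\<close>-naturality of the associator of \<open>C\<close>. The compositors of source and
  target rearrange a product of six parameter objects in two steps, which agree by
  \<open>interchange_interchange\<close>.
\<close>

lemma tasc_natural:
  "two_natural TTT T asc_source asc_target
    (\<lambda>((A, A'), A''). TAsc slice_monoidal A A' A'')"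
proof (rule two_natural_into_slices, goal_cases)
  case 1
  show ?case
    by (intro pseudofunctor_comp pseudofunctor_prod pseudofunctor_slice_tensor pseudofunctor_id
        T.two_category_axioms)
next
  case 2
  show ?case
    by (intro pseudofunctor_comp pseudofunctor_prod pseudofunctor_slice_tensor pseudofunctor_id
        pseudofunctor_assoc T.two_category_axioms)
next
  case (5 X Y f)
  then show ?case
    using slice_asc_square by (auto simp: ps_simps slice_tensor_simps(1) change_of_base_simps(1))
next
  case (6 X Y f f' \<phi>)
  obtain X1 X2 X3 Y1 Y2 Y3 f1 f2 f3 g1 g2 g3 \<phi>1 \<phi>2 \<phi>3
    where X: "X = ((X1, X2), X3)" "Y = ((Y1, Y2), Y3)"
      "f = ((f1, f2), f3)" "f' = ((g1, g2), g3)" "\<phi> = ((\<phi>1, \<phi>2), \<phi>3)"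
    by (metis surj_pair)
  have "fst f1 \<in> U" "fst f2 \<in> U" "fst f3 \<in> U" "fst g1 \<in> U" "fst g2 \<in> U" "fst g3 \<in> U"
    "\<phi>1 \<in> Hom K (fst f1) (fst g1)" "\<phi>2 \<in> Hom K (fst f2) (fst g2)" "\<phi>3 \<in> Hom K (fst f3) (fst g3)"
    using 6 unfolding X
    by (auto simp: prod_twocat_simps prod_cat_simps intro: T_par_in_U T_hom_par)
  then show ?case
    by (simp add: X ps_simps ten_arr par_ten slice_tensor_simps(1) strict_arr_assoc)
next
  case (7 X Y Z f g)
  obtain X1 X2 X3 Y1 Y2 Y3 Z1 Z2 Z3 f1 f2 f3 g1 g2 g3
    where X: "X = ((X1, X2), X3)" "Y = ((Y1, Y2), Y3)" "Z = ((Z1, Z2), Z3)"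
      "f = ((f1, f2), f3)" "g = ((g1, g2), g3)"
    by (metis surj_pair)
  have u: "fst f1 \<in> U" "fst f2 \<in> U" "fst f3 \<in> U" "fst g1 \<in> U" "fst g2 \<in> U" "fst g3 \<in> U"
    using 7 unfolding X by (auto simp: prod_twocat_simps prod_cat_simps T_par_in_U)
  show ?case
    using interchange_interchange[OF u] u
    by (simp add: X ps_simps Let_def T_simps ten_arr par_ten slice_tensor_simps(1,3) strict_simps
        interchange_hom lw_def[symmetric] rw_def[symmetric])
qed (auto simp: ps_simps Let_def T_simps ten_arr par_ten slice_tensor_simps(1,4) strict_simps tensor_id
    slice_monoidal_simps change_of_base_simps(1) lift_par c_simps um_hom intro!: lift_obj)

abbreviation run_source where
  "run_source \<equiv> ps_comp T TT T (ps_pair (ps_id T) (ps_const T (VUnt B))) slice_tensor"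

abbreviation lun_source where
  "lun_source \<equiv> ps_comp T TT T (ps_pair (ps_const T (VUnt B)) (ps_id T)) slice_tensor"

lemma slice_run_square:
  assumes o: "X \<in> VObj C" "Y \<in> VObj C" and x: "f \<in> Obj (HomC T X Y)"
  shows "\<llangle>T \<Turnstile>\<^sub>1 X \<boxtimes>[B] VUnt B, FO (P1 slice_tensor (X, VUnt B) (Y, VUnt B)) (f, Id1 T (VUnt B)),
      Y \<boxtimes>[B] VUnt B, TRun slice_monoidal Y, Y\<rrangle>
    = \<llangle>T \<Turnstile>\<^sub>1 X \<boxtimes>[B] VUnt B, TRun slice_monoidal X, X, f, Y\<rrangle>" (is ?run)
  and slice_lun_square: "\<llangle>T \<Turnstile>\<^sub>1 VUnt B \<boxtimes>[B] X, FO (P1 slice_tensor (VUnt B, X) (VUnt B, Y)) (Id1 T (VUnt B), f),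
      VUnt B \<boxtimes>[B] Y, TLun slice_monoidal Y, Y\<rrangle>
    = \<llangle>T \<Turnstile>\<^sub>1 VUnt B \<boxtimes>[B] X, TLun slice_monoidal X, X, f, Y\<rrangle>" (is ?lun)
proof -
  note x' = x[unfolded change_of_base_simps]
  have inv: "inv_arr V (VHom C X Y \<otimes>[V] Unt V) (VHom C X Y) (Run V (VHom C X Y)) \<in> Hom V (VHom C X Y) (VHom C X Y \<otimes>[V] Unt V)"
    "inv_arr V (Unt V \<otimes>[V] VHom C X Y) (VHom C X Y) (Lun V (VHom C X Y)) \<in> Hom V (VHom C X Y) (Unt V \<otimes>[V] VHom C X Y)"
    using o G.C.inv_arr_hom[OF _ _ G.S.run_is_iso] G.C.inv_arr_hom[OF _ _ G.S.lun_is_iso]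
    by (simp_all add: V.smc_simps C.vhom_obj)
  note simps = o x' inv c_simps slice.k_simps V.smc_simps fn_simps slice_tensor_simps vcat_prod_simps
    vfn_comp_def vfn_insert_right_def vfn_insert_left_def vfn_id_def um_hom
  show ?run
    using lift_square[OF C.vrun_nat_iso, of X Y f]
    by (simp add: simps slice_monoidal_simps change_of_base_simps(3) slice.mul_act_right unit_mul)
  show ?lun
    using lift_square[OF C.vlun_nat_iso, of X Y f]
    by (simp add: simps slice_monoidal_simps change_of_base_simps(3) slice.mul_act_left unit_mul)
qed

lemma trun_natural: "two_natural T T run_source (ps_id T) (TRun slice_monoidal)"
proof (rule two_natural_into_slices)
  show "pseudofunctor T T run_source"
    by (intro pseudofunctor_comp pseudofunctor_pair pseudofunctor_slice_tensor pseudofunctor_id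
        pseudofunctor_const T.two_category_axioms) (simp add: change_of_base_simps c_simps)
  show "pseudofunctor T T (ps_id T)" by (intro pseudofunctor_id T.two_category_axioms)
qed (auto simp: ps_simps Let_def slice_monoidal_simps(4) slice_run_square[unfolded slice_monoidal_simps] slice_tensor_simps(1,3,4)
    T_simps ten_arr par_ten lift_par T_par_in_U T_hom_par interchange_unit strict_arr_unit_right strict_simps
    tensor_id change_of_base_simps(1) c_simps um_hom intro!: lift_obj)

lemma tlun_natural: "two_natural T T lun_source (ps_id T) (TLun slice_monoidal)"
proof (rule two_natural_into_slices)
  show "pseudofunctor T T lun_source"
    by (intro pseudofunctor_comp pseudofunctor_pair pseudofunctor_slice_tensor pseudofunctor_id
        pseudofunctor_const T.two_category_axioms) (simp add: change_of_base_simps c_simps)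
  show "pseudofunctor T T (ps_id T)" by (intro pseudofunctor_id T.two_category_axioms)
qed (auto simp: ps_simps Let_def slice_monoidal_simps(5) slice_lun_square[unfolded slice_monoidal_simps] slice_tensor_simps(1,3,4)
    T_simps ten_arr par_ten lift_par T_par_in_U T_hom_par interchange_unit strict_arr_unit_left strict_simps
    tensor_id change_of_base_simps(1) c_simps um_hom intro!: lift_obj)

text \<open>
  As every coherence 1-cell is lifted, the pentagon, the triangle and invertibility are lifted from the
  underlying monoidal category of \<open>C\<close>.
\<close>

theorem nearly_strict_monoidal_slice: "nearly_strict_monoidal T slice_monoidal"
proof (intro nearly_strict_monoidal.intro nearly_strict_monoidal_axioms.intro T.two_category_axioms,
    goal_cases)
  note simps = slice_monoidal_simps slice_tensor_simps(1) change_of_base_simps(1) um_simps c_simps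
    lift_id lift_tensor lift_hcomp_um um_hom um_tensor_hom um_cmp_hom
  {
    case (3 A1 A2 A3)
    then show ?case using UM.asc_is_iso[of A1 A2 A3] by (auto simp: simps intro!: lift_iso)
  next
    case (4 A)
    then show ?case using UM.run_is_iso[of A] by (auto simp: simps intro!: lift_iso)
  next
    case (5 A)
    then show ?case using UM.lun_is_iso[of A] by (auto simp: simps intro!: lift_iso)
  next
    case (9 A1 A2 A3 A4)
    then show ?case using UM.pentagon[of A1 A2 A3 A4] by (simp add: simps)
  next
    case (10 A1 A2)
    then show ?case using UM.triangle[of A1 A2] by (simp add: simps)
  }
qed (simp_all add: slice_monoidal_simps(1,2) pseudofunctor_slice_tensor tasc_natural trun_natural
    tlun_natural change_of_base_simps(1) c_simps)

end

section \<open>The symmetry\<close>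

lemma underlying_symmetric_simps:
  "Obj (underlying_symmetric V C B s) = VObj C"
  "Hom (underlying_symmetric V C B s) X Y = Hom V (Unt V) (VHom C X Y)"
  "Idn (underlying_symmetric V C B s) = VIdn C"
  "Cmp (underlying_symmetric V C B s) = Cmp (underlying_monoidal V C B)"
  "Tensor (underlying_symmetric V C B s) = Tensor (underlying_monoidal V C B)"
  "Unt (underlying_symmetric V C B s) = VUnt B"
  "Asc (underlying_symmetric V C B s) = VAsc B"
  "Run (underlying_symmetric V C B s) = VRun B"
  "Lun (underlying_symmetric V C B s) = VLun B"
  "Sym (underlying_symmetric V C B s) = s"
  by (simp_all add: underlying_symmetric_def underlying_monoidal_def underlying_def
      mon_cat.extend_def)

context sliced_monoidal_vcategory
begin

definition slice_sym :: "('c \<Rightarrow> 'c \<Rightarrow> 'va) \<Rightarrow> 'c \<Rightarrow> 'c \<Rightarrow> 'o \<times> 'a" where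
  "slice_sym s A1 A2 = lift (A1 \<boxtimes>[B] A2) (A2 \<boxtimes>[B] A1) (s A1 A2)"

definition slice_sym_cell :: "'c \<times> 'c \<Rightarrow> 'c \<times> 'c \<Rightarrow> ('o \<times> 'a) \<times> ('o \<times> 'a) \<Rightarrow> 'a" where
  "slice_sym_cell X Y f = Sym K (fst (fst f)) (fst (snd f))"

abbreviation sym_target where
  "sym_target \<equiv> ps_comp TT TT T (ps_swap T T) slice_tensor"

text \<open>
  \<open>V\<close>-naturality of \<open>s\<close> moves the symmetry 1-cell to the front at the cost of letting the symmetry of \<open>V\<close> act
  on the product of \<open>f1\<close> and \<open>f2\<close>. By \<open>mul_sym_hom\<close> there is a 2-cell from the result to the product of \<open>f2\<close>
  and \<open>f1\<close>; whiskering it with the symmetry 1-cell does not change the underlying arrow of \<open>K\<close>.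
\<close>

lemma slice_sym_cell_hom:
  assumes sym: "symmetric_monoidal_vcategory V C B s"
    and o: "A1 \<in> VObj C" "A2 \<in> VObj C" "B1 \<in> VObj C" "B2 \<in> VObj C"
    and x: "f1 \<in> Obj (HomC T A1 B1)" "f2 \<in> Obj (HomC T A2 B2)"
  shows "Sym K (fst f1) (fst f2) \<in> Hom (HomC T (A1 \<boxtimes>[B] A2) (B2 \<boxtimes>[B] B1))
    \<llangle>T \<Turnstile>\<^sub>1 A1 \<boxtimes>[B] A2, FO (P1 slice_tensor (A1, A2) (B1, B2)) (f1, f2), B1 \<boxtimes>[B] B2, slice_sym s B1 B2,
      B2 \<boxtimes>[B] B1\<rrangle>
    \<llangle>T \<Turnstile>\<^sub>1 A1 \<boxtimes>[B] A2, slice_sym s A1 A2, A2 \<boxtimes>[B] A1, FO (P1 slice_tensor (A2, A1) (B2, B1)) (f2, f1),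
      B2 \<boxtimes>[B] B1\<rrangle>"
proof -
  interpret sym: symmetric_monoidal_vcategory V C B s by (rule sym)
  interpret US: symmetric_monoidal_category "underlying_symmetric V C B s"
    by (rule sym.underlying_is_symmetric)
  have s: "s A A' \<in> Hom V (Unt V) (VHom C (A \<boxtimes>[B] A') (A' \<boxtimes>[B] A))" if "A \<in> VObj C" "A' \<in> VObj C" for A A'
    using US.sym_hom[of A A'] that by (simp add: underlying_symmetric_simps underlying_monoidal_simps)
  note x' = x[unfolded change_of_base_simps]
  note simps = o x' s c_simps slice.k_simps V.smc_simps fn_simps slice_tensor_simps vcat_prod_simps
    vfn_comp_def vfn_swap_def
  let ?z = "mul (VHom C A1 B1) (VHom C A2 B2) (f1, f2)"
  let ?w = "act (VHom C A1 B1 \<otimes>[V] VHom C A2 B2) (VHom C A2 B2 \<otimes>[V] VHom C A1 B1)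
    (Sym V (VHom C A1 B1) (VHom C A2 B2)) ?z"
  let ?ten = "act (VHom C A2 B2 \<otimes>[V] VHom C A1 B1) (VHom C (A2 \<boxtimes>[B] A1) (B2 \<boxtimes>[B] B1)) (ten A2 A1 B2 B1)"
  have src: "\<llangle>T \<Turnstile>\<^sub>1 A1 \<boxtimes>[B] A2, FO (P1 slice_tensor (A1, A2) (B1, B2)) (f1, f2), B1 \<boxtimes>[B] B2, slice_sym s B1 B2,
      B2 \<boxtimes>[B] B1\<rrangle>
    = \<llangle>T \<Turnstile>\<^sub>1 A1 \<boxtimes>[B] A2, slice_sym s A1 A2, A2 \<boxtimes>[B] A1, ?ten ?w, B2 \<boxtimes>[B] B1\<rrangle>"
    using lift_square[OF sym.vsym_nat_iso, of "(A1, A2)" "(B1, B2)" ?z]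
    by (simp add: simps slice_sym_def)
  have cell: "Sym K (fst f1) (fst f2) \<in> Hom (Kfun N (VHom C (A2 \<boxtimes>[B] A1) (B2 \<boxtimes>[B] B1)))
      (?ten ?w) (?ten (mul (VHom C A2 B2) (VHom C A1 B1) (f2, f1)))"
    by (intro act_hom_par mul_sym_hom) (simp_all add: simps del: slice.act_cmp)
  have "FA (HComp T (A1 \<boxtimes>[B] A2) (A2 \<boxtimes>[B] A1) (B2 \<boxtimes>[B] B1)) (slice_sym s A1 A2, ?ten ?w)
      (slice_sym s A1 A2, ?ten (mul (VHom C A2 B2) (VHom C A1 B1) (f2, f1)))
      (Idn (HomC T (A1 \<boxtimes>[B] A2) (A2 \<boxtimes>[B] A1)) (slice_sym s A1 A2), Sym K (fst f1) (fst f2))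
    \<in> Hom (HomC T (A1 \<boxtimes>[B] A2) (B2 \<boxtimes>[B] B1))
      \<llangle>T \<Turnstile>\<^sub>1 A1 \<boxtimes>[B] A2, slice_sym s A1 A2, A2 \<boxtimes>[B] A1, ?ten ?w, B2 \<boxtimes>[B] B1\<rrangle>
      \<llangle>T \<Turnstile>\<^sub>1 A1 \<boxtimes>[B] A2, slice_sym s A1 A2, A2 \<boxtimes>[B] A1,
        ?ten (mul (VHom C A2 B2) (VHom C A1 B1) (f2, f1)), B2 \<boxtimes>[B] B1\<rrangle>"
  proof (rule T.hcomp_hom[OF _ _ _ _ _ _ _ _ _ refl refl])
    show t: "slice_sym s A1 A2 \<in> Obj (HomC T (A1 \<boxtimes>[B] A2) (A2 \<boxtimes>[B] A1))"
      unfolding slice_sym_def by (rule lift_obj) (simp_all add: simps)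
    then show "slice_sym s A1 A2 \<in> Obj (HomC T (A1 \<boxtimes>[B] A2) (A2 \<boxtimes>[B] A1))" .
    from t show "Idn (HomC T (A1 \<boxtimes>[B] A2) (A2 \<boxtimes>[B] A1)) (slice_sym s A1 A2)
        \<in> Hom (HomC T (A1 \<boxtimes>[B] A2) (A2 \<boxtimes>[B] A1)) (slice_sym s A1 A2) (slice_sym s A1 A2)"
      by (intro category.id_hom[OF T.homc_cat]) (simp_all add: change_of_base_simps(1) simps)
  qed (use cell in \<open>simp_all add: change_of_base_simps(1,2) simps del: slice.act_cmp\<close>)
  moreover have "FA (HComp T (A1 \<boxtimes>[B] A2) (A2 \<boxtimes>[B] A1) (B2 \<boxtimes>[B] B1)) (slice_sym s A1 A2, ?ten ?w)
      (slice_sym s A1 A2, ?ten (mul (VHom C A2 B2) (VHom C A1 B1) (f2, f1)))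
      (Idn (HomC T (A1 \<boxtimes>[B] A2) (A2 \<boxtimes>[B] A1)) (slice_sym s A1 A2), Sym K (fst f1) (fst f2))
    = Sym K (fst f1) (fst f2)"
    using x by (simp add: T_simps par_simps slice_sym_def lift_par T_par_in_U strict_simps strict_arr_unit_left)
  ultimately show ?thesis
    unfolding src by (simp add: slice_tensor_simps fn_simps)
qed

theorem nearly_strict_symmetric_monoidal_slice:
  assumes sym: "symmetric_monoidal_vcategory V C B s"
  shows "nearly_strict_symmetric_monoidal T slice_monoidal (slice_sym s) slice_sym_cell"
proof -
  interpret sym: symmetric_monoidal_vcategory V C B s by (rule sym)
  interpret US: symmetric_monoidal_category "underlying_symmetric V C B s"
    by (rule sym.underlying_is_symmetric)
  have s: "s A A' \<in> Hom V (Unt V) (VHom C (A \<boxtimes>[B] A') (A' \<boxtimes>[B] A))" if "A \<in> VObj C" "A' \<in> VObj C" for A A'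
    using US.sym_hom[of A A'] that by (simp add: underlying_symmetric_simps underlying_monoidal_simps)
  note us_simps = underlying_symmetric_simps underlying_monoidal_simps
  note simps = slice_monoidal_simps slice_tensor_simps(1) change_of_base_simps(1) us_simps c_simps
    lift_id lift_tensor lift_hcomp_um um_hom um_tensor_hom um_cmp_hom slice_sym_def s
  have strong: "strong_transformation TT T slice_tensor sym_target (\<lambda>(A, A'). slice_sym s A A') slice_sym_cell"
  proof (rule strong_transformation_into_slices, goal_cases)
    case 1
    show ?case by (rule pseudofunctor_slice_tensor)
  next
    case 2
    show ?case
      by (intro pseudofunctor_comp pseudofunctor_swap pseudofunctor_slice_tensor T.two_category_axioms)
  next
    \<comment> \<open>boundaries of the naturality 2-cells\<close>
    case (5 X Y f)
    obtain A1 A2 B1 B2 f1 f2 where X: "X = (A1, A2)" "Y = (B1, B2)" "f = (f1, f2)"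
      by (metis surj_pair)
    show ?case
      using slice_sym_cell_hom[OF sym, of A1 A2 B1 B2 f1 f2] 5
      by (simp add: X ps_simps slice_tensor_simps(1) slice_sym_cell_def change_of_base_simps(1))
  next
    \<comment> \<open>their invertibility\<close>
    case (6 X Y f)
    obtain A1 A2 B1 B2 f1 f2 where X: "X = (A1, A2)" "Y = (B1, B2)" "f = (f1, f2)"
      by (metis surj_pair)
    have "fst f1 \<in> U" "fst f2 \<in> U"
      using 6 unfolding X by (auto simp: prod_twocat_simps prod_cat_simps intro: T_par_in_U)
    then show ?case
      by (simp add: X ps_simps par_ten slice_tensor_simps(1) slice_sym_cell_def K.sym_is_iso strict_obj)
  next
    \<comment> \<open>their naturality\<close>
    case (7 X Y f f' \<phi>)
    obtain A1 A2 B1 B2 f1 f2 g1 g2 \<phi>1 \<phi>2 where X: "X = (A1, A2)" "Y = (B1, B2)" "f = (f1, f2)"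
      "f' = (g1, g2)" "\<phi> = (\<phi>1, \<phi>2)"
      by (metis surj_pair)
    have "fst f1 \<in> U" "fst f2 \<in> U" "fst g1 \<in> U" "fst g2 \<in> U"
      "\<phi>1 \<in> Hom K (fst f1) (fst g1)" "\<phi>2 \<in> Hom K (fst f2) (fst g2)"
      using 7 unfolding X by (auto simp: prod_twocat_simps prod_cat_simps intro: T_par_in_U T_hom_par)
    then show ?case
      by (simp add: X ps_simps par_ten ten_arr slice_tensor_simps(1) slice_sym_cell_def K.sym_nat strict_obj)
  next
    \<comment> \<open>their compatibility with the tensorators\<close>
    case (8 X Y Z f g)
    obtain A1 A2 B1 B2 D1 D2 f1 f2 g1 g2 where X: "X = (A1, A2)" "Y = (B1, B2)" "Z = (D1, D2)"
      "f = (f1, f2)" "g = (g1, g2)"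
      by (metis surj_pair)
    have u: "fst f1 \<in> U" "fst f2 \<in> U" "fst g1 \<in> U" "fst g2 \<in> U"
      using 8 unfolding X by (auto simp: prod_twocat_simps prod_cat_simps intro: T_par_in_U)
    show ?case
      using interchange_sym[OF u] u
      by (simp add: X ps_simps Let_def T_simps par_ten ten_arr slice_tensor_simps(1,3) slice_sym_cell_def
          strict_simps tensor_id interchange_hom)
  qed (auto simp: ps_simps Let_def T_simps par_ten ten_arr slice_tensor_simps(1,4) slice_sym_cell_def
      strict_simps strict_sym_unit tensor_id slice_sym_def change_of_base_simps(1) lift_par c_simps s
      intro!: lift_obj)
  show ?thesis
  proof (intro nearly_strict_symmetric_monoidal.intro nearly_strict_symmetric_monoidal_axioms.intro
      nearly_strict_monoidal_slice, goal_cases)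
    case 1
    show ?case using strong by (simp only: slice_monoidal_simps)
  next
    case (2 A1 A2)
    then show ?case using US.sym_sym[of A1 A2] by (simp add: simps)
  next
    case (3 A1 A2 A3)
    then show ?case using US.hexagon[of A1 A2 A3] by (simp add: simps)
  next
    case (4 A)
    then show ?case using US.sym_unit[of A] by (simp add: simps)
  qed
qed

end

section \<open>Slices of a Kleisli category along a lifted functor\<close>

context symmetric_monoidal_monad
begin

text \<open>
  On objects of \<open>U\<close> the interchange map is a whiskered symmetry, both in \<open>W\<close> and in the Kleisli category, and
  lifting respects products and symmetries.
\<close>

lemma lift_interchange:
  assumes "full_strict_monoidal_subcategory W U" "X1 \<in> U" "X2 \<in> U" "Y1 \<in> U" "Y2 \<in> U"
  shows "L ((X1 \<otimes>[W] X2) \<otimes>[W] (Y1 \<otimes>[W] Y2)) ((X1 \<otimes>[W] Y1) \<otimes>[W] (X2 \<otimes>[W] Y2))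
      (interchange W X1 X2 Y1 Y2) = interchange K X1 X2 Y1 Y2"
proof -
  interpret SW: strict_symmetric_subcategory W U
    by (intro strict_symmetric_subcategory.intro strict_subcategory.intro strict_subcategory_axioms.intro
        target_monoidal target_symmetric assms(1))
  interpret SK: strict_symmetric_subcategory K U
    by (intro strict_symmetric_subcategory.intro strict_subcategory.intro strict_subcategory_axioms.intro
        monoidal_category_kleisli symmetric_monoidal_category_kleisli
        full_strict_monoidal_subcategory_kleisli assms(1))
  have o: "X1 \<in> Obj W" "X2 \<in> Obj W" "Y1 \<in> Obj W" "Y2 \<in> Obj W"
    using assms SW.strict_obj by simp_all
  have "L (X2 \<otimes>[W] (Y1 \<otimes>[W] Y2)) (Y1 \<otimes>[W] (X2 \<otimes>[W] Y2))
      (SW.rw (X2 \<otimes>[W] Y1) (Y1 \<otimes>[W] X2) (Sym W X2 Y1) Y2)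
    = SK.rw (X2 \<otimes>[W] Y1) (Y1 \<otimes>[W] X2) (Sym K X2 Y1) Y2"
    using lift_tensor[of "X2 \<otimes>[W] Y1" "Y1 \<otimes>[W] X2" Y2 Y2 "Sym W X2 Y1" "Idn W Y2"] assms o
    by (simp add: SW.rw_def SK.rw_def SW.strict_objs kleisli_simps(11) lift_id m_simps)
  moreover have "SW.rw (X2 \<otimes>[W] Y1) (Y1 \<otimes>[W] X2) (Sym W X2 Y1) Y2
      \<in> Hom W (X2 \<otimes>[W] (Y1 \<otimes>[W] Y2)) (Y1 \<otimes>[W] (X2 \<otimes>[W] Y2))"
    using assms by (simp add: SW.strict_simps)
  ultimately show ?thesis
    using assms o
      lift_tensor[of X1 X1 "X2 \<otimes>[W] (Y1 \<otimes>[W] Y2)" "Y1 \<otimes>[W] (X2 \<otimes>[W] Y2)" "Idn W X1"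
        "SW.rw (X2 \<otimes>[W] Y1) (Y1 \<otimes>[W] X2) (Sym W X2 Y1) Y2"]
    by (simp add: SW.strict_interchange SK.strict_interchange SW.lw_def SK.lw_def kl_obj_simps
        SW.strict_objs lift_id m_simps)
qed

lemma push_eq:
  assumes F: "lax_monoidal_functor V W F"
    and o: "A \<in> Obj V" "B \<in> Obj V" "D \<in> Obj V" "h \<in> Hom V (A \<otimes>[V] B) D"
  shows "push V W M F A B D h = \<llangle>K \<Turnstile> FO F A \<otimes>[W] FO F B, Ltil (lax_comp V W K F (kl_embed W M)) A B,
      FO F (A \<otimes>[V] B), FA (lax_comp V W K F (kl_embed W M)) (A \<otimes>[V] B) D h, FO F D\<rrangle>"
proof -
  interpret F: lax_monoidal_functor V W F by (rule F)
  show ?thesis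
    using o
    by (simp add: push_def embed_FA embed_til[OF F] lift_cmp F.lax_simps m_simps F.S.mon_simps)
       (simp add: kl_lift_def F.lax_simps m_simps F.S.mon_simps)
qed

lemma lift_1cell_eq:
  assumes F: "lax_monoidal_functor V W F"
    and o: "VHom C X Y \<in> Obj V" "c \<in> Hom V (Unt V) (VHom C X Y)"
  shows "lift_1cell V W M F C X Y c = (Unt W, \<llangle>K \<Turnstile> Unt W, Leps (lax_comp V W K F (kl_embed W M)),
      FO F (Unt V), FA (lax_comp V W K F (kl_embed W M)) (Unt V) (VHom C X Y) c, FO F (VHom C X Y)\<rrangle>)"
proof -
  interpret F: lax_monoidal_functor V W F by (rule F)
  show ?thesis
    using o
    by (simp add: lift_1cell_def embed_FA embed_eps[OF F] lift_cmp F.lax_simps m_simps F.S.mon_simps)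
       (simp add: kl_lift_def F.lax_simps m_simps F.S.mon_simps)
qed

end

theorem theorem3p13:
  fixes V :: "('vo, 'va) sym_mon_cat" and W :: "('wo, 'wa) sym_mon_cat"
    and M :: "('wo, 'wa) sm_monad" and F :: "('vo, 'va, 'wo, 'wa) lax_fn"
    and U :: "'wo set" and C :: "('c, 'vo, 'va) vcat"
    and K :: "('wo, 'wa) sym_mon_cat" and FC :: "'c \<Rightarrow> 'c \<Rightarrow> 'wo"
    and T :: "('c, 'wo \<times> 'wa, 'wa) twocat"
  assumes V: "symmetric_monoidal_category V"
    and W: "symmetric_monoidal_category W"
    and M: "symmetric_monoidal_monad W M"
    and F: "symmetric_lax_monoidal_functor V W F"
    and U: "full_strict_monoidal_subcategory W U"
    and C: "vcategory V C"
    and K_eq: "K = kleisli W M"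
    and FC_eq: "FC = (\<lambda>X Y. FO F (VHom C X Y))"
    and T_eq: "T = change_of_base V (slice_MF V W M F U) C"
  shows
    "lax_monoidal_to_cat V (slice_MF V W M F U) \<and> two_category T \<and>
     Cell0 T = VObj C \<and>
     (\<forall>X\<in>VObj C. \<forall>Y\<in>VObj C. Obj (HomC T X Y) = {(U1, f). U1 \<in> U \<and> f \<in> Hom K U1 (FC X Y)}) \<and>
     (\<forall>X\<in>VObj C. \<forall>Y\<in>VObj C. \<forall>(U1, f)\<in>Obj (HomC T X Y). \<forall>(V1, g)\<in>Obj (HomC T X Y).
        Hom (HomC T X Y) (U1, f) (V1, g) = {\<phi> \<in> Hom K U1 V1. f = \<llangle>K \<Turnstile> U1, \<phi>, V1, g, FC X Y\<rrangle>} \<and>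
        (\<forall>(W1, h)\<in>Obj (HomC T X Y). \<forall>\<phi>\<in>Hom (HomC T X Y) (U1, f) (V1, g).
          \<forall>\<psi>\<in>Hom (HomC T X Y) (V1, g) (W1, h).
            \<llangle>HomC T X Y \<Turnstile> (U1, f), \<phi>, (V1, g), \<psi>, (W1, h)\<rrangle> = \<llangle>K \<Turnstile> U1, \<phi>, V1, \<psi>, W1\<rrangle>)) \<and>
     (\<forall>X\<in>VObj C. \<forall>Y\<in>VObj C. \<forall>Z\<in>VObj C.
        \<forall>(U1, f1)\<in>Obj (HomC T X Y). \<forall>(U2, f2)\<in>Obj (HomC T Y Z).
        \<llangle>T \<Turnstile>\<^sub>1 X, (U1, f1), Y, (U2, f2), Z\<rrangle> =
          (U1 \<otimes>[W] U2,
           \<llangle>K \<Turnstile> U1 \<otimes>[W] U2,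
              \<llangle>K \<Turnstile> U1, f1, FC X Y \<otimes> U2, f2, FC Y Z\<rrangle>,
              FC X Y \<otimes>[W] FC Y Z,
              push V W M F (VHom C X Y) (VHom C Y Z) (VHom C X Z) (VCmp C X Y Z),
              FC X Z\<rrangle>) \<and>
        (\<forall>(V1, g1)\<in>Obj (HomC T X Y). \<forall>(V2, g2)\<in>Obj (HomC T Y Z).
          \<forall>\<phi>1\<in>Hom (HomC T X Y) (U1, f1) (V1, g1). \<forall>\<phi>2\<in>Hom (HomC T Y Z) (U2, f2) (V2, g2).
            FA (HComp T X Y Z) ((U1, f1), (U2, f2)) ((V1, g1), (V2, g2)) (\<phi>1, \<phi>2)
            = \<llangle>K \<Turnstile> U1, \<phi>1, V1 \<otimes> U2, \<phi>2, V2\<rrangle>)) \<and>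
     (\<forall>X\<in>VObj C. Id1 T X = lift_1cell V W M F C X X (VIdn C X)) \<and>
     (\<forall>B :: ('c, 'va) mon_struct. monoidal_vcategory V C B \<longrightarrow>
       (\<exists>S :: ('c, 'wo \<times> 'wa, 'wa) mon_twostruct.
         nearly_strict_monoidal T S \<and>
         (\<forall>A1\<in>VObj C. \<forall>A2\<in>VObj C. A1 \<otimes>\<^sub>0[S] A2 = A1 \<boxtimes>[B] A2) \<and>
         (\<forall>A1\<in>VObj C. \<forall>A2\<in>VObj C. \<forall>B1\<in>VObj C. \<forall>B2\<in>VObj C.
            \<forall>(U1, f1)\<in>Obj (HomC T A1 B1). \<forall>(U2, f2)\<in>Obj (HomC T A2 B2).
            \<llangle>S \<Turnstile>\<^sub>1 A1, (U1, f1), B1 \<otimes> A2, (U2, f2), B2\<rrangle> =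
              (U1 \<otimes>[W] U2,
               \<llangle>K \<Turnstile> U1 \<otimes>[W] U2,
                  \<llangle>K \<Turnstile> U1, f1, FC A1 B1 \<otimes> U2, f2, FC A2 B2\<rrangle>,
                  FC A1 B1 \<otimes>[W] FC A2 B2,
                  push V W M F (VHom C A1 B1) (VHom C A2 B2) (VHom C (A1 \<boxtimes>[B] A2) (B1 \<boxtimes>[B] B2))
                    (VFA (VTensor B) (A1, A2) (B1, B2)),
                  FC (A1 \<boxtimes>[B] A2) (B1 \<boxtimes>[B] B2)\<rrangle>) \<and>
            (\<forall>(V1, g1)\<in>Obj (HomC T A1 B1). \<forall>(V2, g2)\<in>Obj (HomC T A2 B2).
              \<forall>\<phi>1\<in>Hom (HomC T A1 B1) (U1, f1) (V1, g1). \<forall>\<phi>2\<in>Hom (HomC T A2 B2) (U2, f2) (V2, g2).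
                FA (P1 (TTensor S) (A1, A2) (B1, B2)) ((U1, f1), (U2, f2)) ((V1, g1), (V2, g2)) (\<phi>1, \<phi>2)
                = \<llangle>K \<Turnstile> U1, \<phi>1, V1 \<otimes> U2, \<phi>2, V2\<rrangle>) \<and>
            (\<forall>D1\<in>VObj C. \<forall>D2\<in>VObj C.
              \<forall>(Q1, g1)\<in>Obj (HomC T B1 D1). \<forall>(Q2, g2)\<in>Obj (HomC T B2 D2).
                Pcmp (TTensor S) (A1, A2) (B1, B2) (D1, D2) ((U1, f1), (U2, f2)) ((Q1, g1), (Q2, g2))
                = kl_lift W M ((U1 \<otimes>[W] U2) \<otimes>[W] (Q1 \<otimes>[W] Q2)) ((U1 \<otimes>[W] Q1) \<otimes>[W] (U2 \<otimes>[W] Q2))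
                    (interchange W U1 U2 Q1 Q2))) \<and>
         TUnt S = VUnt B \<and>
         (\<forall>A1\<in>VObj C. \<forall>A2\<in>VObj C. \<forall>A3\<in>VObj C.
            TAsc S A1 A2 A3 = lift_1cell V W M F C ((A1 \<boxtimes>[B] A2) \<boxtimes>[B] A3) (A1 \<boxtimes>[B] (A2 \<boxtimes>[B] A3))
              (VAsc B A1 A2 A3)) \<and>
         (\<forall>A\<in>VObj C. TRun S A = lift_1cell V W M F C (A \<boxtimes>[B] VUnt B) A (VRun B A)) \<and>
         (\<forall>A\<in>VObj C. TLun S A = lift_1cell V W M F C (VUnt B \<boxtimes>[B] A) A (VLun B A)) \<and>
         (\<forall>s. symmetric_monoidal_vcategory V C B s \<longrightarrow>
           (\<exists>t n. nearly_strict_symmetric_monoidal T S t n \<and>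
             (\<forall>A1\<in>VObj C. \<forall>A2\<in>VObj C.
                t A1 A2 = lift_1cell V W M F C (A1 \<boxtimes>[B] A2) (A2 \<boxtimes>[B] A1) (s A1 A2)) \<and>
             (\<forall>A1\<in>VObj C. \<forall>A2\<in>VObj C. \<forall>B1\<in>VObj C. \<forall>B2\<in>VObj C.
                \<forall>(U1, f1)\<in>Obj (HomC T A1 B1). \<forall>(U2, f2)\<in>Obj (HomC T A2 B2).
                n (A1, A2) (B1, B2) ((U1, f1), (U2, f2))
                = kl_lift W M (U1 \<otimes>[W] U2) (U2 \<otimes>[W] U1) (Sym W U1 U2))))))"
proof -
  interpret M: symmetric_monoidal_monad W M by (rule M)
  interpret F: symmetric_lax_monoidal_functor V W F by (rule F)
  let ?G = "lax_comp V W (kleisli W M) F (kl_embed W M)"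
  have G: "symmetric_lax_monoidal_functor V (kleisli W M) ?G"
    by (rule M.lax_functor_into_kleisli[OF F])
  interpret sliced_vcategory V "kleisli W M" U ?G C
    by (intro sliced_vcategory.intro symmetric_slice_along.intro slice_along.intro
        strict_symmetric_subcategory.intro strict_subcategory.intro strict_subcategory_axioms.intro
        M.monoidal_category_kleisli M.symmetric_monoidal_category_kleisli
        M.full_strict_monoidal_subcategory_kleisli U C G symmetric_lax_monoidal_functor.axioms(1)[OF G])
  note lax = F.lax_monoidal_functor_axioms
  have N_eq: "slice_MF V W M F U = N"
    by (simp add: slice_MF_def)
  have FO_G: "FO ?G = FO F"
    by (rule M.embed_FO)
  have T: "T = change_of_base V N C"
    by (simp add: T_eq N_eq)
  have K: "kleisli W M = K"
    by (simp add: K_eq)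
  \<comment> \<open>The cells of the abstract construction agree with their descriptions in terms of \<open>F\<close> and the monad.\<close>
  have lift: "lift X Y c = lift_1cell V W M F C X Y c"
    if "X \<in> VObj C" "Y \<in> VObj C" "c \<in> Hom V (Unt V) (VHom C X Y)" for X Y c
    using that M.lift_1cell_eq[OF lax, of C X Y c]
    by (simp add: lift_def slice_simps FO_G M.kl_obj_simps g_simps[unfolded FO_G M.kl_obj_simps] C.vhom_obj)
  have prod: "FO (fn_comp (Ktil N A B) (Karr N (A \<otimes>[V] B) D h)) ((P, f), (Q, g))
      = (P \<otimes>[W] Q, \<llangle>K \<Turnstile> P \<otimes>[W] Q, \<llangle>K \<Turnstile> P, f, FO F A \<otimes> Q, g, FO F B\<rrangle>,
          FO F A \<otimes>[W] FO F B, push V W M F A B D h, FO F D\<rrangle>)"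
    if "A \<in> Obj V" "B \<in> Obj V" "D \<in> Obj V" "h \<in> Hom V (A \<otimes>[V] B) D" "P \<in> U" "Q \<in> U"
      "f \<in> Hom K P (FO F A)" "g \<in> Hom K Q (FO F B)" for A B D h P Q f g
    using that M.push_eq[OF lax, of A B D h] g_simps tensor_hom[of P "FO F A" Q "FO F B" f g]
    by (simp add: K_eq fn_simps slice_simps FO_G M.kl_obj_simps g_simps[unfolded FO_G M.kl_obj_simps])
  have elem: "x \<in> Obj (HomC T X Y) \<longleftrightarrow> fst x \<in> U \<and> snd x \<in> Hom K (fst x) (FC X Y)" for x X Y
    by (cases x) (simp add: T change_of_base_simps slice_simps FO_G K_eq FC_eq)
  show ?thesis
    unfolding N_eq
  proof (intro conjI allI impI, goal_cases)
    case 1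
    show ?case by (rule slice_lax_monoidal)
  next
    case 2
    show ?case unfolding T by (rule T.two_category_axioms)
  next
    case 3
    show ?case by (simp add: T change_of_base_simps)
  next
    \<comment> \<open>1-cells\<close>
    case 4
    show ?case by (auto simp: elem)
  next
    \<comment> \<open>2-cells and their vertical composition\<close>
    case 5
    show ?case by (auto simp: T change_of_base_simps slice_simps FO_G K_eq FC_eq)
  next
    \<comment> \<open>horizontal composition\<close>
    case 6
    have "HComp T X Y Z = fn_comp (Ktil N (VHom C X Y) (VHom C Y Z))
        (Karr N (VHom C X Y \<otimes>[V] VHom C Y Z) (VHom C X Z) (VCmp C X Y Z))" for X Y Z
      by (simp add: T change_of_base_simps)
    then show ?case
      by (auto simp: prod elem FC_eq C.vhom_obj C.vcmp_hom)
         (simp add: fn_comp_simps(2) mul_arr slice_simps(6) K_eq)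
  next
    \<comment> \<open>identity 1-cells\<close>
    case 7
    show ?case by (simp add: T lift_id lift C.vid_hom)
  next
    \<comment> \<open>the monoidal structure\<close>
    case (8 B)
    interpret mon: sliced_monoidal_vcategory V "kleisli W M" U ?G C B
      by (intro sliced_monoidal_vcategory.intro sliced_vcategory_axioms 8)
    let ?S = "mon.slice_monoidal"
    note simps = mon.slice_monoidal_simps mon.slice_tensor_simps
    show ?case
    proof (intro exI[of _ ?S] conjI allI impI, goal_cases)
      case 1
      show ?case unfolding T by (rule mon.nearly_strict_monoidal_slice)
    next
      \<comment> \<open>products of 1-cells and of 2-cells, and tensorators\<close>
      case 3
      have "P1 (TTensor ?S) (A1, A2) (B1, B2) = fn_comp (Ktil N (VHom C A1 B1) (VHom C A2 B2))
          (Karr N (VHom C A1 B1 \<otimes>[V] VHom C A2 B2) (VHom C (A1 \<boxtimes>[B] A2) (B1 \<boxtimes>[B] B2))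
            (VFA (VTensor B) (A1, A2) (B1, B2)))" for A1 A2 B1 B2
        by (simp add: simps)
      then show ?case
        by (auto simp: prod elem FC_eq mon.c_simps)
           (simp_all add: simps fn_comp_simps(2) mul_arr slice_simps(6) K_eq M.lift_interchange[OF U])
    next
      \<comment> \<open>the symmetry\<close>
      case (8 s)
      interpret sym: symmetric_monoidal_vcategory V C B s by (rule 8)
      interpret US: symmetric_monoidal_category "underlying_symmetric V C B s"
        by (rule sym.underlying_is_symmetric)
      have s_hom: "s A A' \<in> Hom V (Unt V) (VHom C (A \<boxtimes>[B] A') (A' \<boxtimes>[B] A))"
        if "A \<in> VObj C" "A' \<in> VObj C" for A A'
        using US.sym_hom[of A A'] that by (simp add: underlying_symmetric_simps underlying_monoidal_simps)
      show ?case
        unfolding T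
        by (intro exI[of _ "mon.slice_sym s"] exI[of _ mon.slice_sym_cell] conjI
            mon.nearly_strict_symmetric_monoidal_slice 8)
           (auto simp: mon.slice_sym_def mon.slice_sym_cell_def lift s_hom mon.c_simps kleisli_simps(11))
    qed (simp_all add: simps lift mon.um_hom mon.c_simps)
  qed
qed

end
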